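(* Let $\mathcal X_n$ be either $\mathcal P_n$ (for all $n$) or $\mathcal B_n$ (for all $n$). Assume that $\rho_n=n^kr_n^{d(k-1)}\to\infty$ and $nr_n^d\to0$ as $n\to\infty$. Then, for any Borel set $A\subset\mathbb R^m$, $$-\inf_{\mathbf u\in A^\circ}I(\mathbf u)\le\liminf_{n\to\infty}\frac{\rho_n}{b_n^2}\log\mathbb P\Big(\frac1{b_n}\overline{S_n(\mathcal X_n)}\in A\Big)\le\limsup_{n\to\infty}\frac{\rho_n}{b_n^2}\log\mathbb P\Big(\frac1{b_n}\overline{S_n(\mathcal X_n)}\in A\Big)\le-\inf_{\mathbf u\in\overline A}I(\mathbf u),$$ where $A^\circ$, $\overline A$ are the interior and closure of $A$ in $\mathbb R^m$, and $S_n$ is the vector of component counts of random geometric graphs defined in the context.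
   Context: Fix integers $d\ge2$, $k\ge2$, $m\ge1$. $\mathcal P_n$ is a Poisson point process on $[0,1]^d$ with intensity $n$; $\mathcal B_n$ is the binomial process of $n$ i.i.d. uniform points in $[0,1]^d$. $(r_n)$ is a sequence of positive numbers with $r_n\to0$. $(b_n)$ is a positive sequence with $\rho_n/b_n\to\infty$ and $\rho_n/b_n^2\to0$. $\|\cdot\|$ is the Euclidean norm, $\mathbf 0_d$ the origin of $\mathbb R^d$, and $\overline X=X-\mathbb E[X]$ for a random vector $X$. For a finite set $\mathcal X\subset\mathbb R^d$ and $r>0$, $G(\mathcal X,r)$ is the graph with vertex set $\mathcal X$ and an edge between distinct $x,x'\in\mathcal X$ iff $\|x-x'\|\le r$. Let $t_1,\dots,t_m\in(0,\infty)$ and let $\Gamma_1,\dots,\Gamma_m$ be pairwise non-isomorphic connected graphs with $k$ vertices. Define $H=(h^{(1)},\dots,h^{(m)})$ by $h^{(i)}(x_1,\dots,x_k)=\mathbf 1\{G(\{x_1,\dots,x_k\},t_i)\cong\Gamma_i\}$, where $\cong$ is graph isomorphism. Standing assumption: for every $\mathbf a\in\mathbb R^m\setminus\{\mathbf 0\}$, $\int_{(\mathbb R^d)^{k-1}}|\langle\mathbf a,H(\mathbf 0_d,\mathbf y)\rangle|\,d\mathbf y>0$ (in particular every $\Gamma_i$ is realizable as a geometric graph in $\mathbb R^d$). For a finite set $\mathcal X$ define $S_n(\mathcal X)=(S_n^{(i)}(\mathcal X))_{i=1,\dots,m}$ by $$S_n^{(i)}(\mathcal X)=\sum_{\mathcal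 Y\subset\mathcal X,\,|\mathcal Y|=k}\mathbf 1\{\|y-y'\|\ge r_nt_i\ \forall y\in\mathcal Y,\,y'\in\mathcal X\setminus\mathcal Y\}\,h^{(i)}(r_n^{-1}\mathcal Y);$$ it represents the number of connected components of $G(\mathcal X,r_nt_i)$ isomorphic to $\Gamma_i$. The rate function is $I(\mathbf u)=\frac12\langle\mathbf u,\Gamma^{-1}\mathbf u\rangle$, $\mathbf u\in\mathbb R^m$, where $\Gamma$ is the (invertible, by the standing assumption) $m\times m$ matrix with entries $\frac1{k!}\int_{(\mathbb R^d)^{k-1}}h^{(i)}(\mathbf 0_d,\mathbf y)h^{(j)}(\mathbf 0_d,\mathbf y)\,d\mathbf y$. *)

theory Defs
  imports
    "HOL-Probability.Probability"
    "Graph_Theory.Graph_Theory"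
begin

text \<open>
  Finite simple graphs are rendered by \<^locale>\<open>pair_graph\<close>, i.e. finite loop-free digraphs with a
  symmetric set of arcs; \<^const>\<open>digraph_iso\<close> between two such graphs is graph isomorphism.
\<close>

definition geom_graph :: "'a::real_normed_vector set \<Rightarrow> real \<Rightarrow> 'a pair_pre_digraph" where
  "geom_graph X r =
     \<lparr> pverts = X, parcs = {(x, y). x \<in> X \<and> y \<in> X \<and> x \<noteq> y \<and> norm (x - y) \<le> r} \<rparr>"

text \<open>
  The functions \<open>h\<^sup>(\<^sup>i\<^sup>)\<close> depend on \<open>(x\<^sub>1, \<dots>, x\<^sub>k)\<close> only through the set \<open>{x\<^sub>1, \<dots>, x\<^sub>k}\<close>, so they are
  defined on sets. If two coordinates coincide, that set has fewer than \<open>k\<close> elements and the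
  indicator of a graph on \<open>k\<close> vertices vanishes.
\<close>

definition shape_ind :: "'v pair_pre_digraph \<Rightarrow> real \<Rightarrow> 'a::real_normed_vector set \<Rightarrow> real" where
  "shape_ind \<Gamma> t Y = of_bool (digraph_iso (with_proj (geom_graph Y t)) (with_proj \<Gamma>))"

definition H_vec ::
  "('m \<Rightarrow> 'v pair_pre_digraph) \<Rightarrow> ('m \<Rightarrow> real) \<Rightarrow> 'a::real_normed_vector set \<Rightarrow> real ^ 'm::finite"
  where "H_vec \<Gamma> t Y = (\<chi> i. shape_ind (\<Gamma> i) (t i) Y)"

definition with_origin :: "nat \<Rightarrow> (nat \<Rightarrow> 'a::real_normed_vector) \<Rightarrow> 'a set" where
  "with_origin k y = insert 0 (y ` {..<k - 1})"

text \<open>\<open>(\<real>\<^sup>d)\<^sup>k\<^sup>-\<^sup>1\<close> with Lebesgue measure; a point \<open>y\<close> has the coordinates \<open>y 0, \<dots>, y (k - 2)\<close>.\<close>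

definition lborel_tuples :: "nat \<Rightarrow> (nat \<Rightarrow> 'a::euclidean_space) measure" where
  "lborel_tuples k = PiM {..<k - 1} (\<lambda>_. lborel)"

definition component_count ::
  "nat \<Rightarrow> ('m \<Rightarrow> 'v pair_pre_digraph) \<Rightarrow> ('m \<Rightarrow> real) \<Rightarrow> real \<Rightarrow>
     'a::real_normed_vector set \<Rightarrow> real ^ 'm::finite" where
  "component_count k \<Gamma> t r X =
     (\<chi> i. \<Sum>Y\<in>{Y. Y \<subseteq> X \<and> card Y = k}.
        of_bool (\<forall>y\<in>Y. \<forall>y'\<in>X - Y. norm (y - y') \<ge> r * t i)
        * shape_ind (\<Gamma> i) (t i) ((\<lambda>x. inverse r *\<^sub>R x) ` Y))"

text \<open>
  The type of points \<open>'a\<close> only occurs under the integral, whence the explicit type argument.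
\<close>

definition Gram_matrix ::
  "'a::euclidean_space itself \<Rightarrow> nat \<Rightarrow> ('m \<Rightarrow> 'v pair_pre_digraph) \<Rightarrow> ('m \<Rightarrow> real) \<Rightarrow>
     real ^ 'm ^ 'm::finite" where
  "Gram_matrix _ k \<Gamma> t =
     (\<chi> i j. 1 / fact k *
        (LINT y|(lborel_tuples k :: (nat \<Rightarrow> 'a) measure).
           shape_ind (\<Gamma> i) (t i) (with_origin k y) * shape_ind (\<Gamma> j) (t j) (with_origin k y)))"

definition rate_fun ::
  "'a::euclidean_space itself \<Rightarrow> nat \<Rightarrow> ('m \<Rightarrow> 'v pair_pre_digraph) \<Rightarrow> ('m \<Rightarrow> real) \<Rightarrow>
     real ^ 'm::finite \<Rightarrow> real" where
  "rate_fun T k \<Gamma> t u = 1 / 2 * (u \<bullet> (matrix_inv (Gram_matrix T k \<Gamma> t) *v u))"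

definition unit_cube :: "(real ^ 'd::finite) set" where
  "unit_cube = {x. \<forall>i. 0 \<le> x $ i \<and> x $ i \<le> 1}"

text \<open>
  Point processes are random finite sets of points. This loses nothing, as the processes below
  are almost surely simple. The Poisson probabilities are written out because \<^const>\<open>poisson_pmf\<close> is
  only specified for positive rates, whereas the mean \<open>c |B|\<close> may be zero.
\<close>

definition poisson_process ::
  "'w measure \<Rightarrow> real \<Rightarrow> ('w \<Rightarrow> (real ^ 'd::finite) set) \<Rightarrow> bool" where
  "poisson_process M c X \<longleftrightarrow>
     prob_space M \<and>
     (\<forall>\<omega>\<in>space M. finite (X \<omega>) \<and> X \<omega> \<subseteq> unit_cube) \<and>
     (\<forall>B\<in>sets borel. B \<subseteq> unit_cube \<longrightarrow>
        (\<lambda>\<omega>. card (X \<omega> \<inter> B)) \<in> measurable M (count_space UNIV) \<and>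
        (\<forall>j. measure M {\<omega> \<in> space M. card (X \<omega> \<inter> B) = j}
             = exp (- (c * measure lborel B)) * (c * measure lborel B) ^ j / fact j)) \<and>
     (\<forall>\<B>. finite \<B> \<and> \<B> \<subseteq> sets borel \<and> (\<forall>B\<in>\<B>. B \<subseteq> unit_cube) \<and> disjoint \<B> \<longrightarrow>
        prob_space.indep_vars M (\<lambda>_. count_space UNIV) (\<lambda>B \<omega>. card (X \<omega> \<inter> B)) \<B>)"

definition binomial_process ::
  "'w measure \<Rightarrow> nat \<Rightarrow> ('w \<Rightarrow> (real ^ 'd::finite) set) \<Rightarrow> bool" where
  "binomial_process M n X \<longleftrightarrow>
     prob_space M \<and>
     (\<exists>U :: nat \<Rightarrow> 'w \<Rightarrow> real ^ 'd.
        prob_space.indep_vars M (\<lambda>_. borel) U {..<n} \<and>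
        (\<forall>i<n. distr M borel (U i) = uniform_measure lborel unit_cube) \<and>
        (\<forall>\<omega>\<in>space M. X \<omega> = (\<lambda>i. U i \<omega>) ` {..<n}))"

definition log_prob :: "real \<Rightarrow> ereal" where
  "log_prob p = (if p = 0 then - \<infinity> else ereal (ln p))"

end

theory Submission imports Defs begin

text \<open>
  Let \<open>F = \<theta> \<bullet> S\<close> be a linear functional of the component counts, \<open>\<lambda> = b / \<rho>\<close> and
  \<open>a = b\<^sup>2 / \<rho> = \<lambda>\<^sup>2 \<rho>\<close>, so that \<open>\<lambda>\<close> tends to 0 and \<open>a\<close> to infinity. At the scale \<open>b\<close> the centred counts
  behave like a Gaussian vector with covariance \<open>\<rho> G\<close>, where \<open>G\<close> is the Gram matrix: for every \<open>\<theta>\<close>,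
  \<open>E exp (\<lambda> (F - E F)) = exp (a (\<theta> \<bullet> G \<theta> / 2 + o(1)))\<close>. From this the moderate deviation principle with
  speed \<open>a\<close> follows by the argument of Gaertner and Ellis: half-spaces and the exponential Chebyshev
  inequality give the upper bound (\<open>prob_upper_bound\<close>), exponential tilting gives the lower bound
  (\<open>prob_lower_bound\<close>).

  For the Poisson process the moment generating function is computed by cutting the unit cube into
  cells whose side is a large multiple \<open>L\<close> of \<open>r\<close>. The components inside different cells are
  independent, and their number in one cell is bounded by a constant, because a cell is covered by
  boundedly many balls too small to meet two components. A cell holds about \<open>n r\<^sup>d\<close> points, which is small,
  so its count is governed by the event that it holds exactly \<open>k\<close> points, and the second moments of
  all cells add up to nearly \<open>\<rho> (\<theta> \<bullet> G \<theta>)\<close>. As \<open>\<lambda>\<close> tends to 0, the second order expansion of the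
  exponential function (\<open>mgf_indep_upper\<close>, \<open>mgf_indep_lower\<close>) then yields the moment generating function
  of the part inside the cells. Components that cross cell boundaries are shared out
  between the cells. The resulting edge terms depend on each other only between
  neighbouring cells, and their second moments add up to a small multiple of \<open>\<rho>\<close> if \<open>L\<close> is large
  (\<open>boundary_sq_upper\<close>). Together this gives \<open>poisson_mgf\<close>.

  For the binomial process let \<open>g j\<close> be the moment generating function for \<open>j\<close> uniform points, whose
  average over a Poisson variable \<open>j\<close> with mean \<open>n\<close> is the Poisson one. One more point changes the
  count only if it falls close to \<open>k - 1\<close> others, so the relative increments of \<open>g\<close> near \<open>n\<close> are at most
  \<open>\<delta> = O (\<lambda> (n r\<^sup>d)\<^sup>k\<^sup>-\<^sup>1)\<close> (\<open>g_increment\<close>). Since \<open>n \<delta>\<^sup>2 = o(a)\<close>, the value \<open>g n\<close> agrees with that average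
  up to a factor \<open>exp (o(a))\<close> (\<open>depoissonize\<close>). This computes the moment generating function with the count
  centred at the Poisson mean, and Jensen's inequality shows that the two means are close enough
  (\<open>recenter\<close>).
\<close>



section \<open>Moderate deviations from moment generating functions\<close>

lemma eventually_const_le_exp:
  fixes a :: "nat \<Rightarrow> real"
  assumes "filterlim a at_top sequentially" "e > 0"
  shows "\<forall>\<^sub>F n in sequentially. c \<le> exp (a n * e)"
proof -
  have "filterlim (\<lambda>n. exp (a n * e)) at_top sequentially"
    by (rule filterlim_compose[OF exp_at_top])
       (rule filterlim_at_top_mult_tendsto_pos[OF tendsto_const assms(2) assms(1), simplified mult.commute[of e], simplified]
        | use assms filterlim_tendsto_pos_mult_at_top[OF tendsto_const assms(2) assms(1)] in \<open>simp add: mult.commute\<close>)+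
  then show ?thesis by (simp add: filterlim_at_top)
qed

locale pos_def_matrix =
  fixes G :: "real ^ 'm ^ 'm::finite"
  assumes G_sym: "x \<bullet> (G *v y) = y \<bullet> (G *v x)"
    and G_pos: "x \<noteq> 0 \<Longrightarrow> x \<bullet> (G *v x) > 0"
begin

abbreviation "Gi \<equiv> matrix_inv G"

lemma G_inv: "G *v (Gi *v x) = x" "Gi *v (G *v x) = x"
proof -
  have "inj ((*v) G)"
  proof (rule injI)
    fix x y assume "G *v x = G *v y"
    then have "G *v (x - y) = 0" by (simp add: matrix_vector_mult_diff_distrib)
    then show "x = y" using G_pos[of "x - y"] by fastforce
  qed
  then have "invertible G"
    using invertible_left_inverse matrix_left_invertible_injective by blast
  then have "G ** Gi = mat 1 \<and> Gi ** G = mat 1"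
    unfolding invertible_def matrix_inv_def by (rule someI_ex)
  then show "G *v (Gi *v x) = x" "Gi *v (G *v x) = x"
    by (simp_all add: matrix_vector_mul_assoc)
qed

definition rate :: "real ^ 'm \<Rightarrow> real" where "rate u = 1 / 2 * (u \<bullet> (Gi *v u))"

lemma rate_scaleR: "rate (c *\<^sub>R u) = c\<^sup>2 * rate u"
  by (simp add: rate_def matrix_vector_mult_scaleR power2_eq_square)

lemma rate_pos: "u \<noteq> 0 \<Longrightarrow> rate u > 0"
  using G_pos[of "Gi *v u"] G_inv[of u] unfolding rate_def
  by (metis inner_commute matrix_vector_mult_0_right mult_pos_pos zero_less_divide_1_iff zero_less_numeral)

lemma continuous_on_rate: "continuous_on A rate"
  unfolding rate_def by (intro continuous_intros linear_continuous_on_compose) (auto intro: linear_continuous_on linear_linear)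

text \<open>Positive definiteness makes the rate function at least a multiple of the squared norm, by its minimum
  on the unit sphere.\<close>

lemma compact_rate_level:
  assumes "\<alpha> > 0"
  shows "compact {e. rate e = \<alpha>}"
proof -
  obtain c where c: "c > 0" "\<And>u. rate u \<ge> c * (norm u)\<^sup>2"
  proof -
    have "compact (sphere (0::real^'m) 1)" by simp
    moreover have "sphere (0::real^'m) 1 \<noteq> {}" by (simp)
    ultimately obtain s where s: "s \<in> sphere 0 1" "\<And>y. y \<in> sphere 0 1 \<Longrightarrow> rate s \<le> rate y"
      using continuous_attains_inf[OF _ _ continuous_on_rate] by metis
    have "rate u \<ge> rate s * (norm u)\<^sup>2" for u
    proof (cases "u = 0")
      case False
      then have "rate u = (norm u)\<^sup>2 * rate (inverse (norm u) *\<^sub>R u)"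
        using rate_scaleR[of "norm u" "inverse (norm u) *\<^sub>R u"] by simp
      then show ?thesis using s(2)[of "inverse (norm u) *\<^sub>R u"] False
        by (simp add: mult.commute mult_left_mono)
    qed (simp add: rate_def)
    moreover have "rate s > 0" using s(1) by (intro rate_pos) auto
    ultimately show thesis using that by blast
  qed
  have "closed {e. rate e = \<alpha>}"
    using continuous_closed_preimage[OF continuous_on_rate[of UNIV] closed_UNIV, of "{\<alpha>}"]
    by (simp add: vimage_def)
  moreover have "bounded {e. rate e = \<alpha>}"
    unfolding bounded_iff
  proof (intro exI ballI)
    fix e assume "e \<in> {e. rate e = \<alpha>}"
    then have "c * (norm e)\<^sup>2 \<le> \<alpha>" using c(2)[of e] by simp
    then have "(norm e)\<^sup>2 \<le> \<alpha> / c" using c(1) by (simp add: field_simps)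
    then show "norm e \<le> sqrt (\<alpha> / c)" by (rule real_le_rsqrt)
  qed
  ultimately show ?thesis by (simp add: compact_eq_bounded_closed)
qed

text \<open>Every level set of the rate function is cut off from the origin by finitely many
  half-spaces, each of which costs almost the full rate in the exponential Chebyshev inequality.
  As the rate function is homogeneous of degree 2, these half-spaces cover the whole super-level
  set, which is how the unbounded part of a closed set is controlled.\<close>

lemma rate_superlevel_half_spaces:
  assumes "\<alpha> > 0" "0 < e" "e \<le> \<alpha>"
  obtains D where "finite D" "\<And>d. d \<in> D \<Longrightarrow> rate d = \<alpha>"
    "\<And>u. rate u \<ge> \<alpha> \<Longrightarrow> \<exists>d\<in>D. (Gi *v d) \<bullet> u \<ge> 2 * \<alpha> - e"
proof -
  let ?E = "{e. rate e = \<alpha>}"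
  let ?U = "\<lambda>d. {x. (Gi *v d) \<bullet> x > 2 * \<alpha> - e}"
  have "?E \<subseteq> (\<Union>d\<in>?E. ?U d)"
    using assms by (auto simp: rate_def inner_commute)
  moreover have "\<And>d. d \<in> ?E \<Longrightarrow> open (?U d)" by (simp add: open_halfspace_gt)
  ultimately obtain D where D: "D \<subseteq> ?E" "finite D" "?E \<subseteq> (\<Union>d\<in>D. ?U d)"
    using compactE_image[OF compact_rate_level[OF assms(1)], of ?E ?U] by metis
  have "\<exists>d\<in>D. (Gi *v d) \<bullet> u \<ge> 2 * \<alpha> - e" if u: "rate u \<ge> \<alpha>" for u
  proof -
    define s where "s = sqrt (\<alpha> / rate u)"
    have s: "0 < s" "s \<le> 1" "s\<^sup>2 = \<alpha> / rate u" using u assms by (auto simp: s_def)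
    have "rate (s *\<^sub>R u) = \<alpha>" unfolding rate_scaleR s(3) using u assms by simp
    then obtain d where d: "d \<in> D" "(Gi *v d) \<bullet> (s *\<^sub>R u) > 2 * \<alpha> - e" using D(3) by blast
    have "0 < s * ((Gi *v d) \<bullet> u)" using d(2) assms by simp
    then have "0 < (Gi *v d) \<bullet> u" using s by (simp add: zero_less_mult_iff)
    then have "(Gi *v d) \<bullet> u \<ge> s * ((Gi *v d) \<bullet> u)"
      using s by (intro mult_left_le_one_le) auto
    then show ?thesis using d by (intro bexI[of _ d]) auto
  qed
  then show thesis using that D by blast
qed

end

lemma (in prob_space) exp_markov:
  assumes "integrable M (\<lambda>\<omega>. exp (a * f \<omega>))" "a > 0" "f \<in> borel_measurable M"
  shows "prob {\<omega>\<in>space M. f \<omega> \<ge> c} \<le> exp (- a * c) * expectation (\<lambda>\<omega>. exp (a * f \<omega>))"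
proof -
  have "prob {\<omega>\<in>space M. f \<omega> \<ge> c} = expectation (indicator {\<omega>\<in>space M. f \<omega> \<ge> c})"
    using assms by (simp)
  also have "\<dots> \<le> expectation (\<lambda>\<omega>. exp (- a * c) * exp (a * f \<omega>))"
  proof (rule integral_mono)
    show "indicator {\<omega> \<in> space M. c \<le> f \<omega>} x \<le> exp (- a * c) * exp (a * f x)" for x
      using assms(2) by (auto simp: indicator_def simp flip: exp_add)
  qed (use assms in \<open>auto intro!: integrable_real_indicator simp: emeasure_eq_measure\<close>)
  finally show ?thesis by simp
qed

text \<open>The moment generating functions of \<open>T\<close> at the scale \<open>a\<close> are, to leading exponential order, those of a
  Gaussian vector with covariance \<open>G / a\<close>.\<close>

locale mgf_asymptotics = pos_def_matrix G for G :: "real ^ 'm ^ 'm::finite" +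
  fixes L :: "nat \<Rightarrow> 'w measure" and T :: "nat \<Rightarrow> 'w \<Rightarrow> real ^ 'm" and a :: "nat \<Rightarrow> real"
  assumes prob: "prob_space (L n)"
    and T_meas: "T n \<in> borel_measurable (L n)"
    and a_lim: "filterlim a at_top sequentially"
    and mgf_int: "integrable (L n) (\<lambda>\<omega>. exp (a n * (\<theta> \<bullet> T n \<omega>)))"
    and mgf_upper: "e > 0 \<Longrightarrow> \<forall>\<^sub>F n in sequentially.
      (\<integral>\<omega>. exp (a n * (\<theta> \<bullet> T n \<omega>)) \<partial>L n) \<le> exp (a n * (1/2 * (\<theta> \<bullet> (G *v \<theta>)) + e))"
    and mgf_lower: "e > 0 \<Longrightarrow> \<forall>\<^sub>F n in sequentially.
      (\<integral>\<omega>. exp (a n * (\<theta> \<bullet> T n \<omega>)) \<partial>L n) \<ge> exp (a n * (1/2 * (\<theta> \<bullet> (G *v \<theta>)) - e))"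
begin

lemma a_pos: "\<forall>\<^sub>F n in sequentially. a n > 0"
  using a_lim by (simp add: filterlim_at_top_dense)

text \<open>Outside the ellipsoid of level \<open>\<alpha>\<close>, a point lies in one of finitely many half-spaces. The exponential
  Chebyshev inequality with the normal vector of the half-space bounds each of them.\<close>

lemma prob_upper_bound:
  assumes A: "\<And>u. u \<in> A \<Longrightarrow> rate u \<ge> \<alpha>" and "\<alpha> > 0" "e > 0"
  shows "\<forall>\<^sub>F n in sequentially. measure (L n) {\<omega>\<in>space (L n). T n \<omega> \<in> A} \<le> exp (- a n * (\<alpha> - e))"
proof -
  define \<epsilon> where "\<epsilon> = min \<alpha> (e / 3)"
  have \<epsilon>: "0 < \<epsilon>" "\<epsilon> \<le> \<alpha>" "3 * \<epsilon> \<le> e" using assms by (auto simp: \<epsilon>_def)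
  obtain D where D: "finite D" "\<And>d. d \<in> D \<Longrightarrow> rate d = \<alpha>"
    "\<And>u. rate u \<ge> \<alpha> \<Longrightarrow> \<exists>d\<in>D. (Gi *v d) \<bullet> u \<ge> 2 * \<alpha> - \<epsilon>"
    using rate_superlevel_half_spaces[OF \<open>\<alpha> > 0\<close> \<epsilon>(1,2)] by blast
  have "\<forall>\<^sub>F n in sequentially. \<forall>d\<in>D. 
     (\<integral>\<omega>. exp (a n * ((Gi *v d) \<bullet> T n \<omega>)) \<partial>L n) \<le> exp (a n * (1/2 * ((Gi *v d) \<bullet> (G *v (Gi *v d))) + \<epsilon>))"
    using D(1) mgf_upper[OF \<epsilon>(1)] by (simp add: eventually_ball_finite_distrib)
  moreover have "\<forall>\<^sub>F n in sequentially. real (card D) \<le> exp (a n * \<epsilon>)"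
    by (rule eventually_const_le_exp[OF a_lim \<epsilon>(1)])
  ultimately show ?thesis using a_pos
  proof eventually_elim
    case (elim n)
    interpret prob_space "L n" by (rule prob)
    note [measurable] = T_meas[of n]
    have "prob {\<omega>\<in>space (L n). T n \<omega> \<in> A} \<le> prob (\<Union>d\<in>D. {\<omega>\<in>space (L n). (Gi *v d) \<bullet> T n \<omega> \<ge> 2 * \<alpha> - \<epsilon>})"
      by (rule finite_measure_mono) (use A D in \<open>auto intro!: sets.finite_UN simp: D\<close>)
    also have "\<dots> \<le> (\<Sum>d\<in>D. prob {\<omega>\<in>space (L n). (Gi *v d) \<bullet> T n \<omega> \<ge> 2 * \<alpha> - \<epsilon>})"
      using D(1) by (intro finite_measure_subadditive_finite) auto
    also have "\<dots> \<le> (\<Sum>d\<in>D. exp (- a n * (\<alpha> - 2 * \<epsilon>)))"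
    proof (rule sum_mono)
      fix d assume d: "d \<in> D"
      have "prob {\<omega>\<in>space (L n). (Gi *v d) \<bullet> T n \<omega> \<ge> 2 * \<alpha> - \<epsilon>} 
          \<le> exp (- a n * (2 * \<alpha> - \<epsilon>)) * (\<integral>\<omega>. exp (a n * ((Gi *v d) \<bullet> T n \<omega>)) \<partial>L n)"
        using elim(3) by (intro exp_markov mgf_int) auto
      also have "\<dots> \<le> exp (- a n * (2 * \<alpha> - \<epsilon>)) * exp (a n * (\<alpha> + \<epsilon>))"
        using elim(1) d D(2)[OF d] by (intro mult_left_mono) (auto simp: G_inv rate_def inner_commute)
      also have "\<dots> = exp (- a n * (\<alpha> - 2 * \<epsilon>))"
        by (simp add: algebra_simps flip: exp_add)
      finally show "prob {\<omega>\<in>space (L n). (Gi *v d) \<bullet> T n \<omega> \<ge> 2 * \<alpha> - \<epsilon>} \<le> exp (- a n * (\<alpha> - 2 * \<epsilon>))" .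
    qed
    also have "\<dots> = real (card D) * exp (- a n * (\<alpha> - 2 * \<epsilon>))" by simp
    also have "\<dots> \<le> exp (a n * \<epsilon>) * exp (- a n * (\<alpha> - 2 * \<epsilon>))"
      using elim by (intro mult_right_mono) auto
    also have "\<dots> = exp (- a n * (\<alpha> - 3 * \<epsilon>))"
      by (simp add: algebra_simps flip: exp_add)
    also have "\<dots> \<le> exp (- a n * (\<alpha> - e))" using \<epsilon> elim by (simp add: mult_left_mono)
    finally show ?case .
  qed
qed

text \<open>Under the tilt by \<open>\<theta> = G\<^sup>-\<^sup>1 x\<close> the mean is \<open>x\<close>, and the probability of missing a
  small box around \<open>x\<close> decays exponentially, by the upper bounds for the tilts near \<open>\<theta>\<close>.\<close>

lemma prob_lower_bound:
  assumes x: "x \<in> interior A" and A: "A \<in> sets borel" and "e > 0"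
  shows "\<forall>\<^sub>F n in sequentially. measure (L n) {\<omega>\<in>space (L n). T n \<omega> \<in> A} \<ge> exp (- a n * (rate x + e))"
proof -
  define \<theta> where "\<theta> = Gi *v x"
  have G\<theta>: "G *v \<theta> = x" by (simp add: \<theta>_def G_inv)
  have q: "1/2 * (\<theta> \<bullet> x) = rate x" by (simp add: \<theta>_def rate_def inner_commute)
  define N where "N = (\<Sum>i\<in>UNIV. \<bar>\<theta> $ i\<bar>) + 1"
  have N: "N \<ge> 1" "(\<Sum>i\<in>UNIV. \<bar>\<theta> $ i\<bar>) \<le> N" by (auto simp: N_def sum_nonneg)
  obtain \<delta>0 where \<delta>0: "\<delta>0 > 0" "ball x \<delta>0 \<subseteq> A" using x by (auto simp: mem_interior)
  define \<delta> where "\<delta> = min (\<delta>0 / (2 * real CARD('m))) (min 1 (e / (3 * N)))"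
  have \<delta>: "\<delta> > 0" "CARD('m) * \<delta> < \<delta>0" "N * \<delta> \<le> e / 3" "\<delta> \<le> 1"
  proof -
    show "\<delta> > 0" using \<delta>0 assms N by (auto simp: \<delta>_def)
    have "CARD('m) * \<delta> \<le> CARD('m) * (\<delta>0 / (2 * real CARD('m)))"
      by (intro mult_left_mono) (auto simp: \<delta>_def)
    also have "\<dots> < \<delta>0" using \<delta>0 by simp
    finally show "CARD('m) * \<delta> < \<delta>0" .
    have "N * \<delta> \<le> N * (e / (3 * N))" using N by (intro mult_left_mono) (auto simp: \<delta>_def)
    then show "N * \<delta> \<le> e / 3" using N by simp
  qed (auto simp: \<delta>_def)
  define H where "H = (\<lambda>(i::'m, \<sigma>::bool). (if \<sigma> then 1 else -1 :: real) *\<^sub>R (axis i 1 :: real^'m))"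
  define g where "g = Max ((\<lambda>\<eta>. \<eta> \<bullet> (G *v \<eta>)) ` range H) + 1"
  have g: "\<eta> \<bullet> (G *v \<eta>) \<le> g" if "\<eta> \<in> range H" for \<eta>
  proof -
    have "\<eta> \<bullet> (G *v \<eta>) \<le> Max ((\<lambda>\<eta>. \<eta> \<bullet> (G *v \<eta>)) ` range H)"
      using that by (intro Max_ge) auto
    then show ?thesis unfolding g_def by linarith
  qed
  have g_pos: "g > 0"
  proof -
    have "H (undefined, True) \<noteq> 0" by (simp add: H_def axis_eq_0_iff)
    then show ?thesis using G_pos g[of "H (undefined, True)"] by fastforce
  qed
  define s where "s = min (min 1 e) (\<delta> / g)"
  have s: "s > 0" "s * g \<le> \<delta>" "s \<le> 1" "s \<le> e"
  proof -
    have "s \<le> \<delta> / g" by (simp add: s_def)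
    then show "s * g \<le> \<delta>" using g_pos by (simp add: field_simps)
  qed (use \<delta> g_pos assms in \<open>auto simp: s_def\<close>)
  define \<epsilon> where "\<epsilon> = s * \<delta> / 8"
  have \<epsilon>: "\<epsilon> > 0" "\<epsilon> \<le> e / 8" using s \<delta> unfolding \<epsilon>_def by (auto intro: order.trans[OF mult_mono[of s e \<delta> 1]])
  have "\<forall>\<^sub>F n in sequentially. \<forall>\<eta>\<in>range H. 
     (\<integral>\<omega>. exp (a n * ((\<theta> + s *\<^sub>R \<eta>) \<bullet> T n \<omega>)) \<partial>L n)
       \<le> exp (a n * (1/2 * ((\<theta> + s *\<^sub>R \<eta>) \<bullet> (G *v (\<theta> + s *\<^sub>R \<eta>))) + \<epsilon>))"
    by (subst eventually_ball_finite_distrib) (use mgf_upper[OF \<epsilon>(1)] in auto)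
  moreover have "\<forall>\<^sub>F n in sequentially. (\<integral>\<omega>. exp (a n * (\<theta> \<bullet> T n \<omega>)) \<partial>L n) \<ge> exp (a n * (1/2 * (\<theta> \<bullet> (G *v \<theta>)) - \<epsilon>))"
    using mgf_lower[OF \<epsilon>(1)] .
  moreover have "\<forall>\<^sub>F n in sequentially. 2 * real (card (range H)) \<le> exp (a n * (s * \<delta> / 4))"
    using s \<delta> by (intro eventually_const_le_exp[OF a_lim]) auto
  moreover have "\<forall>\<^sub>F n in sequentially. 2 \<le> exp (a n * (e / 3))"
    using assms by (intro eventually_const_le_exp[OF a_lim]) auto
  ultimately show ?thesis using a_pos
  proof eventually_elim
    case (elim n)
    interpret prob_space "L n" by (rule prob)
    note [measurable] = T_meas[of n]
    let ?g = "\<lambda>\<omega>. exp (a n * (\<theta> \<bullet> T n \<omega>))"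
    let ?bad = "\<lambda>\<eta>. {\<omega>\<in>space (L n). \<eta> \<bullet> (T n \<omega> - x) \<ge> \<delta>}"
    let ?good = "{\<omega>\<in>space (L n). \<forall>\<eta>\<in>range H. \<eta> \<bullet> (T n \<omega> - x) < \<delta>}"
    let ?q = "rate x"
    have fin: "finite (range H)" by simp
    have good_meas[measurable]: "?good \<in> sets (L n)" using fin by measurable
    have coord: "\<bar>(T n \<omega> - x) $ i\<bar> < \<delta>" if "\<omega> \<in> ?good" for \<omega> i
    proof -
      have "H (i, True) \<bullet> (T n \<omega> - x) < \<delta>" "H (i, False) \<bullet> (T n \<omega> - x) < \<delta>" using that by blast+
      then show ?thesis by (simp add: H_def inner_axis' abs_less_iff)
    qed
    have bad: "(\<integral>\<omega>. ?g \<omega> * indicator (?bad \<eta>) \<omega> \<partial>L n) \<le> exp (a n * (?q - 3 * s * \<delta> / 8))" if "\<eta> \<in> range H" for \<eta>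
    proof -
      have "(\<integral>\<omega>. ?g \<omega> * indicator (?bad \<eta>) \<omega> \<partial>L n) 
         \<le> (\<integral>\<omega>. exp (- a n * s * (\<delta> + \<eta> \<bullet> x)) * exp (a n * ((\<theta> + s *\<^sub>R \<eta>) \<bullet> T n \<omega>)) \<partial>L n)"
      proof (rule integral_mono)
        show "integrable (L n) (\<lambda>\<omega>. ?g \<omega> * indicator (?bad \<eta>) \<omega>)"
          by (intro integrable_real_mult_indicator mgf_int) measurable
        fix \<omega>
        show "?g \<omega> * indicator (?bad \<eta>) \<omega> \<le> exp (- a n * s * (\<delta> + \<eta> \<bullet> x)) * exp (a n * ((\<theta> + s *\<^sub>R \<eta>) \<bullet> T n \<omega>))"
        proof (cases "\<omega> \<in> ?bad \<eta>")
          case True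
          then have "a n * s * \<delta> \<le> a n * s * (\<eta> \<bullet> T n \<omega> - \<eta> \<bullet> x)" 
            using elim s by (intro mult_left_mono) (auto simp: inner_diff_right)
          then show ?thesis using True by (simp add: inner_add_left algebra_simps flip: exp_add)
        qed simp
      qed (use mgf_int in auto)
      also have "\<dots> = exp (- a n * s * (\<delta> + \<eta> \<bullet> x)) * (\<integral>\<omega>. exp (a n * ((\<theta> + s *\<^sub>R \<eta>) \<bullet> T n \<omega>)) \<partial>L n)" by simp
      also have "\<dots> \<le> exp (- a n * s * (\<delta> + \<eta> \<bullet> x)) * exp (a n * (1/2 * ((\<theta> + s *\<^sub>R \<eta>) \<bullet> (G *v (\<theta> + s *\<^sub>R \<eta>))) + \<epsilon>))"
        using elim(1) that by (intro mult_left_mono) auto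
      also have "\<dots> = exp (a n * (1/2 * ((\<theta> + s *\<^sub>R \<eta>) \<bullet> (G *v (\<theta> + s *\<^sub>R \<eta>))) + \<epsilon> - s * \<delta> - s * (\<eta> \<bullet> x)))"
        by (simp add: algebra_simps flip: exp_add)
      also have "1/2 * ((\<theta> + s *\<^sub>R \<eta>) \<bullet> (G *v (\<theta> + s *\<^sub>R \<eta>))) = ?q + s * (\<eta> \<bullet> x) + s / 2 * (s * (\<eta> \<bullet> (G *v \<eta>)))"
        using q G_sym[of \<theta> \<eta>]
        by (simp add: matrix_vector_right_distrib matrix_vector_mult_scaleR inner_add_left inner_add_right G\<theta> inner_commute algebra_simps)
      also have "exp (a n * (?q + s * (\<eta> \<bullet> x) + s / 2 * (s * (\<eta> \<bullet> (G *v \<eta>))) + \<epsilon> - s * \<delta> - s * (\<eta> \<bullet> x)))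
          \<le> exp (a n * (?q - 3 * s * \<delta> / 8))"
      proof -
        have "s * (\<eta> \<bullet> (G *v \<eta>)) \<le> \<delta>" using g[OF that] s by (meson mult_left_mono order.trans less_imp_le)
        then have "s / 2 * (s * (\<eta> \<bullet> (G *v \<eta>))) \<le> s / 2 * \<delta>" using s by (intro mult_left_mono) auto
        also have "\<dots> = s * \<delta> - 3 * s * \<delta> / 8 - s * \<delta> / 8" by simp
        finally have "?q + s * (\<eta> \<bullet> x) + s / 2 * (s * (\<eta> \<bullet> (G *v \<eta>))) + \<epsilon> - s * \<delta> - s * (\<eta> \<bullet> x) \<le> ?q - 3 * s * \<delta> / 8"
          unfolding \<epsilon>_def by linarith
        then show ?thesis using elim by (simp add: mult_left_mono)
      qed
      finally show ?thesis .
    qed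
    have int_good: "integrable (L n) (\<lambda>\<omega>. ?g \<omega> * indicator ?good \<omega>)"
      by (intro integrable_real_mult_indicator mgf_int) measurable
    have int_bad: "integrable (L n) (\<lambda>\<omega>. ?g \<omega> * indicator (?bad \<eta>) \<omega>)" for \<eta>
      by (intro integrable_real_mult_indicator mgf_int) measurable
    have "exp (a n * (?q - \<epsilon>)) \<le> (\<integral>\<omega>. ?g \<omega> \<partial>L n)" using elim(2) q by (simp add: G\<theta>)
    also have "\<dots> \<le> (\<integral>\<omega>. ?g \<omega> * indicator ?good \<omega> + (\<Sum>\<eta>\<in>range H. ?g \<omega> * indicator (?bad \<eta>) \<omega>) \<partial>L n)"
    proof (rule integral_mono)
      fix \<omega> assume \<omega>: "\<omega> \<in> space (L n)"
      show "?g \<omega> \<le> ?g \<omega> * indicator ?good \<omega> + (\<Sum>\<eta>\<in>range H. ?g \<omega> * indicator (?bad \<eta>) \<omega>)"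
      proof (cases "\<omega> \<in> ?good")
        case True then show ?thesis by (simp add: sum_nonneg)
      next
        case False
        then obtain \<eta> where \<eta>: "\<eta> \<in> range H" "\<omega> \<in> ?bad \<eta>" using \<omega> by (auto simp: not_less)
        have "?g \<omega> * indicator (?bad \<eta>) \<omega> \<le> (\<Sum>\<eta>\<in>range H. ?g \<omega> * indicator (?bad \<eta>) \<omega>)"
          using \<eta> by (intro member_le_sum) auto
        then show ?thesis using \<eta> False by simp
      qed
    next
      show "integrable (L n) (\<lambda>\<omega>. ?g \<omega> * indicator ?good \<omega> + (\<Sum>\<eta>\<in>range H. ?g \<omega> * indicator (?bad \<eta>) \<omega>))"
        by (intro Bochner_Integration.integrable_add Bochner_Integration.integrable_sum int_good int_bad)
    qed (rule mgf_int)
    also have "\<dots> = (\<integral>\<omega>. ?g \<omega> * indicator ?good \<omega> \<partial>L n) + (\<Sum>\<eta>\<in>range H. (\<integral>\<omega>. ?g \<omega> * indicator (?bad \<eta>) \<omega> \<partial>L n))"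
      by (subst Bochner_Integration.integral_add, rule int_good, rule Bochner_Integration.integrable_sum, rule int_bad,
          subst Bochner_Integration.integral_sum, rule int_bad, rule refl)
    also have "\<dots> \<le> (\<integral>\<omega>. exp (a n * (2 * ?q + N * \<delta>)) * indicator ?good \<omega> \<partial>L n) + (\<Sum>\<eta>\<in>range H. exp (a n * (?q - 3 * s * \<delta> / 8)))"
    proof (intro add_mono sum_mono bad integral_mono)
      fix \<omega>
      show "?g \<omega> * indicator ?good \<omega> \<le> exp (a n * (2 * ?q + N * \<delta>)) * indicator ?good \<omega>"
      proof (cases "\<omega> \<in> ?good")
        case True
        have "\<theta> \<bullet> T n \<omega> = \<theta> \<bullet> x + \<theta> \<bullet> (T n \<omega> - x)" by (simp add: inner_diff_right)
        also have "\<theta> \<bullet> (T n \<omega> - x) \<le> (\<Sum>i\<in>UNIV. \<bar>\<theta> $ i\<bar> * \<delta>)"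
          unfolding inner_vec_def
        proof (rule sum_mono)
          fix i
          have "\<theta> $ i * (T n \<omega> - x) $ i \<le> \<bar>\<theta> $ i\<bar> * \<bar>(T n \<omega> - x) $ i\<bar>" by (metis abs_ge_self abs_mult)
          also have "\<dots> \<le> \<bar>\<theta> $ i\<bar> * \<delta>" using coord[OF True, of i] by (intro mult_left_mono) auto
          finally show "\<theta> $ i \<bullet> (T n \<omega> - x) $ i \<le> \<bar>\<theta> $ i\<bar> * \<delta>" by simp
        qed
        also have "\<dots> \<le> N * \<delta>" unfolding sum_distrib_right[symmetric] using N \<delta> by (intro mult_right_mono) auto
        finally show ?thesis using True q elim by (simp add: mult_left_mono)
      qed simp
    next
      show "integrable (L n) (\<lambda>\<omega>. ?g \<omega> * indicator ?good \<omega>)" by (rule int_good)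
    next
      show "integrable (L n) (\<lambda>\<omega>. exp (a n * (2 * ?q + N * \<delta>)) * indicator ?good \<omega>)"
        by (intro integrable_mult_right integrable_real_indicator good_meas) (simp add: emeasure_eq_measure)
    qed
    also have "\<dots> = exp (a n * (2 * ?q + N * \<delta>)) * prob ?good + real (card (range H)) * exp (a n * (?q - 3 * s * \<delta> / 8))"
      by simp
    finally have main: "exp (a n * (?q - \<epsilon>)) \<le> exp (a n * (2 * ?q + N * \<delta>)) * prob ?good + real (card (range H)) * exp (a n * (?q - 3 * s * \<delta> / 8))" .
    have "real (card (range H)) * exp (a n * (?q - 3 * s * \<delta> / 8)) \<le> exp (a n * (s * \<delta> / 4)) / 2 * exp (a n * (?q - 3 * s * \<delta> / 8))"
      using elim(3) by (intro mult_right_mono) auto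
    also have "\<dots> = exp (a n * (?q - \<epsilon>)) / 2" unfolding \<epsilon>_def by (simp add: algebra_simps flip: exp_add)
    finally have "exp (a n * (?q - \<epsilon>)) / 2 \<le> exp (a n * (2 * ?q + N * \<delta>)) * prob ?good" using main by linarith
    then have "exp (- a n * (2 * ?q + N * \<delta>)) * (exp (a n * (?q - \<epsilon>)) / 2) \<le> exp (- a n * (2 * ?q + N * \<delta>)) * (exp (a n * (2 * ?q + N * \<delta>)) * prob ?good)"
      by (intro mult_left_mono) auto
    also have "\<dots> = prob ?good" by (simp add: mult.assoc[symmetric] flip: exp_add)
    finally have 1: "exp (- a n * (?q + N * \<delta> + \<epsilon>)) / 2 \<le> prob ?good" by (simp add: algebra_simps flip: exp_add)
    have "exp (- a n * (?q + e)) * 2 \<le> exp (- a n * (?q + e)) * exp (a n * (e / 3))"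
      using elim by (intro mult_left_mono) auto
    also have "\<dots> = exp (- a n * (?q + 2 * e / 3))" by (simp add: algebra_simps flip: exp_add)
    also have "\<dots> \<le> exp (- a n * (?q + N * \<delta> + \<epsilon>))" using \<epsilon> \<delta> elim assms by (simp add: mult_left_mono)
    finally have "exp (- a n * (?q + e)) \<le> prob ?good" using 1 by simp
    also have "\<dots> \<le> prob {\<omega>\<in>space (L n). T n \<omega> \<in> A}"
    proof (rule finite_measure_mono)
      show "?good \<subseteq> {\<omega> \<in> space (L n). T n \<omega> \<in> A}"
      proof safe
        fix \<omega> assume \<omega>: "\<omega> \<in> space (L n)" "\<forall>\<eta>\<in>range H. \<eta> \<bullet> (T n \<omega> - x) < \<delta>"
        have "norm (T n \<omega> - x) \<le> (\<Sum>i\<in>UNIV. \<bar>(T n \<omega> - x) $ i\<bar>)" by (rule norm_le_l1_cart)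
        also have "\<dots> \<le> (\<Sum>i::'m\<in>UNIV. \<delta>)" using coord \<omega> by (intro sum_mono less_imp_le) blast
        also have "\<dots> < \<delta>0" using \<delta> by simp
        finally show "T n \<omega> \<in> A" using \<delta>0 by (auto simp: dist_norm norm_minus_commute)
      qed
    qed (use A in measurable)
    finally show ?case .
  qed
qed

end

text \<open>An infimum that is infinite (over an empty set) or not attained is only approached through real
  levels, whence the two limits below rest on bounds at every single point or level of the rate
  function.\<close>

lemma liminf_ge_neg_INF:
  fixes p c :: "nat \<Rightarrow> real" and J :: "'x \<Rightarrow> real"
  assumes lower: "\<And>x e. x \<in> B \<Longrightarrow> e > 0 \<Longrightarrow> \<forall>\<^sub>F n in sequentially. p n \<ge> exp (- (J x + e) / c n)"
    and c: "\<forall>\<^sub>F n in sequentially. c n > 0"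
  shows "- (INF u\<in>B. ereal (J u)) \<le> liminf (\<lambda>n. ereal (c n) * log_prob (p n))"
proof -
  have "ereal (- J x) \<le> liminf (\<lambda>n. ereal (c n) * log_prob (p n))" if x: "x \<in> B" for x
  proof (rule ereal_le_epsilon2)
    fix e :: real assume "e > 0"
    have "\<forall>\<^sub>F n in sequentially. ereal (- J x - e) \<le> ereal (c n) * log_prob (p n)"
      using lower[OF x \<open>e > 0\<close>] c
    proof eventually_elim
      case (elim n)
      have p: "p n > 0" using elim(1) exp_gt_zero less_le_trans by blast
      then have "- (J x + e) / c n \<le> ln (p n)" using elim by (simp add: ln_ge_iff)
      then have "- (J x + e) \<le> c n * ln (p n)" using elim by (simp add: field_simps)
      then show ?case using p by (simp add: log_prob_def)
    qed
    then have "ereal (- J x - e) \<le> liminf (\<lambda>n. ereal (c n) * log_prob (p n))" by (rule Liminf_bounded)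
    then show "ereal (- J x) \<le> liminf (\<lambda>n. ereal (c n) * log_prob (p n)) + ereal e"
      by (cases "liminf (\<lambda>n. ereal (c n) * log_prob (p n))") auto
  qed
  then have "(SUP x\<in>B. - ereal (J x)) \<le> liminf (\<lambda>n. ereal (c n) * log_prob (p n))"
    by (intro SUP_least) simp
  then show ?thesis by (simp add: ereal_INF_uminus_eq ereal_uminus_le_reorder flip: ereal_SUP_uminus_eq)
qed

lemma limsup_le_neg_INF:
  fixes p c :: "nat \<Rightarrow> real" and J :: "'x \<Rightarrow> real"
  assumes upper: "\<And>\<alpha> e. (\<And>x. x \<in> B \<Longrightarrow> J x \<ge> \<alpha>) \<Longrightarrow> \<alpha> > 0 \<Longrightarrow> e > 0 \<Longrightarrow> \<forall>\<^sub>F n in sequentially. p n \<le> exp (- (\<alpha> - e) / c n)"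
    and c: "\<forall>\<^sub>F n in sequentially. c n > 0" and p: "\<And>n. 0 \<le> p n" "\<And>n. p n \<le> 1"
  shows "limsup (\<lambda>n. ereal (c n) * log_prob (p n)) \<le> - (INF u\<in>B. ereal (J u))"
proof -
  have "limsup (\<lambda>n. ereal (c n) * log_prob (p n)) \<le> ereal (- \<alpha>)" if \<alpha>: "ereal \<alpha> < (INF u\<in>B. ereal (J u))" for \<alpha>
  proof (cases "\<alpha> > 0")
    case True
    have B: "x \<in> B \<Longrightarrow> J x \<ge> \<alpha>" for x
    proof -
      assume "x \<in> B"
      then have "(INF u\<in>B. ereal (J u)) \<le> ereal (J x)" by (rule INF_lower)
      with \<alpha> have "ereal \<alpha> \<le> ereal (J x)" by (meson less_imp_le order.trans)
      then show ?thesis by simp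
    qed
    show ?thesis
    proof (rule ereal_le_epsilon2)
      fix e :: real assume "e > 0"
      have up: "\<forall>\<^sub>F n in sequentially. p n \<le> exp (- (\<alpha> - e) / c n)"
        by (rule upper[OF _ True \<open>e > 0\<close>]) (rule B)
      have "\<forall>\<^sub>F n in sequentially. ereal (c n) * log_prob (p n) \<le> ereal (- \<alpha> + e)"
        using up c
      proof eventually_elim
        case (elim n)
        show ?case
        proof (cases "p n = 0")
          case False
          then have "p n > 0" using p[of n] by simp
          then have "ln (p n) \<le> - (\<alpha> - e) / c n" using elim by (metis ln_exp ln_le_cancel_iff exp_gt_zero)
          then have "c n * ln (p n) \<le> - \<alpha> + e" using elim by (simp add: field_simps)
          then show ?thesis using False by (simp add: log_prob_def)
        qed (use elim in \<open>simp add: log_prob_def\<close>)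
      qed
      then have "limsup (\<lambda>n. ereal (c n) * log_prob (p n)) \<le> ereal (- \<alpha> + e)" by (rule Limsup_bounded)
      then show "limsup (\<lambda>n. ereal (c n) * log_prob (p n)) \<le> ereal (- \<alpha>) + ereal e" by simp
    qed
  next
    case False
    have "\<forall>\<^sub>F n in sequentially. ereal (c n) * log_prob (p n) \<le> 0"
      using c
    proof eventually_elim
      case (elim n)
      have "p n \<noteq> 0 \<Longrightarrow> ln (p n) \<le> 0" using p[of n] by simp
      then show ?case using elim by (auto simp: log_prob_def mult_nonneg_nonpos)
    qed
    then have "limsup (\<lambda>n. ereal (c n) * log_prob (p n)) \<le> 0" by (rule Limsup_bounded)
    then show ?thesis using False by (simp add: order.trans[where b = 0])
  qed
  then have *: "ereal \<alpha> \<le> - limsup (\<lambda>n. ereal (c n) * log_prob (p n))" if "ereal \<alpha> < (INF u\<in>B. ereal (J u))" for \<alpha>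
    using ereal_minus_le_minus[of "- limsup (\<lambda>n. ereal (c n) * log_prob (p n))" "ereal \<alpha>"] that by simp
  have "(INF u\<in>B. ereal (J u)) \<le> - limsup (\<lambda>n. ereal (c n) * log_prob (p n))"
  proof (rule dense_le)
    fix x assume "x < (INF u\<in>B. ereal (J u))"
    then obtain z where z: "x < ereal z" "ereal z < (INF u\<in>B. ereal (J u))" using ereal_dense2 by blast
    then show "x \<le> - limsup (\<lambda>n. ereal (c n) * log_prob (p n))"
      using *[OF z(2)] by (meson less_imp_le order.trans)
  qed
  then show ?thesis
    using ereal_minus_le_minus[of "- limsup (\<lambda>n. ereal (c n) * log_prob (p n))" "INF u\<in>B. ereal (J u)"] by simp
qed



section \<open>Random finite sets and their void probabilities\<close>

text \<open>A configuration is a finite set of points; events are generated by the void events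
  \<open>Y \<inter> B = {}\<close>. As void events are closed under intersection, a law on configurations
  is determined by its void probabilities (Renyi's theorem), and independence of restrictions to
  disjoint regions can be read off from them.\<close>

definition conf :: "'a::euclidean_space set measure" where
  "conf = sigma {Y. finite Y} {{Y. finite Y \<and> Y \<inter> B = {}} | B. B \<in> sets borel}"

lemma space_conf[simp]: "space conf = {Y. finite Y}"
  unfolding conf_def by (rule space_measure_of) auto

lemma sets_conf: "sets (conf :: 'a::euclidean_space set measure)
    = sigma_sets {Y. finite Y} {{Y. finite Y \<and> Y \<inter> B = {}} | B. B \<in> sets borel}"
  unfolding conf_def by (rule sets_measure_of) auto

lemma void_in_sets_conf[measurable]: "B \<in> sets borel \<Longrightarrow> {Y. finite Y \<and> Y \<inter> B = {}} \<in> sets conf"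
  unfolding sets_conf by (auto intro!: sigma_sets.Basic)

lemma measurable_confI:
  assumes "\<And>\<omega>. \<omega> \<in> space M \<Longrightarrow> finite (f \<omega>)"
    and "\<And>B. B \<in> sets borel \<Longrightarrow> {\<omega>\<in>space M. f \<omega> \<inter> B = {}} \<in> sets M"
  shows "f \<in> measurable M conf"
  unfolding conf_def
proof (rule measurable_measure_of)
  fix C assume "C \<in> {{Y. finite Y \<and> Y \<inter> B = {}} | B::'b set. B \<in> sets borel}"
  then obtain B where B: "B \<in> sets borel" "C = {Y. finite Y \<and> Y \<inter> B = {}}" by auto
  have "f -` C \<inter> space M = {\<omega>\<in>space M. f \<omega> \<inter> B = {}}" using assms(1) B by auto
  then show "f -` C \<inter> space M \<in> sets M" using assms(2) B by simp
qed (use assms in auto)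

lemma measurable_conf_void:
  assumes "f \<in> measurable M conf" "B \<in> sets borel"
  shows "{\<omega>\<in>space M. f \<omega> \<inter> B = {}} \<in> sets M"
proof -
  have "f -` {Y. finite Y \<and> Y \<inter> B = {}} \<inter> space M \<in> sets M" using assms by (intro measurable_sets) auto
  moreover have "f -` {Y. finite Y \<and> Y \<inter> B = {}} \<inter> space M = {\<omega>\<in>space M. f \<omega> \<inter> B = {}}"
    using measurable_space[OF assms(1)] by auto
  ultimately show ?thesis by simp
qed

text \<open>The void events are stable under intersection: avoiding \<open>B\<close> and \<open>C\<close> means avoiding \<open>B \<union> C\<close>.\<close>

lemma conf_measure_eqI:
  assumes "prob_space M" "prob_space N" and sets: "sets M = sets conf" "sets N = sets conf"
    and void: "\<And>B. B \<in> sets borel \<Longrightarrow> measure M {Y. finite Y \<and> Y \<inter> B = {}} = measure N {Y. finite Y \<and> Y \<inter> B = {}}"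
  shows "M = N"
proof -
  interpret M: prob_space M by fact
  interpret N: prob_space N by fact
  let ?E = "{{Y. finite Y \<and> Y \<inter> B = {}} | B::'a set. B \<in> sets borel}"
  show ?thesis
  proof (rule measure_eqI_generator_eq[where E = ?E and \<Omega> = "{Y. finite Y}" and A = "\<lambda>_. {Y. finite Y}"])
    show "Int_stable ?E"
    proof (rule Int_stableI)
      fix C D assume "C \<in> ?E" "D \<in> ?E"
      then obtain A B where "A \<in> sets borel" "C = {Y. finite Y \<and> Y \<inter> A = {}}" 
        "B \<in> sets borel" "D = {Y. finite Y \<and> Y \<inter> B = {}}" by auto
      then show "C \<inter> D \<in> ?E" by (intro CollectI exI[of _ "A \<union> B"]) auto
    qed
    show "range (\<lambda>_. {Y. finite Y}) \<subseteq> ?E" by (auto intro!: exI[of _ "{}"])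
  qed (use sets void in \<open>auto simp: sets_conf M.emeasure_eq_measure N.emeasure_eq_measure\<close>)
qed

lemma measurable_conf_Int[measurable]:
  assumes "W \<in> sets borel" shows "(\<lambda>Y. Y \<inter> W) \<in> measurable conf conf"
proof (rule measurable_confI)
  fix B :: "'a set" assume "B \<in> sets borel"
  have "{Y \<in> space conf. Y \<inter> W \<inter> B = {}} = {Y. finite Y \<and> Y \<inter> (W \<inter> B) = {}}" by (auto simp: Int_assoc)
  then show "{Y \<in> space conf. Y \<inter> W \<inter> B = {}} \<in> sets conf" using assms \<open>B \<in> sets borel\<close> by simp
qed auto

lemma measurable_conf_image:
  fixes f :: "'i \<Rightarrow> 'w \<Rightarrow> 'b::euclidean_space"
  assumes [measurable]: "\<And>i. i \<in> I \<Longrightarrow> f i \<in> borel_measurable M" and I: "finite I"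
  shows "(\<lambda>\<omega>. (\<lambda>i. f i \<omega>) ` I) \<in> measurable M conf"
proof (rule measurable_confI)
  fix B :: "'b set" assume [measurable]: "B \<in> sets borel"
  have "{\<omega>\<in>space M. (\<lambda>i. f i \<omega>) ` I \<inter> B = {}} = {\<omega>\<in>space M. \<forall>i\<in>I. f i \<omega> \<notin> B}" by auto
  also have "\<dots> \<in> sets M" using I by measurable
  finally show "{\<omega>\<in>space M. (\<lambda>i. f i \<omega>) ` I \<inter> B = {}} \<in> sets M" .
qed (use I in auto)

lemma measurable_tuple_conf[measurable]:
  "finite I \<Longrightarrow> (\<lambda>x. x ` I) \<in> measurable (PiM I (\<lambda>_. borel)) conf"
  by (rule measurable_conf_image) auto

text \<open>Counts are determined by void events: \<open>Y\<close> has \<open>j\<close> points in \<open>B\<close> iff it hits \<open>B\<close> in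
  \<open>j\<close> pairwise disjoint members of a countable base.\<close>

lemma separated_base_sets:
  fixes Z :: "'a::metric_space set"
  assumes "finite Z" "topological_basis \<B>"
  obtains f where "\<And>z. z \<in> Z \<Longrightarrow> f z \<in> \<B>" "\<And>z. z \<in> Z \<Longrightarrow> z \<in> f z" "disjoint_family_on f Z"
proof -
  have "\<exists>d>0. \<forall>z\<in>Z. z \<noteq> a \<longrightarrow> d \<le> dist a z" for a by (rule finite_set_avoid[OF assms(1)])
  then obtain d where d: "\<And>a. d a > 0" "\<And>a z. z \<in> Z \<Longrightarrow> z \<noteq> a \<Longrightarrow> d a \<le> dist a z" by metis
  define e where "e = Min (insert 1 (d ` Z))"
  have e: "e > 0" "\<And>a. a \<in> Z \<Longrightarrow> e \<le> d a" using assms(1) d(1) by (auto simp: e_def)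
  have "\<exists>b. b \<in> \<B> \<and> z \<in> b \<and> b \<subseteq> ball z (e/2)" for z
    using topological_basisE[OF assms(2), of "ball z (e/2)" z] e(1) by (metis centre_in_ball half_gt_zero open_ball)
  then obtain f where f: "\<And>z. f z \<in> \<B>" "\<And>z. z \<in> f z" "\<And>z. f z \<subseteq> ball z (e/2)" by metis
  have "disjoint_family_on f Z"
    unfolding disjoint_family_on_def
  proof (intro ballI impI)
    fix z z' assume z: "z \<in> Z" "z' \<in> Z" "z \<noteq> z'"
    have "e \<le> dist z z'" using e(2)[of z] d(2)[of z' z] z by force
    then show "f z \<inter> f z' = {}"
      using f(3)[of z] f(3)[of z'] dist_triangle_half_r[of _ z e z'] by (force simp: dist_commute)
  qed
  then show thesis using that f by blast
qed

lemma card_ge_iff_hits_disjoint: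
  fixes Y :: "'a::metric_space set"
  assumes "finite Y" "topological_basis \<B>"
  shows "k \<le> card (Y \<inter> B) \<longleftrightarrow> (\<exists>C \<in> {C. C \<subseteq> \<B> \<and> finite C}. card C = k \<and> disjoint C \<and> (\<forall>b\<in>C. Y \<inter> (B \<inter> b) \<noteq> {}))"
proof
  assume "k \<le> card (Y \<inter> B)"
  then obtain Z where Z: "Z \<subseteq> Y \<inter> B" "card Z = k" "finite Z" using obtain_subset_with_card_n by metis
  obtain f where f: "\<And>z. z \<in> Z \<Longrightarrow> f z \<in> \<B>" "\<And>z. z \<in> Z \<Longrightarrow> z \<in> f z" "disjoint_family_on f Z"
    using separated_base_sets[OF Z(3) assms(2)] by metis
  have "inj_on f Z" using f(2,3) by (force simp: inj_on_def disjoint_family_on_def)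
  moreover have "disjoint (f ` Z)" using f(3) by (rule disjoint_family_on_disjoint_image)
  ultimately show "\<exists>C \<in> {C. C \<subseteq> \<B> \<and> finite C}. card C = k \<and> disjoint C \<and> (\<forall>b\<in>C. Y \<inter> (B \<inter> b) \<noteq> {})"
    using Z f by (intro bexI[of _ "f ` Z"]) (auto simp: card_image)
next
  assume "\<exists>C \<in> {C. C \<subseteq> \<B> \<and> finite C}. card C = k \<and> disjoint C \<and> (\<forall>b\<in>C. Y \<inter> (B \<inter> b) \<noteq> {})"
  then obtain C where C: "finite C" "card C = k" "disjoint C" "\<forall>b\<in>C. Y \<inter> (B \<inter> b) \<noteq> {}" by auto
  then have "\<forall>b\<in>C. \<exists>y. y \<in> Y \<inter> (B \<inter> b)" by blast
  then obtain y where y: "\<And>b. b \<in> C \<Longrightarrow> y b \<in> Y \<inter> (B \<inter> b)" by metis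
  have "inj_on y C" using y C(3) unfolding inj_on_def disjoint_def by (metis IntD2 IntI emptyE)
  then have "card C \<le> card (Y \<inter> B)" using y assms(1) by (intro card_inj_on_le[of y]) auto
  then show "k \<le> card (Y \<inter> B)" using C by simp
qed

lemma measurable_conf_card[measurable]:
  fixes B :: "'a::euclidean_space set"
  assumes "B \<in> sets borel" shows "(\<lambda>Y. card (Y \<inter> B)) \<in> measurable conf (count_space UNIV)"
proof -
  obtain \<B> :: "'a set set" where B: "countable \<B>" "topological_basis \<B>" using ex_countable_basis by metis
  have \<B>: "b \<in> sets borel" if "b \<in> \<B>" for b using topological_basis_open[OF B(2) that] by simp
  have ge: "{Y \<in> space conf. k \<le> card (Y \<inter> B)} \<in> sets conf" for k
  proof -
    have "{Y \<in> space conf. k \<le> card (Y \<inter> B)} = {Y \<in> space conf. \<exists>C \<in> {C. C \<subseteq> \<B> \<and> finite C}. 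
        card C = k \<and> disjoint C \<and> (\<forall>b\<in>C. \<not> Y \<inter> (B \<inter> b) = {})}"
      using card_ge_iff_hits_disjoint[OF _ B(2)] by auto
    also have "\<dots> = (\<Union>C \<in> {C. C \<subseteq> \<B> \<and> finite C \<and> card C = k \<and> disjoint C}. {Y \<in> space conf. \<forall>b\<in>C. \<not> Y \<inter> (B \<inter> b) = {}})"
      by auto
    also have "\<dots> \<in> sets conf"
    proof (rule sets.countable_UN'')
      show "countable {C. C \<subseteq> \<B> \<and> finite C \<and> card C = k \<and> disjoint C}"
        by (rule countable_subset[OF _ countable_Collect_finite_subset[OF B(1)]]) auto
      fix C assume C: "C \<in> {C. C \<subseteq> \<B> \<and> finite C \<and> card C = k \<and> disjoint C}"
      have "{Y \<in> space conf. \<forall>b\<in>C. \<not> Y \<inter> (B \<inter> b) = {}} = space conf - (\<Union>b\<in>C. {Y. finite Y \<and> Y \<inter> (B \<inter> b) = {}})"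
        by auto
      also have "\<dots> \<in> sets conf" using C \<B> assms
        by (intro sets.Diff sets.top sets.finite_UN void_in_sets_conf sets.Int) auto
      finally show "{Y \<in> space conf. \<forall>b\<in>C. \<not> Y \<inter> (B \<inter> b) = {}} \<in> sets conf" .
    qed
    finally show ?thesis .
  qed
  have eq: "(\<lambda>Y. card (Y \<inter> B)) -` {j} \<inter> space conf
      = {Y \<in> space conf. j \<le> card (Y \<inter> B)} - {Y \<in> space conf. Suc j \<le> card (Y \<inter> B)}" for j
    by auto
  have "(\<lambda>Y. card (Y \<inter> B)) -` {j} \<inter> space conf \<in> sets conf" for j
    unfolding eq by (intro sets.Diff ge)
  then show ?thesis
    by (subst measurable_count_space_eq2_countable) auto
qed

text \<open>The uniform distribution on the points of a configuration. Sums over the points of a configuration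
  are integrals against this kernel, which makes them measurable also in further parameters.\<close>

definition point_kernel :: "'a::euclidean_space set \<Rightarrow> 'a measure" where
  "point_kernel Y = scale_measure (ennreal (1 / real (card Y))) (distr (count_space Y) borel id)"

lemma point_kernel_measurable: "point_kernel \<in> measurable conf (subprob_algebra borel)"
proof (rule measurable_subprob_algebra)
  have em: "emeasure (point_kernel Y) B = ennreal (real (card (Y \<inter> B)) / real (card Y))" 
    if "finite Y" "B \<in> sets borel" for Y B :: "'a set"
    using that by (simp add: point_kernel_def emeasure_distr Int_commute ennreal_of_nat_eq_real_of_nat flip: ennreal_mult)
  fix Y :: "'a set" assume Y: "Y \<in> space conf"
  show "subprob_space (point_kernel Y)"
  proof
    have "emeasure (point_kernel Y) UNIV \<le> 1" using em[of Y UNIV] Y by simp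
    then show "emeasure (point_kernel Y) (space (point_kernel Y)) \<le> 1" 
      by (simp add: point_kernel_def space_scale_measure)
  qed (simp add: point_kernel_def space_scale_measure)
next
  fix B :: "'a set" assume B[measurable]: "B \<in> sets borel"
  have "(\<lambda>Y. ennreal (real (card (Y \<inter> B)) / real (card (Y \<inter> UNIV)))) \<in> borel_measurable conf"
    by measurable
  then show "(\<lambda>Y. emeasure (point_kernel Y) B) \<in> borel_measurable conf"
    by (rule measurable_cong[THEN iffD1, rotated])
       (auto simp: point_kernel_def emeasure_distr Int_commute ennreal_of_nat_eq_real_of_nat simp flip: ennreal_mult)
qed (simp add: point_kernel_def)

lemma measurable_point_sum_ennreal:
  fixes f :: "'p \<Rightarrow> 'a::euclidean_space \<Rightarrow> ennreal"
  assumes [measurable]: "Y \<in> measurable N conf" "case_prod f \<in> borel_measurable (N \<Otimes>\<^sub>M borel)"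
  shows "(\<lambda>p. \<Sum>y\<in>Y p. f p y) \<in> borel_measurable N"
proof -
  have [measurable]: "(\<lambda>p. \<integral>\<^sup>+y. f p y \<partial>point_kernel (Y p)) \<in> borel_measurable N"
    by (rule nn_integral_measurable_subprob_algebra2[OF assms(2) measurable_compose[OF assms(1) point_kernel_measurable]])
  have [measurable]: "(\<lambda>p. card (Y p \<inter> UNIV)) \<in> measurable N (count_space UNIV)"
    by (rule measurable_compose[OF assms(1) measurable_conf_card]) simp
  have "(\<lambda>p. of_nat (card (Y p \<inter> UNIV)) * (\<integral>\<^sup>+y. f p y \<partial>point_kernel (Y p))) \<in> borel_measurable N"
    by measurable
  moreover have "of_nat (card (Y p \<inter> UNIV)) * (\<integral>\<^sup>+y. f p y \<partial>point_kernel (Y p)) = (\<Sum>y\<in>Y p. f p y)" if p: "p \<in> space N" for p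
  proof -
    have fin: "finite (Y p)" using measurable_space[OF assms(1) p] by simp
    have [measurable]: "f p \<in> borel_measurable borel" using measurable_Pair2[OF assms(2) p] by simp
    have "(\<integral>\<^sup>+y. f p y \<partial>point_kernel (Y p)) = ennreal (1 / real (card (Y p))) * (\<Sum>y\<in>Y p. f p y)"
      using fin unfolding point_kernel_def
      by (subst nn_integral_scale_measure) (auto simp: nn_integral_distr nn_integral_count_space_finite)
    moreover have "of_nat (card (Y p)) * ennreal (1 / real (card (Y p))) = 1" if "Y p \<noteq> {}"
      using that fin by (simp add: ennreal_of_nat_eq_real_of_nat flip: ennreal_mult)
    ultimately show ?thesis using fin by (cases "Y p = {}") (simp_all flip: mult.assoc)
  qed
  ultimately show ?thesis by (simp cong: measurable_cong)
qed

lemma measurable_point_sum: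
  fixes f :: "'p \<Rightarrow> 'a::euclidean_space \<Rightarrow> real"
  assumes "Y \<in> measurable N conf" "case_prod f \<in> borel_measurable (N \<Otimes>\<^sub>M borel)"
  shows "(\<lambda>p. \<Sum>y\<in>Y p. f p y) \<in> borel_measurable N"
proof -
  have "case_prod (\<lambda>p y. ennreal (f p y)) \<in> borel_measurable (N \<Otimes>\<^sub>M borel)"
    "case_prod (\<lambda>p y. ennreal (- f p y)) \<in> borel_measurable (N \<Otimes>\<^sub>M borel)"
    using measurable_compose[OF assms(2) measurable_ennreal]
      measurable_compose[OF borel_measurable_uminus[OF assms(2)] measurable_ennreal]
    by (simp_all add: case_prod_beta')
  note m = this[THEN measurable_point_sum_ennreal[OF assms(1)]]
  have "(\<lambda>p. enn2real (\<Sum>y\<in>Y p. ennreal (f p y)) - enn2real (\<Sum>y\<in>Y p. ennreal (- f p y))) \<in> borel_measurable N"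
    by (rule borel_measurable_diff[OF borel_measurable_enn2real[OF m(1)] borel_measurable_enn2real[OF m(2)]])
  moreover have "enn2real (\<Sum>y\<in>Z. ennreal (f p y)) - enn2real (\<Sum>y\<in>Z. ennreal (- f p y)) = (\<Sum>y\<in>Z. f p y)" for p Z
  proof -
    have *: "enn2real (\<Sum>y\<in>Z. ennreal (g y)) = (\<Sum>y\<in>Z. max 0 (g y))" for g :: "'a \<Rightarrow> real"
    proof -
      have "(\<Sum>y\<in>Z. ennreal (g y)) = (\<Sum>y\<in>Z. ennreal (max 0 (g y)))" by (intro sum.cong refl) (simp add: max_def ennreal_neg)
      also have "\<dots> = ennreal (\<Sum>y\<in>Z. max 0 (g y))" by (rule sum_ennreal) simp
      finally show ?thesis by (simp add: sum_nonneg)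
    qed
    show ?thesis unfolding * sum_subtractf[symmetric] by (intro sum.cong) (auto simp: max_def)
  qed
  ultimately show ?thesis by simp
qed

lemma sum_PiE_Suc:
  "(\<Sum>x\<in>PiE {..<Suc k} (\<lambda>_. Y). f x) = (\<Sum>x\<in>PiE {..<k} (\<lambda>_. Y). \<Sum>y\<in>Y. f (x(k := y)))"
proof -
  have "(\<Sum>x\<in>PiE {..<Suc k} (\<lambda>_. Y). f x) = (\<Sum>x\<in>(\<lambda>(y, g). g(k := y)) ` (Y \<times> PiE {..<k} (\<lambda>_. Y)). f x)"
    by (subst lessThan_Suc, subst PiE_insert_eq, rule refl)
  also have "\<dots> = (\<Sum>(y, g)\<in>Y \<times> PiE {..<k} (\<lambda>_. Y). f (g(k := y)))"
    by (subst sum.reindex[OF inj_combinator]) (simp_all add: case_prod_unfold)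
  also have "\<dots> = (\<Sum>y\<in>Y. \<Sum>x\<in>PiE {..<k} (\<lambda>_. Y). f (x(k := y)))" by (rule sum.cartesian_product[symmetric])
  also have "\<dots> = (\<Sum>x\<in>PiE {..<k} (\<lambda>_. Y). \<Sum>y\<in>Y. f (x(k := y)))" by (rule sum.swap)
  finally show ?thesis .
qed

text \<open>By induction on the number of points, as a sum over tuples is an iterated sum over points.\<close>

lemma measurable_tuple_sum:
  fixes f :: "'p \<Rightarrow> (nat \<Rightarrow> 'a::euclidean_space) \<Rightarrow> real"
  assumes [measurable]: "Y \<in> measurable N conf"
    and f: "case_prod f \<in> borel_measurable (N \<Otimes>\<^sub>M PiM {..<k} (\<lambda>_. borel))"
  shows "(\<lambda>p. \<Sum>x\<in>PiE {..<k} (\<lambda>_. Y p). f p x) \<in> borel_measurable N"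
  using f
proof (induction k arbitrary: f)
  case 0
  note [measurable] = 0
  have "(\<lambda>p. (p, \<lambda>_. undefined)) \<in> N \<rightarrow>\<^sub>M N \<Otimes>\<^sub>M PiM {..<0} (\<lambda>_. borel :: 'a measure)"
    by (rule measurable_Pair, rule measurable_ident_sets, simp, rule measurable_const) (simp add: space_PiM PiE_def extensional_def)
  from measurable_compose[OF this 0] show ?case by (simp)
next
  case (Suc k)
  have upd: "(\<lambda>q. (fst (fst q), (snd (fst q))(k := snd q))) 
     \<in> ((N \<Otimes>\<^sub>M PiM {..<k} (\<lambda>_. borel)) \<Otimes>\<^sub>M borel) \<rightarrow>\<^sub>M N \<Otimes>\<^sub>M PiM {..<Suc k} (\<lambda>_. borel :: 'a measure)"
    by (rule measurable_Pair, measurable, rule measurable_fun_upd[where J = "{..<k}"]) (auto simp: lessThan_Suc)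
  have "(\<lambda>((p, x), y). f p (x(k := y))) \<in> borel_measurable ((N \<Otimes>\<^sub>M PiM {..<k} (\<lambda>_. borel)) \<Otimes>\<^sub>M borel)"
    using measurable_compose[OF upd Suc.prems] by (simp add: case_prod_beta')
  then have "(\<lambda>q. \<Sum>y\<in>Y (fst q). (\<lambda>(p, x) y. f p (x(k := y))) q y) \<in> borel_measurable (N \<Otimes>\<^sub>M PiM {..<k} (\<lambda>_. borel))"
    by (intro measurable_point_sum measurable_compose[OF measurable_fst assms(1)]) (simp add: case_prod_beta')
  then have "(\<lambda>p. \<Sum>x\<in>PiE {..<k} (\<lambda>_. Y p). \<Sum>y\<in>Y p. f p (x(k := y))) \<in> borel_measurable N"
    by (intro Suc.IH) (simp only: case_prod_beta')
  then show ?case by (simp add: sum_PiE_Suc)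
qed

text \<open>Measurability of sums over subsets is inherited from sums over tuples: every \<open>k\<close>-element set is
  enumerated by \<open>k!\<close> injective tuples.\<close>

lemma sum_subsets_eq_sum_tuples:
  fixes g :: "'a set \<Rightarrow> real"
  assumes "finite X"
  shows "(\<Sum>Y | Y \<subseteq> X \<and> card Y = k. g Y)
    = (\<Sum>x\<in>PiE {..<k} (\<lambda>_. X). if inj_on x {..<k} then g (x ` {..<k}) else 0) / fact k"
proof -
  let ?T = "{x \<in> PiE {..<k} (\<lambda>_. X). inj_on x {..<k}}"
  let ?S = "{Y. Y \<subseteq> X \<and> card Y = k}"
  have finP: "finite (PiE {..<k} (\<lambda>_. X))" using assms by (intro finite_PiE) auto
  then have finT: "finite ?T" by (rule rev_finite_subset) blast
  have finS: "finite ?S" by (rule finite_subset[of _ "Pow X"]) (use assms in auto)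
  have sub: "(\<lambda>x. x ` {..<k}) ` ?T \<subseteq> ?S" by (force simp: card_image)
  have "(\<Sum>x\<in>PiE {..<k} (\<lambda>_. X). if inj_on x {..<k} then g (x ` {..<k}) else 0) = (\<Sum>x\<in>?T. g (x ` {..<k}))"
    by (rule sum.inter_filter[OF finP, symmetric])
  also have "\<dots> = (\<Sum>Y\<in>?S. \<Sum>x\<in>{x\<in>?T. x ` {..<k} = Y}. g (x ` {..<k}))"
    by (rule sum.group[OF finT finS sub, symmetric])
  also have "\<dots> = (\<Sum>Y\<in>?S. fact k * g Y)"
  proof (intro sum.cong refl)
    fix Y assume Y: "Y \<in> ?S"
    then have finY: "finite Y" using assms finite_subset by auto
    have "{x\<in>?T. x ` {..<k} = Y} = {x \<in> {..<k} \<rightarrow>\<^sub>E Y. inj_on x {..<k}}"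
    proof (intro set_eqI iffI)
      fix x assume "x \<in> {x \<in> {..<k} \<rightarrow>\<^sub>E Y. inj_on x {..<k}}"
      then have x: "x \<in> {..<k} \<rightarrow>\<^sub>E Y" "inj_on x {..<k}" by auto
      then have "x ` {..<k} = Y" using Y finY by (intro card_subset_eq) (auto simp: card_image)
      then show "x \<in> {x\<in>?T. x ` {..<k} = Y}" using x Y by (auto simp: PiE_iff)
    qed auto
    moreover have "card {x \<in> {..<k} \<rightarrow>\<^sub>E Y. inj_on x {..<k}} = fact k"
      using Y finY by (subst card_inj_on_subset_funcset) (auto simp: fact_prod_rev)
    ultimately have "card {x\<in>?T. x ` {..<k} = Y} = fact k" by (simp only:)
    moreover have "(\<Sum>x\<in>{x\<in>?T. x ` {..<k} = Y}. g (x ` {..<k})) = (\<Sum>x\<in>{x\<in>?T. x ` {..<k} = Y}. g Y)"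
      by (intro sum.cong) auto
    ultimately show "(\<Sum>x\<in>{x\<in>?T. x ` {..<k} = Y}. g (x ` {..<k})) = fact k * g Y" by (simp only: sum_constant of_nat_fact)
  qed
  also have "\<dots> = fact k * (\<Sum>Y\<in>?S. g Y)" by (simp add: sum_distrib_left)
  finally show ?thesis by simp
qed



section \<open>Binomial and Poisson laws on configurations\<close>

definition binom_law :: "'a::euclidean_space set \<Rightarrow> nat \<Rightarrow> 'a set measure" where
  "binom_law W j = distr (PiM {..<j} (\<lambda>_. uniform_measure lborel W)) conf (\<lambda>x. x ` {..<j})"

definition pois_law :: "'a::euclidean_space set \<Rightarrow> real \<Rightarrow> 'a set measure" where
  "pois_law W c = measure_pmf (poisson_pmf (c * measure lborel W)) \<bind> binom_law W"

lemma sets_uniform_tuples: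
  "sets (PiM I (\<lambda>_. uniform_measure lborel W)) = sets (PiM I (\<lambda>_. borel))"
  by (intro sets_PiM_cong) auto

lemma measurable_uniform_tuples[simp]:
  "measurable (PiM I (\<lambda>_. uniform_measure lborel W)) N = measurable (PiM I (\<lambda>_. borel)) N"
  by (rule measurable_cong_sets[OF sets_uniform_tuples refl])

lemma sets_binom_law[simp, measurable_cong]: "sets (binom_law W j) = sets conf"
  by (simp add: binom_law_def)

lemma space_binom_law[simp]: "space (binom_law W j) = {Y. finite Y}"
  by (simp add: binom_law_def)

locale window =
  fixes W :: "'a::euclidean_space set"
  assumes W_meas[measurable]: "W \<in> sets borel" and W_pos: "measure lborel W > 0"
    and W_fin: "emeasure lborel W \<noteq> \<infinity>"
begin

lemma W_pos': "emeasure lborel W \<noteq> 0"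
  using W_pos by (auto simp: measure_def)

lemma em_W: "emeasure lborel W = ennreal (measure lborel W)"
  using W_fin by (simp add: emeasure_eq_ennreal_measure)

lemma prob_space_uniform: "prob_space (uniform_measure lborel W)"
  by (rule prob_space_uniform_measure[OF W_pos' W_fin])

lemma prob_space_uniform_tuples: "prob_space (PiM I (\<lambda>_. uniform_measure lborel W))"
  by (intro prob_space_PiM prob_space_uniform)

lemma prob_space_binom_law: "prob_space (binom_law W j)"
  unfolding binom_law_def using prob_space_uniform_tuples
  by (intro prob_space.prob_space_distr) auto

lemma measure_uniform: "B \<in> sets borel \<Longrightarrow> measure (uniform_measure lborel W) B = measure lborel (W \<inter> B) / measure lborel W"
  using W_fin W_pos' by (intro measure_uniform_measure) auto

lemma nn_integral_binom_law:
  assumes [measurable]: "f \<in> borel_measurable conf"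
  shows "(\<integral>\<^sup>+Y. f Y \<partial>binom_law W j) = (\<integral>\<^sup>+x. f (x ` {..<j}) \<partial>PiM {..<j} (\<lambda>_. uniform_measure lborel W))"
  unfolding binom_law_def by (intro nn_integral_distr) auto

lemma void_binom_law:
  assumes B[measurable]: "B \<in> sets borel"
  shows "measure (binom_law W j) {Y. finite Y \<and> Y \<inter> B = {}} = (1 - measure lborel (W \<inter> B) / measure lborel W) ^ j"
proof -
  interpret U: prob_space "uniform_measure lborel W" by (rule prob_space_uniform)
  interpret finite_product_prob_space "\<lambda>_::nat. uniform_measure lborel W" "{..<j}" by unfold_locales simp
  have "measure (binom_law W j) {Y. finite Y \<and> Y \<inter> B = {}} 
    = measure (PiM {..<j} (\<lambda>_. uniform_measure lborel W)) ((\<lambda>x. x ` {..<j}) -` {Y. finite Y \<and> Y \<inter> B = {}} \<inter> space (PiM {..<j} (\<lambda>_. uniform_measure lborel W)))"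
    unfolding binom_law_def by (intro measure_distr) auto
  also have "(\<lambda>x. x ` {..<j}) -` {Y. finite Y \<and> Y \<inter> B = {}} \<inter> space (PiM {..<j} (\<lambda>_. uniform_measure lborel W)) = PiE {..<j} (\<lambda>_. - B)"
    by (auto simp: space_PiM PiE_iff)
  also have "measure (PiM {..<j} (\<lambda>_. uniform_measure lborel W)) (PiE {..<j} (\<lambda>_. - B)) = measure (uniform_measure lborel W) (- B) ^ j"
    by (subst finite_measure_PiM_emb) simp_all
  also have "measure (uniform_measure lborel W) (- B) = 1 - measure (uniform_measure lborel W) B"
    using U.prob_compl[of B] by (simp add: Compl_eq_Diff_UNIV)
  finally show ?thesis using measure_uniform[OF B] by simp
qed

lemma binom_law_measurable: "binom_law W \<in> measurable (measure_pmf p) (subprob_algebra conf)"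
  by (auto simp: space_subprob_algebra intro!: prob_space_imp_subprob_space prob_space_binom_law)

lemma sets_pois_law[simp, measurable_cong]: "sets (pois_law W c) = sets conf"
  unfolding pois_law_def by (rule sets_bind[where N = conf]) auto

lemma prob_space_pois_law: "prob_space (pois_law W c)"
  unfolding pois_law_def using binom_law_measurable prob_space_binom_law
  by (intro measure_pmf.prob_space_bind[where S = conf]) auto

lemma nn_integral_pois_law:
  assumes [measurable]: "f \<in> borel_measurable conf"
  shows "(\<integral>\<^sup>+Y. f Y \<partial>pois_law W c) = (\<integral>\<^sup>+j. (\<integral>\<^sup>+Y. f Y \<partial>binom_law W j) \<partial>measure_pmf (poisson_pmf (c * measure lborel W)))"
  unfolding pois_law_def by (rule nn_integral_bind[OF assms binom_law_measurable])

lemma void_pois_law: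
  assumes B[measurable]: "B \<in> sets borel" and "c > 0"
  shows "measure (pois_law W c) {Y. finite Y \<and> Y \<inter> B = {}} = exp (- c * measure lborel (W \<inter> B))"
proof -
  let ?w = "measure lborel W" and ?V = "{Y. finite Y \<and> Y \<inter> B = {}}"
  interpret P: prob_space "pois_law W c" by (rule prob_space_pois_law)
  define \<mu> where "\<mu> = c * ?w"
  have \<mu>: "\<mu> > 0" using W_pos assms by (simp add: \<mu>_def)
  define q where "q = 1 - measure lborel (W \<inter> B) / ?w"
  have q: "q \<ge> 0"
    using W_pos W_fin measure_mono_fmeasurable[of "W \<inter> B" W lborel] by (simp add: q_def fmeasurable_def top.not_eq_extremum)
  have "(\<lambda>j. (\<mu> * q) ^ j /\<^sub>R fact j) sums exp (\<mu> * q)" by (rule exp_converges)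
  then have "(\<lambda>j. exp (- \<mu>) * ((\<mu> * q) ^ j /\<^sub>R fact j)) sums (exp (- \<mu>) * exp (\<mu> * q))" by (rule sums_mult)
  then have s: "(\<lambda>j. pmf (poisson_pmf \<mu>) j * q ^ j) sums exp (- \<mu> * (1 - q))"
    using \<mu> by (simp add: power_mult_distrib field_simps flip: exp_add)
  have "emeasure (pois_law W c) ?V = (\<integral>\<^sup>+j. emeasure (binom_law W j) ?V \<partial>measure_pmf (poisson_pmf \<mu>))"
    unfolding pois_law_def \<mu>_def by (rule emeasure_bind[OF _ binom_law_measurable]) auto
  also have "\<dots> = (\<integral>\<^sup>+j. ennreal (q ^ j) \<partial>measure_pmf (poisson_pmf \<mu>))"
    using prob_space_binom_law by (simp add: finite_measure.emeasure_eq_measure prob_space.finite_measure void_binom_law[OF B] q_def)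
  also have "\<dots> = (\<Sum>j. ennreal (pmf (poisson_pmf \<mu>) j * q ^ j))"
    using q by (simp add: nn_integral_measure_pmf nn_integral_count_space_nat ennreal_mult del: pmf_poisson)
  also have "\<dots> = ennreal (exp (- \<mu> * (1 - q)))"
    using q by (intro suminf_ennreal_eq s) (simp del: pmf_poisson)
  also have "- \<mu> * (1 - q) = - c * measure lborel (W \<inter> B)"
    using W_pos by (simp add: \<mu>_def q_def)
  finally show ?thesis by (simp add: P.emeasure_eq_measure)
qed

end

lemma poisson_tail:
  assumes "\<mu> > 0"
  shows "emeasure (measure_pmf (poisson_pmf \<mu>)) {m..} \<le> ennreal (\<mu> ^ m)"
proof -
  let ?p = "pmf (poisson_pmf \<mu>)"
  have "emeasure (measure_pmf (poisson_pmf \<mu>)) {m..} = (\<integral>\<^sup>+j. ennreal (?p j) \<partial>count_space {m..})"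
    by (simp add: nn_integral_pmf)
  also have "\<dots> = (\<integral>\<^sup>+i. ennreal (?p (i + m)) \<partial>count_space UNIV)"
  proof (rule nn_integral_bij_count_space[symmetric])
    show "bij_betw (\<lambda>i. i + m) UNIV {m..}"
      by (rule bij_betw_byWitness[where f' = "\<lambda>i. i - m"]) auto
  qed
  also have "\<dots> \<le> (\<integral>\<^sup>+i. ennreal (\<mu> ^ m) * ennreal (?p i) \<partial>count_space UNIV)"
  proof (rule nn_integral_mono)
    fix i :: nat
    have "(fact i :: real) \<le> fact (i + m)" by (rule fact_mono) simp
    then have "\<mu> ^ (i + m) / fact (i + m) \<le> \<mu> ^ (i + m) / fact i"
      using assms by (intro divide_left_mono) auto
    then have "?p (i + m) \<le> \<mu> ^ m * ?p i"
      using assms mult_right_mono[of "\<mu> ^ (i + m) / fact (i + m)" "\<mu> ^ (i + m) / fact i" "exp (- \<mu>)"]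
      by (simp add: power_add mult_ac)
    then show "ennreal (?p (i + m)) \<le> ennreal (\<mu> ^ m) * ennreal (?p i)"
      using assms by (simp add: ennreal_leI del: pmf_poisson flip: ennreal_mult)
  qed
  also have "\<dots> = ennreal (\<mu> ^ m)"
    by (subst nn_integral_cmult) (simp_all add: nn_integral_pmf_eq_1)
  finally show ?thesis .
qed

text \<open>A Poisson process with intensity \<open>c\<close> on \<open>D\<close>, described by its void probabilities alone. The law and the
  independence of its restrictions follow from them.\<close>

locale void_process = prob_space M for M :: "'w measure" +
  fixes X :: "'w \<Rightarrow> 'a::euclidean_space set" and c :: real and D :: "'a set"
  assumes X_meas[measurable]: "X \<in> measurable M conf"
    and c_pos: "c > 0"
    and D_meas[measurable]: "D \<in> sets borel" and D_fin: "emeasure lborel D \<noteq> \<infinity>"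
    and void: "B \<in> sets borel \<Longrightarrow> prob {\<omega>\<in>space M. X \<omega> \<inter> B = {}} = exp (- c * measure lborel (B \<inter> D))"
begin

lemma fmeasurable_D: "B \<in> sets borel \<Longrightarrow> B \<inter> D \<in> fmeasurable lborel"
  by (rule fmeasurableI2[of D]) (use D_fin in \<open>auto simp: fmeasurable_def top.not_eq_extremum\<close>)

lemma distr_restrict:
  assumes "window W" "W \<subseteq> D"
  shows "distr M conf (\<lambda>\<omega>. X \<omega> \<inter> W) = pois_law W c"
proof (rule conf_measure_eqI)
  interpret window W by fact
  have [measurable]: "(\<lambda>\<omega>. X \<omega> \<inter> W) \<in> measurable M conf"
    by (rule measurable_compose[OF X_meas measurable_conf_Int[OF W_meas]])
  show "prob_space (distr M conf (\<lambda>\<omega>. X \<omega> \<inter> W))" by (rule prob_space_distr) simp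
  show "prob_space (pois_law W c)" by (rule prob_space_pois_law)
  fix B :: "'a set" assume B[measurable]: "B \<in> sets borel"
  have "measure (distr M conf (\<lambda>\<omega>. X \<omega> \<inter> W)) {Y. finite Y \<and> Y \<inter> B = {}} 
     = prob ((\<lambda>\<omega>. X \<omega> \<inter> W) -` {Y. finite Y \<and> Y \<inter> B = {}} \<inter> space M)"
    by (rule measure_distr) auto
  also have "(\<lambda>\<omega>. X \<omega> \<inter> W) -` {Y. finite Y \<and> Y \<inter> B = {}} \<inter> space M = {\<omega>\<in>space M. X \<omega> \<inter> (W \<inter> B) = {}}"
    using measurable_space[OF X_meas] by auto
  also have "prob \<dots> = exp (- c * measure lborel (W \<inter> B))"
  proof -
    have "W \<inter> B \<inter> D = W \<inter> B" using assms(2) by auto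
    then show ?thesis using void[of "W \<inter> B"] by simp
  qed
  finally show "measure (distr M conf (\<lambda>\<omega>. X \<omega> \<inter> W)) {Y. finite Y \<and> Y \<inter> B = {}} = measure (pois_law W c) {Y. finite Y \<and> Y \<inter> B = {}}"
    using void_pois_law[OF B c_pos] by simp
qed (simp_all add: window.sets_pois_law[OF assms(1)])

text \<open>The joint void probabilities factor, because the exponent is additive over disjoint sets, and void
  events form an intersection-stable generator.\<close>

lemma indep_restrict:
  assumes W: "\<And>i. i \<in> I \<Longrightarrow> W i \<in> sets borel" and disj: "disjoint_family_on W I"
  shows "indep_vars (\<lambda>_. conf) (\<lambda>i \<omega>. X \<omega> \<inter> W i) I"
proof -
  let ?E = "\<lambda>i. {{\<omega>\<in>space M. X \<omega> \<inter> W i \<inter> B = {}} | B. B \<in> sets borel}"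
  have meas: "(\<lambda>\<omega>. X \<omega> \<inter> W i) \<in> measurable M conf" if "i \<in> I" for i
    using W[OF that] by (rule measurable_compose[OF X_meas measurable_conf_Int])
  have "indep_sets ?E I"
  proof (rule indep_setsI)
    fix i assume "i \<in> I"
    then show "?E i \<subseteq> events" by (auto intro: measurable_conf_void[OF meas])
  next
    fix A J assume J: "J \<noteq> {}" "J \<subseteq> I" "finite J" "\<forall>j\<in>J. A j \<in> ?E j"
    have "\<forall>j\<in>J. \<exists>B. B \<in> sets borel \<and> A j = {\<omega>\<in>space M. X \<omega> \<inter> W j \<inter> B = {}}"
    proof
      fix j assume "j \<in> J"
      with J(4) have "A j \<in> ?E j" by (rule bspec)
      then show "\<exists>B. B \<in> sets borel \<and> A j = {\<omega>\<in>space M. X \<omega> \<inter> W j \<inter> B = {}}" by (elim CollectE exE) auto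
    qed
    then obtain B where B': "\<forall>j\<in>J. B j \<in> sets borel \<and> A j = {\<omega>\<in>space M. X \<omega> \<inter> W j \<inter> B j = {}}"
      by (rule bchoice[THEN exE])
    then have B: "\<And>j. j \<in> J \<Longrightarrow> B j \<in> sets borel" "\<And>j. j \<in> J \<Longrightarrow> A j = {\<omega>\<in>space M. X \<omega> \<inter> W j \<inter> B j = {}}"
      by blast+
    have WB: "W j \<inter> B j \<in> sets borel" if "j \<in> J" for j using that B W J by auto
    have "(\<Inter>j\<in>J. A j) = {\<omega>\<in>space M. X \<omega> \<inter> (\<Union>j\<in>J. W j \<inter> B j) = {}}" using J(1) B(2) by auto
    then have "prob (\<Inter>j\<in>J. A j) = exp (- c * measure lborel ((\<Union>j\<in>J. W j \<inter> B j) \<inter> D))"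
      using void[of "\<Union>j\<in>J. W j \<inter> B j"] WB J(3) by (simp add: sets.finite_UN)
    also have "(\<Union>j\<in>J. W j \<inter> B j) \<inter> D = (\<Union>j\<in>J. (W j \<inter> B j) \<inter> D)" by auto
    also have "measure lborel (\<Union>j\<in>J. (W j \<inter> B j) \<inter> D) = (\<Sum>j\<in>J. measure lborel ((W j \<inter> B j) \<inter> D))"
    proof (intro measure_finite_Union J(3))
      show "disjoint_family_on (\<lambda>j. (W j \<inter> B j) \<inter> D) J"
        unfolding disjoint_family_on_def
      proof (intro ballI impI)
        fix m n assume "m \<in> J" "n \<in> J" "m \<noteq> n"
        then have "W m \<inter> W n = {}" using disjoint_family_onD[OF disj] J(2) by blast
        then show "W m \<inter> B m \<inter> D \<inter> (W n \<inter> B n \<inter> D) = {}" by blast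
      qed
    qed (use WB fmeasurable_D in \<open>auto simp: fmeasurable_def top.not_eq_extremum\<close>)
    also have "exp (- c * (\<Sum>j\<in>J. measure lborel ((W j \<inter> B j) \<inter> D))) = (\<Prod>j\<in>J. exp (- c * measure lborel ((W j \<inter> B j) \<inter> D)))"
      using J(3) by (simp add: exp_sum sum_distrib_left sum_negf[symmetric])
    also have "\<dots> = (\<Prod>j\<in>J. prob (A j))"
    proof (rule prod.cong[OF refl])
      fix j assume j: "j \<in> J"
      have "A j = {\<omega>\<in>space M. X \<omega> \<inter> (W j \<inter> B j) = {}}" using B(2)[OF j] by (simp add: Int_assoc)
      then show "exp (- c * measure lborel ((W j \<inter> B j) \<inter> D)) = prob (A j)" using void[OF WB[OF j]] by simp
    qed
    finally show "prob (\<Inter>j\<in>J. A j) = (\<Prod>j\<in>J. prob (A j))" .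
  qed
  moreover have "Int_stable (?E i)" for i
  proof (rule Int_stableI)
    fix a b assume "a \<in> ?E i" "b \<in> ?E i"
    then obtain A B where "A \<in> sets borel" "a = {\<omega>\<in>space M. X \<omega> \<inter> W i \<inter> A = {}}" 
      "B \<in> sets borel" "b = {\<omega>\<in>space M. X \<omega> \<inter> W i \<inter> B = {}}" by auto
    then show "a \<inter> b \<in> ?E i" by (intro CollectI exI[of _ "A \<union> B"]) auto
  qed
  ultimately have ind: "indep_sets (\<lambda>i. sigma_sets (space M) (?E i)) I" by (rule indep_sets_sigma)
  show ?thesis
    unfolding indep_vars_def2
  proof
    show "\<forall>i\<in>I. (\<lambda>\<omega>. X \<omega> \<inter> W i) \<in> measurable M conf" using meas by blast
    show "indep_sets (\<lambda>i. {(\<lambda>\<omega>. X \<omega> \<inter> W i) -` A \<inter> space M |A. A \<in> sets conf}) I"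
    proof (rule indep_sets_mono_sets[OF ind])
      fix i assume i: "i \<in> I"
      have "{(\<lambda>\<omega>. X \<omega> \<inter> W i) -` A \<inter> space M |A. A \<in> sets conf} 
        = sigma_sets (space M) {(\<lambda>\<omega>. X \<omega> \<inter> W i) -` A \<inter> space M |A. A \<in> {{Y. finite Y \<and> Y \<inter> B = {}} | B. B \<in> sets borel}}"
        unfolding sets_conf by (rule sigma_sets_vimage_commute) (use measurable_space[OF meas[OF i]] in auto)
      also have "{(\<lambda>\<omega>. X \<omega> \<inter> W i) -` A \<inter> space M |A. A \<in> {{Y. finite Y \<and> Y \<inter> B = {}} | B. B \<in> sets borel}} = ?E i"
      proof -
        have "(\<lambda>\<omega>. X \<omega> \<inter> W i) -` {Y. finite Y \<and> Y \<inter> B = {}} \<inter> space M = {\<omega>\<in>space M. X \<omega> \<inter> W i \<inter> B = {}}" for B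
          using measurable_space[OF meas[OF i]] by auto
        then show ?thesis by (auto simp: Setcompr_eq_image image_image)
      qed
      finally show "{(\<lambda>\<omega>. X \<omega> \<inter> W i) -` A \<inter> space M |A. A \<in> sets conf} \<subseteq> sigma_sets (space M) (?E i)" by simp
    qed
  qed
qed

lemma nn_integral_restrict:
  assumes "window W" "W \<subseteq> D" and [measurable]: "f \<in> borel_measurable conf"
  shows "(\<integral>\<^sup>+\<omega>. f (X \<omega> \<inter> W) \<partial>M) = (\<integral>\<^sup>+j. (\<integral>\<^sup>+Y. f Y \<partial>binom_law W j) \<partial>measure_pmf (poisson_pmf (c * measure lborel W)))"
proof -
  interpret window W by fact
  have [measurable]: "(\<lambda>\<omega>. X \<omega> \<inter> W) \<in> measurable M conf"
    by (rule measurable_compose[OF X_meas measurable_conf_Int[OF W_meas]])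
  have "(\<integral>\<^sup>+\<omega>. f (X \<omega> \<inter> W) \<partial>M) = (\<integral>\<^sup>+Y. f Y \<partial>distr M conf (\<lambda>\<omega>. X \<omega> \<inter> W))"
    by (rule nn_integral_distr[symmetric]) auto
  then show ?thesis unfolding distr_restrict[OF assms(1,2)] by (simp add: nn_integral_pois_law)
qed

end



section \<open>Geometric graphs isomorphic to a given connected graph\<close>

lemma digraph_iso_geom_graph_iff:
  assumes "pair_graph \<Gamma>"
  shows "digraph_iso (with_proj (geom_graph Y t)) (with_proj \<Gamma>) \<longleftrightarrow>
    (\<exists>\<sigma>. bij_betw \<sigma> Y (pverts \<Gamma>) \<and> (\<forall>x\<in>Y. \<forall>y\<in>Y. (\<sigma> x, \<sigma> y) \<in> parcs \<Gamma> \<longleftrightarrow> x \<noteq> y \<and> norm (x - y) \<le> t))"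
    (is "?L \<longleftrightarrow> ?R")
proof
  assume ?L
  then obtain f where f: "pre_digraph.digraph_isomorphism (with_proj (geom_graph Y t)) f"
    "with_proj \<Gamma> = app_iso f (with_proj (geom_graph Y t))" unfolding digraph_iso_def by blast
  define \<sigma> where "\<sigma> = iso_verts f"
  have V: "pverts \<Gamma> = \<sigma> ` Y" using arg_cong[OF f(2), of verts] by (simp add: \<sigma>_def geom_graph_def)
  have A: "parcs \<Gamma> = iso_arcs f ` parcs (geom_graph Y t)" using arg_cong[OF f(2), of arcs] by simp
  have T: "fst = iso_tail f" using arg_cong[OF f(2), of tail] by simp
  have H: "snd = iso_head f" using arg_cong[OF f(2), of head] by simp
  have inj: "inj_on \<sigma> Y" using f(1) by (simp add: pre_digraph.digraph_isomorphism_def \<sigma>_def geom_graph_def)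
  have arc: "iso_arcs f a = (\<sigma> (fst a), \<sigma> (snd a))" if "a \<in> parcs (geom_graph Y t)" for a
    using f(1) that fun_cong[OF T, of "iso_arcs f a"] fun_cong[OF H, of "iso_arcs f a"]
    by (intro prod_eqI) (simp_all add: pre_digraph.digraph_isomorphism_def \<sigma>_def)
  show ?R
  proof (intro exI[of _ \<sigma>] conjI ballI)
    show "bij_betw \<sigma> Y (pverts \<Gamma>)" using inj V by (simp add: bij_betw_def)
    fix x y assume xy: "x \<in> Y" "y \<in> Y"
    have "(\<sigma> x, \<sigma> y) \<in> parcs \<Gamma> \<longleftrightarrow> (\<exists>a\<in>parcs (geom_graph Y t). \<sigma> x = \<sigma> (fst a) \<and> \<sigma> y = \<sigma> (snd a))"
      unfolding A using arc by force
    also have "\<dots> \<longleftrightarrow> (\<exists>a\<in>parcs (geom_graph Y t). x = fst a \<and> y = snd a)"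
      using inj xy by (intro bex_cong refl) (auto simp: geom_graph_def inj_on_eq_iff)
    also have "\<dots> \<longleftrightarrow> x \<noteq> y \<and> norm (x - y) \<le> t" using xy by (auto simp: geom_graph_def)
    finally show "(\<sigma> x, \<sigma> y) \<in> parcs \<Gamma> \<longleftrightarrow> x \<noteq> y \<and> norm (x - y) \<le> t" .
  qed
next
  interpret G: pair_graph \<Gamma> by fact
  assume ?R
  then obtain \<sigma> where \<sigma>: "bij_betw \<sigma> Y (pverts \<Gamma>)" 
    "\<forall>x\<in>Y. \<forall>y\<in>Y. (\<sigma> x, \<sigma> y) \<in> parcs \<Gamma> \<longleftrightarrow> x \<noteq> y \<and> norm (x - y) \<le> t" by blast
  define f where "f = \<lparr>iso_verts = \<sigma>, iso_arcs = map_prod \<sigma> \<sigma>, iso_head = snd, iso_tail = fst\<rparr>"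
  let ?G = "geom_graph Y t"
  have inj: "inj_on \<sigma> Y" "\<sigma> ` Y = pverts \<Gamma>" using \<sigma>(1) by (auto simp: bij_betw_def)
  have "pre_digraph.digraph_isomorphism (with_proj ?G) f"
    unfolding pre_digraph.digraph_isomorphism_def
  proof (intro conjI ballI)
    show "wf_digraph (with_proj ?G)" by unfold_locales (auto simp: geom_graph_def)
    show "inj_on (iso_arcs f) (arcs (with_proj ?G))"
      using inj(1) by (auto simp: f_def geom_graph_def inj_on_def)
  qed (use inj in \<open>auto simp: f_def geom_graph_def\<close>)
  moreover have "map_prod \<sigma> \<sigma> ` parcs ?G = parcs \<Gamma>"
  proof (intro set_eqI iffI)
    fix e assume "e \<in> map_prod \<sigma> \<sigma> ` parcs ?G"
    then show "e \<in> parcs \<Gamma>" using \<sigma>(2) by (auto simp: geom_graph_def)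
  next
    fix e assume e: "e \<in> parcs \<Gamma>"
    then have "fst e \<in> \<sigma> ` Y" "snd e \<in> \<sigma> ` Y" using G.arc_fst_in_verts G.arc_snd_in_verts inj by auto
    then obtain x y where xy: "x \<in> Y" "y \<in> Y" "e = (\<sigma> x, \<sigma> y)" by (metis imageE prod.collapse)
    then have "(x, y) \<in> parcs ?G" using \<sigma>(2) e by (auto simp: geom_graph_def)
    then show "e \<in> map_prod \<sigma> \<sigma> ` parcs ?G" using xy(3) by (force intro: image_eqI[of _ _ "(x, y)"])
  qed
  then have "with_proj \<Gamma> = app_iso f (with_proj ?G)"
    using inj by (simp add: app_iso_def with_proj_def f_def geom_graph_def)
  ultimately show ?L unfolding digraph_iso_def by blast
qed

locale connected_graph =
  fixes \<Gamma> :: "'v pair_pre_digraph" and k :: nat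
  assumes graph: "pair_graph \<Gamma>" and card_verts: "card (pverts \<Gamma>) = k" and k_pos: "k > 0"
    and conn: "Digraph_Component.connected (with_proj \<Gamma>)"
begin

lemma shape_ind_iff:
  "shape_ind \<Gamma> t Y = of_bool (\<exists>\<sigma>. bij_betw \<sigma> Y (pverts \<Gamma>) \<and>
     (\<forall>x\<in>Y. \<forall>y\<in>Y. (\<sigma> x, \<sigma> y) \<in> parcs \<Gamma> \<longleftrightarrow> x \<noteq> y \<and> norm (x - y) \<le> t))"
  unfolding shape_ind_def digraph_iso_geom_graph_iff[OF graph] ..

lemma shape_ind_cases: "shape_ind \<Gamma> t Y = 0 \<or> shape_ind \<Gamma> t Y = 1"
  by (simp add: shape_ind_def)

lemma finite_verts: "finite (pverts \<Gamma>)"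
  using card_verts k_pos by (simp add: card_ge_0_finite)

lemma card_shape: "shape_ind \<Gamma> t Y \<noteq> 0 \<Longrightarrow> card Y = k \<and> finite Y"
  using card_verts k_pos bij_betw_same_card finite_verts bij_betw_finite
  unfolding shape_ind_iff of_bool_eq_0_iff not_not by metis

lemma shape_ind_isometric_image:
  assumes "\<And>x y. x \<in> Y \<Longrightarrow> y \<in> Y \<Longrightarrow> norm (g x - g y) = norm (x - y)"
  shows "shape_ind \<Gamma> t (g ` Y) = shape_ind \<Gamma> t Y"
proof -
  have inj: "inj_on g Y" 
  proof (rule inj_onI)
    fix x y assume "x \<in> Y" "y \<in> Y" "g x = g y"
    then show "x = y" using assms[of x y] by simp
  qed
  have "(\<exists>\<sigma>. bij_betw \<sigma> (g ` Y) (pverts \<Gamma>) \<and> (\<forall>x\<in>g ` Y. \<forall>y\<in>g ` Y. (\<sigma> x, \<sigma> y) \<in> parcs \<Gamma> \<longleftrightarrow> x \<noteq> y \<and> norm (x - y) \<le> t))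
    \<longleftrightarrow> (\<exists>\<sigma>. bij_betw \<sigma> Y (pverts \<Gamma>) \<and> (\<forall>x\<in>Y. \<forall>y\<in>Y. (\<sigma> x, \<sigma> y) \<in> parcs \<Gamma> \<longleftrightarrow> x \<noteq> y \<and> norm (x - y) \<le> t))"
    (is "?L \<longleftrightarrow> ?R")
  proof
    assume ?L
    then obtain \<sigma> where \<sigma>: "bij_betw \<sigma> (g ` Y) (pverts \<Gamma>)" 
      "\<And>x y. x\<in>g ` Y \<Longrightarrow> y\<in>g ` Y \<Longrightarrow> (\<sigma> x, \<sigma> y) \<in> parcs \<Gamma> \<longleftrightarrow> x \<noteq> y \<and> norm (x - y) \<le> t" by blast
    have "bij_betw (\<sigma> \<circ> g) Y (pverts \<Gamma>)"
      using inj \<sigma>(1) by (intro bij_betw_trans[of g Y "g ` Y"]) (auto simp: bij_betw_def)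
    moreover have "((\<sigma> \<circ> g) x, (\<sigma> \<circ> g) y) \<in> parcs \<Gamma> \<longleftrightarrow> x \<noteq> y \<and> norm (x - y) \<le> t" if "x \<in> Y" "y \<in> Y" for x y
      using \<sigma>(2)[of "g x" "g y"] that assms inj by (simp add: inj_on_eq_iff)
    ultimately show ?R by blast
  next
    assume ?R
    then obtain \<sigma> where \<sigma>: "bij_betw \<sigma> Y (pverts \<Gamma>)" 
      "\<And>x y. x\<in>Y \<Longrightarrow> y\<in>Y \<Longrightarrow> (\<sigma> x, \<sigma> y) \<in> parcs \<Gamma> \<longleftrightarrow> x \<noteq> y \<and> norm (x - y) \<le> t" by blast
    define g' where "g' = the_inv_into Y g"
    have g': "g' (g x) = x" if "x \<in> Y" for x using that inj by (simp add: g'_def the_inv_into_f_f)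
    have "bij_betw (\<sigma> \<circ> g') (g ` Y) (pverts \<Gamma>)"
      using \<sigma>(1) bij_betw_the_inv_into[of g Y "g ` Y"] inj unfolding g'_def
      by (intro bij_betw_trans[of _ "g ` Y" Y]) (auto simp: bij_betw_def)
    moreover have "((\<sigma> \<circ> g') x, (\<sigma> \<circ> g') y) \<in> parcs \<Gamma> \<longleftrightarrow> x \<noteq> y \<and> norm (x - y) \<le> t" if "x \<in> g ` Y" "y \<in> g ` Y" for x y
      using that \<sigma>(2) g' assms inj by (auto simp: inj_on_eq_iff)
    ultimately show ?L by blast
  qed
  then show ?thesis unfolding shape_ind_iff by simp
qed

text \<open>Otherwise \<open>S\<close> would be closed under reachability and connectedness would force it to contain all
  vertices.\<close>

lemma exit_arc:
  assumes "S \<subseteq> pverts \<Gamma>" "S \<noteq> {}" "S \<noteq> pverts \<Gamma>"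
  obtains u v where "u \<in> S" "v \<in> pverts \<Gamma> - S" "(u, v) \<in> parcs \<Gamma> \<or> (v, u) \<in> parcs \<Gamma>"
proof (rule ccontr)
  assume no_exit: "\<not> thesis"
  have closed: "\<And>u v. u \<in> S \<Longrightarrow> v \<in> pverts \<Gamma> \<Longrightarrow> (u, v) \<in> parcs \<Gamma> \<or> (v, u) \<in> parcs \<Gamma> \<Longrightarrow> v \<in> S"
    using no_exit that by blast
  obtain u where u: "u \<in> S" using assms by blast
  have "v \<in> S" if v: "v \<in> pverts \<Gamma>" for v
  proof -
    have "(u, v) \<in> rtrancl_on (pverts \<Gamma>) (parcs (mk_symmetric (with_proj \<Gamma>)))"
      using conn u v assms(1) unfolding connected_def strongly_connected_def reachable_def by auto
    then show ?thesis
    proof (induction rule: rtrancl_on_induct)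
      case (step y z)
      then show ?case using closed[of y z] by (auto simp: parcs_mk_symmetric)
    qed (rule u)
  qed
  then show False using assms by blast
qed

text \<open>Seen from one of its points, the distances of the points of a \<open>t\<close>-connected set have no gap
  larger than \<open>t\<close>, so a ball of radius \<open>j t\<close> contains at least \<open>j + 1\<close> of them.\<close>

lemma shape_diameter:
  assumes shape: "shape_ind \<Gamma> t Y \<noteq> 0" and t: "t \<ge> 0" and xy: "x \<in> Y" "y \<in> Y"
  shows "norm (x - y) \<le> real k * t"
proof -
  have Y: "card Y = k" "finite Y" using card_shape[OF shape] by auto
  obtain \<sigma> where \<sigma>: "bij_betw \<sigma> Y (pverts \<Gamma>)" 
      "\<And>x y. x\<in>Y \<Longrightarrow> y\<in>Y \<Longrightarrow> (\<sigma> x, \<sigma> y) \<in> parcs \<Gamma> \<longleftrightarrow> x \<noteq> y \<and> norm (x - y) \<le> t"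
    using shape unfolding shape_ind_iff by (auto simp del: split_paired_Ex)
  define S where "S j = {z\<in>Y. norm (x - z) \<le> real j * t}" for j
  have "S j = Y \<or> j < card (S j)" for j
  proof (induction j)
    case 0
    have "{x} \<subseteq> S 0" using xy by (simp add: S_def)
    then have "card {x} \<le> card (S 0)" using Y by (intro card_mono) (auto simp: S_def)
    then show ?case by simp
  next
    case (Suc j)
    have sub: "S j \<subseteq> S (Suc j)" "S (Suc j) \<subseteq> Y" using t by (auto simp: S_def algebra_simps)
    show ?case
    proof (cases "S j = Y")
      case True
      then show ?thesis using sub by blast
    next
      case False
      have "\<sigma> ` S j \<subseteq> pverts \<Gamma>" "\<sigma> ` S j \<noteq> {}" 
        using \<sigma>(1) xy t by (auto simp: bij_betw_def S_def)
      moreover have "\<sigma> ` S j \<noteq> pverts \<Gamma>"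
      proof
        assume "\<sigma> ` S j = pverts \<Gamma>"
        then have "card (pverts \<Gamma>) \<le> card (S j)" using Y card_image_le[of "S j" \<sigma>] by (simp add: S_def)
        moreover have "card (S j) < card Y" using False Y sub by (intro psubset_card_mono) auto
        ultimately show False using Y card_verts by simp
      qed
      ultimately obtain u v where uv: "u \<in> \<sigma> ` S j" "v \<in> pverts \<Gamma> - \<sigma> ` S j" "(u, v) \<in> parcs \<Gamma> \<or> (v, u) \<in> parcs \<Gamma>"
        by (rule exit_arc)
      obtain a where a: "a \<in> S j" "u = \<sigma> a" using uv(1) by blast
      obtain b where "b \<in> Y" "v = \<sigma> b" using uv(2) \<sigma>(1) by (auto simp: bij_betw_def)
      note ab = a this
      then have b: "b \<notin> S j" "norm (a - b) \<le> t" using uv \<sigma>(2)[of a b] \<sigma>(2)[of b a] by (auto simp: S_def norm_minus_commute)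
      have "norm (x - b) \<le> norm (x - a) + norm (a - b)" using norm_triangle_ineq[of "x - a" "a - b"] by simp
      also have "\<dots> \<le> real (Suc j) * t" using ab b by (simp add: S_def algebra_simps)
      finally have "insert b (S j) \<subseteq> S (Suc j)" using ab sub by (auto simp: S_def)
      then have "card (insert b (S j)) \<le> card (S (Suc j))" using Y by (intro card_mono) (auto simp: S_def)
      moreover have "card (insert b (S j)) = Suc (card (S j))" using b Y by (simp add: S_def)
      ultimately show ?thesis using Suc False by simp
    qed
  qed
  from this[of k] have "S k = Y" using Y card_mono[of Y "S k"] by (auto simp: S_def)
  then show ?thesis using xy by (auto simp: S_def)
qed

text \<open>A finite disjunction of conditions on pairwise distances, from which measurability can be read off.\<close>

lemma shape_ind_tuple_iff:
  "shape_ind \<Gamma> t (x ` {..<k}) = of_bool (inj_on x {..<k} \<and>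
    (\<exists>\<tau>\<in>{\<tau> \<in> {..<k} \<rightarrow>\<^sub>E pverts \<Gamma>. bij_betw \<tau> {..<k} (pverts \<Gamma>)}.
       \<forall>i\<in>{..<k}. \<forall>j\<in>{..<k}. (\<tau> i, \<tau> j) \<in> parcs \<Gamma> \<longleftrightarrow> i \<noteq> j \<and> norm (x i - x j) \<le> t))" (is "_ = of_bool (?I \<and> ?T)")
proof -
  have "(\<exists>\<sigma>. bij_betw \<sigma> (x ` {..<k}) (pverts \<Gamma>) \<and> (\<forall>u\<in>x ` {..<k}. \<forall>v\<in>x ` {..<k}. (\<sigma> u, \<sigma> v) \<in> parcs \<Gamma> \<longleftrightarrow> u \<noteq> v \<and> norm (u - v) \<le> t))
     \<longleftrightarrow> ?I \<and> ?T" (is "?L \<longleftrightarrow> _")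
  proof
    assume ?L
    then obtain \<sigma> where \<sigma>: "bij_betw \<sigma> (x ` {..<k}) (pverts \<Gamma>)" 
      "\<And>u v. u\<in>x ` {..<k} \<Longrightarrow> v\<in>x ` {..<k} \<Longrightarrow> (\<sigma> u, \<sigma> v) \<in> parcs \<Gamma> \<longleftrightarrow> u \<noteq> v \<and> norm (u - v) \<le> t" by blast
    have inj: ?I using bij_betw_same_card[OF \<sigma>(1)] card_verts by (intro eq_card_imp_inj_on) auto
    let ?\<tau> = "restrict (\<sigma> \<circ> x) {..<k}"
    have "bij_betw (\<sigma> \<circ> x) {..<k} (pverts \<Gamma>)"
      using inj \<sigma>(1) by (intro bij_betw_trans[of x "{..<k}" "x ` {..<k}"]) (auto simp: bij_betw_def)
    then have bij: "bij_betw ?\<tau> {..<k} (pverts \<Gamma>)"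
      by (rule bij_betw_cong[THEN iffD1, rotated]) simp
    then have "?\<tau> \<in> {..<k} \<rightarrow>\<^sub>E pverts \<Gamma>" by (auto simp: bij_betw_def)
    moreover have "(?\<tau> i, ?\<tau> j) \<in> parcs \<Gamma> \<longleftrightarrow> i \<noteq> j \<and> norm (x i - x j) \<le> t" if "i \<in> {..<k}" "j \<in> {..<k}" for i j
      using \<sigma>(2)[of "x i" "x j"] that inj by (simp add: inj_on_eq_iff)
    ultimately show "?I \<and> ?T" using inj bij by blast
  next
    assume IT: "?I \<and> ?T"
    then obtain \<tau> where \<tau>: "bij_betw \<tau> {..<k} (pverts \<Gamma>)" 
      "\<And>i j. i\<in>{..<k} \<Longrightarrow> j\<in>{..<k} \<Longrightarrow> (\<tau> i, \<tau> j) \<in> parcs \<Gamma> \<longleftrightarrow> i \<noteq> j \<and> norm (x i - x j) \<le> t" by blast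
    define x' where "x' = the_inv_into {..<k} x"
    have x': "x' (x i) = i" if "i \<in> {..<k}" for i using that IT by (simp add: x'_def the_inv_into_f_f)
    have "bij_betw (\<tau> \<circ> x') (x ` {..<k}) (pverts \<Gamma>)"
      using \<tau>(1) bij_betw_the_inv_into[of x "{..<k}" "x ` {..<k}"] IT unfolding x'_def
      by (intro bij_betw_trans[of _ "x ` {..<k}" "{..<k}"]) (auto simp: bij_betw_def)
    moreover have "((\<tau> \<circ> x') u, (\<tau> \<circ> x') v) \<in> parcs \<Gamma> \<longleftrightarrow> u \<noteq> v \<and> norm (u - v) \<le> t" if "u \<in> x ` {..<k}" "v \<in> x ` {..<k}" for u v
      using that \<tau>(2) x' IT by (auto simp: inj_on_eq_iff)
    ultimately show ?L by blast
  qed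
  then show ?thesis unfolding shape_ind_iff by simp
qed

lemma measurable_shape_ind[measurable]:
  "(\<lambda>x. shape_ind \<Gamma> t (x ` {..<k}) :: real) \<in> borel_measurable (PiM {..<k} (\<lambda>_. borel :: 'a::euclidean_space measure))"
proof -
  have fin: "finite {\<tau> \<in> {..<k} \<rightarrow>\<^sub>E pverts \<Gamma>. bij_betw \<tau> {..<k} (pverts \<Gamma>)}"
    by (rule finite_subset[OF _ finite_PiE[of "{..<k}" "\<lambda>_. pverts \<Gamma>"]]) (auto simp: finite_verts)
  have inj: "inj_on x {..<k} \<longleftrightarrow> (\<forall>i\<in>{..<k}. \<forall>j\<in>{..<k}. i \<noteq> j \<longrightarrow> x i \<noteq> x j)" for x :: "nat \<Rightarrow> 'a"
    by (auto simp: inj_on_def)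
  have comp: "(\<lambda>x. x i) \<in> borel_measurable (PiM {..<k} (\<lambda>_. borel :: 'a measure))" if "i < k" for i
    by (rule measurable_component_singleton) (use that in simp)
  have q: "Measurable.pred (PiM {..<k} (\<lambda>_. borel :: 'a measure)) (\<lambda>x. x i = x j)" if "i < k" "j < k" for i j
  proof -
    have "Measurable.pred (PiM {..<k} (\<lambda>_. borel :: 'a measure)) (\<lambda>x. norm (x i - x j) \<le> 0)"
    proof -
      note [measurable] = comp[OF that(1)] comp[OF that(2)]
      show ?thesis by measurable
    qed
    then show ?thesis by simp
  qed
  have p: "Measurable.pred (PiM {..<k} (\<lambda>_. borel :: 'a measure)) (\<lambda>x. (\<tau> i, \<tau> j) \<in> parcs \<Gamma> \<longleftrightarrow> i \<noteq> j \<and> norm (x i - x j) \<le> t)"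
    if "i \<in> {..<k}" "j \<in> {..<k}" for \<tau> i j using that by measurable
  have "Measurable.pred (PiM {..<k} (\<lambda>_. borel :: 'a measure)) (\<lambda>x. (\<forall>i\<in>{..<k}. \<forall>j\<in>{..<k}. i \<noteq> j \<longrightarrow> x i \<noteq> x j) \<and>
    (\<exists>\<tau>\<in>{\<tau> \<in> {..<k} \<rightarrow>\<^sub>E pverts \<Gamma>. bij_betw \<tau> {..<k} (pverts \<Gamma>)}.
       \<forall>i\<in>{..<k}. \<forall>j\<in>{..<k}. (\<tau> i, \<tau> j) \<in> parcs \<Gamma> \<longleftrightarrow> i \<noteq> j \<and> norm (x i - x j) \<le> t))"
    by (intro pred_intros_logic pred_intros_finite fin p) (auto intro: q)
  from measurable_compose[OF this measurable_of_bool] show ?thesis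
    unfolding shape_ind_tuple_iff inj .
qed

end



section \<open>Sums over isolated clusters\<close>

definition isolated :: "real \<Rightarrow> 'a::real_normed_vector set \<Rightarrow> 'a set \<Rightarrow> bool" where
  "isolated s X Y \<longleftrightarrow> (\<forall>y\<in>Y. \<forall>y'\<in>X - Y. s \<le> norm (y - y'))"

definition cluster_sum :: "nat \<Rightarrow> real \<Rightarrow> ('a::real_normed_vector set \<Rightarrow> real) \<Rightarrow> 'a set \<Rightarrow> real" where
  "cluster_sum k s \<phi> X = (\<Sum>Y | Y \<subseteq> X \<and> card Y = k. of_bool (isolated s X Y) * \<phi> Y)"

lemma cluster_sum_alt:
  assumes "finite X"
  shows "cluster_sum k s \<phi> X = (\<Sum>Y | Y \<subseteq> X \<and> card Y = k \<and> isolated s X Y \<and> \<phi> Y \<noteq> 0. \<phi> Y)"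
  unfolding cluster_sum_def
  by (rule sum.mono_neutral_cong_right) (use assms in auto)

text \<open>A point of an isolated set takes all points of the configuration at distance less than \<open>s\<close> with
  it. So if \<open>W\<close> is covered by balls of radius \<open>s / 2\<close>, an isolated subset of \<open>W\<close> is determined by the
  balls that it meets.\<close>

lemma card_isolated_le:
  assumes "finite X" "finite A" and cover: "W \<subseteq> (\<Union>a\<in>A. ball a (s / 2))"
  shows "card {Y. Y \<subseteq> X \<inter> W \<and> isolated s X Y} \<le> 2 ^ card A"
proof -
  let ?S = "{Y. Y \<subseteq> X \<inter> W \<and> isolated s X Y}"
  let ?f = "\<lambda>Y. {a\<in>A. Y \<inter> ball a (s / 2) \<noteq> {}}"
  have recover: "Y = X \<inter> W \<inter> (\<Union>a\<in>?f Y. ball a (s / 2))" if Y: "Y \<in> ?S" for Y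
  proof
    show "Y \<subseteq> X \<inter> W \<inter> (\<Union>a\<in>?f Y. ball a (s / 2))" using Y cover by blast
    show "X \<inter> W \<inter> (\<Union>a\<in>?f Y. ball a (s / 2)) \<subseteq> Y"
    proof
      fix x assume "x \<in> X \<inter> W \<inter> (\<Union>a\<in>?f Y. ball a (s / 2))"
      then obtain a y where a: "x \<in> X" "x \<in> ball a (s / 2)" "y \<in> Y" "y \<in> ball a (s / 2)" by blast
      have "norm (y - x) < s" using dist_triangle_half_r[of a y s x] a by (simp add: dist_norm)
      then show "x \<in> Y" using a Y unfolding isolated_def by force
    qed
  qed
  have "inj_on ?f ?S"
  proof (rule inj_onI)
    fix Y Z assume Y: "Y \<in> ?S" and Z: "Z \<in> ?S" and eq: "?f Y = ?f Z"
    show "Y = Z" using recover[OF Y] recover[OF Z] unfolding eq by simp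
  qed
  moreover have "?f ` ?S \<subseteq> Pow A" by blast
  ultimately have "card ?S \<le> card (Pow A)" using assms(2) by (intro card_inj_on_le) auto
  then show ?thesis using assms(2) by (simp add: card_Pow)
qed

lemma abs_sum_clusters_le:
  fixes \<phi> :: "'a::real_normed_vector set \<Rightarrow> real"
  assumes "finite X" "finite A" "W \<subseteq> (\<Union>a\<in>A. ball a (s / 2))"
    and "\<And>Y. Y \<in> S \<Longrightarrow> Y \<subseteq> X \<inter> W \<and> isolated s X Y" and "\<And>Y. Y \<in> S \<Longrightarrow> \<bar>\<phi> Y\<bar> \<le> 1"
  shows "\<bar>\<Sum>Y\<in>S. \<phi> Y\<bar> \<le> 2 ^ card A"
proof -
  have fin: "finite {Y. Y \<subseteq> X \<inter> W \<and> isolated s X Y}"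
    by (rule finite_subset[of _ "Pow X"]) (use assms(1) in auto)
  have "\<bar>\<Sum>Y\<in>S. \<phi> Y\<bar> \<le> (\<Sum>Y\<in>S. \<bar>\<phi> Y\<bar>)" by (rule sum_abs)
  also have "\<dots> \<le> (\<Sum>Y\<in>S. 1)" using assms(5) by (intro sum_mono)
  also have "\<dots> = real (card S)" by simp
  also have "\<dots> \<le> real (2 ^ card A)"
  proof -
    have "S \<subseteq> {Y. Y \<subseteq> X \<inter> W \<and> isolated s X Y}" using assms(4) by blast
    then have "card S \<le> 2 ^ card A" using card_isolated_le[OF assms(1-3)] card_mono[OF fin] by (meson order.trans)
    then show ?thesis by (simp only: of_nat_le_iff)
  qed
  finally show ?thesis by simp
qed

lemma abs_cluster_sum_le:
  assumes "finite X" "finite A" "W \<subseteq> (\<Union>a\<in>A. ball a (s / 2))"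
    and "\<And>Y. Y \<subseteq> X \<Longrightarrow> \<phi> Y \<noteq> 0 \<Longrightarrow> Y \<subseteq> W \<and> \<bar>\<phi> Y\<bar> \<le> 1"
  shows "\<bar>cluster_sum k s \<phi> X\<bar> \<le> 2 ^ card A"
  unfolding cluster_sum_alt[OF assms(1)]
  by (rule abs_sum_clusters_le[OF assms(1-3)]) (use assms(4) in auto)

lemma cluster_sum_card_eq:
  assumes "finite X" "card X = k"
  shows "cluster_sum k s \<phi> X = \<phi> X"
proof -
  have "Y = X" if "Y \<subseteq> X" "card Y = k" for Y
    using card_subset_eq[OF assms(1) that(1)] that(2) assms(2) by simp
  then have "{Y. Y \<subseteq> X \<and> card Y = k} = {X}" using assms(2) by blast
  then show ?thesis by (simp add: cluster_sum_def isolated_def)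
qed

lemma cluster_sum_card_less:
  assumes "finite X" "card X < k"
  shows "cluster_sum k s \<phi> X = 0"
proof -
  have "{Y. Y \<subseteq> X \<and> card Y = k} = {}" using assms card_mono[OF assms(1)] by (auto simp: not_le[symmetric])
  then show ?thesis unfolding cluster_sum_def by (simp only: sum.empty)
qed

text \<open>A region that contains the clusters together with their exclusion zones determines the sum.\<close>

lemma cluster_sum_local:
  assumes X: "finite X"
    and V: "\<And>Y. Y \<subseteq> X \<Longrightarrow> \<phi> Y \<noteq> 0 \<Longrightarrow> Y \<subseteq> V"
      "\<And>Y y x. Y \<subseteq> X \<Longrightarrow> \<phi> Y \<noteq> 0 \<Longrightarrow> y \<in> Y \<Longrightarrow> x \<in> X \<Longrightarrow> norm (y - x) < s \<Longrightarrow> x \<in> V"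
  shows "cluster_sum k s \<phi> (X \<inter> V) = cluster_sum k s \<phi> X"
proof -
  have iff: "isolated s (X \<inter> V) Y \<longleftrightarrow> isolated s X Y" if "Y \<subseteq> X" "\<phi> Y \<noteq> 0" for Y
    using V(2)[OF that] unfolding isolated_def by (meson Diff_iff IntD1 IntI not_le)
  have "{Y. Y \<subseteq> X \<inter> V \<and> card Y = k \<and> isolated s (X \<inter> V) Y \<and> \<phi> Y \<noteq> 0} = {Y. Y \<subseteq> X \<and> card Y = k \<and> isolated s X Y \<and> \<phi> Y \<noteq> 0}"
    using V(1) iff by blast
  then show ?thesis using X by (simp add: cluster_sum_alt)
qed

lemma sum_cluster_sum:
  "(\<Sum>c\<in>C. cluster_sum k s (\<phi> c) X) = cluster_sum k s (\<lambda>Y. \<Sum>c\<in>C. \<phi> c Y) X"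
  unfolding cluster_sum_def by (subst sum.swap) (simp add: sum_distrib_left)

text \<open>The new point \<open>x\<close> only affects clusters within distance \<open>\<delta> + s\<close>: those that contain it and those whose
  isolation it destroys. Boundedly many clusters fit into that ball, and any change
  requires \<open>k - 1\<close> old points in it.\<close>

lemma cluster_sum_insert:
  assumes X: "finite X" and A: "finite A" "cball x (\<delta> + s) \<subseteq> (\<Union>a\<in>A. ball a (s / 2))" and "s \<ge> 0"
    and \<phi>: "\<And>Y. \<bar>\<phi> Y\<bar> \<le> 1" "\<And>Y u v. \<phi> Y \<noteq> 0 \<Longrightarrow> u \<in> Y \<Longrightarrow> v \<in> Y \<Longrightarrow> norm (u - v) \<le> \<delta>"
  shows "\<bar>cluster_sum k s \<phi> (insert x X) - cluster_sum k s \<phi> X\<bar>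
    \<le> 2 * 2 ^ card A * of_bool (k \<le> card (X \<inter> cball x (\<delta> + s)) + 1)"
proof (cases "x \<in> X")
  case True
  then show ?thesis by (simp add: insert_absorb)
next
  case False
  let ?W = "cball x (\<delta> + s)"
  let ?C = "\<lambda>X. {Y. Y \<subseteq> X \<and> card Y = k \<and> isolated s X Y \<and> \<phi> Y \<noteq> 0}"
  let ?N = "\<lambda>X. {Y \<in> ?C X. Y \<subseteq> ?W}" let ?O = "\<lambda>X. {Y \<in> ?C X. \<not> Y \<subseteq> ?W}"
  have split: "cluster_sum k s \<phi> X' = (\<Sum>Y\<in>?N X'. \<phi> Y) + (\<Sum>Y\<in>?O X'. \<phi> Y)" if "finite X'" for X'
  proof -
    have fin: "finite (?C X')" by (rule finite_subset[of _ "Pow X'"]) (use that in auto)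
    have "(\<Sum>Y\<in>?C X'. \<phi> Y) = (\<Sum>Y\<in>?N X' \<union> ?O X'. \<phi> Y)" by (rule sum.cong) auto
    also have "\<dots> = (\<Sum>Y\<in>?N X'. \<phi> Y) + (\<Sum>Y\<in>?O X'. \<phi> Y)"
      by (rule sum.union_disjoint; (rule finite_subset[OF _ fin])?) blast+
    finally show ?thesis using that by (simp add: cluster_sum_alt)
  qed
  have near: "Y \<subseteq> ?W" if "\<phi> Y \<noteq> 0" "y \<in> Y" "norm (x - y) \<le> s" for Y y
  proof
    fix u assume "u \<in> Y"
    then have "norm (y - u) \<le> \<delta>" using \<phi>(2) that by blast
    then show "u \<in> ?W" using norm_triangle_ineq[of "x - y" "y - u"] that by (simp add: dist_norm)
  qed
  have "?O (insert x X) = ?O X"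
  proof (intro set_eqI iffI)
    fix Y assume Y: "Y \<in> ?O (insert x X)"
    then have "x \<notin> Y" using near[of Y x] \<open>s \<ge> 0\<close> by auto
    then show "Y \<in> ?O X" using Y by (auto simp: isolated_def)
  next
    fix Y assume Y: "Y \<in> ?O X"
    then have "s \<le> norm (y - x)" if "y \<in> Y" for y using near[of Y y] that by (force simp: norm_minus_commute)
    then show "Y \<in> ?O (insert x X)" using Y by (auto simp: isolated_def)
  qed
  then have diff: "cluster_sum k s \<phi> (insert x X) - cluster_sum k s \<phi> X = (\<Sum>Y\<in>?N (insert x X). \<phi> Y) - (\<Sum>Y\<in>?N X. \<phi> Y)"
    using split[of X] split[of "insert x X"] X by simp
  show ?thesis
  proof (cases "k \<le> card (X \<inter> ?W) + 1")
    case True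
    have "\<bar>\<Sum>Y\<in>?N (insert x X). \<phi> Y\<bar> \<le> 2 ^ card A" "\<bar>\<Sum>Y\<in>?N X. \<phi> Y\<bar> \<le> 2 ^ card A"
      using X \<phi>(1) by (intro abs_sum_clusters_le[OF _ A, of "insert x X"] abs_sum_clusters_le[OF _ A, of X]; force)+
    then show ?thesis unfolding diff using True by simp
  next
    case False
    have *: "card Y \<le> card (X \<inter> ?W) + 1" if "Y \<subseteq> insert x X" "Y \<subseteq> ?W" for Y
    proof -
      have "card Y \<le> card (insert x (X \<inter> ?W))" using that X by (intro card_mono) auto
      then show ?thesis using X by (simp add: card_insert_if split: if_splits)
    qed
    have "?N (insert x X) = {}" using * False by fastforce
    moreover have "?N X = {}" using *[OF subset_insertI2] False by fastforce
    ultimately show ?thesis unfolding diff by (simp only: sum.empty) simp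
  qed
qed

lemma measurable_cluster_sum:
  fixes \<phi> :: "'a::euclidean_space set \<Rightarrow> real"
  assumes \<phi>: "(\<lambda>x. \<phi> (x ` {..<k})) \<in> borel_measurable (PiM {..<k} (\<lambda>_. borel))"
  shows "cluster_sum k s \<phi> \<in> borel_measurable conf"
proof -
  let ?C = "conf :: 'a set measure" and ?P = "PiM {..<k} (\<lambda>_. borel :: 'a measure)"
  define near where "near x y = (of_bool (\<exists>i\<in>{..<k}. \<not> s \<le> norm (x i - y) \<and> (\<forall>j\<in>{..<k}. 0 < norm (y - x j))) :: real)" for x :: "nat \<Rightarrow> 'a" and y
  have comp: "(\<lambda>q. snd (fst q) i) \<in> borel_measurable ((?C \<Otimes>\<^sub>M ?P) \<Otimes>\<^sub>M (borel :: 'a measure))" if "i \<in> {..<k}" for i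
  proof -
    have "(\<lambda>q. snd (fst q)) \<in> measurable ((?C \<Otimes>\<^sub>M ?P) \<Otimes>\<^sub>M (borel :: 'a measure)) ?P" by measurable
    from measurable_compose[OF this measurable_component_singleton[OF that]] show ?thesis .
  qed
  have p: "Measurable.pred ((?C \<Otimes>\<^sub>M ?P) \<Otimes>\<^sub>M (borel :: 'a measure)) 
     (\<lambda>q. \<exists>i\<in>{..<k}. \<not> s \<le> norm (snd (fst q) i - snd q) \<and> (\<forall>j\<in>{..<k}. 0 < norm (snd q - snd (fst q) j)))"
  proof (intro pred_intros_finite pred_intros_logic finite_lessThan)
    fix i j assume i: "i \<in> {..<k}" and j: "j \<in> {..<k}"
    note [measurable] = comp[OF i] comp[OF j]
    show "Measurable.pred ((?C \<Otimes>\<^sub>M ?P) \<Otimes>\<^sub>M borel) (\<lambda>q. s \<le> norm (snd (fst q) i - snd q))"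
      by measurable
    show "Measurable.pred ((?C \<Otimes>\<^sub>M ?P) \<Otimes>\<^sub>M borel) (\<lambda>q. 0 < norm (snd q - snd (fst q) j))"
      by measurable
  qed
  have "(\<lambda>q. \<Sum>y\<in>fst q. near (snd q) y) \<in> borel_measurable (?C \<Otimes>\<^sub>M ?P)"
    using measurable_compose[OF p measurable_of_bool]
    by (intro measurable_point_sum) (simp_all add: near_def case_prod_beta')
  moreover define g where "g = (\<lambda>q :: 'a set \<times> (nat \<Rightarrow> 'a). \<Sum>y\<in>fst q. near (snd q) y)"
  ultimately have mg: "g \<in> borel_measurable (?C \<Otimes>\<^sub>M ?P)" by (simp only:)
  have mi: "Measurable.pred (?C \<Otimes>\<^sub>M ?P) (\<lambda>q. inj_on (snd q) {..<k})"
  proof -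
    have "Measurable.pred (?C \<Otimes>\<^sub>M ?P) (\<lambda>q. \<forall>i\<in>{..<k}. \<forall>j\<in>{..<k}. i \<noteq> j \<longrightarrow> 0 < norm (snd q i - snd q j))"
    proof (intro pred_intros_finite pred_intros_logic finite_lessThan)
      fix i j assume ij: "i \<in> {..<k}" "j \<in> {..<k}"
      have [measurable]: "(\<lambda>q. snd q i) \<in> borel_measurable (?C \<Otimes>\<^sub>M ?P)" "(\<lambda>q. snd q j) \<in> borel_measurable (?C \<Otimes>\<^sub>M ?P)"
        by (rule measurable_compose[OF measurable_snd measurable_component_singleton], rule ij)+
      show "Measurable.pred (?C \<Otimes>\<^sub>M ?P) (\<lambda>q. 0 < norm (snd q i - snd q j))" by measurable
    qed simp
    moreover have "inj_on (snd q) {..<k} \<longleftrightarrow> (\<forall>i\<in>{..<k}. \<forall>j\<in>{..<k}. i \<noteq> j \<longrightarrow> 0 < norm (snd q i - snd q j))"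
      for q :: "'a set \<times> (nat \<Rightarrow> 'a)"
      unfolding inj_on_def by (simp, blast)
    ultimately show ?thesis by (simp only:)
  qed
  define h where "h = (\<lambda>q :: 'a set \<times> (nat \<Rightarrow> 'a). \<phi> (snd q ` {..<k}))"
  have mh: "h \<in> borel_measurable (?C \<Otimes>\<^sub>M ?P)"
    unfolding h_def by (rule measurable_compose[OF measurable_snd \<phi>])
  define f where "f X x = (if inj_on x {..<k} then (if (\<Sum>y\<in>X. near x y) \<le> 0 then 1 else 0) * \<phi> (x ` {..<k}) else 0)" for X :: "'a set" and x :: "nat \<Rightarrow> 'a"
  have "(\<lambda>q. if inj_on (snd q) {..<k} then (if g q \<le> 0 then 1 else 0) * h q else 0) \<in> borel_measurable (?C \<Otimes>\<^sub>M ?P)"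
    by (rule measurable_If[OF borel_measurable_times[OF measurable_If[OF borel_measurable_const borel_measurable_const
          borel_measurable_le[OF mg borel_measurable_const]] mh] borel_measurable_const mi[unfolded pred_def]])
  then have f: "case_prod f \<in> borel_measurable (?C \<Otimes>\<^sub>M ?P)"
    unfolding f_def g_def h_def case_prod_beta' .
  have eq: "cluster_sum k s \<phi> X = (\<Sum>x\<in>PiE {..<k} (\<lambda>_. X). f X x) / fact k" if X: "finite X" for X
  proof -
    have "(\<Sum>y\<in>X. near x y) \<le> 0 \<longleftrightarrow> isolated s X (x ` {..<k})" for x
    proof -
      have nonneg: "0 \<le> near x y" for y by (simp add: near_def)
      have "0 \<le> (\<Sum>y\<in>X. near x y)" by (intro sum_nonneg nonneg)
      then have "(\<Sum>y\<in>X. near x y) \<le> 0 \<longleftrightarrow> (\<Sum>y\<in>X. near x y) = 0" by linarith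
      also have "\<dots> \<longleftrightarrow> (\<forall>y\<in>X. near x y = 0)" using X nonneg by (intro sum_nonneg_eq_0_iff)
      also have "\<dots> \<longleftrightarrow> (\<forall>y\<in>X. y \<in> x ` {..<k} \<or> (\<forall>i\<in>{..<k}. s \<le> norm (x i - y)))"
      proof (intro ball_cong refl)
        fix y
        have "near x y = 0 \<longleftrightarrow> \<not> (\<exists>i\<in>{..<k}. \<not> s \<le> norm (x i - y) \<and> (\<forall>j\<in>{..<k}. y \<noteq> x j))"
          by (simp add: near_def)
        then show "near x y = 0 \<longleftrightarrow> y \<in> x ` {..<k} \<or> (\<forall>i\<in>{..<k}. s \<le> norm (x i - y))" by blast
      qed
      also have "\<dots> \<longleftrightarrow> isolated s X (x ` {..<k})" unfolding isolated_def by blast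
      finally show ?thesis .
    qed
    then show ?thesis unfolding cluster_sum_def sum_subsets_eq_sum_tuples[OF X] f_def
      by (intro arg_cong2[where f = "(/)"] sum.cong refl) auto
  qed
  have "(\<lambda>X. (\<Sum>x\<in>PiE {..<k} (\<lambda>_. X). f X x) / fact k) \<in> borel_measurable conf"
    using measurable_tuple_sum[OF measurable_ident_sets[OF refl] f] by simp
  then show ?thesis by (rule measurable_cong[THEN iffD2, rotated]) (simp add: eq)
qed

text \<open>The number \<open>N\<close> does not depend on the scale \<open>r\<close>, since a cover of a fixed ball can be translated and
  dilated.\<close>

lemma cover_cball:
  fixes L s :: real
  assumes "s > 0"
  obtains N where "\<And>(z::'a::euclidean_space) r. r > 0 \<Longrightarrow> \<exists>A. finite A \<and> card A \<le> N \<and> cball z (r * L) \<subseteq> (\<Union>a\<in>A. ball a (r * s / 2))"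
proof -
  have "cball (0::'a) L \<subseteq> (\<Union>a\<in>cball 0 L. ball a (s / 2))" using assms by auto
  then obtain A where A: "A \<subseteq> cball (0::'a) L" "finite A" "cball 0 L \<subseteq> (\<Union>a\<in>A. ball a (s / 2))"
    using compactE_image[OF compact_cball[of "0::'a" L], of "cball 0 L" "\<lambda>a. ball a (s / 2)"] by (metis open_ball)
  have "\<exists>B. finite B \<and> card B \<le> card A \<and> cball z (r * L) \<subseteq> (\<Union>a\<in>B. ball a (r * s / 2))" if r: "r > 0" for z :: 'a and r
  proof (intro exI[of _ "(\<lambda>a. z + r *\<^sub>R a) ` A"] conjI)
    show "cball z (r * L) \<subseteq> (\<Union>a\<in>(\<lambda>a. z + r *\<^sub>R a) ` A. ball a (r * s / 2))"
    proof
      fix x assume x: "x \<in> cball z (r * L)"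
      have "norm (inverse r *\<^sub>R (x - z)) = norm (x - z) / r" using r by (simp only: norm_scaleR) (simp add: divide_inverse_commute)
      also have "\<dots> \<le> L" using x r by (simp add: dist_norm norm_minus_commute field_simps)
      finally have "norm (inverse r *\<^sub>R (x - z)) \<le> L" .
      then have "inverse r *\<^sub>R (x - z) \<in> cball 0 L" by (simp only: mem_cball_0)
      then have "inverse r *\<^sub>R (x - z) \<in> (\<Union>a\<in>A. ball a (s / 2))" using A(3) by blast
      then obtain a where a: "a \<in> A" "norm (a - inverse r *\<^sub>R (x - z)) < s / 2" by (auto simp: dist_norm)
      have "z + r *\<^sub>R a - x = r *\<^sub>R (a - inverse r *\<^sub>R (x - z))" using r by (simp add: algebra_simps)
      then have "norm (z + r *\<^sub>R a - x) = r * norm (a - inverse r *\<^sub>R (x - z))" using r by simp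
      also have "\<dots> < r * (s / 2)" using a r by (intro mult_strict_left_mono) auto
      finally show "x \<in> (\<Union>a\<in>(\<lambda>a. z + r *\<^sub>R a) ` A. ball a (r * s / 2))" using a(1) by (auto simp: dist_norm)
    qed
  qed (use A in \<open>auto intro: card_image_le\<close>)
  then show thesis using that by blast
qed



section \<open>Integrals over tuples of points\<close>

interpretation lborel_tuple: product_sigma_finite "\<lambda>_::nat. lborel :: 'a::euclidean_space measure"
  by standard

lemma sets_lborel_tuples: "sets (PiM I (\<lambda>_. lborel)) = sets (PiM I (\<lambda>_. borel))"
  by (intro sets_PiM_cong) auto

lemma measurable_lborel_tuples[simp]: "measurable (PiM I (\<lambda>_. lborel)) N = measurable (PiM I (\<lambda>_. borel)) N"
  by (rule measurable_cong_sets[OF sets_lborel_tuples refl])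

lemma nn_integral_lborel_affine:
  fixes z :: "'a::euclidean_space"
  assumes "f \<in> borel_measurable borel" "r > 0"
  shows "(\<integral>\<^sup>+x. f x \<partial>lborel) = ennreal (r ^ DIM('a)) * (\<integral>\<^sup>+x. f (z + r *\<^sub>R x) \<partial>lborel)"
proof -
  note [measurable] = assms(1)
  have "(\<integral>\<^sup>+x. f x \<partial>lborel) = (\<integral>\<^sup>+x. f x \<partial>density (distr lborel borel (\<lambda>x. z + r *\<^sub>R x)) (\<lambda>_. ennreal (\<bar>r\<bar> ^ DIM('a))))"
    using lborel_affine[of r z] assms(2) by (simp add: ennreal_power)
  also have "\<dots> = (\<integral>\<^sup>+x. ennreal (r ^ DIM('a)) * f (z + r *\<^sub>R x) \<partial>lborel)"
    using assms(2) by (simp add: nn_integral_density nn_integral_distr)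
  also have "\<dots> = ennreal (r ^ DIM('a)) * (\<integral>\<^sup>+x. f (z + r *\<^sub>R x) \<partial>lborel)" by (rule nn_integral_cmult) measurable
  finally show ?thesis .
qed

lemma nn_integral_PiM_lborel_affine:
  fixes z :: "'a::euclidean_space"
  assumes "finite I" "f \<in> borel_measurable (PiM I (\<lambda>_. borel))" "r > 0"
  shows "(\<integral>\<^sup>+x. f x \<partial>PiM I (\<lambda>_::nat. lborel)) =
    ennreal (r ^ (DIM('a) * card I)) * (\<integral>\<^sup>+y. f (\<lambda>i\<in>I. z + r *\<^sub>R y i) \<partial>PiM I (\<lambda>_. lborel))"
  using assms(1,2)
proof (induction I arbitrary: f rule: finite_induct)
  case empty
  have "(\<lambda>i\<in>{}. z + r *\<^sub>R x i) = (\<lambda>i. undefined)" for x :: "nat \<Rightarrow> 'a" by (simp add: restrict_def)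
  then show ?case by (simp add: PiM_empty nn_integral_count_space_finite)
next
  case (insert i I)
  note [measurable] = insert.prems
  have upd: "(\<lambda>(x, y). f (x(i := y))) \<in> borel_measurable (PiM I (\<lambda>_. borel) \<Otimes>\<^sub>M borel)"
  proof -
    have "(\<lambda>q. (fst q)(i := snd q)) \<in> PiM I (\<lambda>_. borel) \<Otimes>\<^sub>M borel \<rightarrow>\<^sub>M PiM (insert i I) (\<lambda>_. borel :: 'a measure)"
      by (rule measurable_fun_upd[where J = I]) auto
    from measurable_compose[OF this insert.prems] show ?thesis by (simp only: case_prod_beta')
  qed
  let ?d = "ennreal (r ^ DIM('a))"
  have in_meas: "(\<lambda>y. f (x(i := y))) \<in> borel_measurable borel" if "x \<in> space (PiM I (\<lambda>_. borel :: 'a measure))" for x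
    using measurable_Pair2[OF upd that] by simp
  define g where "g x = (\<integral>\<^sup>+y. f (x(i := z + r *\<^sub>R y)) \<partial>lborel)" for x
  have upd2: "(\<lambda>(x, y). f (x(i := z + r *\<^sub>R y))) \<in> borel_measurable (PiM I (\<lambda>_. borel) \<Otimes>\<^sub>M lborel)"
  proof -
    have "(\<lambda>q. (fst q)(i := z + r *\<^sub>R snd q)) \<in> PiM I (\<lambda>_. borel) \<Otimes>\<^sub>M lborel \<rightarrow>\<^sub>M PiM (insert i I) (\<lambda>_. borel :: 'a measure)"
      by (rule measurable_fun_upd[where J = I]) auto
    from measurable_compose[OF this insert.prems] show ?thesis by (simp only: case_prod_beta')
  qed
  have g_meas: "g \<in> borel_measurable (PiM I (\<lambda>_. borel))"
    unfolding g_def by (rule sigma_finite_measure.borel_measurable_nn_integral[OF _ upd2]) (rule sigma_finite_lborel)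
  have "(\<integral>\<^sup>+x. f x \<partial>PiM (insert i I) (\<lambda>_. lborel)) = (\<integral>\<^sup>+x. (\<integral>\<^sup>+y. f (x(i := y)) \<partial>lborel) \<partial>PiM I (\<lambda>_. lborel))"
    using insert by (intro lborel_tuple.product_nn_integral_insert) auto
  also have "\<dots> = (\<integral>\<^sup>+x. ?d * g x \<partial>PiM I (\<lambda>_. lborel))"
  proof (rule nn_integral_cong)
    fix x :: "nat \<Rightarrow> 'a" assume "x \<in> space (PiM I (\<lambda>_. lborel))"
    then have "x \<in> space (PiM I (\<lambda>_. borel :: 'a measure))" by (simp add: space_PiM)
    from nn_integral_lborel_affine[OF in_meas[OF this] assms(3), of z]
    show "(\<integral>\<^sup>+y. f (x(i := y)) \<partial>lborel) = ?d * g x" by (simp add: g_def)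
  qed
  also have "\<dots> = ?d * (\<integral>\<^sup>+x. g x \<partial>PiM I (\<lambda>_. lborel))" using g_meas by (intro nn_integral_cmult) simp
  also have "\<dots> = ?d * (ennreal (r ^ (DIM('a) * card I)) * (\<integral>\<^sup>+x. g (\<lambda>i\<in>I. z + r *\<^sub>R x i) \<partial>PiM I (\<lambda>_. lborel)))"
    by (subst insert.IH[OF g_meas]) (rule refl)
  also have "\<dots> = ennreal (r ^ (DIM('a) * card (insert i I))) * (\<integral>\<^sup>+x. g (\<lambda>i\<in>I. z + r *\<^sub>R x i) \<partial>PiM I (\<lambda>_. lborel))"
    using insert.hyps assms(3) by (simp add: power_add ennreal_mult mult.assoc)
  also have "(\<integral>\<^sup>+x. g (\<lambda>i\<in>I. z + r *\<^sub>R x i) \<partial>PiM I (\<lambda>_. lborel)) 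
     = (\<integral>\<^sup>+x. (\<integral>\<^sup>+y. f (\<lambda>j\<in>insert i I. z + r *\<^sub>R (x(i := y)) j) \<partial>lborel) \<partial>PiM I (\<lambda>_. lborel))"
    unfolding g_def using insert.hyps
    by (intro nn_integral_cong arg_cong[where f = f]) (auto simp: fun_eq_iff)
  also have "\<dots> = (\<integral>\<^sup>+y. f (\<lambda>j\<in>insert i I. z + r *\<^sub>R y j) \<partial>PiM (insert i I) (\<lambda>_. lborel))"
  proof (rule lborel_tuple.product_nn_integral_insert[symmetric])
    have "(\<lambda>y. \<lambda>j\<in>insert i I. z + r *\<^sub>R y j) \<in> PiM (insert i I) (\<lambda>_. borel) \<rightarrow>\<^sub>M PiM (insert i I) (\<lambda>_. borel :: 'a measure)"
      by (rule measurable_restrict) auto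
    from measurable_compose[OF this insert.prems]
    show "(\<lambda>y. f (\<lambda>j\<in>insert i I. z + r *\<^sub>R y j)) \<in> borel_measurable (PiM (insert i I) (\<lambda>_. lborel))" by simp
  qed (use insert in auto)
  finally show ?case .
qed

lemma lessThan_eq_insert_last: "k > 0 \<Longrightarrow> {..<k} = insert (k - 1) {..<k - 1}" for k :: nat
  by auto

lemma tuple_image_upd: "k > 0 \<Longrightarrow> (x(k - 1 := z)) ` {..<k} = insert z (x ` {..<k - 1})" for k :: nat
  by (subst lessThan_eq_insert_last) auto

lemma measurable_tuple_upd_last:
  fixes z :: "'a::euclidean_space" and k :: nat
  assumes "k > 0"
  shows "(\<lambda>x. x(k - 1 := z)) \<in> PiM {..<k - 1} (\<lambda>_. borel) \<rightarrow>\<^sub>M PiM {..<k} (\<lambda>_. borel :: 'a measure)"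
  by (rule measurable_fun_upd[where J = "{..<k - 1}"]) (use assms in auto)

lemma measurable_with_origin:
  fixes h :: "'a::euclidean_space set \<Rightarrow> 'b::topological_space"
  assumes "k > 0" "(\<lambda>x. h (x ` {..<k})) \<in> borel_measurable (PiM {..<k} (\<lambda>_. borel))"
  shows "(\<lambda>y. h (with_origin k y)) \<in> borel_measurable (PiM {..<k - 1} (\<lambda>_. borel))"
  using measurable_compose[OF measurable_tuple_upd_last[OF assms(1), of 0] assms(2)]
  by (simp only: tuple_image_upd[OF assms(1)] with_origin_def)

text \<open>Fixing the last point of a tuple and rescaling the others around it turns the integral of a
  translation invariant function into the integral over tuples that contain the origin.\<close>

lemma nn_integral_anchored:
  fixes h h0 :: "'a::euclidean_space set \<Rightarrow> ennreal"
  assumes k: "k > 0" and r: "r > 0" and D: "D \<in> sets borel"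
    and h: "(\<lambda>x. h (x ` {..<k})) \<in> borel_measurable (PiM {..<k} (\<lambda>_. borel))"
    and inv: "\<And>z Y. h ((\<lambda>x. z + r *\<^sub>R x) ` Y) = h0 Y"
  shows "(\<integral>\<^sup>+x. h (x ` {..<k}) * indicator D (x (k - 1)) \<partial>PiM {..<k} (\<lambda>_. lborel))
    = emeasure lborel D * ennreal (r ^ (DIM('a) * (k - 1))) * (\<integral>\<^sup>+y. h0 (with_origin k y) \<partial>lborel_tuples k)"
proof -
  let ?V = "\<integral>\<^sup>+y. h0 (with_origin k y) \<partial>lborel_tuples k"
  let ?c = "ennreal (r ^ (DIM('a) * (k - 1)))"
  have ins: "{..<k} = insert (k - 1) {..<k - 1}" by (rule lessThan_eq_insert_last[OF k])
  have hz: "(\<lambda>x. h (insert z (x ` {..<k - 1}))) \<in> borel_measurable (PiM {..<k - 1} (\<lambda>_. borel))" for z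
    using measurable_compose[OF measurable_tuple_upd_last[OF k] h] by (simp only: tuple_image_upd[OF k])
  have inner: "(\<integral>\<^sup>+x. h (insert z (x ` {..<k - 1})) \<partial>PiM {..<k - 1} (\<lambda>_. lborel)) = ?c * ?V" for z
  proof -
    have "(\<integral>\<^sup>+x. h (insert z (x ` {..<k - 1})) \<partial>PiM {..<k - 1} (\<lambda>_. lborel)) 
       = ?c * (\<integral>\<^sup>+y. h (insert z ((\<lambda>i\<in>{..<k - 1}. z + r *\<^sub>R y i) ` {..<k - 1})) \<partial>PiM {..<k - 1} (\<lambda>_. lborel))"
      using nn_integral_PiM_lborel_affine[OF _ hz r, of z z] by simp
    also have "(\<integral>\<^sup>+y. h (insert z ((\<lambda>i\<in>{..<k - 1}. z + r *\<^sub>R y i) ` {..<k - 1})) \<partial>PiM {..<k - 1} (\<lambda>_. lborel)) = ?V"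
      unfolding lborel_tuples_def
    proof (rule nn_integral_cong)
      fix y :: "nat \<Rightarrow> 'a"
      have "insert z ((\<lambda>i\<in>{..<k - 1}. z + r *\<^sub>R y i) ` {..<k - 1}) = (\<lambda>x. z + r *\<^sub>R x) ` with_origin k y"
        by (auto simp: with_origin_def image_image)
      then show "h (insert z ((\<lambda>i\<in>{..<k - 1}. z + r *\<^sub>R y i) ` {..<k - 1})) = h0 (with_origin k y)"
        by (simp only: inv)
    qed
    finally show ?thesis .
  qed
  have meas: "(\<lambda>x. h (x ` {..<k}) * indicator D (x (k - 1))) \<in> borel_measurable (PiM {..<k} (\<lambda>_. borel))"
  proof -
    have "(\<lambda>x. x (k - 1)) \<in> borel_measurable (PiM {..<k} (\<lambda>_. borel :: 'a measure))"
      by (rule measurable_component_singleton) (use k in auto)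
    from measurable_compose[OF this borel_measurable_indicator[OF D]] show ?thesis
      by (rule borel_measurable_times_ennreal[OF h])
  qed
  have "(\<integral>\<^sup>+x. h (x ` {..<k}) * indicator D (x (k - 1)) \<partial>PiM {..<k} (\<lambda>_. lborel)) =
     (\<integral>\<^sup>+z. (\<integral>\<^sup>+x. h ((x(k - 1 := z)) ` {..<k}) * indicator D ((x(k - 1 := z)) (k - 1)) \<partial>PiM {..<k - 1} (\<lambda>_. lborel)) \<partial>lborel)"
    using lborel_tuple.product_nn_integral_insert_rev[of "{..<k - 1}" "k - 1" "\<lambda>x. h (x ` {..<k}) * indicator D (x (k - 1))"] meas
    by (simp only: ins[symmetric] measurable_lborel_tuples finite_lessThan lessThan_iff less_irrefl not_False_eq_True)
  also have "\<dots> = (\<integral>\<^sup>+z. (?c * ?V) * indicator D z \<partial>lborel)"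
  proof (rule nn_integral_cong)
    fix z :: 'a
    have "(\<integral>\<^sup>+x. h (insert z (x ` {..<k - 1})) * indicator D z \<partial>PiM {..<k - 1} (\<lambda>_. lborel)) 
      = (\<integral>\<^sup>+x. h (insert z (x ` {..<k - 1})) \<partial>PiM {..<k - 1} (\<lambda>_. lborel)) * indicator D z"
      by (rule nn_integral_multc) (simp only: measurable_lborel_tuples hz)
    then show "(\<integral>\<^sup>+x. h ((x(k - 1 := z)) ` {..<k}) * indicator D ((x(k - 1 := z)) (k - 1)) \<partial>PiM {..<k - 1} (\<lambda>_. lborel)) 
       = (?c * ?V) * indicator D z"
      unfolding inner by (simp only: tuple_image_upd[OF k] fun_upd_same)
  qed
  also have "\<dots> = (?c * ?V) * emeasure lborel D" using D by (intro nn_integral_cmult_indicator) simp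
  finally show ?thesis by (simp add: mult_ac)
qed

lemma (in window) nn_integral_uniform_tuples:
  assumes "finite I" "f \<in> borel_measurable (PiM I (\<lambda>_. borel))"
  shows "ennreal (measure lborel W) ^ card I * (\<integral>\<^sup>+x. f x \<partial>PiM I (\<lambda>_::nat. uniform_measure lborel W))
    = (\<integral>\<^sup>+x. f x * indicator (PiE I (\<lambda>_. W)) x \<partial>PiM I (\<lambda>_. lborel))"
  using assms
proof (induction I arbitrary: f rule: finite_induct)
  case empty
  then show ?case by (simp add: PiM_empty nn_integral_count_space_finite)
next
  case (insert i I)
  interpret U: prob_space "uniform_measure lborel W" by (rule prob_space_uniform)
  interpret PU: product_sigma_finite "\<lambda>_::nat. uniform_measure lborel W" by standard
  let ?w = "ennreal (measure lborel W)"
  have upd: "(\<lambda>(x, y). f (x(i := y))) \<in> borel_measurable (PiM I (\<lambda>_. borel) \<Otimes>\<^sub>M borel)"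
  proof -
    have "(\<lambda>q. (fst q)(i := snd q)) \<in> PiM I (\<lambda>_. borel) \<Otimes>\<^sub>M borel \<rightarrow>\<^sub>M PiM (insert i I) (\<lambda>_. borel :: 'a measure)"
      by (rule measurable_fun_upd[where J = I]) auto
    from measurable_compose[OF this insert.prems] show ?thesis by (simp only: case_prod_beta')
  qed
  have in_meas: "(\<lambda>y. f (x(i := y))) \<in> borel_measurable borel" if "x \<in> space (PiM I (\<lambda>_. borel :: 'a measure))" for x
    using measurable_Pair2[OF upd that] by simp
  define g where "g x = (\<integral>\<^sup>+y. f (x(i := y)) * indicator W y \<partial>lborel)" for x
  have "(\<lambda>q. f ((fst q)(i := snd q)) * indicator W (snd q)) \<in> borel_measurable (PiM I (\<lambda>_. borel) \<Otimes>\<^sub>M lborel)"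
  proof (rule borel_measurable_times_ennreal)
    show "(\<lambda>q. f ((fst q)(i := snd q))) \<in> borel_measurable (PiM I (\<lambda>_. borel) \<Otimes>\<^sub>M lborel)"
      using upd by (simp add: case_prod_beta' cong: measurable_cong_sets)
    show "(\<lambda>q. indicator W (snd q)) \<in> borel_measurable (PiM I (\<lambda>_. borel :: 'a measure) \<Otimes>\<^sub>M lborel)"
      by (rule measurable_compose[OF measurable_snd]) simp
  qed
  then have g_meas: "g \<in> borel_measurable (PiM I (\<lambda>_. borel))"
    unfolding g_def by (intro sigma_finite_measure.borel_measurable_nn_integral[OF sigma_finite_lborel]) (simp add: case_prod_beta')
  have "(\<integral>\<^sup>+x. f x \<partial>PiM (insert i I) (\<lambda>_. uniform_measure lborel W)) 
     = (\<integral>\<^sup>+x. (\<integral>\<^sup>+y. f (x(i := y)) \<partial>uniform_measure lborel W) \<partial>PiM I (\<lambda>_. uniform_measure lborel W))"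
    using insert by (intro PU.product_nn_integral_insert) auto
  also have "\<dots> = (\<integral>\<^sup>+x. g x / ?w \<partial>PiM I (\<lambda>_. uniform_measure lborel W))"
  proof (rule nn_integral_cong)
    fix x assume "x \<in> space (PiM I (\<lambda>_. uniform_measure lborel W))"
    then have "x \<in> space (PiM I (\<lambda>_. borel :: 'a measure))" by (simp add: space_PiM)
    from in_meas[OF this]
    show "(\<integral>\<^sup>+y. f (x(i := y)) \<partial>uniform_measure lborel W) = g x / ?w"
      unfolding g_def em_W[symmetric] by (intro nn_integral_uniform_measure) auto
  qed
  also have "\<dots> = (\<integral>\<^sup>+x. g x \<partial>PiM I (\<lambda>_. uniform_measure lborel W)) / ?w" 
    using g_meas by (intro nn_integral_divide) simp
  finally have "?w ^ card (insert i I) * (\<integral>\<^sup>+x. f x \<partial>PiM (insert i I) (\<lambda>_. uniform_measure lborel W))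
     = ?w ^ card I * (?w * ((\<integral>\<^sup>+x. g x \<partial>PiM I (\<lambda>_. uniform_measure lborel W)) / ?w))"
    using insert.hyps by (simp add: mult_ac)
  also have "?w * ((\<integral>\<^sup>+x. g x \<partial>PiM I (\<lambda>_. uniform_measure lborel W)) / ?w) = (\<integral>\<^sup>+x. g x \<partial>PiM I (\<lambda>_. uniform_measure lborel W))"
    using W_pos by (simp add: ennreal_times_divide mult.commute[of ?w] ennreal_mult_divide_eq)
  also have "?w ^ card I * \<dots> = (\<integral>\<^sup>+x. g x * indicator (PiE I (\<lambda>_. W)) x \<partial>PiM I (\<lambda>_. lborel))"
    by (rule insert.IH[OF g_meas])
  also have "\<dots> = (\<integral>\<^sup>+x. (\<integral>\<^sup>+y. f (x(i := y)) * indicator (PiE (insert i I) (\<lambda>_. W)) (x(i := y)) \<partial>lborel) \<partial>PiM I (\<lambda>_. lborel))"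
  proof (rule nn_integral_cong)
    fix x :: "nat \<Rightarrow> 'a" assume x: "x \<in> space (PiM I (\<lambda>_. lborel))"
    have ind: "indicator (PiE (insert i I) (\<lambda>_. W)) (x(i := y)) = (indicator W y * indicator (PiE I (\<lambda>_. W)) x :: ennreal)" for y
    proof -
      have "x(i := y) \<in> PiE (insert i I) (\<lambda>_. W) \<longleftrightarrow> y \<in> W \<and> x \<in> PiE I (\<lambda>_. W)"
        using x insert.hyps by (auto simp: space_PiM PiE_iff extensional_def split: if_splits)
      then show ?thesis by (auto simp: indicator_def)
    qed
    have "x \<in> space (PiM I (\<lambda>_. borel :: 'a measure))" using x by (simp add: space_PiM)
    then show "g x * indicator (PiE I (\<lambda>_. W)) x = (\<integral>\<^sup>+y. f (x(i := y)) * indicator (PiE (insert i I) (\<lambda>_. W)) (x(i := y)) \<partial>lborel)"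
      unfolding ind g_def mult.assoc[symmetric]
      by (intro nn_integral_multc[symmetric] borel_measurable_times_ennreal) (auto dest: in_meas)
  qed
  also have "\<dots> = (\<integral>\<^sup>+x. f x * indicator (PiE (insert i I) (\<lambda>_. W)) x \<partial>PiM (insert i I) (\<lambda>_. lborel))"
  proof (rule lborel_tuple.product_nn_integral_insert[symmetric])
    have "PiE (insert i I) (\<lambda>_. W) \<in> sets (PiM (insert i I) (\<lambda>_. borel :: 'a measure))"
      using insert.hyps by (intro sets_PiM_I_finite) auto
    then show "(\<lambda>x. f x * indicator (PiE (insert i I) (\<lambda>_. W)) x) \<in> borel_measurable (PiM (insert i I) (\<lambda>_. lborel))"
      using insert.prems by (intro borel_measurable_times_ennreal borel_measurable_indicator) (auto simp: sets_lborel_tuples)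
  qed (use insert in auto)
  finally show ?case .
qed

section \<open>Moments of a statistic of sparse points\<close>

text \<open>The expected number of points in \<open>W\<close> is small, so a statistic that vanishes on fewer than
  \<open>k\<close> points is governed by the event that \<open>W\<close> holds exactly \<open>k\<close> points.\<close>

lemma (in void_process)
  fixes Z :: "'a set \<Rightarrow> real"
  assumes W: "window W" "W \<subseteq> D" and Z[measurable]: "Z \<in> borel_measurable conf"
    and bound: "\<And>Y. finite Y \<Longrightarrow> \<bar>Z Y\<bar> \<le> K" and zero: "\<And>Y. finite Y \<Longrightarrow> card Y < k \<Longrightarrow> Z Y = 0"
  defines "\<mu> \<equiv> c * measure lborel W"
    and "T \<equiv> \<integral>\<^sup>+x. ennreal ((Z (x ` {..<k}))\<^sup>2) * indicator (PiE {..<k} (\<lambda>_. W)) x \<partial>PiM {..<k} (\<lambda>_. lborel)"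
  shows second_moment_upper: "T \<le> ennreal t \<Longrightarrow> t \<ge> 0 \<Longrightarrow>
      (\<integral>\<omega>. (Z (X \<omega> \<inter> W))\<^sup>2 \<partial>M) \<le> c ^ k / fact k * t + K\<^sup>2 * \<mu> ^ Suc k"
    and second_moment_lower: "T \<ge> ennreal t \<Longrightarrow> t \<ge> 0 \<Longrightarrow> (\<integral>\<omega>. (Z (X \<omega> \<inter> W))\<^sup>2 \<partial>M) \<ge> exp (- \<mu>) * (c ^ k / fact k * t)"
    and first_moment: "\<bar>\<integral>\<omega>. Z (X \<omega> \<inter> W) \<partial>M\<bar> \<le> K * \<mu> ^ k"
proof -
  interpret window W by fact
  have K: "K \<ge> 0" using bound[of "{}"] by simp
  have \<mu>: "\<mu> > 0" using c_pos W_pos by (simp add: \<mu>_def)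
  let ?p = "poisson_pmf \<mu>"
  have XW[measurable]: "(\<lambda>\<omega>. X \<omega> \<inter> W) \<in> measurable M conf"
    by (rule measurable_compose[OF X_meas measurable_conf_Int[OF W_meas]])
  have ZX[measurable]: "(\<lambda>\<omega>. Z (X \<omega> \<inter> W)) \<in> borel_measurable M" by (rule measurable_compose[OF XW Z])
  have fin: "finite (X \<omega> \<inter> W)" if "\<omega> \<in> space M" for \<omega> using measurable_space[OF XW that] by simp
  define q where "q j = (\<integral>\<^sup>+Y. ennreal ((Z Y)\<^sup>2) \<partial>binom_law W j)" for j
  have sq_int: "integrable M (\<lambda>\<omega>. (Z (X \<omega> \<inter> W))\<^sup>2)"
    using bound fin by (intro integrable_const_bound[of _ "K\<^sup>2"]) (auto simp: abs_le_square_iff[symmetric] K)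
  have E: "ennreal (\<integral>\<omega>. (Z (X \<omega> \<inter> W))\<^sup>2 \<partial>M) = (\<integral>\<^sup>+j. q j \<partial>measure_pmf ?p)"
    unfolding q_def \<mu>_def nn_integral_eq_integral[OF sq_int, simplified, symmetric]
    by (rule nn_integral_restrict[OF W]) measurable
  have q_formula: "q j = (\<integral>\<^sup>+x. ennreal ((Z (x ` {..<j}))\<^sup>2) \<partial>PiM {..<j} (\<lambda>_. uniform_measure lborel W))" for j
    unfolding q_def by (rule nn_integral_binom_law) measurable
  have card_le: "finite (x ` {..<j})" "card (x ` {..<j}) \<le> j" for x :: "nat \<Rightarrow> 'a" and j
    using card_image_le[of "{..<j}" x] by auto
  have q_small: "q j = 0" if "j < k" for j
    unfolding q_formula using zero[OF card_le(1) le_less_trans[OF card_le(2) that]] by simp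
  have q_le: "q j \<le> ennreal (K\<^sup>2)" for j
  proof -
    interpret B: prob_space "binom_law W j" by (rule prob_space_binom_law)
    have "q j \<le> (\<integral>\<^sup>+Y. ennreal (K\<^sup>2) \<partial>binom_law W j)"
      unfolding q_def using bound by (intro nn_integral_mono ennreal_leI) (auto simp: abs_le_square_iff[symmetric] K)
    then show ?thesis by (simp add: B.emeasure_space_1[unfolded space_binom_law])
  qed
  have Tq: "ennreal (pmf ?p k) * q k = ennreal (exp (- \<mu>) * (c ^ k / fact k)) * T"
  proof -
    have "(\<lambda>x. ennreal ((Z (x ` {..<k}))\<^sup>2)) \<in> borel_measurable (PiM {..<k} (\<lambda>_. borel))"
      by (rule measurable_compose[OF measurable_tuple_conf]) auto
    from nn_integral_uniform_tuples[OF _ this]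
    have "T = ennreal (measure lborel W ^ k) * q k" unfolding T_def q_formula using W_pos by (simp add: ennreal_power)
    moreover have "pmf ?p k = (exp (- \<mu>) * (c ^ k / fact k)) * measure lborel W ^ k"
      using \<mu> by (simp add: \<mu>_def power_mult_distrib)
    moreover have "ennreal ((exp (- \<mu>) * (c ^ k / fact k)) * measure lborel W ^ k)
        = ennreal (exp (- \<mu>) * (c ^ k / fact k)) * ennreal (measure lborel W ^ k)"
      using c_pos by (intro ennreal_mult) auto
    ultimately show ?thesis by (simp only: mult.assoc)
  qed
  have tail: "emeasure (measure_pmf ?p) {Suc k..} \<le> ennreal (\<mu> ^ Suc k)" "emeasure (measure_pmf ?p) {k..} \<le> ennreal (\<mu> ^ k)"
    using poisson_tail[OF \<mu>] by blast+
  have at_k: "(\<integral>\<^sup>+j. q k * indicator {k} j \<partial>measure_pmf ?p) = ennreal (pmf ?p k) * q k"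
    by (simp add: nn_integral_cmult_indicator emeasure_pmf_single mult.commute del: pmf_poisson)
  show "(\<integral>\<omega>. (Z (X \<omega> \<inter> W))\<^sup>2 \<partial>M) \<le> c ^ k / fact k * t + K\<^sup>2 * \<mu> ^ Suc k" if t: "T \<le> ennreal t" "t \<ge> 0"
  proof -
    have "(\<integral>\<^sup>+j. q j \<partial>measure_pmf ?p) \<le> (\<integral>\<^sup>+j. q k * indicator {k} j + ennreal (K\<^sup>2) * indicator {Suc k..} j \<partial>measure_pmf ?p)"
    proof (rule nn_integral_mono)
      fix j show "q j \<le> q k * indicator {k} j + ennreal (K\<^sup>2) * indicator {Suc k..} j"
        using q_small[of j] q_le[of j] by (cases j k rule: linorder_cases) auto
    qed
    also have "\<dots> = ennreal (pmf ?p k) * q k + ennreal (K\<^sup>2) * emeasure (measure_pmf ?p) {Suc k..}"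
      by (subst nn_integral_add) (auto simp: at_k nn_integral_cmult_indicator simp del: pmf_poisson)
    also have "\<dots> \<le> ennreal (c ^ k / fact k) * ennreal t + ennreal (K\<^sup>2) * ennreal (\<mu> ^ Suc k)"
      unfolding Tq
    proof (intro add_mono mult_mono tail t)
      show "ennreal (exp (- \<mu>) * (c ^ k / fact k)) \<le> ennreal (c ^ k / fact k)"
        using \<mu> c_pos by (intro ennreal_leI mult_left_le_one_le) auto
    qed auto
    also have "\<dots> = ennreal (c ^ k / fact k * t + K\<^sup>2 * \<mu> ^ Suc k)"
      using t c_pos \<mu> by (simp add: ennreal_mult[symmetric] ennreal_plus[symmetric] del: ennreal_plus power_Suc)
    finally have "ennreal (\<integral>\<omega>. (Z (X \<omega> \<inter> W))\<^sup>2 \<partial>M) \<le> ennreal (c ^ k / fact k * t + K\<^sup>2 * \<mu> ^ Suc k)" unfolding E .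
    then show ?thesis using t c_pos \<mu> by (subst (asm) ennreal_le_iff) (auto intro!: add_nonneg_nonneg mult_nonneg_nonneg)
  qed
  show "(\<integral>\<omega>. (Z (X \<omega> \<inter> W))\<^sup>2 \<partial>M) \<ge> exp (- \<mu>) * (c ^ k / fact k * t)" if t: "T \<ge> ennreal t" "t \<ge> 0"
  proof -
    have "ennreal (exp (- \<mu>) * (c ^ k / fact k * t)) = ennreal (exp (- \<mu>) * (c ^ k / fact k)) * ennreal t"
      using t c_pos by (simp add: ennreal_mult[symmetric] mult.assoc)
    also have "\<dots> \<le> ennreal (pmf ?p k) * q k" unfolding Tq by (intro mult_left_mono t) auto
    also have "\<dots> \<le> (\<integral>\<^sup>+j. q j \<partial>measure_pmf ?p)"
      unfolding at_k[symmetric] by (intro nn_integral_mono) (auto simp: indicator_def)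
    also have "\<dots> = ennreal (\<integral>\<omega>. (Z (X \<omega> \<inter> W))\<^sup>2 \<partial>M)" by (rule E[symmetric])
    finally show ?thesis by (subst (asm) ennreal_le_iff) auto
  qed
  have abs_int: "integrable M (\<lambda>\<omega>. \<bar>Z (X \<omega> \<inter> W)\<bar>)"
    using bound fin by (intro integrable_const_bound[of _ K]) auto
  have "ennreal (\<integral>\<omega>. \<bar>Z (X \<omega> \<inter> W)\<bar> \<partial>M) = (\<integral>\<^sup>+j. (\<integral>\<^sup>+Y. ennreal \<bar>Z Y\<bar> \<partial>binom_law W j) \<partial>measure_pmf ?p)"
    unfolding \<mu>_def nn_integral_eq_integral[OF abs_int, simplified, symmetric]
    by (rule nn_integral_restrict[OF W]) measurable
  also have "\<dots> \<le> (\<integral>\<^sup>+j. ennreal K * indicator {k..} j \<partial>measure_pmf ?p)"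
  proof (rule nn_integral_mono)
    fix j
    interpret B: prob_space "binom_law W j" by (rule prob_space_binom_law)
    show "(\<integral>\<^sup>+Y. ennreal \<bar>Z Y\<bar> \<partial>binom_law W j) \<le> ennreal K * indicator {k..} j"
    proof (cases "j < k")
      case True
      have "(\<integral>\<^sup>+Y. ennreal \<bar>Z Y\<bar> \<partial>binom_law W j) = (\<integral>\<^sup>+x. ennreal \<bar>Z (x ` {..<j})\<bar> \<partial>PiM {..<j} (\<lambda>_. uniform_measure lborel W))"
        by (rule nn_integral_binom_law) measurable
      also have "\<dots> = 0" using zero[OF card_le(1) le_less_trans[OF card_le(2) True]] by simp
      finally show ?thesis by simp
    next
      case False
      have "(\<integral>\<^sup>+Y. ennreal \<bar>Z Y\<bar> \<partial>binom_law W j) \<le> (\<integral>\<^sup>+Y. ennreal K \<partial>binom_law W j)"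
        using bound by (intro nn_integral_mono ennreal_leI) auto
      then show ?thesis using False by (simp add: B.emeasure_space_1[unfolded space_binom_law])
    qed
  qed
  also have "\<dots> = ennreal K * emeasure (measure_pmf ?p) {k..}" by (rule nn_integral_cmult_indicator) auto
  also have "\<dots> \<le> ennreal K * ennreal (\<mu> ^ k)" by (intro mult_left_mono tail) auto
  also have "\<dots> = ennreal (K * \<mu> ^ k)" using K \<mu> by (simp add: ennreal_mult)
  finally have "(\<integral>\<omega>. \<bar>Z (X \<omega> \<inter> W)\<bar> \<partial>M) \<le> K * \<mu> ^ k" using K \<mu> by (subst (asm) ennreal_le_iff) auto
  then show "\<bar>\<integral>\<omega>. Z (X \<omega> \<inter> W) \<partial>M\<bar> \<le> K * \<mu> ^ k"
    using integral_abs_bound[of M "\<lambda>\<omega>. Z (X \<omega> \<inter> W)"] by linarith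
qed



section \<open>Partition of the unit cube into cells\<close>

text \<open>The minimum puts the right end point of the unit interval into the last cell, so that the cells
  partition the closed cube.\<close>

definition idx :: "nat \<Rightarrow> real \<Rightarrow> int" where
  "idx J a = min \<lfloor>real J * a\<rfloor> (int J - 1)"

definition cells :: "nat \<Rightarrow> ('d::finite \<Rightarrow> int) set" where
  "cells J = PiE UNIV (\<lambda>_. {0..<int J})"

definition cell :: "nat \<Rightarrow> ('d::finite \<Rightarrow> int) \<Rightarrow> (real ^ 'd) set" where
  "cell J z = {x \<in> unit_cube. \<forall>i. idx J (x $ i) = z i}"

definition nbhd :: "nat \<Rightarrow> ('d::finite \<Rightarrow> int) \<Rightarrow> (real ^ 'd) set" where
  "nbhd J z = {x \<in> unit_cube. \<forall>i. \<bar>idx J (x $ i) - z i\<bar> \<le> 1}"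

definition padded_box :: "nat \<Rightarrow> ('d::finite \<Rightarrow> int) \<Rightarrow> real \<Rightarrow> (real ^ 'd) set" where
  "padded_box J z \<delta> = cbox (\<chi> i. of_int (z i) / real J - \<delta>) (\<chi> i. (of_int (z i) + 1) / real J + \<delta>)"

lemma mem_padded_box:
  "x \<in> padded_box J z \<delta> \<longleftrightarrow> (\<forall>i. of_int (z i) / real J - \<delta> \<le> x $ i \<and> x $ i \<le> (of_int (z i) + 1) / real J + \<delta>)"
  by (auto simp: padded_box_def mem_box_cart)

lemma finite_cells: "finite (cells J)"
  unfolding cells_def by (rule finite_PiE) auto

lemma card_cells: "card (cells J :: ('d::finite \<Rightarrow> int) set) = J ^ CARD('d)"
  unfolding cells_def by (subst card_PiE) auto

lemma unit_cube_eq_cbox: "(unit_cube :: (real ^ 'd::finite) set) = cbox 0 1"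
  by (auto simp: unit_cube_def mem_box_cart)

lemma sets_unit_cube[measurable]: "(unit_cube :: (real ^ 'd::finite) set) \<in> sets borel"
  by (simp add: unit_cube_eq_cbox)

lemma emeasure_box_const:
  fixes l u :: "real ^ 'd::finite"
  assumes "\<And>i. u $ i - l $ i = c" "c \<ge> 0"
  shows "emeasure lborel (cbox l u) = ennreal (c ^ CARD('d))" "emeasure lborel (box l u) = ennreal (c ^ CARD('d))"
proof -
  have b: "(u - l) \<bullet> b = c" if "b \<in> Basis" for b
    using that assms(1) by (auto simp: Basis_vec_def inner_axis)
  have le: "\<forall>b\<in>Basis. l \<bullet> b \<le> u \<bullet> b"
  proof
    fix b :: "real ^ 'd" assume "b \<in> Basis"
    then have "u \<bullet> b - l \<bullet> b = c" using b by (simp add: inner_diff_left)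
    then show "l \<bullet> b \<le> u \<bullet> b" using assms(2) by linarith
  qed
  have "(\<Prod>b\<in>Basis. (u - l) \<bullet> b) = (\<Prod>b\<in>(Basis::(real^'d) set). c)" using b by (rule prod.cong[OF refl])
  then show "emeasure lborel (cbox l u) = ennreal (c ^ CARD('d))" "emeasure lborel (box l u) = ennreal (c ^ CARD('d))"
    using le by (simp_all add: emeasure_lborel_cbox_eq emeasure_lborel_box_eq)
qed

lemma emeasure_unit_cube: "emeasure lborel (unit_cube :: (real ^ 'd::finite) set) = 1"
  unfolding unit_cube_eq_cbox by (subst emeasure_box_const(1)[of _ _ 1]) auto

lemma emeasure_padded_box:
  assumes "1 / real J + 2 * \<delta> \<ge> 0"
  shows "emeasure lborel (padded_box J z \<delta> :: (real ^ 'd::finite) set) = ennreal ((1 / real J + 2 * \<delta>) ^ CARD('d))"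
  unfolding padded_box_def by (rule emeasure_box_const(1)[OF _ assms]) (simp add: add_divide_distrib)

lemma measurable_idx[measurable]: "idx J \<in> borel \<rightarrow>\<^sub>M count_space UNIV"
proof -
  have "(\<lambda>a. \<lfloor>real J * a\<rfloor>) \<in> borel \<rightarrow>\<^sub>M count_space UNIV"
    by (rule measurable_compose[OF _ measurable_real_floor]) measurable
  from measurable_compose[OF this, of "\<lambda>n. min n (int J - 1)"] show ?thesis
    unfolding idx_def by simp
qed

lemma measurable_idx_nth: "(\<lambda>x. idx J (x $ i)) \<in> (borel :: (real ^ 'd::finite) measure) \<rightarrow>\<^sub>M count_space UNIV"
  by (rule measurable_compose[OF _ measurable_idx]) (intro borel_measurable_continuous_onI continuous_intros)

lemma sets_idx: "{x :: real ^ 'd::finite. P (idx J (x $ i))} \<in> sets borel"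
  using measurable_sets[OF measurable_idx_nth[of J i], of "{n. P n}"] by (simp add: vimage_def)

lemma sets_cell[measurable]: "cell J z \<in> sets borel"
proof -
  have "cell J z = unit_cube \<inter> (\<Inter>i. {x. idx J (x $ i) = z i})" by (auto simp: cell_def)
  then show ?thesis using sets_idx[where P = "\<lambda>n. n = _"] by (auto intro!: sets.Int sets.finite_INT)
qed

lemma sets_nbhd[measurable]: "nbhd J z \<in> sets borel"
proof -
  have "nbhd J z = unit_cube \<inter> (\<Inter>i. {x. \<bar>idx J (x $ i) - z i\<bar> \<le> 1})" by (auto simp: nbhd_def)
  then show ?thesis using sets_idx[where P = "\<lambda>n. \<bar>n - _\<bar> \<le> 1"] by (auto intro!: sets.Int sets.finite_INT)
qed

context
  fixes J :: nat
  assumes J: "J > 0"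
begin

lemma idx_bounds:
  assumes "0 \<le> a" "a \<le> 1"
  shows "0 \<le> idx J a" "idx J a < int J" "of_int (idx J a) / real J \<le> a" "a \<le> (of_int (idx J a) + 1) / real J"
proof -
  have "0 \<le> real J * a" using assms by simp
  then show "0 \<le> idx J a" using J by (simp add: idx_def)
  show "idx J a < int J" by (simp add: idx_def)
  have "of_int (idx J a) \<le> real J * a" unfolding idx_def by (meson min.cobounded1 of_int_floor_le of_int_le_iff order.trans)
  then show "of_int (idx J a) / real J \<le> a" using J by (simp add: field_simps)
  have "real J * a \<le> of_int (idx J a) + 1"
  proof (cases "\<lfloor>real J * a\<rfloor> \<le> int J - 1")
    case True
    then show ?thesis by (simp add: idx_def less_imp_le)
  next
    case False
    then have "idx J a = int J - 1" by (simp add: idx_def)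
    moreover have "real J * a \<le> real J" using assms by (simp add: mult_left_le)
    ultimately show ?thesis by simp
  qed
  then show "a \<le> (of_int (idx J a) + 1) / real J" using J by (simp add: field_simps)
qed

lemma idx_eqI:
  assumes "0 \<le> n" "n < int J" "of_int n / real J \<le> a" "a < (of_int n + 1) / real J"
  shows "idx J a = n"
proof -
  have "of_int n \<le> real J * a" "real J * a < of_int n + 1" using assms J by (simp_all add: field_simps)
  then have "\<lfloor>real J * a\<rfloor> = n" by (simp add: floor_unique)
  then show ?thesis using assms by (simp add: idx_def)
qed

lemma idx_lipschitz:
  assumes "\<bar>a - b\<bar> \<le> 1 / real J"
  shows "\<bar>idx J a - idx J b\<bar> \<le> 1"
proof -
  have "\<bar>real J * (a - b)\<bar> = real J * \<bar>a - b\<bar>" by (simp add: abs_mult)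
  also have "\<dots> \<le> 1" using assms J by (simp add: field_simps)
  finally have "\<bar>real J * a - real J * b\<bar> \<le> 1" by (simp only: right_diff_distrib)
  then have "\<bar>\<lfloor>real J * a\<rfloor> - \<lfloor>real J * b\<rfloor>\<bar> \<le> 1" by linarith
  then show ?thesis unfolding idx_def by linarith
qed

lemma ex_cell: "x \<in> unit_cube \<Longrightarrow> \<exists>z\<in>cells J. x \<in> cell J z"
  using idx_bounds by (intro bexI[of _ "\<lambda>i. idx J (x $ i)"]) (auto simp: cell_def cells_def unit_cube_def)

lemma cell_disjoint: "x \<in> cell J z \<Longrightarrow> x \<in> cell J z' \<Longrightarrow> z = z'"
  by (auto simp: cell_def)

lemma cell_subset_cube: "cell J z \<subseteq> unit_cube" and nbhd_subset_cube: "nbhd J z \<subseteq> unit_cube"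
  and cell_subset_nbhd: "cell J z \<subseteq> nbhd J z"
  by (auto simp: cell_def nbhd_def)

lemma cell_subset_padded_box:
  assumes "\<delta> \<ge> 0" shows "cell J z \<subseteq> padded_box J z \<delta>"
proof
  fix x assume x: "x \<in> cell J z"
  show "x \<in> padded_box J z \<delta>"
    unfolding mem_padded_box
  proof
    fix i
    have "0 \<le> x $ i" "x $ i \<le> 1" "idx J (x $ i) = z i" using x by (auto simp: cell_def unit_cube_def)
    with idx_bounds(3,4)[of "x $ i"] assms
    show "of_int (z i) / real J - \<delta> \<le> x $ i \<and> x $ i \<le> (of_int (z i) + 1) / real J + \<delta>" by simp
  qed
qed

lemma in_cellI:
  assumes z: "z \<in> cells J" and x: "\<And>i. of_int (z i) / real J \<le> x $ i" "\<And>i. x $ i < (of_int (z i) + 1) / real J"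
  shows "x \<in> cell J z"
proof -
  have z: "0 \<le> z i" "z i < int J" for i using z by (auto simp: cells_def PiE_iff)
  have "x \<in> unit_cube"
    unfolding unit_cube_def
  proof (safe)
    fix i
    have "0 \<le> of_int (z i) / real J" using z[of i] by simp
    then show "0 \<le> x $ i" using x(1)[of i] by linarith
    have "(of_int (z i) + 1) / real J \<le> 1" using z[of i] J by (simp add: field_simps)
    then show "x $ i \<le> 1" using x(2)[of i] by linarith
  qed
  then show ?thesis using idx_eqI[OF z] x by (simp add: cell_def)
qed

lemma near_padded_box:
  assumes "norm (x - y) \<le> \<epsilon>" "x \<in> padded_box J z \<delta>"
  shows "y \<in> padded_box J z (\<delta> + \<epsilon>)"
  unfolding mem_padded_box
proof
  fix i
  have "\<bar>x $ i - y $ i\<bar> \<le> \<epsilon>" using component_le_norm_cart[of "x - y" i] assms(1) by simp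
  then show "of_int (z i) / real J - (\<delta> + \<epsilon>) \<le> y $ i \<and> y $ i \<le> (of_int (z i) + 1) / real J + (\<delta> + \<epsilon>)"
    using assms(2)[unfolded mem_padded_box, rule_format, of i] by linarith
qed

lemma padded_box_subset_cell:
  assumes "z \<in> cells J" "\<delta> < 0" shows "padded_box J z \<delta> \<subseteq> cell J z"
proof
  fix x assume "x \<in> padded_box J z \<delta>"
  then have "of_int (z i) / real J - \<delta> \<le> x $ i \<and> x $ i \<le> (of_int (z i) + 1) / real J + \<delta>" for i by (simp add: mem_padded_box)
  then show "x \<in> cell J z" using assms by (intro in_cellI) (smt (verit))+
qed

lemma near_cell_in_nbhd:
  assumes "x \<in> cell J z" "y \<in> unit_cube" "norm (x - y) \<le> 1 / real J"
  shows "y \<in> nbhd J z"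
proof -
  have "\<bar>idx J (y $ i) - z i\<bar> \<le> 1" for i
  proof -
    have "\<bar>y $ i - x $ i\<bar> \<le> 1 / real J" using component_le_norm_cart[of "x - y" i] assms(3) by simp
    then show ?thesis using idx_lipschitz[of "y $ i" "x $ i"] assms(1) by (auto simp: cell_def)
  qed
  then show ?thesis using assms(2) by (simp add: nbhd_def)
qed

lemma nbhd_subset_padded_box: "nbhd J z \<subseteq> padded_box J z (1 / real J)"
proof
  fix x assume x: "x \<in> nbhd J z"
  show "x \<in> padded_box J z (1 / real J)"
    unfolding mem_padded_box
  proof
    fix i
    have *: "0 \<le> x $ i" "x $ i \<le> 1" "\<bar>idx J (x $ i) - z i\<bar> \<le> 1" using x by (auto simp: nbhd_def unit_cube_def)
    then have "real_of_int (z i) - 1 \<le> of_int (idx J (x $ i))" "real_of_int (idx J (x $ i)) \<le> of_int (z i) + 1" by linarith+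
    then have "(real_of_int (z i) - 1) / real J \<le> of_int (idx J (x $ i)) / real J" 
      "(real_of_int (idx J (x $ i)) + 1) / real J \<le> (of_int (z i) + 1 + 1) / real J" by (intro divide_right_mono; simp)+
    with idx_bounds(3,4)[OF *(1,2)] 
    show "of_int (z i) / real J - 1 / real J \<le> x $ i \<and> x $ i \<le> (of_int (z i) + 1) / real J + 1 / real J" 
      unfolding diff_divide_distrib add_divide_distrib by linarith
  qed
qed

lemma emeasure_cell:
  fixes z :: "'d::finite \<Rightarrow> int"
  assumes "z \<in> cells J" shows "emeasure lborel (cell J z) = ennreal ((1 / real J) ^ CARD('d))"
proof (rule antisym)
  have "emeasure lborel (cell J z) \<le> emeasure lborel (padded_box J z 0 :: (real^'d) set)"
    by (intro emeasure_mono cell_subset_padded_box) (auto simp: padded_box_def)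
  then show "emeasure lborel (cell J z) \<le> ennreal ((1 / real J) ^ CARD('d))"
    using emeasure_padded_box[of J 0 z] by simp
  let ?l = "(\<chi> i. of_int (z i) / real J) :: real^'d" and ?u = "(\<chi> i. (of_int (z i) + 1) / real J) :: real^'d"
  have "box ?l ?u \<subseteq> cell J z"
    by (intro subsetI in_cellI[OF assms]) (auto simp: mem_box_cart less_imp_le)
  then have "emeasure lborel (box ?l ?u) \<le> emeasure lborel (cell J z)" by (intro emeasure_mono) auto
  then show "ennreal ((1 / real J) ^ CARD('d)) \<le> emeasure lborel (cell J z)"
    using emeasure_box_const(2)[of ?u ?l "1 / real J"] by (simp add: add_divide_distrib)
qed

lemma emeasure_nbhd_le: "emeasure lborel (nbhd J z :: (real ^ 'd::finite) set) \<le> ennreal ((3 / real J) ^ CARD('d))"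
proof -
  have "emeasure lborel (nbhd J z) \<le> emeasure lborel (padded_box J z (1 / real J) :: (real^'d) set)"
    by (intro emeasure_mono nbhd_subset_padded_box) (auto simp: padded_box_def)
  then show ?thesis using emeasure_padded_box[of J "1 / real J" z] by simp
qed

lemma window_cell: "z \<in> cells J \<Longrightarrow> window (cell J z)"
  by standard (use J in \<open>simp_all add: emeasure_cell measure_def\<close>)

lemma window_nbhd:
  fixes z :: "'d::finite \<Rightarrow> int"
  assumes "z \<in> cells J" shows "window (nbhd J z)"
proof
  show "nbhd J z \<in> sets borel" by (rule sets_nbhd)
  show fin: "emeasure lborel (nbhd J z) \<noteq> \<infinity>"
    using emeasure_nbhd_le[of z] by (auto simp: top_unique)
  have "emeasure lborel (cell J z) \<le> emeasure lborel (nbhd J z)"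
    by (intro emeasure_mono cell_subset_nbhd) auto
  moreover have "0 < emeasure lborel (cell J z)" using emeasure_cell[OF assms] J by simp
  ultimately have "emeasure lborel (nbhd J z) > 0" by (rule less_le_trans[rotated])
  then show "measure lborel (nbhd J z) > 0" using fin
    by (simp add: measure_def enn2real_positive_iff top.not_eq_extremum)
qed

lemma measure_cell: "z \<in> cells J \<Longrightarrow> measure lborel (cell J z :: (real ^ 'd::finite) set) = (1 / real J) ^ CARD('d)"
  by (simp add: measure_def emeasure_cell)

lemma measure_nbhd_le: "measure lborel (nbhd J z :: (real ^ 'd::finite) set) \<le> (3 / real J) ^ CARD('d)"
  unfolding measure_def by (rule enn2real_leI[OF _ emeasure_nbhd_le]) simp

text \<open>Neighbourhoods of cells whose indices agree modulo 3 are disjoint.\<close>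

lemma nbhd_disjoint:
  assumes "z \<noteq> z'" "\<forall>i. z i mod 3 = z' i mod 3"
  shows "nbhd J z \<inter> nbhd J z' = {}"
proof (rule ccontr)
  assume "nbhd J z \<inter> nbhd J z' \<noteq> {}"
  then obtain x where x: "x \<in> nbhd J z" "x \<in> nbhd J z'" by auto
  obtain i where i: "z i \<noteq> z' i" using assms(1) by blast
  have "\<bar>idx J (x $ i) - z i\<bar> \<le> 1" "\<bar>idx J (x $ i) - z' i\<bar> \<le> 1" using x by (auto simp: nbhd_def)
  then have "\<bar>z i - z' i\<bar> \<le> 2" by linarith
  moreover have "z i mod 3 = z' i mod 3" using assms(2) by blast
  ultimately show False using i by presburger
qed

lemma cell_subset_cball:
  "cell J z \<subseteq> cball (\<chi> i. of_int (z i) / real J) (real CARD('d) / real J)" for z :: "'d::finite \<Rightarrow> int"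
proof
  fix x assume "x \<in> cell J z"
  then have x: "of_int (z i) / real J \<le> x $ i \<and> x $ i \<le> (of_int (z i) + 1) / real J" for i
    using cell_subset_padded_box[of 0 z] by (auto simp: mem_padded_box)
  have "norm ((\<chi> i. of_int (z i) / real J) - x) \<le> (\<Sum>i\<in>UNIV. \<bar>((\<chi> i. of_int (z i) / real J) - x) $ i\<bar>)"
    by (rule norm_le_l1_cart)
  also have "\<dots> \<le> (\<Sum>i::'d\<in>UNIV. 1 / real J)"
  proof (rule sum_mono)
    fix i
    show "\<bar>((\<chi> i. of_int (z i) / real J) - x) $ i\<bar> \<le> 1 / real J"
      using x[of i] unfolding add_divide_distrib vector_minus_component vec_lambda_beta by linarith
  qed
  finally show "x \<in> cball (\<chi> i. of_int (z i) / real J) (real CARD('d) / real J)" by (simp add: dist_norm)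
qed

end



section \<open>Moment generating functions of sums of bounded independent variables\<close>

lemma exp_second_order:
  fixes u b :: real
  assumes "\<bar>u\<bar> \<le> b"
  shows "exp u \<le> 1 + u + u\<^sup>2 / 2 * exp b" "exp u \<ge> 1 + u + u\<^sup>2 / 2 * exp (- b)"
proof -
  obtain s where s: "\<bar>s\<bar> \<le> \<bar>u\<bar>" "exp u = (\<Sum>m<2. u ^ m / fact m) + exp s / fact 2 * u ^ 2"
    using Maclaurin_exp_le[of u 2] by blast
  have eq: "exp u = 1 + u + u\<^sup>2 / 2 * exp s" using s(2) by (simp add: numeral_2_eq_2)
  show "exp u \<le> 1 + u + u\<^sup>2 / 2 * exp b"
    unfolding eq using s(1) assms by (intro add_left_mono mult_left_mono) auto
  show "exp u \<ge> 1 + u + u\<^sup>2 / 2 * exp (- b)"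
    unfolding eq using s(1) assms by (intro add_left_mono mult_left_mono) auto
qed

text \<open>A substitute for \<open>1 + x \<ge> exp x\<close> in lower bounds, nearly sharp for small \<open>x\<close>.\<close>

lemma one_plus_ge_exp:
  fixes x y :: real
  assumes "0 \<le> x" "x \<le> y"
  shows "exp (x / (1 + y)) \<le> 1 + x"
proof -
  have "x / (1 + y) \<le> x / (1 + x)" using assms by (intro divide_left_mono) auto
  moreover have "1 - exp (- (x / (1 + x))) \<le> x / (1 + x)" using exp_ge_add_one_self[of "- (x / (1 + x))"] by linarith
  then have "1 / (1 + x) \<le> exp (- (x / (1 + x)))" using assms by (simp add: field_simps)
  then have "exp (x / (1 + x)) \<le> 1 + x" using assms by (simp add: exp_minus field_simps)
  ultimately show ?thesis by (meson exp_le_cancel_iff order.trans)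
qed

context prob_space
begin

context
  fixes Z :: "'a \<Rightarrow> real" and K l :: real
  assumes Z[measurable]: "Z \<in> borel_measurable M" and bound: "\<And>\<omega>. \<omega> \<in> space M \<Longrightarrow> \<bar>Z \<omega>\<bar> \<le> K"
begin

lemma bounded_integrable: "integrable M Z"
  using bound by (intro integrable_const_bound[of _ K]) auto

lemma bounded_sq_integrable: "integrable M (\<lambda>\<omega>. (Z \<omega>)\<^sup>2)"
proof (rule integrable_const_bound[of _ "K\<^sup>2"])
  show "AE x in M. norm ((Z x)\<^sup>2) \<le> K\<^sup>2"
    using bound by (intro AE_I2) (metis abs_ge_zero norm_power power_mono real_norm_def)
qed simp

lemma bounded_expectation: "\<bar>expectation Z\<bar> \<le> K"
proof -
  have "\<bar>expectation Z\<bar> \<le> expectation (\<lambda>\<omega>. \<bar>Z \<omega>\<bar>)" by (rule integral_abs_bound)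
  also have "\<dots> \<le> expectation (\<lambda>\<omega>. K)" using bounded_integrable bound by (intro integral_mono) auto
  finally show ?thesis by (simp add: prob_space)
qed

lemma centered_bound: "\<omega> \<in> space M \<Longrightarrow> \<bar>Z \<omega> - expectation Z\<bar> \<le> 2 * K"
  using bound[of \<omega>] bounded_expectation by linarith

lemma centered_sq: "expectation (\<lambda>\<omega>. (Z \<omega> - expectation Z)\<^sup>2) = expectation (\<lambda>\<omega>. (Z \<omega>)\<^sup>2) - (expectation Z)\<^sup>2"
  using variance_eq[OF bounded_integrable bounded_sq_integrable] .

lemma centered_exp_integrable: "integrable M (\<lambda>\<omega>. exp (l * (Z \<omega> - expectation Z)))"
proof (rule integrable_const_bound[of _ "exp (\<bar>l\<bar> * (2 * K))"])
  show "AE \<omega> in M. norm (exp (l * (Z \<omega> - expectation Z))) \<le> exp (\<bar>l\<bar> * (2 * K))"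
  proof (rule AE_I2)
    fix \<omega> assume "\<omega> \<in> space M"
    then have "\<bar>l\<bar> * \<bar>Z \<omega> - expectation Z\<bar> \<le> \<bar>l\<bar> * (2 * K)" by (intro mult_left_mono centered_bound) auto
    then show "norm (exp (l * (Z \<omega> - expectation Z))) \<le> exp (\<bar>l\<bar> * (2 * K))" by (simp flip: abs_mult)
  qed
qed simp

lemma centered_sq_integrable: "integrable M (\<lambda>\<omega>. (Z \<omega> - expectation Z)\<^sup>2)"
proof (rule integrable_const_bound[of _ "(2 * K)\<^sup>2"])
  show "AE x in M. norm ((Z x - expectation Z)\<^sup>2) \<le> (2 * K)\<^sup>2"
    using centered_bound by (intro AE_I2) (metis abs_ge_zero norm_power power_mono real_norm_def)
qed simp

lemma quadratic_expectation:
  "expectation (\<lambda>\<omega>. 1 + l * (Z \<omega> - expectation Z) + (l * (Z \<omega> - expectation Z))\<^sup>2 / 2 * a)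
    = 1 + l\<^sup>2 / 2 * a * (expectation (\<lambda>\<omega>. (Z \<omega>)\<^sup>2) - (expectation Z)\<^sup>2)"
  "integrable M (\<lambda>\<omega>. 1 + l * (Z \<omega> - expectation Z) + (l * (Z \<omega> - expectation Z))\<^sup>2 / 2 * a)"
proof -
  have i1: "integrable M (\<lambda>\<omega>. Z \<omega> - expectation Z)" using bounded_integrable by simp
  have eq: "(\<lambda>\<omega>. 1 + l * (Z \<omega> - expectation Z) + (l * (Z \<omega> - expectation Z))\<^sup>2 / 2 * a)
     = (\<lambda>\<omega>. 1 + l * (Z \<omega> - expectation Z) + (l\<^sup>2 / 2 * a) * (Z \<omega> - expectation Z)\<^sup>2)"
    by (simp add: power_mult_distrib fun_eq_iff)
  have z: "expectation (\<lambda>\<omega>. Z \<omega> - expectation Z) = 0" using bounded_integrable by (simp add: prob_space)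
  show "expectation (\<lambda>\<omega>. 1 + l * (Z \<omega> - expectation Z) + (l * (Z \<omega> - expectation Z))\<^sup>2 / 2 * a)
    = 1 + l\<^sup>2 / 2 * a * (expectation (\<lambda>\<omega>. (Z \<omega>)\<^sup>2) - (expectation Z)\<^sup>2)"
    unfolding eq centered_sq[symmetric] using i1 centered_sq_integrable z
    by (simp add: prob_space del: Bochner_Integration.integral_diff)
  show "integrable M (\<lambda>\<omega>. 1 + l * (Z \<omega> - expectation Z) + (l * (Z \<omega> - expectation Z))\<^sup>2 / 2 * a)"
    unfolding eq using i1 centered_sq_integrable by simp
qed

lemma scaled_centered_bound: "\<omega> \<in> space M \<Longrightarrow> \<bar>l * (Z \<omega> - expectation Z)\<bar> \<le> 2 * K * \<bar>l\<bar>"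
  using mult_left_mono[OF centered_bound[of \<omega>], of "\<bar>l\<bar>"] by (simp add: abs_mult mult_ac)

lemma mgf_bounded_upper:
  "expectation (\<lambda>\<omega>. exp (l * (Z \<omega> - expectation Z))) \<le> exp (l\<^sup>2 / 2 * exp (2 * K * \<bar>l\<bar>) * expectation (\<lambda>\<omega>. (Z \<omega>)\<^sup>2))"
proof -
  have "expectation (\<lambda>\<omega>. exp (l * (Z \<omega> - expectation Z))) 
    \<le> expectation (\<lambda>\<omega>. 1 + l * (Z \<omega> - expectation Z) + (l * (Z \<omega> - expectation Z))\<^sup>2 / 2 * exp (2 * K * \<bar>l\<bar>))"
    by (intro integral_mono centered_exp_integrable quadratic_expectation exp_second_order scaled_centered_bound)
  also have "\<dots> \<le> 1 + l\<^sup>2 / 2 * exp (2 * K * \<bar>l\<bar>) * expectation (\<lambda>\<omega>. (Z \<omega>)\<^sup>2)"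
    unfolding quadratic_expectation by (intro add_left_mono mult_left_mono) auto
  also have "\<dots> \<le> exp (l\<^sup>2 / 2 * exp (2 * K * \<bar>l\<bar>) * expectation (\<lambda>\<omega>. (Z \<omega>)\<^sup>2))" by (rule exp_ge_add_one_self)
  finally show ?thesis .
qed

lemma mgf_bounded_lower:
  "exp (l\<^sup>2 / 2 * exp (- (2 * K * \<bar>l\<bar>)) * (expectation (\<lambda>\<omega>. (Z \<omega>)\<^sup>2) - (expectation Z)\<^sup>2) / (1 + l\<^sup>2 * K\<^sup>2))
    \<le> expectation (\<lambda>\<omega>. exp (l * (Z \<omega> - expectation Z)))"
proof -
  obtain \<omega>0 where \<omega>0: "\<omega>0 \<in> space M" using not_empty by blast
  have K: "K \<ge> 0" using bound[OF \<omega>0] by linarith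
  let ?v = "expectation (\<lambda>\<omega>. (Z \<omega>)\<^sup>2) - (expectation Z)\<^sup>2"
  let ?x = "l\<^sup>2 / 2 * exp (- (2 * K * \<bar>l\<bar>)) * ?v"
  have v0: "0 \<le> ?v" unfolding centered_sq[symmetric] by simp
  have "expectation (\<lambda>\<omega>. (Z \<omega>)\<^sup>2) \<le> expectation (\<lambda>\<omega>. K\<^sup>2)"
    using bound K by (intro integral_mono bounded_sq_integrable) (auto simp: abs_le_square_iff[symmetric])
  then have vK: "?v \<le> K\<^sup>2" by (simp add: prob_space) (smt (verit) zero_le_power2)
  have "?x \<le> l\<^sup>2 * 1 * K\<^sup>2"
    using v0 vK K by (intro mult_mono) auto
  then have "exp (?x / (1 + l\<^sup>2 * K\<^sup>2)) \<le> 1 + ?x" using v0 by (intro one_plus_ge_exp) auto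
  also have "\<dots> = expectation (\<lambda>\<omega>. 1 + l * (Z \<omega> - expectation Z) + (l * (Z \<omega> - expectation Z))\<^sup>2 / 2 * exp (- (2 * K * \<bar>l\<bar>)))"
    unfolding quadratic_expectation ..
  also have "\<dots> \<le> expectation (\<lambda>\<omega>. exp (l * (Z \<omega> - expectation Z)))"
    by (intro integral_mono centered_exp_integrable quadratic_expectation exp_second_order scaled_centered_bound)
  finally show ?thesis .
qed

end

text \<open>For bounded summands and a small parameter \<open>l\<close>, the moment generating function of a centred sum is
  \<open>exp (l\<^sup>2 / 2 * V)\<close>, \<open>V\<close> being the variance, up to factors in the exponent that
  tend to 1 as \<open>l\<close> tends to 0. In the upper bound the second moments stand in for the variances.\<close>

lemma
  fixes Z :: "'i \<Rightarrow> 'a \<Rightarrow> real"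
  assumes fin: "finite I" and ind: "indep_vars (\<lambda>_. borel) Z I"
    and bound: "\<And>i \<omega>. i \<in> I \<Longrightarrow> \<omega> \<in> space M \<Longrightarrow> \<bar>Z i \<omega>\<bar> \<le> K"
  shows mgf_indep_upper: "expectation (\<lambda>\<omega>. exp (l * (\<Sum>i\<in>I. Z i \<omega> - expectation (Z i))))
      \<le> exp (l\<^sup>2 / 2 * exp (2 * K * \<bar>l\<bar>) * (\<Sum>i\<in>I. expectation (\<lambda>\<omega>. (Z i \<omega>)\<^sup>2)))"
    and mgf_indep_lower: "exp (l\<^sup>2 / 2 * exp (- (2 * K * \<bar>l\<bar>)) * (\<Sum>i\<in>I. expectation (\<lambda>\<omega>. (Z i \<omega>)\<^sup>2) - (expectation (Z i))\<^sup>2) / (1 + l\<^sup>2 * K\<^sup>2))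
      \<le> expectation (\<lambda>\<omega>. exp (l * (\<Sum>i\<in>I. Z i \<omega> - expectation (Z i))))"
    and mgf_indep_integrable: "integrable M (\<lambda>\<omega>. exp (l * (\<Sum>i\<in>I. Z i \<omega> - expectation (Z i))))"
proof -
  have meas: "Z i \<in> borel_measurable M" if "i \<in> I" for i using ind that by (auto simp: indep_vars_def)
  let ?f = "\<lambda>i \<omega>. exp (l * (Z i \<omega> - expectation (Z i)))"
  have ind': "indep_vars (\<lambda>_. borel) ?f I"
    by (rule indep_vars_compose2[OF ind, of "\<lambda>i z. exp (l * (z - expectation (Z i)))"]) simp
  have eq: "(\<lambda>\<omega>. exp (l * (\<Sum>i\<in>I. Z i \<omega> - expectation (Z i)))) = (\<lambda>\<omega>. \<Prod>i\<in>I. ?f i \<omega>)"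
    using fin by (simp add: sum_distrib_left exp_sum)
  have int: "integrable M (?f i)" if "i \<in> I" for i using that by (intro centered_exp_integrable[OF meas bound])
  have E: "expectation (\<lambda>\<omega>. exp (l * (\<Sum>i\<in>I. Z i \<omega> - expectation (Z i)))) = (\<Prod>i\<in>I. expectation (?f i))"
    unfolding eq by (rule indep_vars_lebesgue_integral[OF fin ind' int])
  show "integrable M (\<lambda>\<omega>. exp (l * (\<Sum>i\<in>I. Z i \<omega> - expectation (Z i))))"
    unfolding eq by (rule indep_vars_integrable[OF fin ind' int])
  have "(\<Prod>i\<in>I. expectation (?f i)) \<le> (\<Prod>i\<in>I. exp (l\<^sup>2 / 2 * exp (2 * K * \<bar>l\<bar>) * expectation (\<lambda>\<omega>. (Z i \<omega>)\<^sup>2)))"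
    by (intro prod_mono conjI mgf_bounded_upper[OF meas bound] integral_nonneg) auto
  also have "\<dots> = exp (l\<^sup>2 / 2 * exp (2 * K * \<bar>l\<bar>) * (\<Sum>i\<in>I. expectation (\<lambda>\<omega>. (Z i \<omega>)\<^sup>2)))"
    using fin by (simp add: sum_distrib_left exp_sum)
  finally show "expectation (\<lambda>\<omega>. exp (l * (\<Sum>i\<in>I. Z i \<omega> - expectation (Z i))))
      \<le> exp (l\<^sup>2 / 2 * exp (2 * K * \<bar>l\<bar>) * (\<Sum>i\<in>I. expectation (\<lambda>\<omega>. (Z i \<omega>)\<^sup>2)))" unfolding E .
  have "exp (l\<^sup>2 / 2 * exp (- (2 * K * \<bar>l\<bar>)) * (\<Sum>i\<in>I. expectation (\<lambda>\<omega>. (Z i \<omega>)\<^sup>2) - (expectation (Z i))\<^sup>2) / (1 + l\<^sup>2 * K\<^sup>2))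
    = (\<Prod>i\<in>I. exp (l\<^sup>2 / 2 * exp (- (2 * K * \<bar>l\<bar>)) * (expectation (\<lambda>\<omega>. (Z i \<omega>)\<^sup>2) - (expectation (Z i))\<^sup>2) / (1 + l\<^sup>2 * K\<^sup>2)))"
    using fin by (simp only: sum_distrib_left sum_divide_distrib exp_sum)
  also have "\<dots> \<le> (\<Prod>i\<in>I. expectation (?f i))"
    by (intro prod_mono conjI mgf_bounded_lower[OF meas bound]) auto
  finally show "exp (l\<^sup>2 / 2 * exp (- (2 * K * \<bar>l\<bar>)) * (\<Sum>i\<in>I. expectation (\<lambda>\<omega>. (Z i \<omega>)\<^sup>2) - (expectation (Z i))\<^sup>2) / (1 + l\<^sup>2 * K\<^sup>2))
      \<le> expectation (\<lambda>\<omega>. exp (l * (\<Sum>i\<in>I. Z i \<omega> - expectation (Z i))))" unfolding E .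
qed

end

section \<open>The component counts\<close>

locale shapes =
  fixes k :: nat and \<Gamma> :: "'m::finite \<Rightarrow> 'v pair_pre_digraph" and t :: "'m \<Rightarrow> real"
    and dim :: "(real ^ 'd::finite) itself"
  assumes k2: "k \<ge> 2" and t_pos: "\<And>i. t i > 0" and graph: "\<And>i. pair_graph (\<Gamma> i)"
    and vertices: "\<And>i. card (pverts (\<Gamma> i)) = k"
    and conn: "\<And>i. Digraph_Component.connected (with_proj (\<Gamma> i))"
begin

lemma k_pos: "k > 0" using k2 by simp

lemma connected_graph: "connected_graph (\<Gamma> i) k"
  by (intro connected_graph.intro graph vertices conn k_pos)

definition tm :: real where "tm = Max (range t)"

lemma t_le_tm: "t i \<le> tm" unfolding tm_def by (rule Max_ge) auto

lemma tm_pos: "tm > 0" using t_pos t_le_tm less_le_trans by blast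

text \<open>At scale 1, a cluster together with its exclusion zone has radius at most \<open>R\<close>.\<close>

definition R :: real where "R = (real k + 1) * tm"

lemma R_pos: "R > 0" using tm_pos by (simp add: R_def)

lemma diam_plus_le_R: "real k * tm + t i \<le> R" using t_le_tm[of i] by (simp add: R_def algebra_simps)

definition shape_at :: "'m \<Rightarrow> real \<Rightarrow> (real ^ 'd) set \<Rightarrow> real" where
  "shape_at i r Y = shape_ind (\<Gamma> i) (t i) ((\<lambda>x. inverse r *\<^sub>R x) ` Y)"

definition stat :: "real ^ 'm \<Rightarrow> real \<Rightarrow> (real ^ 'd) set \<Rightarrow> real" where
  "stat \<theta> r X = (\<Sum>i\<in>UNIV. \<theta> $ i * cluster_sum k (r * t i) (shape_at i r) X)"

text \<open>The share of a region \<open>c\<close>: every component counts with the fraction of its points in \<open>c\<close>.\<close>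

definition stat_share :: "real ^ 'm \<Rightarrow> real \<Rightarrow> (real ^ 'd) set \<Rightarrow> (real ^ 'd) set \<Rightarrow> real" where
  "stat_share \<theta> r c X =
     (\<Sum>i\<in>UNIV. \<theta> $ i * cluster_sum k (r * t i) (\<lambda>Y. shape_at i r Y * (real (card (Y \<inter> c)) / real k)) X)"

definition l1 :: "real ^ 'm \<Rightarrow> real" where "l1 \<theta> = (\<Sum>i\<in>UNIV. \<bar>\<theta> $ i\<bar>)"

lemma l1_nonneg: "l1 \<theta> \<ge> 0" by (simp add: l1_def sum_nonneg)

lemma inner_component_count: "\<theta> \<bullet> component_count k \<Gamma> t r X = stat \<theta> r X"
  by (simp add: stat_def component_count_def inner_vec_def cluster_sum_def isolated_def shape_at_def)

lemma shape_at_cases: "shape_at i r Y = 0 \<or> shape_at i r Y = 1"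
  unfolding shape_at_def by (rule connected_graph.shape_ind_cases[OF connected_graph])

lemma shape_at_abs: "\<bar>shape_at i r Y\<bar> \<le> 1" and shape_at_nonneg: "0 \<le> shape_at i r Y" and shape_at_le: "shape_at i r Y \<le> 1"
  using shape_at_cases[of i r Y] by auto

lemma shape_at_diam:
  assumes "r > 0" "shape_at i r Y \<noteq> 0" "u \<in> Y" "v \<in> Y"
  shows "norm (u - v) \<le> r * (real k * tm)"
proof -
  have "norm (inverse r *\<^sub>R u - inverse r *\<^sub>R v) \<le> real k * t i"
    using assms t_pos[of i] unfolding shape_at_def
    by (intro connected_graph.shape_diameter[OF connected_graph]) auto
  also have "\<dots> \<le> real k * tm" using t_le_tm by (intro mult_left_mono) auto
  also have "norm (inverse r *\<^sub>R u - inverse r *\<^sub>R v) = norm (u - v) / r"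
    using assms(1) by (simp add: scaleR_right_diff_distrib[symmetric] divide_inverse_commute del: scaleR_right_diff_distrib)
  finally show ?thesis using assms(1) by (simp add: field_simps)
qed

lemma measurable_shape_at:
  "(\<lambda>x. shape_at i r (x ` {..<k})) \<in> borel_measurable (PiM {..<k} (\<lambda>_. borel))"
proof -
  have "(\<lambda>x. \<lambda>j\<in>{..<k}. inverse r *\<^sub>R x j) \<in> PiM {..<k} (\<lambda>_. borel) \<rightarrow>\<^sub>M PiM {..<k} (\<lambda>_. borel :: (real^'d) measure)"
    by (rule measurable_restrict) auto
  from measurable_compose[OF this connected_graph.measurable_shape_ind[OF connected_graph[of i], of "t i"]]
  show ?thesis by (simp add: shape_at_def image_image)
qed

lemma measurable_stat[measurable]: "stat \<theta> r \<in> borel_measurable conf"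
  unfolding stat_def[abs_def]
  by (intro borel_measurable_sum borel_measurable_times borel_measurable_const measurable_cluster_sum measurable_shape_at)

lemma measurable_stat_share:
  assumes c: "c \<in> sets borel" shows "stat_share \<theta> r c \<in> borel_measurable conf"
proof -
  have "(\<lambda>x. real (card (x ` {..<k} \<inter> c))) \<in> borel_measurable (PiM {..<k} (\<lambda>_. borel :: (real^'d) measure))"
  proof -
    have "(\<lambda>x. card (x ` {..<k} \<inter> c)) \<in> PiM {..<k} (\<lambda>_. borel :: (real^'d) measure) \<rightarrow>\<^sub>M count_space UNIV"
      by (rule measurable_compose[OF measurable_tuple_conf measurable_conf_card[OF c]]) simp
    from measurable_compose[OF this, of real borel] show ?thesis by simp
  qed
  then show ?thesis
    unfolding stat_share_def[abs_def]
    by (intro borel_measurable_sum borel_measurable_times borel_measurable_const measurable_cluster_sum measurable_shape_at borel_measurable_divide)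
qed

lemma stat_card_less: "finite X \<Longrightarrow> card X < k \<Longrightarrow> stat \<theta> r X = 0"
  by (simp add: stat_def cluster_sum_card_less)

lemma stat_card_eq: "finite X \<Longrightarrow> card X = k \<Longrightarrow> stat \<theta> r X = (\<Sum>i\<in>UNIV. \<theta> $ i * shape_at i r X)"
  by (simp add: stat_def cluster_sum_card_eq)

lemma stat_share_card_less: "finite X \<Longrightarrow> card X < k \<Longrightarrow> stat_share \<theta> r c X = 0"
  by (simp add: stat_share_def cluster_sum_card_less)

lemma stat_share_card_eq: "finite X \<Longrightarrow> card X = k \<Longrightarrow>
  stat_share \<theta> r c X = (\<Sum>i\<in>UNIV. \<theta> $ i * (shape_at i r X * (real (card (X \<inter> c)) / real k)))"
  by (simp add: stat_share_def cluster_sum_card_eq)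

lemma stat_empty: "stat \<theta> r {} = 0"
  using stat_card_less[of "{}"] k_pos by simp

lemma share_bound: "real (card (Y \<inter> c)) / real k \<le> 1" if "card Y = k" "finite Y"
  using that k_pos card_mono[of Y "Y \<inter> c"] by (simp add: field_simps)

lemma shape_at_card: "shape_at i r Y \<noteq> 0 \<Longrightarrow> r > 0 \<Longrightarrow> card Y = k \<and> finite Y"
proof -
  assume a: "shape_at i r Y \<noteq> 0" "r > 0"
  have inj: "inj_on (\<lambda>x. inverse r *\<^sub>R x) Y" using a(2) by (auto simp: inj_on_def)
  have "card ((\<lambda>x. inverse r *\<^sub>R x) ` Y) = k \<and> finite ((\<lambda>x. inverse r *\<^sub>R x) ` Y)"
    using a(1) unfolding shape_at_def by (rule connected_graph.card_shape[OF connected_graph])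
  then show ?thesis using card_image[OF inj] finite_imageD[OF _ inj] by simp
qed

text \<open>The bound is uniform in the scale: the ball of radius \<open>r L\<close>, enlarged by the diameter of a cluster, is
  covered by a number of balls of radius \<open>r t\<^sub>i / 2\<close> that depends on \<open>L\<close> only.\<close>

lemma stat_bounds:
  obtains K where "K \<ge> 0"
    "\<And>r z X. r > 0 \<Longrightarrow> finite X \<Longrightarrow> X \<subseteq> cball z (r * L) \<Longrightarrow> \<bar>stat \<theta> r X\<bar> \<le> K"
    "\<And>r z X c. r > 0 \<Longrightarrow> finite X \<Longrightarrow> c \<subseteq> cball z (r * L) \<Longrightarrow> \<bar>stat_share \<theta> r c X\<bar> \<le> K"
proof -
  have "\<exists>N. \<forall>(z::real^'d) r. r > 0 \<longrightarrow> (\<exists>A. finite A \<and> card A \<le> N \<and> cball z (r * (L + R)) \<subseteq> (\<Union>a\<in>A. ball a (r * t i / 2)))" for i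
    using cover_cball[OF t_pos[of i], where L = "L + R"] by metis
  then obtain N where N: "\<And>i (z::real^'d) r. r > 0 \<Longrightarrow> \<exists>A. finite A \<and> card A \<le> N i \<and> cball z (r * (L + R)) \<subseteq> (\<Union>a\<in>A. ball a (r * t i / 2))"
    by metis
  define K where "K = (\<Sum>i\<in>UNIV. \<bar>\<theta> $ i\<bar> * 2 ^ N i)"
  have clus: "\<bar>cluster_sum k (r * t i) \<phi> X\<bar> \<le> 2 ^ N i" 
    if "r > 0" "finite X" "\<And>Y. Y \<subseteq> X \<Longrightarrow> \<phi> Y \<noteq> 0 \<Longrightarrow> Y \<subseteq> cball z (r * (L + R)) \<and> \<bar>\<phi> Y\<bar> \<le> 1" for i r X \<phi> and z :: "real^'d"
  proof -
    note asm = that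
    obtain A where A: "finite A" "card A \<le> N i" "cball z (r * (L + R)) \<subseteq> (\<Union>a\<in>A. ball a (r * t i / 2))"
      using N[OF asm(1)] by blast
    have "\<bar>cluster_sum k (r * t i) \<phi> X\<bar> \<le> 2 ^ card A" by (rule abs_cluster_sum_le[OF asm(2) A(1,3) asm(3)])
    also have "\<dots> \<le> 2 ^ N i" using A(2) by (intro power_increasing) auto
    finally show ?thesis .
  qed
  have total: "\<bar>\<Sum>i\<in>UNIV. \<theta> $ i * f i\<bar> \<le> K" if "\<And>i. \<bar>f i\<bar> \<le> 2 ^ N i" for f
  proof -
    have "\<bar>\<Sum>i\<in>UNIV. \<theta> $ i * f i\<bar> \<le> (\<Sum>i\<in>UNIV. \<bar>\<theta> $ i * f i\<bar>)" by (rule sum_abs)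
    also have "\<dots> \<le> K" unfolding K_def using that by (intro sum_mono) (auto simp: abs_mult intro!: mult_left_mono)
    finally show ?thesis .
  qed
  show thesis
  proof (rule that)
    show "K \<ge> 0" by (simp add: K_def sum_nonneg)
  next
    fix r :: real and z :: "real^'d" and X :: "(real^'d) set" assume a: "r > 0" "finite X" "X \<subseteq> cball z (r * L)"
    have "cball z (r * L) \<subseteq> cball z (r * (L + R))" using a(1) R_pos by (intro subset_cball) (simp add: algebra_simps)
    then show "\<bar>stat \<theta> r X\<bar> \<le> K" unfolding stat_def
      using a shape_at_abs by (intro total clus) auto
  next
    fix r :: real and z :: "real^'d" and X c :: "(real^'d) set" assume a: "r > 0" "finite X" "c \<subseteq> cball z (r * L)"
    show "\<bar>stat_share \<theta> r c X\<bar> \<le> K" unfolding stat_share_def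
    proof (intro total clus[OF a(1,2), where z = z] conjI)
      fix i Y assume Y: "Y \<subseteq> X" "shape_at i r Y * (real (card (Y \<inter> c)) / real k) \<noteq> 0"
      then have nz: "shape_at i r Y \<noteq> 0" and "Y \<inter> c \<noteq> {}" by auto
      then obtain v where v: "v \<in> Y" "v \<in> c" by blast
      show "Y \<subseteq> cball z (r * (L + R))"
      proof
        fix u assume "u \<in> Y"
        then have "norm (v - u) \<le> r * (real k * tm)" using shape_at_diam[OF a(1) nz] v by blast
        also have "\<dots> \<le> r * R" using a(1) tm_pos by (simp add: R_def)
        finally have "norm (v - u) \<le> r * R" .
        moreover have "norm (z - v) \<le> r * L" using v a(3) by (auto simp: dist_norm)
        ultimately show "u \<in> cball z (r * (L + R))"
          using norm_triangle_ineq[of "z - v" "v - u"] by (simp add: dist_norm algebra_simps)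
      qed
      have "real (card (Y \<inter> c)) / real k \<le> 1" by (rule share_bound) (use shape_at_card[OF nz a(1)] in auto)
      moreover have "0 \<le> real (card (Y \<inter> c)) / real k" by simp
      ultimately have "\<bar>real (card (Y \<inter> c)) / real k\<bar> \<le> 1" by linarith
      then show "\<bar>shape_at i r Y * (real (card (Y \<inter> c)) / real k)\<bar> \<le> 1"
        using shape_at_abs[of i r Y] unfolding abs_mult by (intro mult_le_one) auto
    qed
  qed
qed

lemma stat_insert_bound:
  obtains K where "K \<ge> 0"
    "\<And>r x X. r > 0 \<Longrightarrow> finite X \<Longrightarrow> \<bar>stat \<theta> r (insert x X) - stat \<theta> r X\<bar> \<le> K * of_bool (k \<le> card (X \<inter> cball x (r * R)) + 1)"
proof -
  have "\<exists>N. \<forall>(z::real^'d) r. r > 0 \<longrightarrow> (\<exists>A. finite A \<and> card A \<le> N \<and> cball z (r * (real k * tm + t i)) \<subseteq> (\<Union>a\<in>A. ball a (r * t i / 2)))" for i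
    using cover_cball[OF t_pos[of i], where L = "real k * tm + t i"] by metis
  then obtain N where N: "\<And>i (z::real^'d) r. r > 0 \<Longrightarrow> \<exists>A. finite A \<and> card A \<le> N i \<and> cball z (r * (real k * tm + t i)) \<subseteq> (\<Union>a\<in>A. ball a (r * t i / 2))"
    by metis
  define K where "K = (\<Sum>i\<in>UNIV. \<bar>\<theta> $ i\<bar> * (2 * 2 ^ N i))"
  show thesis
  proof (rule that)
    show "K \<ge> 0" by (simp add: K_def sum_nonneg)
    fix r :: real and x :: "real^'d" and X :: "(real^'d) set" assume r: "r > 0" and X: "finite X"
    let ?ind = "of_bool (k \<le> card (X \<inter> cball x (r * R)) + 1) :: real"
    have one: "\<bar>cluster_sum k (r * t i) (shape_at i r) (insert x X) - cluster_sum k (r * t i) (shape_at i r) X\<bar> \<le> 2 * 2 ^ N i * ?ind" for i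
    proof -
      obtain A where A: "finite A" "card A \<le> N i" "cball x (r * (real k * tm + t i)) \<subseteq> (\<Union>a\<in>A. ball a (r * t i / 2))"
        using N[OF r] by blast
      have eq: "r * (real k * tm + t i) = r * (real k * tm) + r * t i" by (simp add: algebra_simps)
      have "\<bar>cluster_sum k (r * t i) (shape_at i r) (insert x X) - cluster_sum k (r * t i) (shape_at i r) X\<bar>
        \<le> 2 * 2 ^ card A * of_bool (k \<le> card (X \<inter> cball x (r * (real k * tm) + r * t i)) + 1)"
        using r t_pos[of i] A(3) unfolding eq
        by (intro cluster_sum_insert X A(1) shape_at_abs shape_at_diam) auto
      also have "\<dots> \<le> 2 * 2 ^ N i * ?ind"
      proof (intro mult_mono)
        have "cball x (r * (real k * tm) + r * t i) \<subseteq> cball x (r * R)"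
          using r diam_plus_le_R[of i] unfolding eq[symmetric] by (intro subset_cball mult_left_mono) auto
        then have "card (X \<inter> cball x (r * (real k * tm) + r * t i)) \<le> card (X \<inter> cball x (r * R))"
          using X by (intro card_mono) auto
        then show "of_bool (k \<le> card (X \<inter> cball x (r * (real k * tm) + r * t i)) + 1) \<le> ?ind" by auto
      qed (use A in \<open>auto intro: power_increasing\<close>)
      finally show ?thesis .
    qed
    have "\<bar>stat \<theta> r (insert x X) - stat \<theta> r X\<bar> 
      = \<bar>\<Sum>i\<in>UNIV. \<theta> $ i * (cluster_sum k (r * t i) (shape_at i r) (insert x X) - cluster_sum k (r * t i) (shape_at i r) X)\<bar>"
      by (simp add: stat_def sum_subtractf right_diff_distrib)
    also have "\<dots> \<le> (\<Sum>i\<in>UNIV. \<bar>\<theta> $ i * (cluster_sum k (r * t i) (shape_at i r) (insert x X) - cluster_sum k (r * t i) (shape_at i r) X)\<bar>)"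
      by (rule sum_abs)
    also have "\<dots> \<le> (\<Sum>i\<in>UNIV. \<bar>\<theta> $ i\<bar> * (2 * 2 ^ N i * ?ind))"
      unfolding abs_mult by (intro sum_mono mult_left_mono one) auto
    also have "\<dots> = K * ?ind" by (simp add: K_def sum_distrib_right mult.assoc)
    finally show "\<bar>stat \<theta> r (insert x X) - stat \<theta> r X\<bar> \<le> K * ?ind" .
  qed
qed

text \<open>The fractions of a component in the cells add up to 1.\<close>

lemma sum_stat_share:
  assumes J: "J > 0" and r: "r > 0" and X: "finite X" "X \<subseteq> unit_cube"
  shows "(\<Sum>z\<in>cells J. stat_share \<theta> r (cell J z) X) = stat \<theta> r X"
proof -
  have share: "(\<Sum>z\<in>cells J. shape_at i r Y * (real (card (Y \<inter> cell J z)) / real k)) = shape_at i r Y" if Y: "Y \<subseteq> X" for i Y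
  proof (cases "shape_at i r Y = 0")
    case False
    have Yk: "card Y = k" "finite Y" using shape_at_card[OF False r] by auto
    have "(\<Sum>z\<in>cells J. card (Y \<inter> cell J z)) = card (\<Union>z\<in>cells J. Y \<inter> cell J z)"
      using Yk cell_disjoint[OF J] by (intro card_UN_disjoint[symmetric] finite_cells) auto
    also have "(\<Union>z\<in>cells J. Y \<inter> cell J z) = Y" using ex_cell[OF J] Y X by blast
    finally have "(\<Sum>z\<in>cells J. real (card (Y \<inter> cell J z))) = real k" using Yk by (simp flip: of_nat_sum)
    then show ?thesis using k_pos by (simp flip: sum_distrib_left sum_divide_distrib)
  qed simp
  have "(\<Sum>z\<in>cells J. stat_share \<theta> r (cell J z) X) 
     = (\<Sum>i\<in>UNIV. \<theta> $ i * (\<Sum>z\<in>cells J. cluster_sum k (r * t i) (\<lambda>Y. shape_at i r Y * (real (card (Y \<inter> cell J z)) / real k)) X))"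
    unfolding stat_share_def by (subst sum.swap) (simp add: sum_distrib_left)
  also have "\<dots> = stat \<theta> r X"
    unfolding stat_def sum_cluster_sum using share
    by (intro sum.cong refl arg_cong2[where f = "(*)"]) (auto simp: cluster_sum_def intro!: sum.cong)
  finally show ?thesis .
qed

lemma stat_share_local:
  assumes J: "J > 0" and r: "r > 0" "r * R \<le> 1 / real J" and X: "finite X" "X \<subseteq> unit_cube"
  shows "stat_share \<theta> r (cell J z) (X \<inter> nbhd J z) = stat_share \<theta> r (cell J z) X"
proof -
  have "cluster_sum k (r * t i) (\<lambda>Y. shape_at i r Y * (real (card (Y \<inter> cell J z)) / real k)) (X \<inter> nbhd J z)
    = cluster_sum k (r * t i) (\<lambda>Y. shape_at i r Y * (real (card (Y \<inter> cell J z)) / real k)) X" for i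
  proof (rule cluster_sum_local[OF X(1)])
    have near: "y \<in> nbhd J z" if "Y \<subseteq> X" "shape_at i r Y * (real (card (Y \<inter> cell J z)) / real k) \<noteq> 0" 
      "u \<in> Y" "y \<in> X" "norm (u - y) \<le> r * t i" for Y y u
    proof -
      have nz: "shape_at i r Y \<noteq> 0" "Y \<inter> cell J z \<noteq> {}" using that(2) by auto
      then obtain v where v: "v \<in> Y" "v \<in> cell J z" by blast
      have "norm (v - y) \<le> norm (v - u) + norm (u - y)" using norm_triangle_ineq[of "v - u" "u - y"] by simp
      also have "\<dots> \<le> r * (real k * tm) + r * t i" using shape_at_diam[OF r(1) nz(1) v(1) that(3)] that(5) by linarith
      also have "\<dots> \<le> r * R" using r diam_plus_le_R[of i] by (simp flip: distrib_left)
      finally show ?thesis using r(2) that(4) X(2) v(2) by (intro near_cell_in_nbhd[OF J]) auto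
    qed
    show "Y \<subseteq> nbhd J z" if "Y \<subseteq> X" "shape_at i r Y * (real (card (Y \<inter> cell J z)) / real k) \<noteq> 0" for Y
    proof
      fix u assume "u \<in> Y"
      then show "u \<in> nbhd J z" using near[OF that, of u u] that(1) r(1) t_pos[of i] by auto
    qed
    show "x \<in> nbhd J z" if "Y \<subseteq> X" "shape_at i r Y * (real (card (Y \<inter> cell J z)) / real k) \<noteq> 0" "y \<in> Y" "x \<in> X" "norm (y - x) < r * t i" for Y y x
      using near[OF that(1,2,3,4)] that(5) by simp
  qed
  then show ?thesis by (simp add: stat_share_def)
qed

end



context shapes
begin

section \<open>The limiting covariance\<close>

abbreviation shape0 :: "'m \<Rightarrow> (nat \<Rightarrow> real ^ 'd) \<Rightarrow> real" where
  "shape0 i y \<equiv> shape_ind (\<Gamma> i) (t i) (with_origin k y)"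

abbreviation gram :: "real ^ 'm ^ 'm" where
  "gram \<equiv> Gram_matrix dim k \<Gamma> t"

lemma measurable_shape0: "shape0 i \<in> borel_measurable (lborel_tuples k)"
  using measurable_with_origin[OF k_pos connected_graph.measurable_shape_ind[OF connected_graph[of i], of "t i"]]
  by (simp add: lborel_tuples_def)

lemma shape0_cases: "shape0 i y = 0 \<or> shape0 i y = 1"
  by (rule connected_graph.shape_ind_cases[OF connected_graph])

lemma shape0_support:
  assumes "shape0 i y \<noteq> 0" "y \<in> space (lborel_tuples k)"
  shows "y \<in> PiE {..<k - 1} (\<lambda>_. cball 0 (real k * tm))"
proof -
  have "norm (0 - y j) \<le> real k * tm" if "j < k - 1" for j
  proof -
    have "norm (0 - y j) \<le> real k * t i"
      using assms(1) t_pos[of i] that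
      by (intro connected_graph.shape_diameter[OF connected_graph]) (auto simp: with_origin_def)
    also have "\<dots> \<le> real k * tm" using t_le_tm by (intro mult_left_mono) auto
    finally show ?thesis .
  qed
  then have "y j \<in> cball 0 (real k * tm)" if "j \<in> {..<k - 1}" for j using that by (simp add: dist_norm)
  moreover have "y \<in> extensional {..<k - 1}" using assms(2) unfolding lborel_tuples_def space_PiM by (simp only: PiE_def Int_iff)
  ultimately show ?thesis unfolding PiE_def by blast
qed

lemma nn_integral_shape0_finite: "(\<integral>\<^sup>+y. ennreal (shape0 i y) \<partial>lborel_tuples k) < \<infinity>"
proof -
  let ?B = "PiE {..<k - 1} (\<lambda>_. cball (0::real^'d) (real k * tm))"
  have B: "?B \<in> sets (lborel_tuples k)"
    unfolding lborel_tuples_def by (rule sets_PiM_I_finite) simp_all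
  have "(\<integral>\<^sup>+y. ennreal (shape0 i y) \<partial>lborel_tuples k) \<le> (\<integral>\<^sup>+y. indicator ?B y \<partial>lborel_tuples k)"
  proof (rule nn_integral_mono)
    fix y :: "nat \<Rightarrow> real ^ 'd" assume y: "y \<in> space (lborel_tuples k)"
    show "ennreal (shape0 i y) \<le> indicator ?B y"
    proof (cases "shape0 i y = 0")
      case False
      have "y \<in> ?B" by (rule shape0_support[OF False y])
      then have "indicator ?B y = (1 :: ennreal)" by (rule indicator_simps(1))
      moreover have "shape0 i y = 1" using shape0_cases[of i y] False by blast
      ultimately show ?thesis by (simp only: ennreal_1 order_refl)
    next
      case True
      then show ?thesis by (simp only: ennreal_0 zero_le)
    qed
  qed
  also have "\<dots> = emeasure (lborel_tuples k) ?B" using B by simp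
  also have "\<dots> = (\<Prod>j\<in>{..<k - 1}. emeasure lborel (cball (0::real^'d) (real k * tm)))"
    unfolding lborel_tuples_def by (intro lborel_tuple.emeasure_PiM) auto
  also have "\<dots> < \<infinity>"
  proof -
    have "emeasure lborel (cball (0::real^'d) (real k * tm)) < \<infinity>" by (rule emeasure_bounded_finite) simp
    then show ?thesis by (simp add: ennreal_prod_eq_top power_less_top_ennreal)
  qed
  finally show ?thesis .
qed

lemma integrable_shape0: "integrable (lborel_tuples k) (shape0 i)"
proof (rule integrableI_nonneg)
  show "AE y in lborel_tuples k. 0 \<le> shape0 i y" using shape0_cases by (intro AE_I2) (metis order_refl zero_le_one)
qed (use measurable_shape0 nn_integral_shape0_finite in auto)

lemma integrable_shape0_mult: "integrable (lborel_tuples k) (\<lambda>y. shape0 i y * shape0 j y)"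
proof (rule Bochner_Integration.integrable_bound[OF integrable_shape0[of i]])
  show "(\<lambda>y. shape0 i y * shape0 j y) \<in> borel_measurable (lborel_tuples k)"
    by (intro borel_measurable_times measurable_shape0)
  show "AE y in lborel_tuples k. norm (shape0 i y * shape0 j y) \<le> norm (shape0 i y)"
  proof (rule AE_I2)
    fix y show "norm (shape0 i y * shape0 j y) \<le> norm (shape0 i y)"
      using shape0_cases[of i y] shape0_cases[of j y] by auto
  qed
qed

lemma sq_inner_H_vec: "(\<theta> \<bullet> H_vec \<Gamma> t (with_origin k y))\<^sup>2
    = (\<Sum>i\<in>UNIV. \<Sum>j\<in>UNIV. (\<theta> $ i * \<theta> $ j) * (shape0 i y * shape0 j y))"
  by (simp add: H_vec_def inner_vec_def power2_eq_square sum_product mult_ac)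

lemma integrable_sq_H: "integrable (lborel_tuples k) (\<lambda>y. (\<theta> \<bullet> H_vec \<Gamma> t (with_origin k y :: (real^'d) set))\<^sup>2)"
  unfolding sq_inner_H_vec
  by (intro Bochner_Integration.integrable_sum integrable_mult_right integrable_shape0_mult)

lemma gram_quadratic:
  "fact k * (\<theta> \<bullet> (gram *v \<theta>)) = (LINT y|lborel_tuples k. (\<theta> \<bullet> H_vec \<Gamma> t (with_origin k y :: (real^'d) set))\<^sup>2)"
proof -
  let ?L = "lborel_tuples k :: (nat \<Rightarrow> real^'d) measure"
  have "(LINT y|?L. (\<theta> \<bullet> H_vec \<Gamma> t (with_origin k y))\<^sup>2)
     = (\<Sum>i\<in>UNIV. \<Sum>j\<in>UNIV. (\<theta> $ i * \<theta> $ j) * (LINT y|?L. shape0 i y * shape0 j y))"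
    unfolding sq_inner_H_vec
    by (subst Bochner_Integration.integral_sum, intro Bochner_Integration.integrable_sum integrable_mult_right integrable_shape0_mult,
        rule sum.cong[OF refl], subst Bochner_Integration.integral_sum, intro integrable_mult_right integrable_shape0_mult) simp
  also have "\<dots> = fact k * (\<theta> \<bullet> (gram *v \<theta>))"
    by (simp add: inner_vec_def matrix_vector_mult_def Gram_matrix_def sum_distrib_left mult_ac)
  finally show ?thesis by simp
qed

lemma gram_nonneg: "\<theta> \<bullet> (gram *v \<theta>) \<ge> 0"
proof -
  have "fact k * (\<theta> \<bullet> (gram *v \<theta>)) \<ge> 0" unfolding gram_quadratic by (intro integral_nonneg_AE AE_I2) simp
  moreover have "(fact k :: real) > 0" by simp
  ultimately show ?thesis by (metis zero_le_mult_iff not_less)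
qed

lemma nn_integral_sq_H:
  "(\<integral>\<^sup>+y. ennreal ((\<theta> \<bullet> H_vec \<Gamma> t (with_origin k y :: (real^'d) set))\<^sup>2) \<partial>lborel_tuples k) = ennreal (fact k * (\<theta> \<bullet> (gram *v \<theta>)))"
  unfolding gram_quadratic by (rule nn_integral_eq_integral[OF integrable_sq_H]) simp

lemma gram_sym: "x \<bullet> (gram *v y) = y \<bullet> (gram *v x)"
proof -
  have "x \<bullet> (gram *v y) = (\<Sum>i\<in>UNIV. \<Sum>j\<in>UNIV. x $ i * (gram $ i $ j * y $ j))"
    by (simp add: inner_vec_def matrix_vector_mult_def sum_distrib_left)
  also have "\<dots> = (\<Sum>j\<in>UNIV. \<Sum>i\<in>UNIV. x $ i * (gram $ i $ j * y $ j))" by (rule sum.swap)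
  also have "\<dots> = (\<Sum>j\<in>UNIV. \<Sum>i\<in>UNIV. y $ j * (gram $ j $ i * x $ i))"
    by (simp add: Gram_matrix_def mult_ac)
  also have "\<dots> = y \<bullet> (gram *v x)"
    by (simp add: inner_vec_def matrix_vector_mult_def sum_distrib_left)
  finally show ?thesis .
qed

text \<open>If the quadratic form vanishes at \<open>\<theta>\<close>, then \<open>\<theta> \<bullet> H\<close> vanishes almost everywhere, because the form is the
  integral of its square.\<close>

lemma gram_pos:
  assumes "(LINT y|lborel_tuples k. \<bar>\<theta> \<bullet> H_vec \<Gamma> t (with_origin k y :: (real^'d) set)\<bar>) > 0"
  shows "\<theta> \<bullet> (gram *v \<theta>) > 0"
proof (rule ccontr)
  assume "\<not> ?thesis"
  then have "\<theta> \<bullet> (gram *v \<theta>) = 0" using gram_nonneg[of \<theta>] by simp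
  then have "(LINT y|lborel_tuples k. (\<theta> \<bullet> H_vec \<Gamma> t (with_origin k y :: (real^'d) set))\<^sup>2) = 0"
    using gram_quadratic[of \<theta>] by simp
  then have "AE y in lborel_tuples k. (\<theta> \<bullet> H_vec \<Gamma> t (with_origin k y :: (real^'d) set))\<^sup>2 = 0"
    using integral_nonneg_eq_0_iff_AE[OF integrable_sq_H[of \<theta>]] by simp
  then have "(LINT y|lborel_tuples k. \<bar>\<theta> \<bullet> H_vec \<Gamma> t (with_origin k y :: (real^'d) set)\<bar>) = 0"
    by (intro integral_eq_zero_AE) auto
  then show False using assms by simp
qed

lemma nn_integral_sum_shape0:
  obtains v where "v \<ge> 0" "(\<integral>\<^sup>+y. ennreal (\<Sum>i\<in>UNIV. shape0 i y) \<partial>lborel_tuples k) = ennreal v"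
proof -
  have nn: "0 \<le> shape0 i y" for i y using shape0_cases[of i y] by auto
  have "(\<integral>\<^sup>+y. ennreal (\<Sum>i\<in>UNIV. shape0 i y) \<partial>lborel_tuples k) = (\<integral>\<^sup>+y. (\<Sum>i\<in>UNIV. ennreal (shape0 i y)) \<partial>lborel_tuples k)"
    using nn by (intro nn_integral_cong sum_ennreal[symmetric])
  also have "\<dots> = (\<Sum>i\<in>UNIV. \<integral>\<^sup>+y. ennreal (shape0 i y) \<partial>lborel_tuples k)"
    by (intro nn_integral_sum measurable_compose[OF measurable_shape0 measurable_ennreal])
  also have "\<dots> < \<infinity>" using nn_integral_shape0_finite by simp
  finally have "(\<integral>\<^sup>+y. ennreal (\<Sum>i\<in>UNIV. shape0 i y) \<partial>lborel_tuples k) < \<infinity>" .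
  then show thesis
    using that[of "enn2real (\<integral>\<^sup>+y. ennreal (\<Sum>i\<in>UNIV. shape0 i y) \<partial>lborel_tuples k)"] by simp
qed

section \<open>Second moments of the cell statistics\<close>

lemma shape_at_affine:
  assumes "r > 0"
  shows "shape_at i r ((\<lambda>x. z + r *\<^sub>R x) ` Y) = shape_ind (\<Gamma> i) (t i) Y"
proof -
  have "(\<lambda>x. inverse r *\<^sub>R x) ` (\<lambda>x. z + r *\<^sub>R x) ` Y = (\<lambda>x. inverse r *\<^sub>R z + x) ` Y"
    using assms by (simp add: image_image scaleR_add_right)
  then show ?thesis unfolding shape_at_def
    by (simp only:) (rule connected_graph.shape_ind_isometric_image[OF connected_graph], simp)
qed

lemma stat_tuple:
  assumes "r > 0"
  shows "stat \<theta> r (x ` {..<k}) = (\<Sum>i\<in>UNIV. \<theta> $ i * shape_at i r (x ` {..<k}))"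
proof (cases "card (x ` {..<k}) = k")
  case True
  then show ?thesis by (intro stat_card_eq) auto
next
  case False
  then have "card (x ` {..<k}) < k" using card_image_le[of "{..<k}" x] by simp
  moreover have "shape_at i r (x ` {..<k}) = 0" for i using shape_at_card[of i r "x ` {..<k}"] False assms by blast
  ultimately show ?thesis by (simp add: stat_card_less)
qed

lemma measurable_sum_shape_at:
  "(\<lambda>x. \<Sum>i\<in>UNIV. \<theta> $ i * shape_at i r (x ` {..<k})) \<in> borel_measurable (PiM {..<k} (\<lambda>_. borel))"
  by (intro borel_measurable_sum borel_measurable_times borel_measurable_const measurable_shape_at)

lemma anchored_sq:
  assumes "r > 0" "D \<in> sets borel"
  shows "(\<integral>\<^sup>+x. ennreal ((\<Sum>i\<in>UNIV. \<theta> $ i * shape_at i r (x ` {..<k}))\<^sup>2) * indicator D (x (k - 1)) \<partial>PiM {..<k} (\<lambda>_. lborel))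
    = emeasure lborel D * ennreal (r ^ (CARD('d) * (k - 1))) * ennreal (fact k * (\<theta> \<bullet> (gram *v \<theta>)))"
proof -
  have "(\<integral>\<^sup>+x. ennreal ((\<Sum>i\<in>UNIV. \<theta> $ i * shape_at i r (x ` {..<k}))\<^sup>2) * indicator D (x (k - 1)) \<partial>PiM {..<k} (\<lambda>_. lborel))
    = emeasure lborel D * ennreal (r ^ (DIM(real^'d) * (k - 1))) * (\<integral>\<^sup>+y. ennreal ((\<theta> \<bullet> H_vec \<Gamma> t (with_origin k y :: (real^'d) set))\<^sup>2) \<partial>lborel_tuples k)"
  proof (rule nn_integral_anchored[OF k_pos assms(1) assms(2), where h = "\<lambda>Y. ennreal ((\<Sum>i\<in>UNIV. \<theta> $ i * shape_at i r Y)\<^sup>2)"])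
    show "(\<lambda>x. ennreal ((\<Sum>i\<in>UNIV. \<theta> $ i * shape_at i r (x ` {..<k}))\<^sup>2)) \<in> borel_measurable (PiM {..<k} (\<lambda>_. borel))"
      by (intro measurable_compose[OF _ measurable_ennreal] borel_measurable_power measurable_sum_shape_at)
  qed (use assms(1) in \<open>simp add: shape_at_affine H_vec_def inner_vec_def\<close>)
  then show ?thesis by (simp only: nn_integral_sq_H) simp
qed

lemma anchored_sum:
  assumes "r > 0" "D \<in> sets borel"
    and v1: "(\<integral>\<^sup>+y. ennreal (\<Sum>i\<in>UNIV. shape0 i y) \<partial>lborel_tuples k) = ennreal v1"
  shows "(\<integral>\<^sup>+x. ennreal (\<Sum>i\<in>UNIV. shape_at i r (x ` {..<k})) * indicator D (x (k - 1)) \<partial>PiM {..<k} (\<lambda>_. lborel))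
    = emeasure lborel D * ennreal (r ^ (CARD('d) * (k - 1))) * ennreal v1"
proof -
  have "(\<integral>\<^sup>+x. ennreal (\<Sum>i\<in>UNIV. shape_at i r (x ` {..<k})) * indicator D (x (k - 1)) \<partial>PiM {..<k} (\<lambda>_. lborel))
    = emeasure lborel D * ennreal (r ^ (DIM(real^'d) * (k - 1))) * (\<integral>\<^sup>+y. ennreal (\<Sum>i\<in>UNIV. shape_ind (\<Gamma> i) (t i) (with_origin k y :: (real^'d) set)) \<partial>lborel_tuples k)"
  proof (rule nn_integral_anchored[OF k_pos assms(1) assms(2), where h = "\<lambda>Y. ennreal (\<Sum>i\<in>UNIV. shape_at i r Y)"])
    show "(\<lambda>x. ennreal (\<Sum>i\<in>UNIV. shape_at i r (x ` {..<k}))) \<in> borel_measurable (PiM {..<k} (\<lambda>_. borel))"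
      by (intro measurable_compose[OF _ measurable_ennreal] borel_measurable_sum measurable_shape_at)
  qed (use assms(1) in \<open>simp add: shape_at_affine\<close>)
  then show ?thesis by (simp only: v1) simp
qed

lemma tuple_last: "x (k - 1) \<in> x ` {..<k}" for x :: "nat \<Rightarrow> 'b"
  using k_pos by auto

text \<open>Dropping the condition that all points but the last lie in the cell only increases the integral, and
  leaves one that scales exactly.\<close>

lemma cell_sq_upper:
  assumes r: "r > 0" and J: "J > 0" and z: "z \<in> cells J"
  shows "(\<integral>\<^sup>+x. ennreal ((stat \<theta> r (x ` {..<k} \<inter> cell J z))\<^sup>2) * indicator (PiE {..<k} (\<lambda>_. cell J z)) x \<partial>PiM {..<k} (\<lambda>_. lborel))
    \<le> ennreal ((1 / real J) ^ CARD('d) * r ^ (CARD('d) * (k - 1)) * (fact k * (\<theta> \<bullet> (gram *v \<theta>))))"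
proof -
  have "(\<integral>\<^sup>+x. ennreal ((stat \<theta> r (x ` {..<k} \<inter> cell J z))\<^sup>2) * indicator (PiE {..<k} (\<lambda>_. cell J z)) x \<partial>PiM {..<k} (\<lambda>_. lborel))
     \<le> (\<integral>\<^sup>+x. ennreal ((\<Sum>i\<in>UNIV. \<theta> $ i * shape_at i r (x ` {..<k}))\<^sup>2) * indicator (cell J z) (x (k - 1)) \<partial>PiM {..<k} (\<lambda>_. lborel))"
  proof (rule nn_integral_mono)
    fix x :: "nat \<Rightarrow> real^'d"
    show "ennreal ((stat \<theta> r (x ` {..<k} \<inter> cell J z))\<^sup>2) * indicator (PiE {..<k} (\<lambda>_. cell J z)) x
      \<le> ennreal ((\<Sum>i\<in>UNIV. \<theta> $ i * shape_at i r (x ` {..<k}))\<^sup>2) * indicator (cell J z) (x (k - 1))"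
    proof (cases "x \<in> PiE {..<k} (\<lambda>_. cell J z)")
      case True
      then have sub: "x ` {..<k} \<subseteq> cell J z" by auto
      then have "x ` {..<k} \<inter> cell J z = x ` {..<k}" by blast
      moreover have "x (k - 1) \<in> cell J z" using sub tuple_last[of x] by blast
      ultimately show ?thesis using True by (simp add: stat_tuple[OF r])
    qed simp
  qed
  also have "\<dots> = ennreal ((1 / real J) ^ CARD('d)) * ennreal (r ^ (CARD('d) * (k - 1))) * ennreal (fact k * (\<theta> \<bullet> (gram *v \<theta>)))"
    unfolding anchored_sq[OF r sets_cell] emeasure_cell[OF J z] ..
  also have "\<dots> = ennreal ((1 / real J) ^ CARD('d) * r ^ (CARD('d) * (k - 1)) * (fact k * (\<theta> \<bullet> (gram *v \<theta>))))"
    using r gram_nonneg by (simp add: ennreal_mult)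
  finally show ?thesis .
qed

text \<open>A cluster whose last point has distance at least \<open>r R\<close> from the boundary of the cell lies in the cell.\<close>

lemma cell_sq_lower:
  assumes r: "r > 0" and J: "J > 0" and z: "z \<in> cells J" and rR: "2 * (r * R) \<le> 1 / real J"
  shows "ennreal ((1 / real J - 2 * (r * R)) ^ CARD('d) * r ^ (CARD('d) * (k - 1)) * (fact k * (\<theta> \<bullet> (gram *v \<theta>))))
    \<le> (\<integral>\<^sup>+x. ennreal ((stat \<theta> r (x ` {..<k} \<inter> cell J z))\<^sup>2) * indicator (PiE {..<k} (\<lambda>_. cell J z)) x \<partial>PiM {..<k} (\<lambda>_. lborel))"
proof -
  let ?D = "padded_box J z (- (r * R)) :: (real^'d) set"
  have D: "?D \<in> sets borel" by (simp add: padded_box_def)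
  have "ennreal ((1 / real J - 2 * (r * R)) ^ CARD('d) * r ^ (CARD('d) * (k - 1)) * (fact k * (\<theta> \<bullet> (gram *v \<theta>))))
     = ennreal ((1 / real J - 2 * (r * R)) ^ CARD('d)) * ennreal (r ^ (CARD('d) * (k - 1))) * ennreal (fact k * (\<theta> \<bullet> (gram *v \<theta>)))"
    using r gram_nonneg rR by (simp add: ennreal_mult)
  also have "\<dots> = (\<integral>\<^sup>+x. ennreal ((\<Sum>i\<in>UNIV. \<theta> $ i * shape_at i r (x ` {..<k}))\<^sup>2) * indicator ?D (x (k - 1)) \<partial>PiM {..<k} (\<lambda>_. lborel))"
    unfolding anchored_sq[OF r D] using emeasure_padded_box[of J "- (r * R)" z] rR by simp
  also have "\<dots> \<le> (\<integral>\<^sup>+x. ennreal ((stat \<theta> r (x ` {..<k} \<inter> cell J z))\<^sup>2) * indicator (PiE {..<k} (\<lambda>_. cell J z)) x \<partial>PiM {..<k} (\<lambda>_. lborel))"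
  proof (rule nn_integral_mono)
    fix x :: "nat \<Rightarrow> real^'d" assume sp: "x \<in> space (PiM {..<k} (\<lambda>_. lborel))"
    show "ennreal ((\<Sum>i\<in>UNIV. \<theta> $ i * shape_at i r (x ` {..<k}))\<^sup>2) * indicator ?D (x (k - 1))
      \<le> ennreal ((stat \<theta> r (x ` {..<k} \<inter> cell J z))\<^sup>2) * indicator (PiE {..<k} (\<lambda>_. cell J z)) x"
    proof (cases "x (k - 1) \<in> ?D \<and> (\<exists>i. shape_at i r (x ` {..<k}) \<noteq> 0)")
      case True
      then obtain i where i: "shape_at i r (x ` {..<k}) \<noteq> 0" by blast
      have sub: "x ` {..<k} \<subseteq> cell J z"
      proof
        fix u assume u: "u \<in> x ` {..<k}"
        have "u \<in> padded_box J z (- (r * R) + r * (real k * tm))"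
          by (rule near_padded_box[OF J shape_at_diam[OF r i tuple_last u]]) (use True in blast)
        moreover have "- (r * R) + r * (real k * tm) < 0" using r tm_pos by (simp add: R_def algebra_simps)
        ultimately show "u \<in> cell J z" using padded_box_subset_cell[OF J z] by blast
      qed
      then have "x ` {..<k} \<inter> cell J z = x ` {..<k}" by blast
      moreover have "x \<in> PiE {..<k} (\<lambda>_. cell J z)" using sub sp by (auto simp: space_PiM PiE_iff)
      ultimately show ?thesis by (simp add: stat_tuple[OF r] indicator_def)
    next
      case False
      then have "x (k - 1) \<notin> ?D \<or> (\<forall>i. shape_at i r (x ` {..<k}) = 0)" by blast
      then show ?thesis by auto
    qed
  qed
  finally show ?thesis .
qed

text \<open>On \<open>k\<close> points, the share of a cell and the count inside the cell differ only if the points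
  form a cluster that crosses the boundary of the cell. All points of such a cluster are close to that
  boundary.\<close>

lemma boundary_sq_upper:
  assumes r: "r > 0" and J: "J > 0" and z: "z \<in> cells J" and rR: "2 * (r * R) \<le> 1 / real J"
    and v1: "v1 \<ge> 0" "(\<integral>\<^sup>+y. ennreal (\<Sum>i\<in>UNIV. shape0 i y) \<partial>lborel_tuples k) = ennreal v1"
  shows "(\<integral>\<^sup>+x. ennreal ((stat_share \<theta> r (cell J z) (x ` {..<k}) - stat \<theta> r (x ` {..<k} \<inter> cell J z))\<^sup>2)
        * indicator (PiE {..<k} (\<lambda>_. nbhd J z)) x \<partial>PiM {..<k} (\<lambda>_. lborel))
    \<le> ennreal ((l1 \<theta>)\<^sup>2 * (((1 / real J + 2 * (r * R)) ^ CARD('d) - (1 / real J - 2 * (r * R)) ^ CARD('d)) * r ^ (CARD('d) * (k - 1)) * v1))"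
proof -
  let ?O = "padded_box J z (r * R) :: (real^'d) set" and ?I = "padded_box J z (- (r * R)) :: (real^'d) set"
  have rR0: "r * R > 0" using r R_pos by simp
  have sets: "?O \<in> sets borel" "?I \<in> sets borel" by (simp_all add: padded_box_def)
  have emO: "emeasure lborel ?O = ennreal ((1 / real J + 2 * (r * R)) ^ CARD('d))"
    using emeasure_padded_box[of J "r * R" z] rR0 by simp
  have emI: "emeasure lborel ?I = ennreal ((1 / real J - 2 * (r * R)) ^ CARD('d))"
    using emeasure_padded_box[of J "- (r * R)" z] rR by simp
  have IO: "?I \<subseteq> ?O" using rR0 by (auto simp: mem_padded_box) (smt (verit))+
  have em: "emeasure lborel (?O - ?I) = ennreal ((1 / real J + 2 * (r * R)) ^ CARD('d) - (1 / real J - 2 * (r * R)) ^ CARD('d))"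
    using sets IO emI emO rR by (subst emeasure_Diff) (simp_all add: ennreal_minus)
  have powle: "(1 / real J - 2 * (r * R)) ^ CARD('d) \<le> (1 / real J + 2 * (r * R)) ^ CARD('d)"
    using rR0 rR by (intro power_mono) auto
  have "(\<integral>\<^sup>+x. ennreal ((stat_share \<theta> r (cell J z) (x ` {..<k}) - stat \<theta> r (x ` {..<k} \<inter> cell J z))\<^sup>2)
        * indicator (PiE {..<k} (\<lambda>_. nbhd J z)) x \<partial>PiM {..<k} (\<lambda>_. lborel))
    \<le> (\<integral>\<^sup>+x. ennreal ((l1 \<theta>)\<^sup>2) * (ennreal (\<Sum>i\<in>UNIV. shape_at i r (x ` {..<k})) * indicator (?O - ?I) (x (k - 1))) \<partial>PiM {..<k} (\<lambda>_. lborel))"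
  proof (rule nn_integral_mono)
    fix x :: "nat \<Rightarrow> real^'d"
    let ?Y = "x ` {..<k}"
    let ?B = "stat_share \<theta> r (cell J z) ?Y - stat \<theta> r (?Y \<inter> cell J z)"
    have fin: "finite ?Y" by simp
    have "ennreal (?B\<^sup>2) \<le> ennreal ((l1 \<theta>)\<^sup>2) * (ennreal (\<Sum>i\<in>UNIV. shape_at i r ?Y) * indicator (?O - ?I) (x (k - 1)))"
    proof (cases "?B = 0")
      case nz: False
      have card: "card ?Y = k"
      proof (rule ccontr)
        assume "card ?Y \<noteq> k"
        then have lt: "card ?Y < k" using card_image_le[of "{..<k}" x] by simp
        have "card (?Y \<inter> cell J z) < k" using card_mono[of ?Y "?Y \<inter> cell J z"] lt by simp
        then have "?B = 0" using lt by (simp add: stat_card_less stat_share_card_less)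
        then show False using nz by simp
      qed
      have ncell: "\<not> ?Y \<subseteq> cell J z"
      proof
        assume sub: "?Y \<subseteq> cell J z"
        then have "?Y \<inter> cell J z = ?Y" by blast
        then have "?B = 0" using stat_share_card_eq[OF fin card, of \<theta> r "cell J z"] stat_card_eq[OF fin card, of \<theta> r] card k_pos by simp
        then show False using nz by simp
      qed
      then have "?Y \<inter> cell J z \<subset> ?Y" by blast
      then have "card (?Y \<inter> cell J z) < k" using psubset_card_mono[OF fin] card by simp
      then have B: "?B = (\<Sum>i\<in>UNIV. \<theta> $ i * (shape_at i r ?Y * (real (card (?Y \<inter> cell J z)) / real k)))"
        using stat_share_card_eq[OF fin card] by (simp add: stat_card_less)
      then obtain i where "\<theta> $ i * (shape_at i r ?Y * (real (card (?Y \<inter> cell J z)) / real k)) \<noteq> 0"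
        using nz by (metis (no_types, lifting) sum.neutral)
      then have i: "shape_at i r ?Y \<noteq> 0" "?Y \<inter> cell J z \<noteq> {}" by auto
      obtain v where v: "v \<in> ?Y" "v \<in> cell J z" using i(2) by blast
      obtain u where u: "u \<in> ?Y" "u \<notin> cell J z" using ncell by blast
      have mono: "padded_box J z \<delta> \<subseteq> padded_box J z \<delta>'" if "\<delta> \<le> \<delta>'" for \<delta> \<delta>' :: real
        using that by (auto simp: mem_padded_box) (smt (verit))+
      have kt: "r * (real k * tm) < r * R" using r tm_pos by (simp add: R_def algebra_simps)
      have "x (k - 1) \<in> padded_box J z (0 + r * (real k * tm))"
        by (rule near_padded_box[OF J shape_at_diam[OF r i(1) v(1) tuple_last]]) (use cell_subset_padded_box[OF J, of 0 z] v in auto)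
      then have inO: "x (k - 1) \<in> ?O" using mono[of "0 + r * (real k * tm)" "r * R"] kt by auto
      have notI: "x (k - 1) \<notin> ?I"
      proof
        assume "x (k - 1) \<in> ?I"
        then have "u \<in> padded_box J z (- (r * R) + r * (real k * tm))"
          by (rule near_padded_box[OF J shape_at_diam[OF r i(1) tuple_last u(1)]])
        then show False using padded_box_subset_cell[OF J z, of "- (r * R) + r * (real k * tm)"] kt u by auto
      qed
      have "\<bar>?B\<bar> \<le> (\<Sum>i\<in>UNIV. \<bar>\<theta> $ i * (shape_at i r ?Y * (real (card (?Y \<inter> cell J z)) / real k))\<bar>)"
        unfolding B by (rule sum_abs)
      also have "\<dots> \<le> l1 \<theta>" unfolding l1_def
      proof (rule sum_mono)
        fix i
        have "shape_at i r ?Y * (real (card (?Y \<inter> cell J z)) / real k) \<le> 1"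
          using share_bound[OF card fin] by (intro mult_le_one shape_at_le) auto
        then show "\<bar>\<theta> $ i * (shape_at i r ?Y * (real (card (?Y \<inter> cell J z)) / real k))\<bar> \<le> \<bar>\<theta> $ i\<bar>"
          unfolding abs_mult[of "\<theta> $ i"] using shape_at_nonneg[of i r ?Y] by (intro mult_left_le) auto
      qed
      finally have "?B\<^sup>2 \<le> (l1 \<theta>)\<^sup>2" using l1_nonneg by (simp add: abs_le_square_iff[symmetric])
      moreover have "1 \<le> (\<Sum>i\<in>UNIV. shape_at i r ?Y)"
      proof -
        have "shape_at i r ?Y \<le> (\<Sum>i\<in>UNIV. shape_at i r ?Y)" by (rule member_le_sum) (auto simp: shape_at_nonneg)
        moreover have "shape_at i r ?Y = 1" using shape_at_cases[of i r ?Y] i(1) by blast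
        ultimately show ?thesis by linarith
      qed
      then have "(l1 \<theta>)\<^sup>2 * 1 \<le> (l1 \<theta>)\<^sup>2 * (\<Sum>i\<in>UNIV. shape_at i r ?Y)" by (rule mult_left_mono) simp
      ultimately have "?B\<^sup>2 \<le> (l1 \<theta>)\<^sup>2 * (\<Sum>i\<in>UNIV. shape_at i r ?Y)" by linarith
      then have "ennreal (?B\<^sup>2) \<le> ennreal ((l1 \<theta>)\<^sup>2) * ennreal (\<Sum>i\<in>UNIV. shape_at i r ?Y)"
        by (simp add: ennreal_mult[symmetric] sum_nonneg shape_at_nonneg ennreal_leI)
      then show ?thesis using inO notI by simp
    qed simp
    then show "ennreal (?B\<^sup>2) * indicator (PiE {..<k} (\<lambda>_. nbhd J z)) x
      \<le> ennreal ((l1 \<theta>)\<^sup>2) * (ennreal (\<Sum>i\<in>UNIV. shape_at i r ?Y) * indicator (?O - ?I) (x (k - 1)))"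
      by (auto simp: indicator_def)
  qed
  also have "\<dots> = ennreal ((l1 \<theta>)\<^sup>2) * (\<integral>\<^sup>+x. ennreal (\<Sum>i\<in>UNIV. shape_at i r (x ` {..<k})) * indicator (?O - ?I) (x (k - 1)) \<partial>PiM {..<k} (\<lambda>_. lborel))"
  proof (rule nn_integral_cmult)
    have "(\<lambda>x. x (k - 1)) \<in> borel_measurable (PiM {..<k} (\<lambda>_. borel :: (real^'d) measure))"
      by (rule measurable_component_singleton) (use k_pos in auto)
    moreover have "(indicator (?O - ?I) :: real^'d \<Rightarrow> ennreal) \<in> borel_measurable borel" using sets by simp
    ultimately have "(\<lambda>x. indicator (?O - ?I) (x (k - 1)) :: ennreal) \<in> borel_measurable (PiM {..<k} (\<lambda>_. borel))"
      by (rule measurable_compose)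
    then show "(\<lambda>x. ennreal (\<Sum>i\<in>UNIV. shape_at i r (x ` {..<k})) * indicator (?O - ?I) (x (k - 1))) \<in> borel_measurable (PiM {..<k} (\<lambda>_. lborel))"
      unfolding measurable_lborel_tuples
      by (intro borel_measurable_times_ennreal measurable_compose[OF _ measurable_ennreal] borel_measurable_sum measurable_shape_at)
  qed
  also have "\<dots> = ennreal ((l1 \<theta>)\<^sup>2) * (ennreal ((1 / real J + 2 * (r * R)) ^ CARD('d) - (1 / real J - 2 * (r * R)) ^ CARD('d)) * ennreal (r ^ (CARD('d) * (k - 1))) * ennreal v1)"
    using sets anchored_sum[OF r _ v1(2), of "?O - ?I"] by (simp add: em)
  also have "\<dots> = ennreal ((l1 \<theta>)\<^sup>2 * (((1 / real J + 2 * (r * R)) ^ CARD('d) - (1 / real J - 2 * (r * R)) ^ CARD('d)) * r ^ (CARD('d) * (k - 1)) * v1))"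
    using powle r v1(1) by (simp add: ennreal_mult)
  finally show ?thesis .
qed

end



section \<open>Decomposition of the component count of a Poisson process\<close>

lemma exp_sum_le_average:
  fixes u :: "'i \<Rightarrow> real"
  assumes "finite C" "C \<noteq> {}"
  shows "exp (\<Sum>q\<in>C. u q) \<le> (\<Sum>q\<in>C. exp (real (card C) * u q)) / real (card C)"
proof -
  have c: "real (card C) > 0" using assms by (simp add: card_gt_0_iff)
  have "exp (\<Sum>q\<in>C. (1 / real (card C)) *\<^sub>R (real (card C) * u q)) \<le> (\<Sum>q\<in>C. (1 / real (card C)) * exp (real (card C) * u q))"
    using c assms by (intro convex_on_sum[OF assms exp_convex]) auto
  then show ?thesis using c by (simp add: sum_divide_distrib)
qed

text \<open>The mesh \<open>1 / J\<close> exceeds the interaction range. The constant \<open>K\<close> bounds the terms of a cell, and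
  \<open>v1\<close> measures the tuples that form a component at scale 1.\<close>

locale cell_decomposition = shapes k \<Gamma> t dim + void_process M X c "unit_cube :: (real ^ 'd) set"
  for k :: nat and \<Gamma> :: "'m::finite \<Rightarrow> 'v pair_pre_digraph" and t :: "'m \<Rightarrow> real"
    and dim :: "(real ^ 'd::finite) itself"
    and M :: "'w measure" and X :: "'w \<Rightarrow> (real ^ 'd) set" and c :: real +
  fixes \<theta> :: "real ^ 'm" and r :: real and J :: nat and K v1 :: real
  assumes X_sub: "\<omega> \<in> space M \<Longrightarrow> X \<omega> \<subseteq> unit_cube"
    and r: "r > 0" and J: "J > 0" and rR: "2 * (r * R) \<le> 1 / real J"
    and stat_K: "z \<in> cells J \<Longrightarrow> finite Y \<Longrightarrow> Y \<subseteq> cell J z \<Longrightarrow> \<bar>stat \<theta> r Y\<bar> \<le> K"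
    and share_K: "z \<in> cells J \<Longrightarrow> finite Y \<Longrightarrow> \<bar>stat_share \<theta> r (cell J z) Y\<bar> \<le> K"
    and v1: "v1 \<ge> 0" "(\<integral>\<^sup>+y. ennreal (\<Sum>i\<in>UNIV. shape0 i y) \<partial>lborel_tuples k) = ennreal v1"
begin

lemma K_nonneg: "K \<ge> 0"
proof -
  have "(\<lambda>_. 0) \<in> (cells J :: ('d \<Rightarrow> int) set)" using J by (auto simp: cells_def)
  from stat_K[OF this, of "{}"] show ?thesis by (simp add: stat_empty)
qed

text \<open>
  The count is split as follows. A cell counts the components that the points inside it form
  by themselves; these terms are independent. The edge term of a cell corrects its count to its share
  of the components of the full configuration, and depends on the points in the
  neighbouring cells only.
\<close>

abbreviation "inner_stat z Y \<equiv> stat \<theta> r (Y \<inter> cell J z)"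
abbreviation "edge_stat z Y \<equiv> stat_share \<theta> r (cell J z) Y - stat \<theta> r (Y \<inter> cell J z)"

definition inside :: "('d \<Rightarrow> int) \<Rightarrow> 'w \<Rightarrow> real" where "inside z \<omega> = inner_stat z (X \<omega> \<inter> cell J z)"
definition edge :: "('d \<Rightarrow> int) \<Rightarrow> 'w \<Rightarrow> real" where "edge z \<omega> = edge_stat z (X \<omega> \<inter> nbhd J z)"

definition inside_sum :: "'w \<Rightarrow> real" where "inside_sum \<omega> = (\<Sum>z\<in>cells J. inside z \<omega> - expectation (inside z))"
definition edge_sum :: "'w \<Rightarrow> real" where "edge_sum \<omega> = (\<Sum>z\<in>cells J. edge z \<omega> - expectation (edge z))"

lemma finite_X: "\<omega> \<in> space M \<Longrightarrow> finite (X \<omega>)"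
  using measurable_space[OF X_meas] by simp

lemma measurable_inner_stat: "inner_stat z \<in> borel_measurable conf"
  by (rule measurable_compose[OF measurable_conf_Int[OF sets_cell] measurable_stat])

lemma measurable_edge_stat: "edge_stat z \<in> borel_measurable conf"
  by (intro borel_measurable_diff measurable_stat_share measurable_inner_stat sets_cell)

lemma inner_stat_bound: "z \<in> cells J \<Longrightarrow> finite Y \<Longrightarrow> \<bar>inner_stat z Y\<bar> \<le> K"
  by (rule stat_K) auto

lemma edge_stat_bound: "z \<in> cells J \<Longrightarrow> finite Y \<Longrightarrow> \<bar>edge_stat z Y\<bar> \<le> 2 * K"
  using inner_stat_bound[of z Y] share_K[of z Y] by linarith

lemma inner_stat_zero: "finite Y \<Longrightarrow> card Y < k \<Longrightarrow> inner_stat z Y = 0"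
  using card_mono[of Y "Y \<inter> cell J z"] by (intro stat_card_less) auto

lemma edge_stat_zero: "finite Y \<Longrightarrow> card Y < k \<Longrightarrow> edge_stat z Y = 0"
  using inner_stat_zero[of Y z] by (simp add: stat_share_card_less)

lemma measurable_inside: "inside z \<in> borel_measurable M"
  unfolding inside_def[abs_def]
  by (rule measurable_compose[OF measurable_compose[OF X_meas measurable_conf_Int[OF sets_cell]] measurable_inner_stat])

lemma measurable_edge: "edge z \<in> borel_measurable M"
  unfolding edge_def[abs_def]
  by (rule measurable_compose[OF measurable_compose[OF X_meas measurable_conf_Int[OF sets_nbhd]] measurable_edge_stat])

lemma inside_bound: "z \<in> cells J \<Longrightarrow> \<omega> \<in> space M \<Longrightarrow> \<bar>inside z \<omega>\<bar> \<le> K"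
  unfolding inside_def using finite_X by (intro inner_stat_bound) auto

lemma edge_bound: "z \<in> cells J \<Longrightarrow> \<omega> \<in> space M \<Longrightarrow> \<bar>edge z \<omega>\<bar> \<le> 2 * K"
  unfolding edge_def using finite_X by (intro edge_stat_bound) auto

lemma stat_decomposition: "\<omega> \<in> space M \<Longrightarrow> stat \<theta> r (X \<omega>) = (\<Sum>z\<in>cells J. inside z \<omega>) + (\<Sum>z\<in>cells J. edge z \<omega>)"
proof -
  assume \<omega>: "\<omega> \<in> space M"
  have rR1: "r * R \<le> 1 / real J" using rR r R_pos mult_pos_pos[OF r R_pos] by linarith
  have eq: "X \<omega> \<inter> nbhd J z \<inter> cell J z = X \<omega> \<inter> cell J z" "X \<omega> \<inter> cell J z \<inter> cell J z = X \<omega> \<inter> cell J z" for z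
    using cell_subset_nbhd[OF J] by blast+
  have "inside z \<omega> + edge z \<omega> = stat_share \<theta> r (cell J z) (X \<omega>)" for z
    unfolding inside_def edge_def eq stat_share_local[OF J r rR1 finite_X[OF \<omega>] X_sub[OF \<omega>]] by simp
  then show ?thesis
    unfolding sum.distrib[symmetric] using sum_stat_share[OF J r finite_X[OF \<omega>] X_sub[OF \<omega>]] by simp
qed

lemma centered_stat: "\<omega> \<in> space M \<Longrightarrow> stat \<theta> r (X \<omega>) - expectation (\<lambda>\<omega>. stat \<theta> r (X \<omega>)) = inside_sum \<omega> + edge_sum \<omega>"
proof -
  assume \<omega>: "\<omega> \<in> space M"
  have i: "integrable M (inside z)" "integrable M (edge z)" if "z \<in> cells J" for z
    using bounded_integrable[OF measurable_inside inside_bound[OF that]] bounded_integrable[OF measurable_edge edge_bound[OF that]] by blast+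
  have "expectation (\<lambda>\<omega>. stat \<theta> r (X \<omega>)) = expectation (\<lambda>\<omega>. (\<Sum>z\<in>cells J. inside z \<omega>) + (\<Sum>z\<in>cells J. edge z \<omega>))"
    by (rule Bochner_Integration.integral_cong[OF refl stat_decomposition])
  also have "\<dots> = (\<Sum>z\<in>cells J. expectation (inside z)) + (\<Sum>z\<in>cells J. expectation (edge z))"
    using i by (simp add: Bochner_Integration.integral_sum)
  finally show ?thesis
    using stat_decomposition[OF \<omega>] by (simp add: inside_sum_def edge_sum_def sum_subtractf)
qed

definition rho :: real where "rho = c ^ k * r ^ (CARD('d) * (k - 1))"
text \<open>The total error of replacing the law of the points in each cell by the contribution of exactly \<open>k\<close>
  points: a sum over all cells of a bound for
  the probability of at least \<open>k + 1\<close> points.\<close>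

definition err :: real where "err = real J ^ CARD('d) * (c * (1 / real J) ^ CARD('d)) ^ Suc k"

lemma rho_nonneg: "rho \<ge> 0"
  using c_pos r by (simp add: rho_def)

lemma J_pow: "real J ^ CARD('d) * (1 / real J) ^ CARD('d) = 1"
  using J by (simp add: power_divide)

lemma inside_sq_sum_upper:
  "(\<Sum>z\<in>cells J. expectation (\<lambda>\<omega>. (inside z \<omega>)\<^sup>2)) \<le> rho * (\<theta> \<bullet> (gram *v \<theta>)) + K\<^sup>2 * err"
proof -
  let ?g = "\<theta> \<bullet> (gram *v \<theta>)"
  have "(\<Sum>z\<in>(cells J :: ('d \<Rightarrow> int) set). expectation (\<lambda>\<omega>. (inside z \<omega>)\<^sup>2)) 
    \<le> (\<Sum>z\<in>(cells J :: ('d \<Rightarrow> int) set). c ^ k / fact k * ((1 / real J) ^ CARD('d) * r ^ (CARD('d) * (k - 1)) * (fact k * ?g)) + K\<^sup>2 * (c * (1 / real J) ^ CARD('d)) ^ Suc k)"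
  proof (rule sum_mono)
    fix z :: "'d \<Rightarrow> int" assume z: "z \<in> cells J"
    show "expectation (\<lambda>\<omega>. (inside z \<omega>)\<^sup>2) \<le> c ^ k / fact k * ((1 / real J) ^ CARD('d) * r ^ (CARD('d) * (k - 1)) * (fact k * ?g)) + K\<^sup>2 * (c * (1 / real J) ^ CARD('d)) ^ Suc k"
      unfolding inside_def measure_cell[OF J z, symmetric]
      by (rule second_moment_upper[OF window_cell[OF J z] cell_subset_cube[OF J] measurable_inner_stat inner_stat_bound[OF z] inner_stat_zero])
         (use cell_sq_upper[OF r J z, of \<theta>] gram_nonneg r in \<open>simp_all add: measure_cell[OF J z]\<close>)
  qed
  also have "\<dots> = real J ^ CARD('d) * (c ^ k / fact k * ((1 / real J) ^ CARD('d) * r ^ (CARD('d) * (k - 1)) * (fact k * ?g))) + K\<^sup>2 * err"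
    by (simp add: card_cells err_def algebra_simps)
  also have "real J ^ CARD('d) * (c ^ k / fact k * ((1 / real J) ^ CARD('d) * r ^ (CARD('d) * (k - 1)) * (fact k * ?g))) 
    = (real J ^ CARD('d) * (1 / real J) ^ CARD('d)) * (rho * ?g)"
    by (simp add: rho_def)
  finally show ?thesis unfolding J_pow by simp
qed

lemma inside_sq_sum_lower:
  assumes small: "c * (1 / real J) ^ CARD('d) \<le> 1"
  shows "exp (- (c * (1 / real J) ^ CARD('d))) * (rho * (\<theta> \<bullet> (gram *v \<theta>)) * (1 - 2 * (r * R) * real J) ^ CARD('d)) - K\<^sup>2 * err
    \<le> (\<Sum>z\<in>cells J. expectation (\<lambda>\<omega>. (inside z \<omega>)\<^sup>2) - (expectation (inside z))\<^sup>2)"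
proof -
  let ?g = "\<theta> \<bullet> (gram *v \<theta>)" and ?\<mu> = "c * (1 / real J) ^ CARD('d)"
  have \<mu>0: "?\<mu> \<ge> 0" using c_pos by simp
  let ?low = "exp (- ?\<mu>) * (c ^ k / fact k * ((1 / real J - 2 * (r * R)) ^ CARD('d) * r ^ (CARD('d) * (k - 1)) * (fact k * ?g))) - K\<^sup>2 * ?\<mu> ^ Suc k"
  have "(1 - 2 * (r * R) * real J) ^ CARD('d) = (real J * (1 / real J - 2 * (r * R))) ^ CARD('d)"
    using J by (simp add: right_diff_distrib mult_ac)
  then have J2: "(1 - 2 * (r * R) * real J) ^ CARD('d) = real J ^ CARD('d) * (1 / real J - 2 * (r * R)) ^ CARD('d)"
    by (simp only: power_mult_distrib)
  have "exp (- ?\<mu>) * (rho * ?g * (1 - 2 * (r * R) * real J) ^ CARD('d)) - K\<^sup>2 * err = (\<Sum>z\<in>(cells J :: ('d \<Rightarrow> int) set). ?low)"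
    unfolding J2 by (simp add: card_cells err_def rho_def right_diff_distrib)
  also have "\<dots> \<le> (\<Sum>z\<in>cells J. expectation (\<lambda>\<omega>. (inside z \<omega>)\<^sup>2) - (expectation (inside z))\<^sup>2)"
  proof (rule sum_mono)
    fix z :: "'d \<Rightarrow> int" assume z: "z \<in> cells J"
    have 1: "exp (- ?\<mu>) * (c ^ k / fact k * ((1 / real J - 2 * (r * R)) ^ CARD('d) * r ^ (CARD('d) * (k - 1)) * (fact k * ?g))) \<le> expectation (\<lambda>\<omega>. (inside z \<omega>)\<^sup>2)"
      unfolding inside_def measure_cell[OF J z, symmetric]
      by (rule second_moment_lower[OF window_cell[OF J z] cell_subset_cube[OF J] measurable_inner_stat inner_stat_bound[OF z] inner_stat_zero])
         (use cell_sq_lower[OF r J z rR, of \<theta>] gram_nonneg r rR in \<open>simp_all add: measure_cell[OF J z]\<close>)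
    have "\<bar>expectation (inside z)\<bar> \<le> K * (c * measure lborel (cell J z)) ^ k"
      unfolding inside_def[abs_def]
      by (rule first_moment[OF window_cell[OF J z] cell_subset_cube[OF J] measurable_inner_stat inner_stat_bound[OF z] inner_stat_zero])
    then have "\<bar>expectation (inside z)\<bar> \<le> K * ?\<mu> ^ k" unfolding measure_cell[OF J z] .
    then have "(expectation (inside z))\<^sup>2 \<le> (K * ?\<mu> ^ k)\<^sup>2" using K_nonneg \<mu>0 by (intro power2_le_iff_abs_le[THEN iffD2]) auto
    also have "\<dots> = K\<^sup>2 * ?\<mu> ^ (k + k)" by (simp only: power_mult_distrib power2_eq_square power_add) (simp add: mult_ac)
    also have "\<dots> \<le> K\<^sup>2 * ?\<mu> ^ Suc k" using \<mu>0 small k2 by (intro mult_left_mono power_decreasing) auto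
    finally show "?low \<le> expectation (\<lambda>\<omega>. (inside z \<omega>)\<^sup>2) - (expectation (inside z))\<^sup>2" using 1 by linarith
  qed
  finally show ?thesis .
qed

lemma edge_sq_sum_upper:
  "(\<Sum>z\<in>cells J. expectation (\<lambda>\<omega>. (edge z \<omega>)\<^sup>2))
    \<le> rho * ((l1 \<theta>)\<^sup>2 * v1 * ((1 + 2 * (r * R) * real J) ^ CARD('d) - (1 - 2 * (r * R) * real J) ^ CARD('d)))
      + 4 * K\<^sup>2 * (3 ^ CARD('d)) ^ Suc k * err"
proof -
  let ?dp = "(1 / real J + 2 * (r * R)) ^ CARD('d) - (1 / real J - 2 * (r * R)) ^ CARD('d)"
  have dp: "?dp \<ge> 0" using r R_pos rR by (simp add: power_mono)
  have "(1 + 2 * (r * R) * real J) ^ CARD('d) = (real J * (1 / real J + 2 * (r * R))) ^ CARD('d)"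
    "(1 - 2 * (r * R) * real J) ^ CARD('d) = (real J * (1 / real J - 2 * (r * R))) ^ CARD('d)"
    using J by (simp_all add: right_diff_distrib distrib_left mult_ac)
  then have P: "(1 + 2 * (r * R) * real J) ^ CARD('d) = real J ^ CARD('d) * (1 / real J + 2 * (r * R)) ^ CARD('d)"
    "(1 - 2 * (r * R) * real J) ^ CARD('d) = real J ^ CARD('d) * (1 / real J - 2 * (r * R)) ^ CARD('d)"
    by (simp_all only: power_mult_distrib)
  have J2: "(1 + 2 * (r * R) * real J) ^ CARD('d) - (1 - 2 * (r * R) * real J) ^ CARD('d) = real J ^ CARD('d) * ?dp"
    by (simp only: P right_diff_distrib)
  let ?\<mu> = "c * (3 / real J) ^ CARD('d)"
  have three: "?\<mu> = 3 ^ CARD('d) * (c * (1 / real J) ^ CARD('d))" by (simp add: power_divide)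
  have "(\<Sum>z\<in>(cells J :: ('d \<Rightarrow> int) set). expectation (\<lambda>\<omega>. (edge z \<omega>)\<^sup>2)) 
    \<le> (\<Sum>z\<in>(cells J :: ('d \<Rightarrow> int) set). c ^ k / 1 * ((l1 \<theta>)\<^sup>2 * (?dp * r ^ (CARD('d) * (k - 1)) * v1)) + (2 * K)\<^sup>2 * ?\<mu> ^ Suc k)"
  proof (rule sum_mono)
    fix z :: "'d \<Rightarrow> int" assume z: "z \<in> cells J"
    let ?t = "(l1 \<theta>)\<^sup>2 * (?dp * r ^ (CARD('d) * (k - 1)) * v1)"
    have t0: "?t \<ge> 0" using dp r v1 by simp
    have "expectation (\<lambda>\<omega>. (edge z \<omega>)\<^sup>2) \<le> c ^ k / fact k * ?t + (2 * K)\<^sup>2 * (c * measure lborel (nbhd J z)) ^ Suc k"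
      unfolding edge_def
      by (rule second_moment_upper[OF window_nbhd[OF J z] nbhd_subset_cube[OF J] measurable_edge_stat edge_stat_bound[OF z] edge_stat_zero])
         (use boundary_sq_upper[OF r J z rR v1, of \<theta>] t0 in simp_all)
    also have "\<dots> \<le> c ^ k / 1 * ?t + (2 * K)\<^sup>2 * ?\<mu> ^ Suc k"
      using c_pos t0 measure_nbhd_le[OF J, of z] fact_ge_1[of k, where ?'a = real]
      by (intro add_mono mult_right_mono mult_left_mono power_mono divide_left_mono) auto
    finally show "expectation (\<lambda>\<omega>. (edge z \<omega>)\<^sup>2) \<le> c ^ k / 1 * ?t + (2 * K)\<^sup>2 * ?\<mu> ^ Suc k" .
  qed
  also have "\<dots> = rho * ((l1 \<theta>)\<^sup>2 * v1 * (real J ^ CARD('d) * ?dp)) + 4 * K\<^sup>2 * (3 ^ CARD('d)) ^ Suc k * err"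
    unfolding three power_mult_distrib[of "3 ^ CARD('d)"]
    by (simp add: card_cells err_def rho_def power_mult_distrib[of 2 K] distrib_left mult_ac)
  finally show ?thesis unfolding J2 .
qed

lemma indep_inside: "indep_vars (\<lambda>_. borel) inside (cells J)"
  unfolding inside_def[abs_def]
  by (rule indep_vars_compose2[OF indep_restrict, of "cells J" "cell J" inner_stat])
     (auto simp: disjoint_family_on_def measurable_inner_stat dest: cell_disjoint[OF J])

text \<open>Two cells of the same colour have disjoint neighbourhoods.\<close>

definition colours :: "('d \<Rightarrow> int) set" where "colours = PiE UNIV (\<lambda>_. {0..<3})"

definition class_of :: "('d \<Rightarrow> int) \<Rightarrow> ('d \<Rightarrow> int) set" where
  "class_of q = {z \<in> cells J. (\<lambda>i. z i mod 3) = q}"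

lemma finite_colours: "finite colours" "card colours = 3 ^ CARD('d)" "colours \<noteq> {}"
proof -
  show f: "finite colours" unfolding colours_def by (rule finite_PiE) auto
  show c: "card colours = 3 ^ CARD('d)" unfolding colours_def by (subst card_PiE) auto
  show "colours \<noteq> {}" using c by auto
qed

lemma indep_edge: "indep_vars (\<lambda>_. borel) edge (class_of q)"
  unfolding edge_def[abs_def]
proof (rule indep_vars_compose2[OF indep_restrict, of "class_of q" "nbhd J" edge_stat])
  show "disjoint_family_on (nbhd J) (class_of q)"
    unfolding disjoint_family_on_def
  proof (intro ballI impI)
    fix z z' assume z: "z \<in> class_of q" "z' \<in> class_of q" "z \<noteq> z'"
    then have "(\<lambda>i. z i mod 3) = (\<lambda>i. z' i mod 3)" by (simp add: class_of_def)
    then have "\<forall>i. z i mod 3 = z' i mod 3" by (simp add: fun_eq_iff)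
    with z(3) show "nbhd J z \<inter> nbhd J z' = {}" by (rule nbhd_disjoint[OF J])
  qed
qed (auto simp: measurable_edge_stat)

lemma sum_classes: "(\<Sum>q\<in>colours. \<Sum>z\<in>class_of q. f z) = (\<Sum>z\<in>cells J. f z)"
  unfolding class_of_def
  by (rule sum.group[OF finite_cells finite_colours(1)]) (auto simp: colours_def)

lemma inside_mgf_upper:
  "expectation (\<lambda>\<omega>. exp (l * inside_sum \<omega>))
    \<le> exp (l\<^sup>2 / 2 * exp (2 * K * \<bar>l\<bar>) * (rho * (\<theta> \<bullet> (gram *v \<theta>)) + K\<^sup>2 * err))"
proof -
  have "expectation (\<lambda>\<omega>. exp (l * inside_sum \<omega>)) \<le> exp (l\<^sup>2 / 2 * exp (2 * K * \<bar>l\<bar>) * (\<Sum>z\<in>cells J. expectation (\<lambda>\<omega>. (inside z \<omega>)\<^sup>2)))"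
    unfolding inside_sum_def by (rule mgf_indep_upper[OF finite_cells indep_inside inside_bound])
  also have "\<dots> \<le> exp (l\<^sup>2 / 2 * exp (2 * K * \<bar>l\<bar>) * (rho * (\<theta> \<bullet> (gram *v \<theta>)) + K\<^sup>2 * err))"
    using inside_sq_sum_upper by (intro iffD2[OF exp_le_cancel_iff] mult_left_mono) auto
  finally show ?thesis .
qed

lemma inside_mgf_lower:
  assumes "c * (1 / real J) ^ CARD('d) \<le> 1"
  shows "exp (l\<^sup>2 / 2 * exp (- (2 * K * \<bar>l\<bar>)) * (exp (- (c * (1 / real J) ^ CARD('d))) * (rho * (\<theta> \<bullet> (gram *v \<theta>)) * (1 - 2 * (r * R) * real J) ^ CARD('d)) - K\<^sup>2 * err) / (1 + l\<^sup>2 * K\<^sup>2))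
    \<le> expectation (\<lambda>\<omega>. exp (l * inside_sum \<omega>))"
proof -
  have "exp (l\<^sup>2 / 2 * exp (- (2 * K * \<bar>l\<bar>)) * (exp (- (c * (1 / real J) ^ CARD('d))) * (rho * (\<theta> \<bullet> (gram *v \<theta>)) * (1 - 2 * (r * R) * real J) ^ CARD('d)) - K\<^sup>2 * err) / (1 + l\<^sup>2 * K\<^sup>2))
    \<le> exp (l\<^sup>2 / 2 * exp (- (2 * K * \<bar>l\<bar>)) * (\<Sum>z\<in>cells J. expectation (\<lambda>\<omega>. (inside z \<omega>)\<^sup>2) - (expectation (inside z))\<^sup>2) / (1 + l\<^sup>2 * K\<^sup>2))"
    using inside_sq_sum_lower[OF assms]
    by (intro iffD2[OF exp_le_cancel_iff] divide_right_mono mult_left_mono) (auto intro: add_nonneg_nonneg)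
  also have "\<dots> \<le> expectation (\<lambda>\<omega>. exp (l * inside_sum \<omega>))"
    unfolding inside_sum_def by (rule mgf_indep_lower[OF finite_cells indep_inside inside_bound])
  finally show ?thesis .
qed

lemma inside_exp_integrable: "integrable M (\<lambda>\<omega>. exp (l * inside_sum \<omega>))"
  unfolding inside_sum_def by (rule mgf_indep_integrable[OF finite_cells indep_inside inside_bound])

lemma class_bound: "z \<in> class_of q \<Longrightarrow> \<omega> \<in> space M \<Longrightarrow> \<bar>edge z \<omega>\<bar> \<le> 2 * K"
  by (rule edge_bound) (auto simp: class_of_def)

lemma finite_class: "finite (class_of q)"
  by (rule finite_subset[OF _ finite_cells[of J]]) (auto simp: class_of_def)

lemma edge_exp_le:
  "exp (l * edge_sum \<omega>) \<le> (\<Sum>q\<in>colours. exp ((3 ^ CARD('d) * l) * (\<Sum>z\<in>class_of q. edge z \<omega> - expectation (edge z)))) / 3 ^ CARD('d)"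
proof -
  have "exp (l * edge_sum \<omega>) = exp (\<Sum>q\<in>colours. l * (\<Sum>z\<in>class_of q. edge z \<omega> - expectation (edge z)))"
    unfolding edge_sum_def sum_distrib_left[symmetric] sum_classes ..
  also have "\<dots> \<le> (\<Sum>q\<in>colours. exp (real (card colours) * (l * (\<Sum>z\<in>class_of q. edge z \<omega> - expectation (edge z))))) / real (card colours)"
    by (rule exp_sum_le_average[OF finite_colours(1,3)])
  finally show ?thesis by (simp add: finite_colours(2) mult.assoc)
qed

lemma edge_sum_measurable: "edge_sum \<in> borel_measurable M"
  unfolding edge_sum_def[abs_def] by (intro borel_measurable_sum borel_measurable_diff measurable_edge borel_measurable_const)

lemma edge_majorant_integrable:
  "integrable M (\<lambda>\<omega>. (\<Sum>q\<in>colours. exp ((3 ^ CARD('d) * l) * (\<Sum>z\<in>class_of q. edge z \<omega> - expectation (edge z)))) / 3 ^ CARD('d))"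
  by (intro integrable_divide Bochner_Integration.integrable_sum mgf_indep_integrable[OF finite_class indep_edge class_bound])

lemma edge_exp_integrable: "integrable M (\<lambda>\<omega>. exp (l * edge_sum \<omega>))"
proof (rule Bochner_Integration.integrable_bound[OF edge_majorant_integrable[of l]])
  show "(\<lambda>\<omega>. exp (l * edge_sum \<omega>)) \<in> borel_measurable M"
    using edge_sum_measurable by simp
  show "AE \<omega> in M. norm (exp (l * edge_sum \<omega>)) \<le> norm ((\<Sum>q\<in>colours. exp ((3 ^ CARD('d) * l) * (\<Sum>z\<in>class_of q. edge z \<omega> - expectation (edge z)))) / 3 ^ CARD('d))"
    by (intro AE_I2) (simp only: real_norm_def abs_exp_cancel, rule order.trans[OF edge_exp_le abs_ge_self])
qed

text \<open>Neighbouring edge terms are dependent. Splitting them by colour into sums of independent terms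
  costs only constants, since the exponential of a sum is at most the average of the exponentials
  of the multiples of its terms.\<close>

lemma edge_mgf_upper:
  "expectation (\<lambda>\<omega>. exp (l * edge_sum \<omega>))
    \<le> exp ((3 ^ CARD('d) * l)\<^sup>2 / 2 * exp (4 * K * \<bar>3 ^ CARD('d) * l\<bar>) *
        (rho * ((l1 \<theta>)\<^sup>2 * v1 * ((1 + 2 * (r * R) * real J) ^ CARD('d) - (1 - 2 * (r * R) * real J) ^ CARD('d)))
         + 4 * K\<^sup>2 * (3 ^ CARD('d)) ^ Suc k * err))" (is "_ \<le> ?E")
proof -
  let ?l = "3 ^ CARD('d) * l"
  let ?f = "\<lambda>q \<omega>. exp (?l * (\<Sum>z\<in>class_of q. edge z \<omega> - expectation (edge z)))"
  have each: "expectation (?f q) \<le> ?E" if q: "q \<in> colours" for q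
  proof -
    have "expectation (?f q) \<le> exp (?l\<^sup>2 / 2 * exp (2 * (2 * K) * \<bar>?l\<bar>) * (\<Sum>z\<in>class_of q. expectation (\<lambda>\<omega>. (edge z \<omega>)\<^sup>2)))"
      by (rule mgf_indep_upper[OF finite_class indep_edge class_bound])
    also have "\<dots> \<le> exp (?l\<^sup>2 / 2 * exp (2 * (2 * K) * \<bar>?l\<bar>) * (\<Sum>z\<in>cells J. expectation (\<lambda>\<omega>. (edge z \<omega>)\<^sup>2)))"
      by (intro iffD2[OF exp_le_cancel_iff] mult_left_mono sum_mono2 finite_cells)
         (auto simp: class_of_def)
    also have "2 * (2 * K) = 4 * K" by simp
    also have "exp (?l\<^sup>2 / 2 * exp (4 * K * \<bar>?l\<bar>) * (\<Sum>z\<in>cells J. expectation (\<lambda>\<omega>. (edge z \<omega>)\<^sup>2))) \<le> ?E"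
      using edge_sq_sum_upper by (intro iffD2[OF exp_le_cancel_iff] mult_left_mono) auto
    finally show ?thesis .
  qed
  have "expectation (\<lambda>\<omega>. exp (l * edge_sum \<omega>)) \<le> expectation (\<lambda>\<omega>. (\<Sum>q\<in>colours. ?f q \<omega>) / 3 ^ CARD('d))"
    by (intro integral_mono edge_exp_integrable edge_majorant_integrable edge_exp_le)
  also have "\<dots> = (\<Sum>q\<in>colours. expectation (?f q)) / 3 ^ CARD('d)"
    by (simp add: Bochner_Integration.integral_sum mgf_indep_integrable[OF finite_class indep_edge class_bound])
  also have "\<dots> \<le> (\<Sum>q\<in>colours. ?E) / 3 ^ CARD('d)" by (intro divide_right_mono sum_mono each) auto
  also have "\<dots> = ?E" by (simp add: finite_colours(2))
  finally show ?thesis .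
qed

end



section \<open>Moment generating function of the Poisson component count\<close>

lemma floor_ge_half: "x \<ge> 1 \<Longrightarrow> x / 2 \<le> real_of_int \<lfloor>x\<rfloor>" for x :: real
proof (cases "x \<ge> 2")
  case False
  assume "x \<ge> 1"
  then have "1 \<le> \<lfloor>x\<rfloor>" by simp
  then have "1 \<le> real_of_int \<lfloor>x\<rfloor>" by linarith
  then show ?thesis using False by linarith
qed linarith

lemma (in cell_decomposition) stat_integrable: "integrable M (\<lambda>\<omega>. stat \<theta> r (X \<omega>))"
proof -
  have "integrable M (\<lambda>\<omega>. (\<Sum>z\<in>cells J. inside z \<omega>) + (\<Sum>z\<in>cells J. edge z \<omega>))"
    using bounded_integrable[OF measurable_inside inside_bound] bounded_integrable[OF measurable_edge edge_bound]
    by (intro Bochner_Integration.integrable_add Bochner_Integration.integrable_sum)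
  then show ?thesis
    by (rule Bochner_Integration.integrable_cong[THEN iffD1, rotated -1]) (simp_all add: stat_decomposition)
qed

lemma factor_out_speed:
  fixes T q l E p b c x F W N :: real
  shows "(q * l)\<^sup>2 / 2 * E * (p * b + c * (p * x)) = (l\<^sup>2 * p) * (q\<^sup>2 / 2 * E * (b + c * x))"
    and "(q * l)\<^sup>2 / 2 * E * (F * (p * b * W) - c * (p * x)) / N = (l\<^sup>2 * p) * (q\<^sup>2 / 2 * E * (F * (b * W) - c * x) / N)"
    and "(T * (q * l))\<^sup>2 / 2 * E * (p * b + c * (p * x)) = (l\<^sup>2 * p) * ((T * q)\<^sup>2 / 2 * E * (b + c * x))"
  by (simp_all add: power2_eq_square algebra_simps)

text \<open>The parameter \<open>lam\<close> at which moment generating functions are taken is \<open>b / \<rho>\<close> for deviations of size \<open>b\<close>,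
  and \<open>a\<close> is then \<open>b\<^sup>2 / \<rho>\<close>, the speed of the principle.\<close>

locale sparse_regime = shapes k \<Gamma> t dim
  for k :: nat and \<Gamma> :: "'m::finite \<Rightarrow> 'v pair_pre_digraph" and t :: "'m \<Rightarrow> real"
    and dim :: "(real ^ 'd::finite) itself" +
  fixes r \<rho> lam a :: "nat \<Rightarrow> real"
  assumes r_pos: "\<And>n. r n > 0" and r_lim: "r \<longlonglongrightarrow> 0"
    and rho_def: "\<And>n. \<rho> n = real n ^ k * r n ^ (CARD('d) * (k - 1))"
    and sparse: "(\<lambda>n. real n * r n ^ CARD('d)) \<longlonglongrightarrow> 0"
    and lam_nonneg: "\<And>n. lam n \<ge> 0" and lam_lim: "lam \<longlonglongrightarrow> 0"
    and a_def: "\<And>n. a n = (lam n)\<^sup>2 * \<rho> n"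
    and a_lim: "filterlim a at_top sequentially"
begin

lemma rho_nonneg: "\<rho> n \<ge> 0" unfolding rho_def using r_pos[of n] by simp

lemma a_pos: "\<forall>\<^sub>F n in sequentially. a n > 0"
  using a_lim by (simp add: filterlim_at_top_dense)

definition mesh :: "real \<Rightarrow> nat \<Rightarrow> nat" where "mesh L n = nat \<lfloor>1 / (L * r n)\<rfloor>"

lemma mesh_eventually:
  assumes "L > 0"
  shows "\<forall>\<^sub>F n in sequentially. mesh L n > 0 \<and> 1 / real (mesh L n) \<le> 2 * L * r n \<and> r n * real (mesh L n) \<le> 1 / L"
proof -
  have "(\<lambda>n. L * r n) \<longlonglongrightarrow> L * 0" by (intro tendsto_intros r_lim)
  then have "\<forall>\<^sub>F n in sequentially. L * r n < 1" by (rule order_tendstoD) simp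
  then show ?thesis
  proof eventually_elim
    case (elim n)
    have Lr: "0 < L * r n" using assms r_pos[of n] by simp
    define x where "x = 1 / (L * r n)"
    have x: "x \<ge> 1" using Lr elim by (simp add: x_def)
    have "0 \<le> \<lfloor>x\<rfloor>" unfolding zero_le_floor using x by linarith
    then have J: "real (mesh L n) = real_of_int \<lfloor>x\<rfloor>" unfolding mesh_def x_def[symmetric] by (rule of_nat_nat)
    have J1: "x / 2 \<le> real (mesh L n)" unfolding J by (rule floor_ge_half[OF x])
    then have pos: "real (mesh L n) > 0" using x by linarith
    have "1 / real (mesh L n) \<le> 1 / (x / 2)" using J1 x pos by (intro divide_left_mono) auto
    also have "\<dots> = 2 * L * r n" by (simp add: x_def)
    finally have 1: "1 / real (mesh L n) \<le> 2 * L * r n" .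
    have "real (mesh L n) \<le> x" unfolding J by simp
    then have "r n * real (mesh L n) \<le> r n * x" using r_pos[of n] by (intro mult_left_mono) auto
    also have "\<dots> = 1 / L" using r_pos[of n] assms by (simp add: x_def)
    finally show ?case using 1 pos by simp
  qed
qed

text \<open>For a fixed ratio \<open>L\<close> of the mesh to \<open>r\<close>, all error terms of the decomposition tend to 0, except those
  that come from the boundaries of the cells. They remain as the dependence on \<open>L\<close>.\<close>

lemma decomposition_mgf:
  fixes M :: "nat \<Rightarrow> 'w measure" and X :: "nat \<Rightarrow> 'w \<Rightarrow> (real ^ 'd) set" and \<theta> :: "real ^ 'm"
  assumes process: "\<forall>n>0. void_process (M n) (X n) (real n) unit_cube"
    and in_cube: "\<forall>n. \<forall>\<omega>\<in>space (M n). X n \<omega> \<subseteq> unit_cube"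
    and L: "L \<ge> 2 * R" and e: "e > 0"
    and v1: "v1 \<ge> 0" "(\<integral>\<^sup>+y. ennreal (\<Sum>i\<in>UNIV. shape0 i y) \<partial>lborel_tuples k) = ennreal v1"
  defines "Q \<equiv> \<theta> \<bullet> (gram *v \<theta>)"
  shows "\<forall>\<^sub>F n in sequentially. integrable (M n) (\<lambda>\<omega>. stat \<theta> (r n) (X n \<omega>)) \<and> (\<exists>A B :: 'w \<Rightarrow> real.
     (\<forall>\<omega>\<in>space (M n). stat \<theta> (r n) (X n \<omega>) - (\<integral>\<omega>. stat \<theta> (r n) (X n \<omega>) \<partial>M n) = A \<omega> + B \<omega>) \<and>
     (\<forall>l. integrable (M n) (\<lambda>\<omega>. exp (l * A \<omega>)) \<and> integrable (M n) (\<lambda>\<omega>. exp (l * B \<omega>))) \<and>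
     (\<integral>\<omega>. exp (p * lam n * A \<omega>) \<partial>M n) \<le> exp (a n * (p\<^sup>2 / 2 * Q + e)) \<and>
     (\<integral>\<omega>. exp (s * lam n * A \<omega>) \<partial>M n) \<ge> exp (a n * (s\<^sup>2 / 2 * (Q * (1 - 2 * R / L) ^ CARD('d)) - e)) \<and>
     (\<forall>q\<in>{q1, q2}. (\<integral>\<omega>. exp (q * lam n * B \<omega>) \<partial>M n)
        \<le> exp (a n * ((3 ^ CARD('d) * q)\<^sup>2 / 2 * ((l1 \<theta>)\<^sup>2 * v1 * ((1 + 2 * R / L) ^ CARD('d) - (1 - 2 * R / L) ^ CARD('d))) + e))))"
proof -
  note proc = process[rule_format] and sub = in_cube[rule_format]
  have Lpos: "L > 0" using L R_pos by linarith
  let ?d = "CARD('d)"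
  obtain K where K: "K \<ge> 0"
    "\<And>r z X. r > 0 \<Longrightarrow> finite X \<Longrightarrow> X \<subseteq> cball z (r * (2 * real ?d * L)) \<Longrightarrow> \<bar>stat \<theta> r X\<bar> \<le> K"
    "\<And>r z X c. r > 0 \<Longrightarrow> finite X \<Longrightarrow> c \<subseteq> cball z (r * (2 * real ?d * L)) \<Longrightarrow> \<bar>stat_share \<theta> r c X\<bar> \<le> K"
    using stat_bounds[of "2 * real ?d * L" \<theta>] by blast
  have Q0: "Q \<ge> 0" unfolding Q_def by (rule gram_nonneg)
  define w where "w = 2 * R / L"
  have w: "0 \<le> w" "w \<le> 1" using L Lpos R_pos by (simp_all add: w_def)
  define C where "C = (2 * L) ^ (?d * k)"
  have C0: "C \<ge> 0" using Lpos by (simp add: C_def)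
  let ?u = "\<lambda>n. real n * r n ^ CARD('d)"
  have lim1: "(\<lambda>n. p\<^sup>2 / 2 * exp (2 * K * \<bar>p * lam n\<bar>) * (Q + K\<^sup>2 * (C * ?u n))) \<longlonglongrightarrow> p\<^sup>2 / 2 * exp (2 * K * \<bar>p * 0\<bar>) * (Q + K\<^sup>2 * (C * 0))"
    by (intro tendsto_intros lam_lim sparse)
  have ev1: "\<forall>\<^sub>F n in sequentially. p\<^sup>2 / 2 * exp (2 * K * \<bar>p * lam n\<bar>) * (Q + K\<^sup>2 * (C * ?u n)) < p\<^sup>2 / 2 * Q + e"
    by (rule order_tendstoD(2)[OF lim1]) (use e in simp)
  have lim2: "(\<lambda>n. s\<^sup>2 / 2 * exp (- (2 * K * \<bar>s * lam n\<bar>)) * (exp (- ((2 * L) ^ ?d * ?u n)) * (Q * (1 - w) ^ ?d) - K\<^sup>2 * (C * ?u n)) / (1 + (s * lam n)\<^sup>2 * K\<^sup>2))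
     \<longlonglongrightarrow> s\<^sup>2 / 2 * exp (- (2 * K * \<bar>s * 0\<bar>)) * (exp (- ((2 * L) ^ ?d * 0)) * (Q * (1 - w) ^ ?d) - K\<^sup>2 * (C * 0)) / (1 + (s * 0)\<^sup>2 * K\<^sup>2)"
    by (intro tendsto_intros lam_lim sparse) simp
  have ev2: "\<forall>\<^sub>F n in sequentially. s\<^sup>2 / 2 * (Q * (1 - w) ^ ?d) - e < 
      s\<^sup>2 / 2 * exp (- (2 * K * \<bar>s * lam n\<bar>)) * (exp (- ((2 * L) ^ ?d * ?u n)) * (Q * (1 - w) ^ ?d) - K\<^sup>2 * (C * ?u n)) / (1 + (s * lam n)\<^sup>2 * K\<^sup>2)"
    by (rule order_tendstoD(1)[OF lim2]) (use e in simp)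
  let ?b = "(l1 \<theta>)\<^sup>2 * v1 * ((1 + w) ^ ?d - (1 - w) ^ ?d)"
  have ev3: "\<forall>\<^sub>F n in sequentially. \<forall>q\<in>{q1, q2}. (3 ^ ?d * q)\<^sup>2 / 2 * exp (4 * K * \<bar>3 ^ ?d * (q * lam n)\<bar>) * (?b + 4 * K\<^sup>2 * (3 ^ ?d) ^ Suc k * (C * ?u n))
      < (3 ^ ?d * q)\<^sup>2 / 2 * ?b + e"
  proof (subst eventually_ball_finite_distrib, simp, rule ballI)
    fix q :: real
    have "(\<lambda>n. (3 ^ ?d * q)\<^sup>2 / 2 * exp (4 * K * \<bar>3 ^ ?d * (q * lam n)\<bar>) * (?b + 4 * K\<^sup>2 * (3 ^ ?d) ^ Suc k * (C * ?u n)))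
      \<longlonglongrightarrow> (3 ^ ?d * q)\<^sup>2 / 2 * exp (4 * K * \<bar>3 ^ ?d * (q * 0)\<bar>) * (?b + 4 * K\<^sup>2 * (3 ^ ?d) ^ Suc k * (C * 0))"
      by (intro tendsto_intros lam_lim sparse)
    then show "\<forall>\<^sub>F n in sequentially. (3 ^ ?d * q)\<^sup>2 / 2 * exp (4 * K * \<bar>3 ^ ?d * (q * lam n)\<bar>) * (?b + 4 * K\<^sup>2 * (3 ^ ?d) ^ Suc k * (C * ?u n))
      < (3 ^ ?d * q)\<^sup>2 / 2 * ?b + e"
      by (rule order_tendstoD(2)) (use e in simp)
  qed
  have "(\<lambda>n. (2 * L) ^ ?d * ?u n) \<longlonglongrightarrow> (2 * L) ^ ?d * 0" by (intro tendsto_intros sparse)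
  then have ev4: "\<forall>\<^sub>F n in sequentially. (2 * L) ^ ?d * ?u n < 1" by (rule order_tendstoD) simp
  show ?thesis
    using mesh_eventually[OF Lpos] ev1 ev2 ev3 ev4 eventually_gt_at_top[of 0]
  proof eventually_elim
    case (elim n)
    let ?J = "mesh L n"
    have J: "?J > 0" "1 / real ?J \<le> 2 * L * r n" "r n * real ?J \<le> 1 / L" using elim(1) by auto
    have rJ: "2 * (r n * R) * real ?J \<le> w" 
      using mult_left_mono[OF J(3), of "2 * R"] R_pos by (simp add: w_def mult_ac)
    have rJ0: "0 \<le> 2 * (r n * R) * real ?J" using r_pos[of n] R_pos by simp
    have rR: "2 * (r n * R) \<le> 1 / real ?J" using rJ w(2) J(1) by (simp add: field_simps)
    have radius: "real ?d / real ?J \<le> r n * (2 * real ?d * L)"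
      using mult_left_mono[OF J(2), of "real ?d"] by (simp add: mult_ac)
    have sub_ball: "cell ?J z \<subseteq> cball (\<chi> i. of_int (z i) / real ?J) (r n * (2 * real ?d * L))" for z :: "'d \<Rightarrow> int"
      using cell_subset_cball[OF J(1), of z] subset_cball[OF radius] by blast
    interpret P: void_process "M n" "X n" "real n" unit_cube by (rule proc) (use elim in simp)
    interpret D: cell_decomposition k \<Gamma> t dim "M n" "X n" "real n" \<theta> "r n" ?J K v1
    proof
      show "\<bar>stat \<theta> (r n) Y\<bar> \<le> K" if "z \<in> cells ?J" "finite Y" "Y \<subseteq> cell ?J z" for z Y
        using K(2)[OF r_pos that(2)] that(3) sub_ball[of z] by blast
      show "\<bar>stat_share \<theta> (r n) (cell ?J z) Y\<bar> \<le> K" if "z \<in> cells ?J" "finite Y" for z Y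
        using K(3)[OF r_pos that(2) sub_ball] .
      show "X n \<omega> \<subseteq> unit_cube" if "\<omega> \<in> space (M n)" for \<omega> by (rule sub[OF that])
    qed (rule r_pos J rR v1)+
    have rho: "D.rho = \<rho> n" unfolding D.rho_def rho_def ..
    have mu: "real n * (1 / real ?J) ^ ?d \<le> (2 * L) ^ ?d * ?u n"
    proof -
      have "(1 / real ?J) ^ ?d \<le> (2 * L * r n) ^ ?d" using J by (intro power_mono) auto
      then have "real n * (1 / real ?J) ^ ?d \<le> real n * (2 * L * r n) ^ ?d" by (rule mult_left_mono) simp
      then show ?thesis by (simp add: power_mult_distrib mult_ac)
    qed
    have err: "D.err \<le> \<rho> n * (C * ?u n)"
    proof -
      have "D.err = (real ?J ^ ?d * (1 / real ?J) ^ ?d) * (real n * (real n * (1 / real ?J) ^ ?d) ^ k)"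
        by (simp add: D.err_def)
      also have "\<dots> = real n * (real n * (1 / real ?J) ^ ?d) ^ k" unfolding D.J_pow by simp
      also have "\<dots> \<le> real n * ((2 * L) ^ ?d * ?u n) ^ k" using mu by (intro mult_left_mono power_mono) auto
      also have "\<dots> = \<rho> n * (C * ?u n)"
      proof -
        have "?d * k = ?d * (k - 1) + ?d" using k_pos by (cases k) auto
        then have rexp: "r n ^ (?d * k) = r n ^ (?d * (k - 1)) * r n ^ ?d" by (simp only: power_add)
        have "((2 * L) ^ ?d * ?u n) ^ k = C * (real n ^ k * r n ^ (?d * k))"
          by (simp only: C_def power_mult_distrib power_mult)
        then have "((2 * L) ^ ?d * ?u n) ^ k = C * (real n ^ k * (r n ^ (?d * (k - 1)) * r n ^ ?d))"
          unfolding rexp .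
        then show ?thesis unfolding rho_def by (simp only: mult_ac)
      qed
      finally show ?thesis .
    qed
    have err_small: "real n * (1 / real ?J) ^ ?d \<le> 1" using mu elim(5) by linarith
    have up: "(\<integral>\<omega>. exp (p * lam n * D.inside_sum \<omega>) \<partial>M n) \<le> exp (a n * (p\<^sup>2 / 2 * Q + e))"
    proof -
      have "(p * lam n)\<^sup>2 / 2 * exp (2 * K * \<bar>p * lam n\<bar>) * (D.rho * Q + K\<^sup>2 * D.err)
        \<le> (p * lam n)\<^sup>2 / 2 * exp (2 * K * \<bar>p * lam n\<bar>) * (\<rho> n * Q + K\<^sup>2 * (\<rho> n * (C * ?u n)))"
        using err unfolding rho by (intro mult_left_mono add_left_mono) auto
      also have "\<dots> = a n * (p\<^sup>2 / 2 * exp (2 * K * \<bar>p * lam n\<bar>) * (Q + K\<^sup>2 * (C * ?u n)))"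
        unfolding a_def by (rule factor_out_speed(1))
      also have "\<dots> \<le> a n * (p\<^sup>2 / 2 * Q + e)"
        using elim(2) rho_nonneg[of n] by (intro mult_left_mono) (auto simp: a_def)
      finally show ?thesis using D.inside_mgf_upper[of "p * lam n"] unfolding Q_def by (meson exp_le_cancel_iff order.trans)
    qed
    have lo: "(\<integral>\<omega>. exp (s * lam n * D.inside_sum \<omega>) \<partial>M n) \<ge> exp (a n * (s\<^sup>2 / 2 * (Q * (1 - w) ^ ?d) - e))"
    proof -
      have "a n * (s\<^sup>2 / 2 * (Q * (1 - w) ^ ?d) - e) \<le> a n * (s\<^sup>2 / 2 * exp (- (2 * K * \<bar>s * lam n\<bar>)) * (exp (- ((2 * L) ^ ?d * ?u n)) * (Q * (1 - w) ^ ?d) - K\<^sup>2 * (C * ?u n)) / (1 + (s * lam n)\<^sup>2 * K\<^sup>2))"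
        using elim(3) rho_nonneg[of n] by (intro mult_left_mono) (auto simp: a_def)
      also have "\<dots> = (s * lam n)\<^sup>2 / 2 * exp (- (2 * K * \<bar>s * lam n\<bar>)) * (exp (- ((2 * L) ^ ?d * ?u n)) * (\<rho> n * Q * (1 - w) ^ ?d) - K\<^sup>2 * (\<rho> n * (C * ?u n))) / (1 + (s * lam n)\<^sup>2 * K\<^sup>2)"
        unfolding a_def by (rule factor_out_speed(2)[symmetric])
      also have "\<dots> \<le> (s * lam n)\<^sup>2 / 2 * exp (- (2 * K * \<bar>s * lam n\<bar>)) * (exp (- (real n * (1 / real ?J) ^ ?d)) * (D.rho * Q * (1 - 2 * (r n * R) * real ?J) ^ ?d) - K\<^sup>2 * D.err) / (1 + (s * lam n)\<^sup>2 * K\<^sup>2)"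
      proof (intro divide_right_mono mult_left_mono diff_mono mult_mono err)
        show "exp (- ((2 * L) ^ ?d * ?u n)) \<le> exp (- (real n * (1 / real ?J) ^ ?d))" using mu by simp
        show "(1 - w) ^ ?d \<le> (1 - 2 * (r n * R) * real ?J) ^ ?d" using rJ w by (intro power_mono) auto
      qed (use rho_nonneg[of n] Q0 w rho in \<open>auto intro!: mult_nonneg_nonneg add_nonneg_nonneg\<close>)
      finally show ?thesis using D.inside_mgf_lower[OF err_small, of "s * lam n"] unfolding Q_def by (meson exp_le_cancel_iff order.trans)
    qed
    have ed: "(\<integral>\<omega>. exp (q * lam n * D.edge_sum \<omega>) \<partial>M n) \<le> exp (a n * ((3 ^ ?d * q)\<^sup>2 / 2 * ?b + e))" if q: "q \<in> {q1, q2}" for q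
    proof -
      have "(3 ^ ?d * (q * lam n))\<^sup>2 / 2 * exp (4 * K * \<bar>3 ^ ?d * (q * lam n)\<bar>) *
        (D.rho * ((l1 \<theta>)\<^sup>2 * v1 * ((1 + 2 * (r n * R) * real ?J) ^ ?d - (1 - 2 * (r n * R) * real ?J) ^ ?d)) + 4 * K\<^sup>2 * (3 ^ ?d) ^ Suc k * D.err)
        \<le> (3 ^ ?d * (q * lam n))\<^sup>2 / 2 * exp (4 * K * \<bar>3 ^ ?d * (q * lam n)\<bar>) *
        (\<rho> n * ?b + 4 * K\<^sup>2 * (3 ^ ?d) ^ Suc k * (\<rho> n * (C * ?u n)))"
        unfolding rho
      proof (intro mult_left_mono add_mono diff_mono err)
        show "(1 + 2 * (r n * R) * real ?J) ^ ?d \<le> (1 + w) ^ ?d" using rJ rJ0 by (intro power_mono) auto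
        show "(1 - w) ^ ?d \<le> (1 - 2 * (r n * R) * real ?J) ^ ?d" using rJ w by (intro power_mono) auto
      qed (use rho_nonneg[of n] v1 in auto)
      also have "\<dots> = a n * ((3 ^ ?d * q)\<^sup>2 / 2 * exp (4 * K * \<bar>3 ^ ?d * (q * lam n)\<bar>) * (?b + 4 * K\<^sup>2 * (3 ^ ?d) ^ Suc k * (C * ?u n)))"
        unfolding a_def by (rule factor_out_speed(3))
      also have "\<dots> \<le> a n * ((3 ^ ?d * q)\<^sup>2 / 2 * ?b + e)"
        using bspec[OF elim(4) q] rho_nonneg[of n] by (intro mult_left_mono) (auto simp: a_def)
      finally show ?thesis using D.edge_mgf_upper[of "q * lam n"] by (meson exp_le_cancel_iff order.trans)
    qed
    show ?case
    proof (rule conjI[OF D.stat_integrable], rule exI[of _ D.inside_sum], rule exI[of _ D.edge_sum], intro conjI ballI allI)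
      show "stat \<theta> (r n) (X n \<omega>) - (\<integral>\<omega>. stat \<theta> (r n) (X n \<omega>) \<partial>M n) = D.inside_sum \<omega> + D.edge_sum \<omega>"
        if "\<omega> \<in> space (M n)" for \<omega> by (rule D.centered_stat[OF that])
      show "integrable (M n) (\<lambda>\<omega>. exp (l * D.inside_sum \<omega>))" "integrable (M n) (\<lambda>\<omega>. exp (l * D.edge_sum \<omega>))" for l
        by (rule D.inside_exp_integrable D.edge_exp_integrable)+
    qed (rule up lo[unfolded w_def] ed[unfolded w_def]; assumption)+
  qed
qed

text \<open>The share of the boundary strips in the volume of the cells vanishes for large \<open>L\<close>.\<close>

lemma edge_cost_small:
  fixes c Q e :: real
  assumes "e > 0"
  shows "\<exists>L0. \<forall>L\<ge>L0. c * ((1 + 2 * R / L) ^ CARD('d) - (1 - 2 * R / L) ^ CARD('d)) < e \<and> Q * (1 - 2 * R / L) ^ CARD('d) > Q - e"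
proof -
  have inv: "((\<lambda>L::real. 2 * R / L) \<longlongrightarrow> 0) at_top" by (rule tendsto_divide_0[OF tendsto_const]) (rule filterlim_at_top_imp_at_infinity[OF filterlim_ident])
  have "((\<lambda>L. c * ((1 + 2 * R / L) ^ CARD('d) - (1 - 2 * R / L) ^ CARD('d))) \<longlongrightarrow> c * ((1 + 0) ^ CARD('d) - (1 - 0) ^ CARD('d))) at_top"
    by (intro tendsto_intros inv)
  then have 1: "\<forall>\<^sub>F L in at_top. c * ((1 + 2 * R / L) ^ CARD('d) - (1 - 2 * R / L) ^ CARD('d)) < e"
    by (rule order_tendstoD(2)) (use assms in simp)
  have "((\<lambda>L. Q * (1 - 2 * R / L) ^ CARD('d)) \<longlongrightarrow> Q * (1 - 0) ^ CARD('d)) at_top"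
    by (intro tendsto_intros inv)
  then have 2: "\<forall>\<^sub>F L in at_top. Q * (1 - 2 * R / L) ^ CARD('d) > Q - e"
    by (rule order_tendstoD(1)) (use assms in simp)
  from eventually_conj[OF 1 2] show ?thesis by (simp add: eventually_at_top_linorder)
qed

text \<open>Both directions compare the statistic with its part inside the cells. The upper bound separates the
  edge part by convexity of the exponential function. For the lower bound the part inside is in turn
  a combination of the statistic and the edge part.\<close>

lemma poisson_mgf:
  fixes M :: "nat \<Rightarrow> 'w measure" and X :: "nat \<Rightarrow> 'w \<Rightarrow> (real ^ 'd) set" and \<theta> :: "real ^ 'm"
  assumes process: "\<forall>n>0. void_process (M n) (X n) (real n) unit_cube"
    and in_cube: "\<forall>n. \<forall>\<omega>\<in>space (M n). X n \<omega> \<subseteq> unit_cube" and e: "e > 0"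
  defines "Y \<equiv> \<lambda>n \<omega>. stat \<theta> (r n) (X n \<omega>) - (\<integral>\<omega>. stat \<theta> (r n) (X n \<omega>) \<partial>M n)"
  shows "\<forall>\<^sub>F n in sequentially.
    (\<integral>\<omega>. exp (lam n * Y n \<omega>) \<partial>M n) \<le> exp (a n * (1 / 2 * (\<theta> \<bullet> (gram *v \<theta>)) + e)) \<and>
    (\<integral>\<omega>. exp (lam n * Y n \<omega>) \<partial>M n) \<ge> exp (a n * (1 / 2 * (\<theta> \<bullet> (gram *v \<theta>)) - e))"
proof -
  note proc = process[rule_format]
  obtain v1 where v1: "v1 \<ge> 0" "(\<integral>\<^sup>+y. ennreal (\<Sum>i\<in>UNIV. shape0 i y) \<partial>lborel_tuples k) = ennreal v1"
    by (rule nn_integral_sum_shape0)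
  define Q where "Q = \<theta> \<bullet> (gram *v \<theta>)"
  have Q0: "Q \<ge> 0" unfolding Q_def by (rule gram_nonneg)
  (* Convexity of exp with weights 1 / p and 1 - 1 / p separates the two parts of the statistic at the
     price of a factor p in the exponent, so p has to be close to 1. *)
  obtain p where p: "p > 1" "p\<^sup>2 / 2 * Q \<le> Q / 2 + e / 8" "(1 / p)\<^sup>2 / 2 * Q \<ge> Q / 2 - e / 8"
  proof -
    have lim: "((\<lambda>p. p\<^sup>2 / 2 * Q) \<longlongrightarrow> 1\<^sup>2 / 2 * Q) (at_right 1)" "((\<lambda>p. (1 / p)\<^sup>2 / 2 * Q) \<longlongrightarrow> (1 / 1)\<^sup>2 / 2 * Q) (at_right 1)"
      by (intro tendsto_intros; simp)+
    have "\<forall>\<^sub>F p in at_right 1. p\<^sup>2 / 2 * Q < Q / 2 + e / 8" "\<forall>\<^sub>F p in at_right 1. (1 / p)\<^sup>2 / 2 * Q > Q / 2 - e / 8"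
      by (rule order_tendstoD(2)[OF lim(1)], use e in simp) (rule order_tendstoD(1)[OF lim(2)], use e in simp)
    with eventually_at_right_less[of "1::real"]
    have "\<forall>\<^sub>F p in at_right (1::real). 1 < p \<and> p\<^sup>2 / 2 * Q \<le> Q / 2 + e / 8 \<and> (1 / p)\<^sup>2 / 2 * Q \<ge> Q / 2 - e / 8"
      by eventually_elim auto
    then have "\<exists>p::real. 1 < p \<and> p\<^sup>2 / 2 * Q \<le> Q / 2 + e / 8 \<and> (1 / p)\<^sup>2 / 2 * Q \<ge> Q / 2 - e / 8"
      by (rule eventually_happens'[OF trivial_limit_at_right_real])
    then show thesis using that by blast
  qed
  (* The weights of the edge part that result from solving for the statistic and for its part inside the cells. *)
  define q1 where "q1 = p / (p - 1)"
  define q2 where "q2 = - (1 / (p - 1))"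
  define cb where "cb = ((3 ^ CARD('d) * q1)\<^sup>2 / 2 + (3 ^ CARD('d) * q2)\<^sup>2 / 2) * ((l1 \<theta>)\<^sup>2 * v1)"
  obtain L0 where L0: "\<And>L. L \<ge> L0 \<Longrightarrow> cb * ((1 + 2 * R / L) ^ CARD('d) - (1 - 2 * R / L) ^ CARD('d)) < e / 8 \<and> Q * (1 - 2 * R / L) ^ CARD('d) > Q - e / 8"
    using edge_cost_small[of "e / 8" cb Q] e by auto
  define L where "L = max L0 (2 * R)"
  let ?D = "(1 + 2 * R / L) ^ CARD('d) - (1 - 2 * R / L) ^ CARD('d)"
  have L: "L \<ge> 2 * R" "cb * ?D < e / 8" "Q * (1 - 2 * R / L) ^ CARD('d) > Q - e / 8" using L0[of L] by (auto simp: L_def)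
  have wL: "2 * R / L \<le> 1" "0 \<le> 2 * R / L" using L(1) R_pos by (auto simp: divide_le_eq)
  have D0: "?D \<ge> 0" using wL by (simp add: power_mono)
  have edge: "(3 ^ CARD('d) * q)\<^sup>2 / 2 * ((l1 \<theta>)\<^sup>2 * v1 * ?D) \<le> e / 8" if "q \<in> {q1, q2}" for q
  proof -
    have "(3 ^ CARD('d) * q)\<^sup>2 / 2 \<le> (3 ^ CARD('d) * q1)\<^sup>2 / 2 + (3 ^ CARD('d) * q2)\<^sup>2 / 2" using that by auto
    then have "(3 ^ CARD('d) * q)\<^sup>2 / 2 * ((l1 \<theta>)\<^sup>2 * v1 * ?D) \<le> ((3 ^ CARD('d) * q1)\<^sup>2 / 2 + (3 ^ CARD('d) * q2)\<^sup>2 / 2) * ((l1 \<theta>)\<^sup>2 * v1 * ?D)"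
      using v1 D0 by (intro mult_right_mono) auto
    also have "\<dots> = cb * ?D" by (simp add: cb_def)
    finally show ?thesis using L(2) by linarith
  qed
  have lowQ: "(1 / p)\<^sup>2 / 2 * (Q * (1 - 2 * R / L) ^ CARD('d)) \<ge> Q / 2 - e / 4"
  proof -
    have "(1 / p)\<^sup>2 / 2 \<le> 1" using p(1) power_le_one[of "1 / p" 2] by simp
    then have "(1 / p)\<^sup>2 / 2 * (Q - Q * (1 - 2 * R / L) ^ CARD('d)) \<le> 1 * (e / 8)"
      using L(3) wL Q0 e by (intro mult_mono) (auto simp: mult_left_le power_le_one)
    moreover have "(1 / p)\<^sup>2 / 2 * (Q * (1 - 2 * R / L) ^ CARD('d))
        = (1 / p)\<^sup>2 / 2 * Q - (1 / p)\<^sup>2 / 2 * (Q - Q * (1 - 2 * R / L) ^ CARD('d))"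
      by (simp only: right_diff_distrib)
    ultimately show ?thesis using p(3) by linarith
  qed
  have two: "\<forall>\<^sub>F n in sequentially. 2 \<le> exp (a n * (e / 4))" by (rule eventually_const_le_exp[OF a_lim]) (use e in simp)
  have four: "\<forall>\<^sub>F n in sequentially. 2 \<le> exp (a n * (e / 8))" by (rule eventually_const_le_exp[OF a_lim]) (use e in simp)
  have e8: "e / 8 > 0" using e by simp
  show ?thesis
    using decomposition_mgf[OF process in_cube L(1) e8 v1, of \<theta> p "1 / p" q1 q2, folded Q_def] two four a_pos eventually_gt_at_top[of 0]
  proof eventually_elim
    case (elim n)
    interpret P: void_process "M n" "X n" "real n" unit_cube by (rule proc) (use elim in simp)
    obtain A B where AB: "\<And>\<omega>. \<omega> \<in> space (M n) \<Longrightarrow> Y n \<omega> = A \<omega> + B \<omega>"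
      and int: "\<And>l. integrable (M n) (\<lambda>\<omega>. exp (l * A \<omega>))" "\<And>l. integrable (M n) (\<lambda>\<omega>. exp (l * B \<omega>))"
      and A_up: "(\<integral>\<omega>. exp (p * lam n * A \<omega>) \<partial>M n) \<le> exp (a n * (p\<^sup>2 / 2 * Q + e / 8))"
      and A_lo: "(\<integral>\<omega>. exp (1 / p * lam n * A \<omega>) \<partial>M n) \<ge> exp (a n * ((1 / p)\<^sup>2 / 2 * (Q * (1 - 2 * R / L) ^ CARD('d)) - e / 8))"
      and B_up: "\<And>q. q \<in> {q1, q2} \<Longrightarrow> (\<integral>\<omega>. exp (q * lam n * B \<omega>) \<partial>M n) \<le> exp (a n * ((3 ^ CARD('d) * q)\<^sup>2 / 2 * ((l1 \<theta>)\<^sup>2 * v1 * ?D) + e / 8))"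
      using elim(1) unfolding Y_def by blast
    have B_up': "(\<integral>\<omega>. exp (q * lam n * B \<omega>) \<partial>M n) \<le> exp (a n * (e / 4))" if "q \<in> {q1, q2}" for q
    proof -
      have "a n * ((3 ^ CARD('d) * q)\<^sup>2 / 2 * ((l1 \<theta>)\<^sup>2 * v1 * ?D) + e / 8) \<le> a n * (e / 4)"
        using edge[OF that] elim(4) by (intro mult_left_mono) auto
      then show ?thesis using B_up[OF that] by (meson exp_le_cancel_iff order.trans)
    qed
    have cong: "(\<integral>\<omega>. exp (lam n * Y n \<omega>) \<partial>M n) = (\<integral>\<omega>. exp (lam n * (A \<omega> + B \<omega>)) \<partial>M n)"
      by (intro Bochner_Integration.integral_cong refl) (simp add: AB)
    have conv: "exp (s * x + (1 - s) * y) \<le> s * exp x + (1 - s) * exp y" if "0 \<le> s" "s \<le> 1" for s x y :: real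
      using convex_onD[OF exp_convex, of "1 - s" x y] that by simp
    have pw: "exp (lam n * (A \<omega> + B \<omega>)) \<le> exp (p * lam n * A \<omega>) + exp (q1 * lam n * B \<omega>)" for \<omega>
    proof -
      have "lam n * (A \<omega> + B \<omega>) = (1 / p) * (p * lam n * A \<omega>) + (1 - 1 / p) * (q1 * lam n * B \<omega>)"
        using p(1) by (simp add: q1_def field_simps)
      also have "exp \<dots> \<le> (1 / p) * exp (p * lam n * A \<omega>) + (1 - 1 / p) * exp (q1 * lam n * B \<omega>)"
        using p(1) by (intro conv) auto
      also have "\<dots> \<le> 1 * exp (p * lam n * A \<omega>) + 1 * exp (q1 * lam n * B \<omega>)"
        using p(1) by (intro add_mono mult_right_mono) auto
      finally show ?thesis by simp
    qed
    have pw2: "exp (1 / p * lam n * A \<omega>) \<le> exp (lam n * (A \<omega> + B \<omega>)) + exp (q2 * lam n * B \<omega>)" for \<omega>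
    proof -
      have "1 / p * lam n * A \<omega> = (1 / p) * (lam n * (A \<omega> + B \<omega>)) + (1 - 1 / p) * (q2 * lam n * B \<omega>)"
        using p(1) by (simp add: q2_def field_simps)
      also have "exp \<dots> \<le> (1 / p) * exp (lam n * (A \<omega> + B \<omega>)) + (1 - 1 / p) * exp (q2 * lam n * B \<omega>)"
        using p(1) by (intro conv) auto
      also have "\<dots> \<le> 1 * exp (lam n * (A \<omega> + B \<omega>)) + 1 * exp (q2 * lam n * B \<omega>)"
        using p(1) by (intro add_mono mult_right_mono) auto
      finally show ?thesis by simp
    qed
    have Ymeas: "(\<lambda>\<omega>. exp (lam n * Y n \<omega>)) \<in> borel_measurable (M n)"
      unfolding Y_def using measurable_compose[OF P.X_meas measurable_stat] by measurable
    have intY: "integrable (M n) (\<lambda>\<omega>. exp (lam n * Y n \<omega>))"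
      by (rule Bochner_Integration.integrable_bound[OF Bochner_Integration.integrable_add[OF int(1)[of "p * lam n"] int(2)[of "q1 * lam n"]] Ymeas])
         (use pw AB in \<open>auto intro!: AE_I2\<close>)
    have intAB: "integrable (M n) (\<lambda>\<omega>. exp (lam n * (A \<omega> + B \<omega>)))"
      using intY by (rule Bochner_Integration.integrable_cong[THEN iffD1, rotated -1]) (auto simp: AB)
    have "(\<integral>\<omega>. exp (lam n * (A \<omega> + B \<omega>)) \<partial>M n) \<le> (\<integral>\<omega>. exp (p * lam n * A \<omega>) + exp (q1 * lam n * B \<omega>) \<partial>M n)"
      by (intro integral_mono intAB Bochner_Integration.integrable_add int pw)
    also have "\<dots> = (\<integral>\<omega>. exp (p * lam n * A \<omega>) \<partial>M n) + (\<integral>\<omega>. exp (q1 * lam n * B \<omega>) \<partial>M n)"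
      by (intro Bochner_Integration.integral_add int)
    also have "\<dots> \<le> exp (a n * (Q / 2 + e / 4)) + exp (a n * (Q / 2 + e / 4))"
    proof (rule add_mono)
      have "a n * (p\<^sup>2 / 2 * Q + e / 8) \<le> a n * (Q / 2 + e / 4)" using p(2) elim(4) by (intro mult_left_mono) auto
      then show "(\<integral>\<omega>. exp (p * lam n * A \<omega>) \<partial>M n) \<le> exp (a n * (Q / 2 + e / 4))"
        using A_up by (meson exp_le_cancel_iff order.trans)
      have "a n * (e / 4) \<le> a n * (Q / 2 + e / 4)" using Q0 elim(4) by (intro mult_left_mono) auto
      then show "(\<integral>\<omega>. exp (q1 * lam n * B \<omega>) \<partial>M n) \<le> exp (a n * (Q / 2 + e / 4))"
        using B_up'[of q1] by (meson exp_le_cancel_iff insertI1 order.trans)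
    qed
    also have "\<dots> = 2 * exp (a n * (Q / 2 + e / 4))" by simp
    also have "\<dots> \<le> exp (a n * (e / 4)) * exp (a n * (Q / 2 + e / 4))" using elim(2) by (intro mult_right_mono) auto
    also have "\<dots> = exp (a n * (Q / 2 + e / 2))" by (simp add: algebra_simps flip: exp_add)
    also have "\<dots> \<le> exp (a n * (1 / 2 * Q + e))" using e elim(4) by (simp add: mult_left_mono)
    finally have upper: "(\<integral>\<omega>. exp (lam n * (A \<omega> + B \<omega>)) \<partial>M n) \<le> exp (a n * (1 / 2 * Q + e))" .
    have lower: "(\<integral>\<omega>. exp (lam n * (A \<omega> + B \<omega>)) \<partial>M n) \<ge> exp (a n * (1 / 2 * Q - e))"
    proof (cases "Q / 2 > e")
      case True
      have "exp (a n * (Q / 2 - e / 2)) \<le> exp (a n * ((1 / p)\<^sup>2 / 2 * (Q * (1 - 2 * R / L) ^ CARD('d)) - e / 8))"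
        using lowQ e elim(4) by (simp add: mult_left_mono)
      also have "\<dots> \<le> (\<integral>\<omega>. exp (1 / p * lam n * A \<omega>) \<partial>M n)" by (rule A_lo)
      also have "\<dots> \<le> (\<integral>\<omega>. exp (lam n * (A \<omega> + B \<omega>)) + exp (q2 * lam n * B \<omega>) \<partial>M n)"
        by (intro integral_mono intAB Bochner_Integration.integrable_add int pw2)
      also have "\<dots> = (\<integral>\<omega>. exp (lam n * (A \<omega> + B \<omega>)) \<partial>M n) + (\<integral>\<omega>. exp (q2 * lam n * B \<omega>) \<partial>M n)"
        by (intro Bochner_Integration.integral_add int intAB)
      also have "\<dots> \<le> (\<integral>\<omega>. exp (lam n * (A \<omega> + B \<omega>)) \<partial>M n) + exp (a n * (e / 4))"
        by (intro add_left_mono B_up') simp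
      finally have 1: "exp (a n * (Q / 2 - e / 2)) \<le> (\<integral>\<omega>. exp (lam n * (A \<omega> + B \<omega>)) \<partial>M n) + exp (a n * (e / 4))" .
      have "2 * exp (a n * (e / 4)) \<le> exp (a n * (e / 4)) * exp (a n * (e / 4))" using elim(2) by (intro mult_right_mono) auto
      also have "\<dots> = exp (a n * (e / 2))" by (simp flip: exp_add)
      also have "\<dots> \<le> exp (a n * (Q / 2 - e / 2))" using True elim(4) by (simp add: mult_left_mono)
      finally have 2: "exp (a n * (Q / 2 - e / 2)) / 2 \<le> (\<integral>\<omega>. exp (lam n * (A \<omega> + B \<omega>)) \<partial>M n)" using 1 by linarith
      have "2 * exp (a n * (1 / 2 * Q - e)) \<le> exp (a n * (e / 4)) * exp (a n * (1 / 2 * Q - e))" using elim(2) by (intro mult_right_mono) auto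
      also have "\<dots> = exp (a n * (Q / 2 - 3 * e / 4))" by (simp add: algebra_simps flip: exp_add)
      also have "\<dots> \<le> exp (a n * (Q / 2 - e / 2))" using e elim(4) by (simp add: mult_left_mono)
      finally show ?thesis using 2 by linarith
    next
      case False
      have stat_int: "integrable (M n) (\<lambda>\<omega>. stat \<theta> (r n) (X n \<omega>))" using elim(1) by blast
      have Yint: "integrable (M n) (Y n)" "(\<integral>\<omega>. Y n \<omega> \<partial>M n) = 0"
        using stat_int by (simp_all add: Y_def P.prob_space)
      have "1 = (\<integral>\<omega>. 1 + lam n * Y n \<omega> \<partial>M n)" using Yint by (simp add: P.prob_space)
      also have "\<dots> \<le> (\<integral>\<omega>. exp (lam n * Y n \<omega>) \<partial>M n)"
        using Yint by (intro integral_mono intY exp_ge_add_one_self) auto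
      finally have "1 \<le> (\<integral>\<omega>. exp (lam n * Y n \<omega>) \<partial>M n)" .
      moreover have "exp (a n * (1 / 2 * Q - e)) \<le> 1" using False elim(4) by (simp add: mult_nonneg_nonpos)
      ultimately show ?thesis using cong by linarith
    qed
    show ?case using upper lower unfolding cong Q_def by blast
  qed
qed

end



section \<open>Transfer from the Poisson to the binomial process\<close>

lemma exp_minus_linear_le:
  fixes s :: real
  assumes "\<bar>s\<bar> \<le> 1" shows "exp s - 1 - s \<le> s\<^sup>2"
proof (cases "s \<ge> 0")
  case True
  then show ?thesis using exp_bound[of s] assms by simp
next
  case False
  (* for s <= 0 the inequality is e^s <= 1 / (1 - s) <= 1 + s + s^2 *)
  have "1 - s \<le> exp (- s)" using exp_ge_add_one_self[of "- s"] by simp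
  then have "exp s * (1 - s) \<le> exp s * exp (- s)" by (intro mult_left_mono) auto
  then have 1: "exp s * (1 - s) \<le> 1" by (simp flip: exp_add)
  have "s * s * s \<le> 0" using False by (simp add: mult_le_0_iff)
  then have "1 \<le> (1 + s + s\<^sup>2) * (1 - s)" by (simp add: algebra_simps power2_eq_square)
  then have "exp s * (1 - s) \<le> (1 + s + s\<^sup>2) * (1 - s)" using 1 by linarith
  then have "exp s \<le> 1 + s + s\<^sup>2" using False by (simp add: mult_le_cancel_right)
  then show ?thesis by simp
qed

lemma ennreal_combination:
  assumes "0 \<le> g" "0 \<le> a" "0 \<le> b" "0 \<le> c" "0 \<le> d"
  shows "ennreal g * (ennreal a + ennreal b + ennreal c * ennreal d) = ennreal (g * (a + b + c * d))"
  using assms by (simp add: ennreal_mult ennreal_plus)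

lemma exp_mult_abs_le: "exp (s * \<bar>x\<bar>) \<le> exp (s * x) + exp (- s * x)" for s x :: real
  by (cases "x \<ge> 0") (auto simp: abs_if)

lemma poisson_exp_moment:
  assumes "\<nu> > 0" "\<bar>s\<bar> \<le> 1"
  shows "(\<integral>\<^sup>+j. ennreal (exp (s * (real j - \<nu>))) \<partial>measure_pmf (poisson_pmf \<nu>)) \<le> ennreal (exp (\<nu> * s\<^sup>2))"
proof -
  have "(\<lambda>j. (\<nu> * exp s) ^ j /\<^sub>R fact j) sums exp (\<nu> * exp s)" by (rule exp_converges)
  then have "(\<lambda>j. (exp (- \<nu>) * exp (- (s * \<nu>))) * ((\<nu> * exp s) ^ j /\<^sub>R fact j)) sums ((exp (- \<nu>) * exp (- (s * \<nu>))) * exp (\<nu> * exp s))" by (rule sums_mult)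
  moreover have "(exp (- \<nu>) * exp (- (s * \<nu>))) * ((\<nu> * exp s) ^ j /\<^sub>R fact j) = pmf (poisson_pmf \<nu>) j * exp (s * (real j - \<nu>))" for j
  proof -
    have "exp s ^ j = exp (s * real j)" by (simp add: exp_of_nat_mult[symmetric] mult.commute)
    moreover have "exp (s * (real j - \<nu>)) = exp (s * real j) * exp (- (s * \<nu>))" by (simp add: algebra_simps flip: exp_add)
    ultimately show ?thesis using assms(1) by (simp add: power_mult_distrib field_simps)
  qed
  ultimately have s: "(\<lambda>j. pmf (poisson_pmf \<nu>) j * exp (s * (real j - \<nu>))) sums ((exp (- \<nu>) * exp (- (s * \<nu>))) * exp (\<nu> * exp s))" by simp
  have "(\<integral>\<^sup>+j. ennreal (exp (s * (real j - \<nu>))) \<partial>measure_pmf (poisson_pmf \<nu>)) = (\<Sum>j. ennreal (pmf (poisson_pmf \<nu>) j * exp (s * (real j - \<nu>))))"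
    by (simp add: nn_integral_measure_pmf nn_integral_count_space_nat ennreal_mult del: pmf_poisson)
  also have "\<dots> = ennreal ((exp (- \<nu>) * exp (- (s * \<nu>))) * exp (\<nu> * exp s))"
    by (intro suminf_ennreal_eq s) (simp del: pmf_poisson)
  also have "(exp (- \<nu>) * exp (- (s * \<nu>))) * exp (\<nu> * exp s) = exp (\<nu> * (exp s - 1 - s))"
    by (simp add: algebra_simps flip: exp_add)
  also have "ennreal \<dots> \<le> ennreal (exp (\<nu> * s\<^sup>2))"
    using exp_minus_linear_le[OF assms(2)] assms(1) by (intro ennreal_leI) simp
  finally show ?thesis .
qed

text \<open>The exponential Chebyshev inequality at \<open>s = 1 / sqrt \<nu>\<close>.\<close>

lemma poisson_concentration:
  assumes "\<nu> \<ge> 1"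
  shows "measure_pmf.prob (poisson_pmf \<nu>) {j. \<bar>real j - \<nu>\<bar> < 3 * sqrt \<nu>} \<ge> 1 / 2"
proof -
  let ?p = "poisson_pmf \<nu>" and ?s = "1 / sqrt \<nu>" and ?T = "{j. \<bar>real j - \<nu>\<bar> \<ge> 3 * sqrt \<nu>}"
  have s: "\<bar>?s\<bar> \<le> 1" "\<bar>- ?s\<bar> \<le> 1" using assms by (simp_all add: field_simps)
  have sq: "\<nu> * ?s\<^sup>2 = 1" "\<nu> * (- ?s)\<^sup>2 = 1" using assms by (simp_all add: power_divide)
  have e3: "exp (-3 :: real) \<ge> 0" by simp
  have "emeasure (measure_pmf ?p) ?T = (\<integral>\<^sup>+j. indicator ?T j \<partial>measure_pmf ?p)" by simp
  also have "\<dots> \<le> (\<integral>\<^sup>+j. ennreal (exp (- 3)) * (ennreal (exp (?s * (real j - \<nu>))) + ennreal (exp (- ?s * (real j - \<nu>)))) \<partial>measure_pmf ?p)"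
  proof (rule nn_integral_mono)
    fix j
    show "indicator ?T j \<le> ennreal (exp (- 3)) * (ennreal (exp (?s * (real j - \<nu>))) + ennreal (exp (- ?s * (real j - \<nu>))))"
    proof (cases "j \<in> ?T")
      case True
      have "3 \<le> ?s * \<bar>real j - \<nu>\<bar>" using True assms by (simp add: field_simps)
      then have "exp 3 \<le> exp (?s * \<bar>real j - \<nu>\<bar>)" by (simp only: exp_le_cancel_iff)
      also have "\<dots> \<le> exp (?s * (real j - \<nu>)) + exp (- ?s * (real j - \<nu>))"
        by (rule exp_mult_abs_le)
      finally have "exp (-3) * exp 3 \<le> exp (-3) * (exp (?s * (real j - \<nu>)) + exp (- ?s * (real j - \<nu>)))"
        by (intro mult_left_mono) auto
      moreover have "exp (-3) * exp 3 = (1::real)" by (simp flip: exp_add)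
      ultimately have "1 \<le> exp (-3) * (exp (?s * (real j - \<nu>)) + exp (- ?s * (real j - \<nu>)))" by simp
      then have "ennreal 1 \<le> ennreal (exp (-3) * (exp (?s * (real j - \<nu>)) + exp (- ?s * (real j - \<nu>))))" by (rule ennreal_leI)
      then show ?thesis using True by (simp add: ennreal_mult ennreal_plus)
    qed simp
  qed
  also have "\<dots> = ennreal (exp (- 3)) * ((\<integral>\<^sup>+j. ennreal (exp (?s * (real j - \<nu>))) \<partial>measure_pmf ?p) + (\<integral>\<^sup>+j. ennreal (exp (- ?s * (real j - \<nu>))) \<partial>measure_pmf ?p))"
    by (simp add: nn_integral_cmult nn_integral_add)
  also have "\<dots> \<le> ennreal (exp (- 3)) * (ennreal (exp (\<nu> * ?s\<^sup>2)) + ennreal (exp (\<nu> * (- ?s)\<^sup>2)))"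
    using assms by (intro mult_left_mono add_mono poisson_exp_moment s) auto
  also have "\<dots> = ennreal (2 * exp (-2))"
    unfolding sq by (simp add: ennreal_plus[symmetric] ennreal_mult[symmetric] exp_add[symmetric] del: ennreal_plus)
  finally have "measure_pmf.prob ?p ?T \<le> 2 * exp (-2)"
    by (simp add: measure_pmf.emeasure_eq_measure)
  moreover have "2 * exp (-2 :: real) \<le> 1 / 2"
  proof -
    have "(4::real) \<le> (1 + 1) ^ 2" by simp
    also have "\<dots> \<le> exp 1 ^ 2" using exp_ge_add_one_self[of 1] by (intro power_mono) auto
    also have "\<dots> = exp 2" using exp_double[of "1::real"] by simp
    finally show ?thesis by (simp add: exp_minus field_simps)
  qed
  moreover have "measure_pmf.prob ?p {j. \<bar>real j - \<nu>\<bar> < 3 * sqrt \<nu>} = 1 - measure_pmf.prob ?p ?T"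
  proof -
    have "{j. \<bar>real j - \<nu>\<bar> < 3 * sqrt \<nu>} = space (measure_pmf ?p) - ?T" by auto
    then show ?thesis using measure_pmf.prob_compl[of ?T ?p] by simp
  qed
  ultimately show ?thesis by linarith
qed

text \<open>A positive sequence that changes slowly near \<open>n\<close> is comparable to its average under the Poisson
  law with mean \<open>n\<close>, which lives on a window of width of order \<open>sqrt n\<close> around \<open>n\<close>.\<close>

lemma depoissonize:
  fixes g :: "nat \<Rightarrow> real" and n :: nat and \<delta> \<kappa> :: real
  assumes n: "n \<ge> 9" and g: "\<And>j. g j > 0" and \<delta>: "0 \<le> \<delta>" "\<delta> \<le> 1 / 2" and \<kappa>: "0 \<le> \<kappa>" "\<kappa> \<le> 1 / 4"
    and near: "\<And>j. j < 2 * n \<Longrightarrow> \<bar>g (Suc j) - g j\<bar> \<le> \<delta> * g j"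
    and crude: "\<And>j. g (Suc j) \<le> exp \<kappa> * g j"
  defines "P \<equiv> \<integral>\<^sup>+j. ennreal (g j) \<partial>measure_pmf (poisson_pmf (real n))"
  shows "P \<le> ennreal (3 * exp (4 * real n * \<delta>\<^sup>2) * g n)"
    and "ennreal (g n) \<le> ennreal (2 * exp (6 + 6 * real n * \<delta>\<^sup>2)) * P"
proof -
  let ?p = "poisson_pmf (real n)"
  have n0: "real n > 0" "real n \<ge> 1" using n by simp_all
  have up: "g (Suc j) \<le> exp (2 * \<delta>) * g j" and down: "g j \<le> exp (2 * \<delta>) * g (Suc j)" if "j < 2 * n" for j
  proof -
    have e: "1 + 2 * \<delta> \<le> exp (2 * \<delta>)" by (rule exp_ge_add_one_self)
    have "g (Suc j) \<le> (1 + 2 * \<delta>) * g j"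
      using near[OF that] g[of j] \<delta> mult_nonneg_nonneg[of \<delta> "g j"] unfolding distrib_right by linarith
    then show "g (Suc j) \<le> exp (2 * \<delta>) * g j"
      using e g[of j] by (meson less_imp_le mult_right_mono order.trans)
    have "1 \<le> (1 + 2 * \<delta>) * (1 - \<delta>)" using \<delta> by (simp add: algebra_simps) (use mult_left_mono[of \<delta> "1/2" "2 * \<delta>"] in simp)
    then have "g j \<le> (1 + 2 * \<delta>) * ((1 - \<delta>) * g j)" using mult_right_mono[of 1 "(1 + 2 * \<delta>) * (1 - \<delta>)" "g j"] g[of j] by (simp add: mult.assoc)
    also have "\<dots> \<le> (1 + 2 * \<delta>) * g (Suc j)"
      using near[OF that] \<delta> by (intro mult_left_mono) (auto simp: left_diff_distrib)
    also have "\<dots> \<le> exp (2 * \<delta>) * g (Suc j)" using e g[of "Suc j"] by (intro mult_right_mono) auto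
    finally show "g j \<le> exp (2 * \<delta>) * g (Suc j)" .
  qed
  have chain: "g (i + m) \<le> exp (2 * \<delta> * real m) * g i \<and> g i \<le> exp (2 * \<delta> * real m) * g (i + m)" if "i + m \<le> 2 * n" for i m
    using that
  proof (induction m)
    case (Suc m)
    have e: "exp (2 * \<delta> * real (Suc m)) = exp (2 * \<delta>) * exp (2 * \<delta> * real m)" by (simp add: algebra_simps flip: exp_add)
    have lt: "i + m < 2 * n" using Suc by simp
    have IH: "g (i + m) \<le> exp (2 * \<delta> * real m) * g i" "g i \<le> exp (2 * \<delta> * real m) * g (i + m)" using Suc by auto
    have "g (i + Suc m) \<le> exp (2 * \<delta>) * g (i + m)" using up[OF lt] by simp
    also have "\<dots> \<le> exp (2 * \<delta>) * (exp (2 * \<delta> * real m) * g i)" using IH by (intro mult_left_mono) auto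
    finally have 1: "g (i + Suc m) \<le> exp (2 * \<delta> * real (Suc m)) * g i" unfolding e by (simp add: mult.assoc)
    have "g i \<le> exp (2 * \<delta> * real m) * (exp (2 * \<delta>) * g (i + Suc m))"
      using IH(2) down[OF lt] by (simp add: mult_left_mono order.trans[OF IH(2)])
    then have "g i \<le> exp (2 * \<delta> * real (Suc m)) * g (i + Suc m)" unfolding e by (simp add: mult_ac)
    with 1 show ?case by blast
  qed simp
  have two: "g j \<le> exp (2 * \<delta> * \<bar>real j - real n\<bar>) * g n \<and> g n \<le> exp (2 * \<delta> * \<bar>real j - real n\<bar>) * g j" if "j \<le> 2 * n" for j
  proof (cases "j \<le> n")
    case True
    then show ?thesis using chain[of j "n - j"] by (simp add: of_nat_diff abs_minus_commute)
  next
    case False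
    then show ?thesis using chain[of n "j - n"] that by (simp add: of_nat_diff)
  qed
  have far: "g (n + m) \<le> exp (\<kappa> * real m) * g n" for m
  proof (induction m)
    case (Suc m)
    have "g (n + Suc m) \<le> exp \<kappa> * g (n + m)" using crude[of "n + m"] by simp
    also have "\<dots> \<le> exp \<kappa> * (exp (\<kappa> * real m) * g n)" using Suc by (intro mult_left_mono) auto
    also have "\<dots> = exp (\<kappa> * real (Suc m)) * g n" by (simp add: algebra_simps flip: exp_add)
    finally show ?case .
  qed simp
  have quarter: "exp (- (real n / 4)) * exp (real n * (1 / 2)\<^sup>2) = 1" by (simp add: power_divide flip: exp_add)
  let ?s1 = "2 * \<delta>"
  have s1: "\<bar>?s1\<bar> \<le> 1" "\<bar>- ?s1\<bar> \<le> 1" using \<delta> by auto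
  have "P \<le> (\<integral>\<^sup>+j. ennreal (g n) * (ennreal (exp (?s1 * (real j - real n))) + ennreal (exp (- ?s1 * (real j - real n)))
      + ennreal (exp (- (real n / 4))) * ennreal (exp (1 / 2 * (real j - real n)))) \<partial>measure_pmf ?p)"
    unfolding P_def
  proof (rule nn_integral_mono)
    fix j
    have "g j \<le> g n * (exp (?s1 * (real j - real n)) + exp (- ?s1 * (real j - real n)) + exp (- (real n / 4)) * exp (1 / 2 * (real j - real n)))"
    proof (cases "j \<le> 2 * n")
      case True
      have "exp (2 * \<delta> * \<bar>real j - real n\<bar>) \<le> exp (?s1 * (real j - real n)) + exp (- ?s1 * (real j - real n))"
        by (rule exp_mult_abs_le)
      also have "\<dots> \<le> exp (?s1 * (real j - real n)) + exp (- ?s1 * (real j - real n)) + exp (- (real n / 4)) * exp (1 / 2 * (real j - real n))"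
        by simp
      finally show ?thesis
        unfolding mult.commute[of "g n"] by (rule order.trans[OF conjunct1[OF two[OF True]] mult_right_mono]) (use g[of n] in simp)
    next
      case False
      define m where "m = j - n"
      have m: "j = n + m" "n \<le> m" using False by (auto simp: m_def)
      have "\<kappa> * real m \<le> 1 / 4 * real m" using \<kappa> by (intro mult_right_mono) auto
      also have "\<dots> \<le> - (real n / 4) + 1 / 2 * real m" using m(2) by simp
      finally have "exp (\<kappa> * real m) \<le> exp (- (real n / 4)) * exp (1 / 2 * real m)" by (simp flip: exp_add)
      also have "\<dots> = exp (- (real n / 4)) * exp (1 / 2 * (real j - real n))" using m by simp
      also have "\<dots> \<le> exp (?s1 * (real j - real n)) + exp (- ?s1 * (real j - real n)) + exp (- (real n / 4)) * exp (1 / 2 * (real j - real n))"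
        by (simp add: add_increasing)
      finally have le: "exp (\<kappa> * real m) \<le> exp (?s1 * (real j - real n)) + exp (- ?s1 * (real j - real n)) + exp (- (real n / 4)) * exp (1 / 2 * (real j - real n))" .
      have "g j \<le> exp (\<kappa> * real m) * g n" using far[of m] unfolding m(1) .
      then show ?thesis
        unfolding mult.commute[of "g n"] using mult_right_mono[OF le, of "g n"] g[of n] by linarith
    qed
    then have "ennreal (g j) \<le> ennreal (g n * (exp (?s1 * (real j - real n)) + exp (- ?s1 * (real j - real n)) + exp (- (real n / 4)) * exp (1 / 2 * (real j - real n))))"
      by (rule ennreal_leI)
    also have "\<dots> = ennreal (g n) * (ennreal (exp (?s1 * (real j - real n))) + ennreal (exp (- ?s1 * (real j - real n)))
      + ennreal (exp (- (real n / 4))) * ennreal (exp (1 / 2 * (real j - real n))))"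
      using g[of n] by (simp add: ennreal_mult ennreal_plus add_nonneg_nonneg)
    finally show "ennreal (g j) \<le> ennreal (g n) * (ennreal (exp (?s1 * (real j - real n))) + ennreal (exp (- ?s1 * (real j - real n)))
      + ennreal (exp (- (real n / 4))) * ennreal (exp (1 / 2 * (real j - real n))))" .
  qed
  also have "\<dots> = ennreal (g n) * ((\<integral>\<^sup>+j. ennreal (exp (?s1 * (real j - real n))) \<partial>measure_pmf ?p) + (\<integral>\<^sup>+j. ennreal (exp (- ?s1 * (real j - real n))) \<partial>measure_pmf ?p)
      + ennreal (exp (- (real n / 4))) * (\<integral>\<^sup>+j. ennreal (exp (1 / 2 * (real j - real n))) \<partial>measure_pmf ?p))"
    by (simp add: nn_integral_cmult nn_integral_add)
  also have "\<dots> \<le> ennreal (g n) * (ennreal (exp (real n * ?s1\<^sup>2)) + ennreal (exp (real n * (- ?s1)\<^sup>2)) + ennreal (exp (- (real n / 4))) * ennreal (exp (real n * (1 / 2)\<^sup>2)))"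
    using n0 by (intro mult_left_mono add_mono poisson_exp_moment s1) auto
  also have "\<dots> = ennreal (g n * (exp (real n * ?s1\<^sup>2) + exp (real n * (- ?s1)\<^sup>2) + exp (- (real n / 4)) * exp (real n * (1 / 2)\<^sup>2)))"
    by (rule ennreal_combination) (use g[of n] in auto)
  also have "\<dots> \<le> ennreal (3 * exp (4 * real n * \<delta>\<^sup>2) * g n)"
  proof (rule ennreal_leI)
    have sq: "real n * ?s1\<^sup>2 = 4 * real n * \<delta>\<^sup>2" "real n * (- ?s1)\<^sup>2 = 4 * real n * \<delta>\<^sup>2" by (simp_all add: power_mult_distrib)
    have "0 \<le> 4 * real n * \<delta>\<^sup>2" by simp
    then have "1 \<le> exp (4 * real n * \<delta>\<^sup>2)" by (simp only: one_le_exp_iff)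
    then have "exp (real n * ?s1\<^sup>2) + exp (real n * (- ?s1)\<^sup>2) + exp (- (real n / 4)) * exp (real n * (1 / 2)\<^sup>2) \<le> 3 * exp (4 * real n * \<delta>\<^sup>2)"
      unfolding quarter sq by linarith
    then show "g n * (exp (real n * ?s1\<^sup>2) + exp (real n * (- ?s1)\<^sup>2) + exp (- (real n / 4)) * exp (real n * (1 / 2)\<^sup>2)) \<le> 3 * exp (4 * real n * \<delta>\<^sup>2) * g n"
      unfolding mult.commute[of "g n"] using g[of n] by (intro mult_right_mono) auto
  qed
  finally show "P \<le> ennreal (3 * exp (4 * real n * \<delta>\<^sup>2) * g n)" .
  let ?W = "{j. \<bar>real j - real n\<bar> < 3 * sqrt (real n)}"
  let ?c = "exp (- (6 + 6 * real n * \<delta>\<^sup>2))"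
  have conc: "measure_pmf.prob ?p ?W \<ge> 1 / 2" by (rule poisson_concentration[OF n0(2)])
  have "ennreal (g n * ?c * (1 / 2)) \<le> ennreal (g n * ?c) * emeasure (measure_pmf ?p) ?W"
    using conc g[of n] by (simp add: measure_pmf.emeasure_eq_measure ennreal_mult[symmetric] mult_left_mono)
  also have "\<dots> = (\<integral>\<^sup>+j. ennreal (g n * ?c) * indicator ?W j \<partial>measure_pmf ?p)"
    by (rule nn_integral_cmult_indicator[symmetric]) simp
  also have "\<dots> \<le> P" unfolding P_def
  proof (rule nn_integral_mono)
    fix j
    show "ennreal (g n * ?c) * indicator ?W j \<le> ennreal (g j)"
    proof (cases "j \<in> ?W")
      case True
      have "3 * sqrt (real n) \<le> sqrt (real n) * sqrt (real n)"
        using n by (intro mult_right_mono real_le_rsqrt) auto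
      then have "3 * sqrt (real n) \<le> real n" by simp
      then have j: "j \<le> 2 * n" using True by (simp add: abs_less_iff)
      have "\<delta> * sqrt (real n) \<le> 1 + real n * \<delta>\<^sup>2"
      proof -
        have "0 \<le> (\<delta> * sqrt (real n) - 1)\<^sup>2" by simp
        then have "2 * (\<delta> * sqrt (real n)) \<le> 1 + (\<delta> * sqrt (real n))\<^sup>2" by (simp add: power2_diff)
        also have "(\<delta> * sqrt (real n))\<^sup>2 = real n * \<delta>\<^sup>2" by (simp add: power_mult_distrib)
        finally show ?thesis using \<delta> n0 by (smt (verit) mult_nonneg_nonneg real_sqrt_ge_zero)
      qed
      moreover have "2 * \<delta> * \<bar>real j - real n\<bar> \<le> 2 * \<delta> * (3 * sqrt (real n))"
        using True \<delta> by (intro mult_left_mono) auto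
      ultimately have "2 * \<delta> * \<bar>real j - real n\<bar> \<le> 6 + 6 * real n * \<delta>\<^sup>2" by (simp add: mult.assoc)
      then have "exp (2 * \<delta> * \<bar>real j - real n\<bar>) \<le> exp (6 + 6 * real n * \<delta>\<^sup>2)" by simp
      then have "g n \<le> exp (6 + 6 * real n * \<delta>\<^sup>2) * g j"
        using two[OF j] g[of j] by (meson less_imp_le mult_right_mono order.trans)
      then have "g n * ?c \<le> (exp (6 + 6 * real n * \<delta>\<^sup>2) * g j) * ?c" by (rule mult_right_mono) simp
      also have "\<dots> = g j" by (simp add: mult.assoc flip: exp_add)
      finally show ?thesis using True by (simp add: ennreal_leI)
    qed simp
  qed
  finally have "ennreal (2 * exp (6 + 6 * real n * \<delta>\<^sup>2)) * ennreal (g n * ?c * (1 / 2)) \<le> ennreal (2 * exp (6 + 6 * real n * \<delta>\<^sup>2)) * P"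
    by (rule mult_left_mono) simp
  moreover have "ennreal (2 * exp (6 + 6 * real n * \<delta>\<^sup>2)) * ennreal (g n * ?c * (1 / 2)) = ennreal (g n)"
    using g[of n] by (simp add: ennreal_mult[symmetric] mult.assoc mult.left_commute flip: exp_add)
  ultimately show "ennreal (g n) \<le> ennreal (2 * exp (6 + 6 * real n * \<delta>\<^sup>2)) * P" by simp
qed



lemma emeasure_cball_le:
  fixes x :: "real ^ 'd::finite"
  assumes "\<epsilon> \<ge> 0" shows "emeasure lborel (cball x \<epsilon>) \<le> ennreal ((2 * \<epsilon>) ^ CARD('d))"
proof -
  have "cball x \<epsilon> \<subseteq> cbox (\<chi> i. x $ i - \<epsilon>) (\<chi> i. x $ i + \<epsilon>)"
  proof
    fix y assume "y \<in> cball x \<epsilon>"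
    then have "\<bar>x $ i - y $ i\<bar> \<le> \<epsilon>" for i
      using component_le_norm_cart[of "x - y" i] by (simp add: dist_norm)
    then have "x $ i - \<epsilon> \<le> y $ i \<and> y $ i \<le> x $ i + \<epsilon>" for i by (smt (verit))
    then show "y \<in> cbox (\<chi> i. x $ i - \<epsilon>) (\<chi> i. x $ i + \<epsilon>)" by (simp add: mem_box_cart)
  qed
  then have "emeasure lborel (cball x \<epsilon>) \<le> emeasure lborel (cbox (\<chi> i. x $ i - \<epsilon>) (\<chi> i. x $ i + \<epsilon>))"
    by (rule emeasure_mono) simp
  also have "\<dots> = ennreal ((2 * \<epsilon>) ^ CARD('d))" using assms by (intro emeasure_box_const(1)) auto
  finally show ?thesis .
qed

lemma abs_exp_minus_one_le:
  fixes u :: real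
  assumes "\<bar>u\<bar> \<le> 1" shows "\<bar>exp u - 1\<bar> \<le> 2 * \<bar>u\<bar>"
proof -
  have "1 + u \<le> exp u" by (rule exp_ge_add_one_self)
  moreover have "exp u - 1 - u \<le> u\<^sup>2" by (rule exp_minus_linear_le[OF assms])
  moreover have "u\<^sup>2 \<le> \<bar>u\<bar>" using mult_left_mono[OF assms, of "\<bar>u\<bar>"] by (simp add: power2_eq_square flip: abs_mult)
  ultimately show ?thesis by linarith
qed

lemma window_unit_cube: "window (unit_cube :: (real ^ 'd::finite) set)"
  by standard (simp_all add: emeasure_unit_cube measure_def)

lemma measure_unit_cube: "measure lborel (unit_cube :: (real ^ 'd::finite) set) = 1"
  by (simp add: measure_def emeasure_unit_cube)

text \<open>The hypothesis on \<open>C\<close> expresses that a new point matters only if it falls near \<open>k - 1\<close> others.\<close>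

locale increments = shapes k \<Gamma> t dim
  for k :: nat and \<Gamma> :: "'m::finite \<Rightarrow> 'v pair_pre_digraph" and t :: "'m \<Rightarrow> real"
    and dim :: "(real ^ 'd::finite) itself" +
  fixes \<theta> :: "real ^ 'm" and r l C :: real
  assumes r0: "r > 0" and l0: "l \<ge> 0" and C0: "C \<ge> 0"
    and insert_bound: "finite Y \<Longrightarrow> \<bar>stat \<theta> r (insert x Y) - stat \<theta> r Y\<bar> \<le> C * of_bool (k \<le> card (Y \<inter> cball x (r * R)) + 1)"
begin

abbreviation unif :: "(real ^ 'd) measure" where "unif \<equiv> uniform_measure lborel unit_cube"

text \<open>Points drawn from the uniform law lie in the cube only almost surely.\<close>

definition cstat :: "(real ^ 'd) set \<Rightarrow> real" where "cstat Y = stat \<theta> r (Y \<inter> unit_cube)"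

definition weight :: "(real ^ 'd) set \<Rightarrow> ennreal" where "weight Y = ennreal (exp (l * cstat Y))"

definition mgf :: "nat set \<Rightarrow> ennreal" where "mgf I = (\<integral>\<^sup>+y. weight (y ` I) \<partial>PiM I (\<lambda>_. unif))"

interpretation unif: prob_space unif by (rule window.prob_space_uniform[OF window_unit_cube])
interpretation PU: product_sigma_finite "\<lambda>_::nat. unif" by standard
lemma prob_tuples: "prob_space (PiM I (\<lambda>_. unif))"
  by (rule window.prob_space_uniform_tuples[OF window_unit_cube])

lemma measurable_cstat: "cstat \<in> borel_measurable conf"
  unfolding cstat_def[abs_def] by (rule measurable_compose[OF measurable_conf_Int[OF sets_unit_cube] measurable_stat])

lemma measurable_weight: "weight \<in> borel_measurable conf"
  unfolding weight_def[abs_def] using measurable_cstat by measurable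

lemma cstat_insert: "finite Y \<Longrightarrow> \<bar>cstat (insert x Y) - cstat Y\<bar> \<le> C * of_bool (k \<le> card (Y \<inter> cball x (r * R)) + 1)"
proof (cases "x \<in> unit_cube")
  case True
  assume fin: "finite Y"
  have "card (Y \<inter> unit_cube \<inter> cball x (r * R)) \<le> card (Y \<inter> cball x (r * R))" using fin by (intro card_mono) auto
  then have "C * of_bool (k \<le> card (Y \<inter> unit_cube \<inter> cball x (r * R)) + 1) \<le> C * of_bool (k \<le> card (Y \<inter> cball x (r * R)) + 1)"
    using C0 by (intro mult_left_mono) auto
  moreover have "insert x Y \<inter> unit_cube = insert x (Y \<inter> unit_cube)" using True by blast
  ultimately show ?thesis unfolding cstat_def using insert_bound[of "Y \<inter> unit_cube" x] fin by simp
next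
  case False
  then have "insert x Y \<inter> unit_cube = Y \<inter> unit_cube" by blast
  then show ?thesis using C0 by (simp add: cstat_def)
qed

lemma cstat_insert_le: "finite Y \<Longrightarrow> \<bar>cstat (insert x Y) - cstat Y\<bar> \<le> C"
proof -
  have "C * of_bool b \<le> C" for b using C0 by (cases b) auto
  then show "finite Y \<Longrightarrow> ?thesis" using cstat_insert[of Y x] order.trans by blast
qed

lemma cstat_union_le: "finite Z \<Longrightarrow> finite Y \<Longrightarrow> \<bar>cstat (Z \<union> Y) - cstat Y\<bar> \<le> C * real (card Z)"
proof (induction Z rule: finite_induct)
  case (insert x Z)
  then have "\<bar>cstat (insert x (Z \<union> Y)) - cstat (Z \<union> Y)\<bar> \<le> C" by (intro cstat_insert_le) auto
  then show ?case using insert by (simp add: algebra_simps)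
qed simp

lemma cstat_le: "finite Y \<Longrightarrow> \<bar>cstat Y\<bar> \<le> C * real (card Y)"
  using cstat_union_le[of Y "{}"] stat_empty by (simp add: cstat_def)

lemma weight_ratio:
  assumes "cstat Y - cstat Y' \<le> c" shows "weight Y \<le> ennreal (exp (l * c)) * weight Y'"
proof -
  have "l * (cstat Y - cstat Y') \<le> l * c" using assms l0 by (rule mult_left_mono)
  then have "exp (l * cstat Y) \<le> exp (l * c + l * cstat Y')" by (simp add: right_diff_distrib)
  then have "exp (l * cstat Y) \<le> exp (l * c) * exp (l * cstat Y')" by (simp only: exp_add)
  then show ?thesis unfolding weight_def by (simp add: ennreal_mult[symmetric] ennreal_leI)
qed

lemma weight_union:
  assumes "finite I" "finite J"
  shows "weight (y ` (I \<union> J)) \<le> ennreal (exp (l * (C * real (card I)))) * weight (y ` J)"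
    and "weight (y ` J) \<le> ennreal (exp (l * (C * real (card I)))) * weight (y ` (I \<union> J))"
proof -
  have "\<bar>cstat (y ` I \<union> y ` J) - cstat (y ` J)\<bar> \<le> C * real (card (y ` I))"
    using assms by (intro cstat_union_le) auto
  also have "\<dots> \<le> C * real (card I)" using C0 card_image_le[OF assms(1), of y] by (intro mult_left_mono) auto
  finally have "\<bar>cstat (y ` (I \<union> J)) - cstat (y ` J)\<bar> \<le> C * real (card I)" by (simp add: image_Un)
  then show "weight (y ` (I \<union> J)) \<le> ennreal (exp (l * (C * real (card I)))) * weight (y ` J)"
    "weight (y ` J) \<le> ennreal (exp (l * (C * real (card I)))) * weight (y ` (I \<union> J))"
    by (intro weight_ratio; linarith)+
qed

lemma measurable_weight_image:
  assumes "finite J" "J \<subseteq> I"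
  shows "(\<lambda>y. weight (y ` J)) \<in> borel_measurable (PiM I (\<lambda>_. borel))"
proof -
  have "(\<lambda>y. (\<lambda>i. y i) ` J) \<in> PiM I (\<lambda>_. borel) \<rightarrow>\<^sub>M conf"
  proof (rule measurable_conf_image)
    fix i assume "i \<in> J"
    then have "i \<in> I" using assms by blast
    then show "(\<lambda>y. y i) \<in> borel_measurable (PiM I (\<lambda>_. borel))" by (rule measurable_component_singleton)
  qed (rule assms)
  from measurable_compose[OF this measurable_weight] show ?thesis by simp
qed

lemma measurable_hits:
  assumes "finite I" "I \<subseteq> N" "B \<in> sets borel"
  shows "(\<lambda>y. \<Prod>i\<in>I. indicator B (y i) :: ennreal) \<in> borel_measurable (PiM N (\<lambda>_. borel :: (real^'d) measure))"
proof (rule borel_measurable_prod_ennreal)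
  fix i assume "i \<in> I"
  then have "i \<in> N" using assms by blast
  then show "(\<lambda>y. indicator B (y i) :: ennreal) \<in> borel_measurable (PiM N (\<lambda>_. borel))"
    using measurable_compose[OF measurable_component_singleton[of i N "\<lambda>_. borel"] borel_measurable_indicator[OF assms(3)]] by blast
qed

lemma nn_integral_hits_weight:
  assumes "finite I" "finite J" "I \<inter> J = {}" "B \<in> sets borel"
  shows "(\<integral>\<^sup>+y. (\<Prod>i\<in>I. indicator B (y i)) * weight (y ` J) \<partial>PiM (I \<union> J) (\<lambda>_. unif)) = emeasure unif B ^ card I * mgf J"
  using assms(1,3)
proof (induction I rule: finite_induct)
  case empty
  then show ?case by (simp add: mgf_def)
next
  case (insert i I)
  have fin: "finite (I \<union> J)" and i: "i \<notin> I \<union> J" using insert assms(2) by auto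
  let ?h = "\<lambda>y. (\<Prod>j\<in>I. indicator B (y j)) * weight (y ` J)"
  have mh: "?h \<in> borel_measurable (PiM (I \<union> J) (\<lambda>_. borel))"
    using insert assms by (intro borel_measurable_times_ennreal measurable_hits measurable_weight_image) auto
  have "(\<integral>\<^sup>+y. (\<Prod>j\<in>insert i I. indicator B (y j)) * weight (y ` J) \<partial>PiM (insert i (I \<union> J)) (\<lambda>_. unif))
    = (\<integral>\<^sup>+y. (\<integral>\<^sup>+z. (\<Prod>j\<in>insert i I. indicator B ((y(i := z)) j)) * weight ((y(i := z)) ` J) \<partial>unif) \<partial>PiM (I \<union> J) (\<lambda>_. unif))"
  proof (rule PU.product_nn_integral_insert[OF fin i])
    show "(\<lambda>y. (\<Prod>j\<in>insert i I. indicator B (y j)) * weight (y ` J)) \<in> borel_measurable (PiM (insert i (I \<union> J)) (\<lambda>_. unif))"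
      unfolding measurable_uniform_tuples
      using insert assms by (intro borel_measurable_times_ennreal measurable_hits measurable_weight_image) auto
  qed
  also have "\<dots> = (\<integral>\<^sup>+y. emeasure unif B * ?h y \<partial>PiM (I \<union> J) (\<lambda>_. unif))"
  proof (rule nn_integral_cong)
    fix y :: "nat \<Rightarrow> real^'d"
    have 1: "(y(i := z)) ` J = y ` J" for z using i by (intro image_cong) auto
    have 2: "(\<Prod>j\<in>I. indicator B ((y(i := z)) j)) = (\<Prod>j\<in>I. indicator B (y j) :: ennreal)" for z
      using i by (intro prod.cong) auto
    have "(\<integral>\<^sup>+z. (\<Prod>j\<in>insert i I. indicator B ((y(i := z)) j)) * weight ((y(i := z)) ` J) \<partial>unif) = (\<integral>\<^sup>+z. ?h y * indicator B z \<partial>unif)"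
      unfolding 1 prod.insert[OF insert.hyps] 2 fun_upd_same by (simp only: mult_ac)
    also have "\<dots> = ?h y * emeasure unif B" using assms(4) by (intro nn_integral_cmult_indicator) simp
    finally show "(\<integral>\<^sup>+z. (\<Prod>j\<in>insert i I. indicator B ((y(i := z)) j)) * weight ((y(i := z)) ` J) \<partial>unif) = emeasure unif B * ?h y"
      by (simp only: mult.commute)
  qed
  also have "\<dots> = emeasure unif B * (\<integral>\<^sup>+y. ?h y \<partial>PiM (I \<union> J) (\<lambda>_. unif))" using mh by (intro nn_integral_cmult) (simp only: measurable_uniform_tuples)
  also have "\<dots> = emeasure unif B * (emeasure unif B ^ card I * mgf J)" using insert by (subst insert.IH) auto
  finally show ?case using insert.hyps by (simp add: mult.assoc)
qed

lemma mgf_remove: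
  assumes "finite I" "finite J" "I \<inter> J = {}"
  shows "mgf J \<le> ennreal (exp (l * (C * real (card I)))) * mgf (I \<union> J)"
proof -
  have "mgf J = (\<integral>\<^sup>+y. weight (y ` J) \<partial>PiM (I \<union> J) (\<lambda>_. unif))"
    using nn_integral_hits_weight[OF assms, of UNIV] unif.emeasure_space_1 by simp
  also have "\<dots> \<le> (\<integral>\<^sup>+y. ennreal (exp (l * (C * real (card I)))) * weight (y ` (I \<union> J)) \<partial>PiM (I \<union> J) (\<lambda>_. unif))"
    using assms by (intro nn_integral_mono weight_union)
  also have "\<dots> = ennreal (exp (l * (C * real (card I)))) * mgf (I \<union> J)"
    unfolding mgf_def using assms measurable_weight_image[of "I \<union> J" "I \<union> J"] by (intro nn_integral_cmult) simp
  finally show ?thesis .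
qed

text \<open>Under the law tilted by the weight, finding \<open>k - 1\<close> points in a small region \<open>B\<close> is about as
  unlikely as under the original law, because removing these points changes the weight only by a
  bounded factor.\<close>

lemma weighted_crowding_le:
  assumes N: "finite N" and B: "B \<in> sets borel"
  shows "(\<integral>\<^sup>+y. of_bool (k - 1 \<le> card (y ` N \<inter> B)) * weight (y ` N) \<partial>PiM N (\<lambda>_. unif))
    \<le> of_nat (card N choose (k - 1)) * (ennreal (exp (2 * (l * (C * real (k - 1))))) * (emeasure unif B ^ (k - 1) * mgf N))"
proof -
  let ?I = "{I. I \<subseteq> N \<and> card I = k - 1}" and ?e = "ennreal (exp (l * (C * real (k - 1))))"
  have finI: "finite ?I" using N by simp
  have "(\<integral>\<^sup>+y. of_bool (k - 1 \<le> card (y ` N \<inter> B)) * weight (y ` N) \<partial>PiM N (\<lambda>_. unif))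
    \<le> (\<integral>\<^sup>+y. (\<Sum>I\<in>?I. ?e * ((\<Prod>i\<in>I. indicator B (y i)) * weight (y ` (N - I)))) \<partial>PiM N (\<lambda>_. unif))"
  proof (rule nn_integral_mono)
    fix y :: "nat \<Rightarrow> real^'d"
    show "of_bool (k - 1 \<le> card (y ` N \<inter> B)) * weight (y ` N) \<le> (\<Sum>I\<in>?I. ?e * ((\<Prod>i\<in>I. indicator B (y i)) * weight (y ` (N - I))))"
    proof (cases "k - 1 \<le> card (y ` N \<inter> B)")
      case True
      have "y ` N \<inter> B = y ` {i\<in>N. y i \<in> B}" by auto
      then have "k - 1 \<le> card {i\<in>N. y i \<in> B}" using True card_image_le[of "{i\<in>N. y i \<in> B}" y] N by simp
      then obtain I where I: "I \<subseteq> {i\<in>N. y i \<in> B}" "card I = k - 1" "finite I" by (rule obtain_subset_with_card_n)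
      have "weight (y ` N) = weight (y ` (I \<union> (N - I)))" using I by (simp add: Un_absorb1 subset_iff)
      also have "\<dots> \<le> ?e * weight (y ` (N - I))" using weight_union(1)[of I "N - I" y] I N by simp
      also have "\<dots> = ?e * ((\<Prod>i\<in>I. indicator B (y i)) * weight (y ` (N - I)))"
      proof -
        have "(\<Prod>i\<in>I. indicator B (y i)) = (1 :: ennreal)" using I(1) by (intro prod.neutral) (auto simp: indicator_def)
        then show ?thesis by simp
      qed
      also have "\<dots> \<le> (\<Sum>I\<in>?I. ?e * ((\<Prod>i\<in>I. indicator B (y i)) * weight (y ` (N - I))))"
        using finI I by (intro member_le_sum[of I ?I "\<lambda>I. ?e * ((\<Prod>i\<in>I. indicator B (y i)) * weight (y ` (N - I)))"]) auto
      finally show ?thesis using True by simp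
    qed simp
  qed
  also have "\<dots> = (\<Sum>I\<in>?I. ?e * (\<integral>\<^sup>+y. (\<Prod>i\<in>I. indicator B (y i)) * weight (y ` (N - I)) \<partial>PiM N (\<lambda>_. unif)))"
  proof (subst nn_integral_sum)
    fix I assume I: "I \<in> ?I"
    then have "finite I" using N finite_subset by auto
    then have m: "(\<lambda>y. (\<Prod>i\<in>I. indicator B (y i)) * weight (y ` (N - I))) \<in> borel_measurable (PiM N (\<lambda>_. unif))"
      unfolding measurable_uniform_tuples using I N B
      by (intro borel_measurable_times_ennreal measurable_hits measurable_weight_image) auto
    show "(\<lambda>y. ?e * ((\<Prod>i\<in>I. indicator B (y i)) * weight (y ` (N - I)))) \<in> borel_measurable (PiM N (\<lambda>_. unif))"
      by (rule borel_measurable_times_ennreal[OF borel_measurable_const m])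
  next
    show "(\<Sum>I\<in>?I. \<integral>\<^sup>+y. ?e * ((\<Prod>i\<in>I. indicator B (y i)) * weight (y ` (N - I))) \<partial>PiM N (\<lambda>_. unif))
       = (\<Sum>I\<in>?I. ?e * (\<integral>\<^sup>+y. (\<Prod>i\<in>I. indicator B (y i)) * weight (y ` (N - I)) \<partial>PiM N (\<lambda>_. unif)))"
    proof (intro sum.cong refl nn_integral_cmult)
      fix I assume I: "I \<in> ?I"
      then have "finite I" using N finite_subset by auto
      then show "(\<lambda>y. (\<Prod>i\<in>I. indicator B (y i)) * weight (y ` (N - I))) \<in> borel_measurable (PiM N (\<lambda>_. unif))"
        unfolding measurable_uniform_tuples using I N B
        by (intro borel_measurable_times_ennreal measurable_hits measurable_weight_image) auto
    qed
  qed
  also have "\<dots> \<le> (\<Sum>I\<in>?I. ?e * (emeasure unif B ^ (k - 1) * (?e * mgf N)))"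
  proof (intro sum_mono mult_left_mono)
    fix I assume I: "I \<in> ?I"
    then have fin: "finite I" "finite (N - I)" "I \<inter> (N - I) = {}" "I \<union> (N - I) = N" using N finite_subset by auto
    have "(\<integral>\<^sup>+y. (\<Prod>i\<in>I. indicator B (y i)) * weight (y ` (N - I)) \<partial>PiM N (\<lambda>_. unif)) = emeasure unif B ^ (k - 1) * mgf (N - I)"
      using nn_integral_hits_weight[OF fin(1-3) B] fin(4) I by simp
    also have "\<dots> \<le> emeasure unif B ^ (k - 1) * (?e * mgf N)"
      using mgf_remove[OF fin(1-3)] fin(4) I by (intro mult_left_mono) auto
    finally show "(\<integral>\<^sup>+y. (\<Prod>i\<in>I. indicator B (y i)) * weight (y ` (N - I)) \<partial>PiM N (\<lambda>_. unif)) \<le> emeasure unif B ^ (k - 1) * (?e * mgf N)" .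
  qed auto
  also have "\<dots> = of_nat (card ?I) * (?e * (emeasure unif B ^ (k - 1) * (?e * mgf N)))" by simp
  also have "card ?I = card N choose (k - 1)" using N by (rule n_subsets)
  also have "?e * (emeasure unif B ^ (k - 1) * (?e * mgf N)) = (?e * ?e) * (emeasure unif B ^ (k - 1) * mgf N)" by (simp only: mult_ac)
  also have "?e * ?e = ennreal (exp (2 * (l * (C * real (k - 1)))))"
    by (simp add: ennreal_mult[symmetric] exp_add[symmetric])
  finally show ?thesis .
qed

definition g :: "nat \<Rightarrow> real" where "g j = enn2real (mgf {..<j})"

lemma mgf_bounds: "ennreal (exp (- (l * (C * real j)))) \<le> mgf {..<j}" "mgf {..<j} \<le> ennreal (exp (l * (C * real j)))"
proof -
  interpret P: prob_space "PiM {..<j} (\<lambda>_. unif)" by (rule prob_tuples)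
  have b: "exp (- (l * (C * real j))) \<le> exp (l * cstat (y ` {..<j}))" "exp (l * cstat (y ` {..<j})) \<le> exp (l * (C * real j))" for y
  proof -
    have "\<bar>cstat (y ` {..<j})\<bar> \<le> C * real (card (y ` {..<j}))" by (rule cstat_le) simp
    also have "\<dots> \<le> C * real j" using C0 card_image_le[of "{..<j}" y] by (intro mult_left_mono) auto
    finally have "l * \<bar>cstat (y ` {..<j})\<bar> \<le> l * (C * real j)" using l0 by (rule mult_left_mono)
    then have "\<bar>l * cstat (y ` {..<j})\<bar> \<le> l * (C * real j)" using l0 by (simp add: abs_mult)
    then show "exp (- (l * (C * real j))) \<le> exp (l * cstat (y ` {..<j}))" "exp (l * cstat (y ` {..<j})) \<le> exp (l * (C * real j))" by auto
  qed
  have "(\<integral>\<^sup>+y. ennreal (exp (- (l * (C * real j)))) \<partial>PiM {..<j} (\<lambda>_. unif)) \<le> mgf {..<j}"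
    unfolding mgf_def weight_def by (intro nn_integral_mono ennreal_leI b)
  then show "ennreal (exp (- (l * (C * real j)))) \<le> mgf {..<j}" by (simp only: nn_integral_const P.emeasure_space_1 mult_1_right)
  have "mgf {..<j} \<le> (\<integral>\<^sup>+y. ennreal (exp (l * (C * real j))) \<partial>PiM {..<j} (\<lambda>_. unif))"
    unfolding mgf_def weight_def by (intro nn_integral_mono ennreal_leI b)
  then show "mgf {..<j} \<le> ennreal (exp (l * (C * real j)))" by (simp only: nn_integral_const P.emeasure_space_1 mult_1_right)
qed

lemma mgf_eq: "mgf {..<j} = ennreal (g j)" and g_pos: "g j > 0"
proof -
  have "mgf {..<j} < top" using mgf_bounds(2)[of j] by (rule le_less_trans) simp
  then show 1: "mgf {..<j} = ennreal (g j)" by (simp add: g_def)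
  have "ennreal (exp (- (l * (C * real j)))) \<le> ennreal (g j)" using mgf_bounds(1)[of j] unfolding 1 .
  then show "g j > 0" by (metis ennreal_le_iff2 exp_gt_zero less_le_trans linorder_not_less)
qed

lemma mgf_Suc: "mgf {..<Suc j} = (\<integral>\<^sup>+x. (\<integral>\<^sup>+y. weight (insert x (y ` {..<j})) \<partial>PiM {..<j} (\<lambda>_. unif)) \<partial>unif)"
proof -
  have "(\<integral>\<^sup>+y. weight (y ` insert j {..<j}) \<partial>PiM (insert j {..<j}) (\<lambda>_. unif))
    = (\<integral>\<^sup>+x. (\<integral>\<^sup>+y. weight ((y(j := x)) ` insert j {..<j}) \<partial>PiM {..<j} (\<lambda>_. unif)) \<partial>unif)"
  proof (rule PU.product_nn_integral_insert_rev)
    show "(\<lambda>y. weight (y ` insert j {..<j})) \<in> borel_measurable (PiM (insert j {..<j}) (\<lambda>_. unif))"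
      unfolding measurable_uniform_tuples by (rule measurable_weight_image) auto
  qed auto
  moreover have "(y(j := x)) ` insert j {..<j} = insert x (y ` {..<j})" for y :: "nat \<Rightarrow> real^'d" and x by auto
  ultimately show ?thesis by (simp only: mgf_def lessThan_Suc)
qed

lemma unif_const: "(\<integral>\<^sup>+x. c \<partial>unif) = c"
  by (simp only: nn_integral_const unif.emeasure_space_1 mult_1_right)

lemma g_Suc_le: "g (Suc j) \<le> exp (l * C) * g j"
proof -
  have "mgf {..<Suc j} \<le> (\<integral>\<^sup>+x. ennreal (exp (l * C)) * mgf {..<j} \<partial>unif)"
    unfolding mgf_Suc
  proof (rule nn_integral_mono)
    fix x
    have "(\<integral>\<^sup>+y. weight (insert x (y ` {..<j})) \<partial>PiM {..<j} (\<lambda>_. unif)) \<le> (\<integral>\<^sup>+y. ennreal (exp (l * C)) * weight (y ` {..<j}) \<partial>PiM {..<j} (\<lambda>_. unif))"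
    proof (intro nn_integral_mono weight_ratio)
      fix y :: "nat \<Rightarrow> real^'d"
      have "\<bar>cstat (insert x (y ` {..<j})) - cstat (y ` {..<j})\<bar> \<le> C" by (rule cstat_insert_le) simp
      then show "cstat (insert x (y ` {..<j})) - cstat (y ` {..<j}) \<le> C" by linarith
    qed
    also have "\<dots> = ennreal (exp (l * C)) * mgf {..<j}"
      unfolding mgf_def using measurable_weight_image[of "{..<j}" "{..<j}"] by (intro nn_integral_cmult) simp
    finally show "(\<integral>\<^sup>+y. weight (insert x (y ` {..<j})) \<partial>PiM {..<j} (\<lambda>_. unif)) \<le> ennreal (exp (l * C)) * mgf {..<j}" .
  qed
  then have "ennreal (g (Suc j)) \<le> ennreal (exp (l * C) * g j)"
    unfolding unif_const mgf_eq using g_pos[of j] by (simp add: ennreal_mult)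
  then show ?thesis using g_pos[of j] by (subst (asm) ennreal_le_iff) auto
qed

text \<open>The expected relative change of the weight by one more point is at most a constant times the tilted
  probability of finding \<open>k - 1\<close> points near it.\<close>

lemma g_increment:
  assumes small: "l * C * real k \<le> 1 / 2"
    and \<delta>: "\<delta> = 6 * (l * C) * real (j choose (k - 1)) * ((2 * (r * R)) ^ CARD('d)) ^ (k - 1)"
  shows "\<bar>g (Suc j) - g j\<bar> \<le> \<delta> * g j"
proof -
  let ?e = "ennreal (2 * (l * C))"
  have lC: "0 \<le> l * C" "l * C \<le> 1"
  proof -
    show 1: "0 \<le> l * C" using l0 C0 by simp
    have "l * C * 1 \<le> l * C * real k" using 1 k2 by (intro mult_left_mono) auto
    then show "l * C \<le> 1" using small by linarith
  qed
  have \<delta>0: "\<delta> \<ge> 0" using \<delta> lC r0 R_pos by simp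
  (* A bound for the change of the weight when x is added to Y. *)
  define Dx where "Dx x Y = ?e * (of_bool (k - 1 \<le> card (Y \<inter> cball x (r * R))) * weight Y)" for x and Y :: "(real^'d) set"
  have Dint: "(\<integral>\<^sup>+y. Dx x (y ` {..<j}) \<partial>PiM {..<j} (\<lambda>_. unif)) \<le> ennreal (\<delta> * g j)" for x
  proof -
    have B: "cball x (r * R) \<in> sets borel" by simp
    have em: "emeasure unif (cball x (r * R)) \<le> ennreal ((2 * (r * R)) ^ CARD('d))"
    proof -
      have "emeasure unif (cball x (r * R)) = emeasure lborel (unit_cube \<inter> cball x (r * R))"
        by (simp add: emeasure_unit_cube divide_ennreal_def)
      also have "\<dots> \<le> emeasure lborel (cball x (r * R))" by (rule emeasure_mono) auto
      also have "\<dots> \<le> ennreal ((2 * (r * R)) ^ CARD('d))" using r0 R_pos by (intro emeasure_cball_le) simp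
      finally show ?thesis .
    qed
    have e3: "exp (2 * (l * (C * real (k - 1)))) \<le> 3"
    proof -
      have "l * C * real (k - 1) \<le> l * C * real k" using lC by (intro mult_left_mono) auto
      then have "2 * (l * (C * real (k - 1))) \<le> 1" using small by (simp add: mult.assoc)
      then have "exp (2 * (l * (C * real (k - 1)))) \<le> exp 1" by simp
      also have "\<dots> \<le> 3" by (rule exp_le)
      finally show ?thesis .
    qed
    have "(\<lambda>Y. of_bool (k - 1 \<le> card (Y \<inter> cball x (r * R))) :: ennreal) \<in> borel_measurable conf"
      by (rule measurable_compose[OF measurable_conf_card[OF B]]) simp
    then have "(\<lambda>Y. of_bool (k - 1 \<le> card (Y \<inter> cball x (r * R))) * weight Y) \<in> borel_measurable conf"
      using measurable_weight by (rule borel_measurable_times_ennreal)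
    from measurable_compose[OF measurable_tuple_conf this, of "{..<j}"]
    have "(\<integral>\<^sup>+y. Dx x (y ` {..<j}) \<partial>PiM {..<j} (\<lambda>_. unif))
      = ?e * (\<integral>\<^sup>+y. of_bool (k - 1 \<le> card (y ` {..<j} \<inter> cball x (r * R))) * weight (y ` {..<j}) \<partial>PiM {..<j} (\<lambda>_. unif))"
      unfolding Dx_def by (intro nn_integral_cmult) simp
    also have "\<dots> \<le> ?e * (of_nat (j choose (k - 1)) * (ennreal (exp (2 * (l * (C * real (k - 1))))) * (emeasure unif (cball x (r * R)) ^ (k - 1) * mgf {..<j})))"
      using weighted_crowding_le[OF _ B, of "{..<j}"] by (intro mult_left_mono) auto
    also have "\<dots> \<le> ?e * (of_nat (j choose (k - 1)) * (ennreal 3 * (ennreal ((2 * (r * R)) ^ CARD('d)) ^ (k - 1) * mgf {..<j})))"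
      using e3 em by (intro mult_left_mono mult_mono power_mono ennreal_leI) auto
    also have "\<dots> = ennreal (2 * (l * C) * (real (j choose (k - 1)) * (3 * (((2 * (r * R)) ^ CARD('d)) ^ (k - 1) * g j))))"
    proof -
      have nonneg: "0 \<le> (2 * (r * R)) ^ CARD('d)" "0 \<le> ((2 * (r * R)) ^ CARD('d)) ^ (k - 1)" "0 \<le> real (j choose (k - 1))"
        "0 \<le> (3::real)" "0 \<le> 2 * (l * C)" using lC r0 R_pos by simp_all
      show ?thesis
        unfolding mgf_eq ennreal_of_nat_eq_real_of_nat ennreal_power[OF nonneg(1)] ennreal_mult'[OF nonneg(2), symmetric]
          ennreal_mult'[OF nonneg(4), symmetric] ennreal_mult'[OF nonneg(3), symmetric] ennreal_mult'[OF nonneg(5), symmetric] ..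
    qed
    also have "\<dots> = ennreal (\<delta> * g j)" unfolding \<delta> by (simp only: mult_ac) simp
    finally show ?thesis .
  qed
  have Dmeas: "(\<lambda>y. Dx x (y ` {..<j})) \<in> borel_measurable (PiM {..<j} (\<lambda>_. unif))" for x
  proof -
    have "(\<lambda>Y. of_bool (k - 1 \<le> card (Y \<inter> cball x (r * R))) :: ennreal) \<in> borel_measurable conf"
      by (rule measurable_compose[OF measurable_conf_card]) auto
    then have "Dx x \<in> borel_measurable conf"
      unfolding Dx_def[abs_def] using measurable_weight by (intro borel_measurable_times_ennreal) auto
    from measurable_compose[OF measurable_tuple_conf this, of "{..<j}"] show ?thesis by simp
  qed
  have pw: "weight (insert x Y) \<le> weight Y + Dx x Y" "weight Y \<le> weight (insert x Y) + Dx x Y" if "finite Y" for x Y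
  proof -
    define u where "u = l * (cstat (insert x Y) - cstat Y)"
    let ?b = "of_bool (k - 1 \<le> card (Y \<inter> cball x (r * R))) :: real"
    have "\<bar>u\<bar> \<le> l * (C * of_bool (k \<le> card (Y \<inter> cball x (r * R)) + 1))"
      unfolding u_def abs_mult using cstat_insert[OF that, of x] l0 by (simp add: mult_left_mono)
    also have "(k \<le> card (Y \<inter> cball x (r * R)) + 1) = (k - 1 \<le> card (Y \<inter> cball x (r * R)))" by auto
    finally have ub: "\<bar>u\<bar> \<le> l * C * ?b" by (simp add: mult.assoc)
    have "l * C * ?b \<le> 1" using lC by auto
    then have "\<bar>exp u - 1\<bar> \<le> 2 * \<bar>u\<bar>" using ub by (intro abs_exp_minus_one_le) linarith
    then have eb: "\<bar>exp u - 1\<bar> \<le> 2 * (l * C) * ?b" using ub by linarith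
    have w: "exp (l * cstat (insert x Y)) = exp (l * cstat Y) * exp u" by (simp add: u_def algebra_simps flip: exp_add)
    have D: "Dx x Y = ennreal (2 * (l * C) * ?b * exp (l * cstat Y))"
    proof -
      have "0 \<le> 2 * (l * C)" using lC by simp
      from ennreal_mult'[OF this, of "exp (l * cstat Y)"] show ?thesis unfolding Dx_def weight_def by (cases "k - 1 \<le> card (Y \<inter> cball x (r * R))") auto
    qed
    have "\<bar>exp u - 1\<bar> * exp (l * cstat Y) \<le> 2 * (l * C) * ?b * exp (l * cstat Y)"
      by (rule mult_right_mono[OF eb]) simp
    moreover have "\<bar>exp u - 1\<bar> * exp (l * cstat Y) = \<bar>exp (l * cstat (insert x Y)) - exp (l * cstat Y)\<bar>"
    proof -
      have "\<bar>exp u - 1\<bar> * exp (l * cstat Y) = \<bar>(exp u - 1) * exp (l * cstat Y)\<bar>" by (simp only: abs_mult abs_exp_cancel)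
      also have "(exp u - 1) * exp (l * cstat Y) = exp (l * cstat (insert x Y)) - exp (l * cstat Y)"
        unfolding w by (simp add: algebra_simps)
      finally show ?thesis .
    qed
    ultimately have 1: "exp (l * cstat (insert x Y)) \<le> exp (l * cstat Y) + 2 * (l * C) * ?b * exp (l * cstat Y)"
      "exp (l * cstat Y) \<le> exp (l * cstat (insert x Y)) + 2 * (l * C) * ?b * exp (l * cstat Y)"
      by linarith+
    show "weight (insert x Y) \<le> weight Y + Dx x Y" "weight Y \<le> weight (insert x Y) + Dx x Y"
      unfolding D weight_def using 1 lC by (simp_all add: ennreal_plus[symmetric] ennreal_leI del: ennreal_plus)
  qed
  have mw: "(\<lambda>y. weight (y ` {..<j})) \<in> borel_measurable (PiM {..<j} (\<lambda>_. unif))"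
    using measurable_weight_image[of "{..<j}" "{..<j}"] by simp
  have mi: "(\<lambda>y. weight (insert x (y ` {..<j}))) \<in> borel_measurable (PiM {..<j} (\<lambda>_. unif))" for x
  proof -
    have "(\<lambda>Y. insert x Y) \<in> conf \<rightarrow>\<^sub>M conf"
    proof (rule measurable_confI)
      fix B :: "(real^'d) set" assume B: "B \<in> sets borel"
      have "{Y \<in> space conf. insert x Y \<inter> B = {}} = (if x \<in> B then {} else {Y. finite Y \<and> Y \<inter> B = {}})" by auto
      then show "{Y \<in> space conf. insert x Y \<inter> B = {}} \<in> sets conf" using B by simp
    qed auto
    from measurable_compose[OF measurable_tuple_conf measurable_compose[OF this measurable_weight], of "{..<j}"]
    show ?thesis by simp
  qed
  have up: "ennreal (g (Suc j)) \<le> ennreal (g j + \<delta> * g j)"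
  proof -
    have "mgf {..<Suc j} \<le> (\<integral>\<^sup>+x. ennreal (g j + \<delta> * g j) \<partial>unif)"
      unfolding mgf_Suc
    proof (rule nn_integral_mono)
      fix x
      have "(\<integral>\<^sup>+y. weight (insert x (y ` {..<j})) \<partial>PiM {..<j} (\<lambda>_. unif)) \<le> (\<integral>\<^sup>+y. weight (y ` {..<j}) + Dx x (y ` {..<j}) \<partial>PiM {..<j} (\<lambda>_. unif))"
        by (intro nn_integral_mono pw) simp
      also have "\<dots> = mgf {..<j} + (\<integral>\<^sup>+y. Dx x (y ` {..<j}) \<partial>PiM {..<j} (\<lambda>_. unif))"
        unfolding mgf_def by (rule nn_integral_add[OF mw Dmeas])
      also have "\<dots> \<le> ennreal (g j) + ennreal (\<delta> * g j)" unfolding mgf_eq by (intro add_left_mono Dint)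
      also have "\<dots> = ennreal (g j + \<delta> * g j)" using g_pos[of j] \<delta>0 by (simp add: ennreal_plus)
      finally show "(\<integral>\<^sup>+y. weight (insert x (y ` {..<j})) \<partial>PiM {..<j} (\<lambda>_. unif)) \<le> ennreal (g j + \<delta> * g j)" .
    qed
    then show ?thesis unfolding unif_const mgf_eq .
  qed
  have down: "ennreal (g j - \<delta> * g j) \<le> ennreal (g (Suc j))"
  proof -
    have "(\<integral>\<^sup>+x. ennreal (g j - \<delta> * g j) \<partial>unif) \<le> mgf {..<Suc j}"
      unfolding mgf_Suc
    proof (rule nn_integral_mono)
      fix x
      let ?B = "\<integral>\<^sup>+y. weight (insert x (y ` {..<j})) \<partial>PiM {..<j} (\<lambda>_. unif)"
      have "ennreal (g j) = mgf {..<j}" by (simp only: mgf_eq)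
      also have "\<dots> \<le> (\<integral>\<^sup>+y. weight (insert x (y ` {..<j})) + Dx x (y ` {..<j}) \<partial>PiM {..<j} (\<lambda>_. unif))"
        unfolding mgf_def by (intro nn_integral_mono pw) simp
      also have "\<dots> = ?B + (\<integral>\<^sup>+y. Dx x (y ` {..<j}) \<partial>PiM {..<j} (\<lambda>_. unif))" by (rule nn_integral_add[OF mi Dmeas])
      also have "\<dots> \<le> ?B + ennreal (\<delta> * g j)" by (intro add_left_mono Dint)
      finally have *: "ennreal (g j) \<le> ?B + ennreal (\<delta> * g j)" .
      show "ennreal (g j - \<delta> * g j) \<le> ?B"
      proof (cases ?B)
        case (real b)
        then have "g j \<le> b + \<delta> * g j" using * \<delta>0 g_pos[of j] by (simp add: ennreal_plus[symmetric] del: ennreal_plus)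
        then have "g j - \<delta> * g j \<le> b" by linarith
          then show ?thesis unfolding real by (rule ennreal_leI)
      qed simp
    qed
    then show ?thesis unfolding unif_const mgf_eq .
  qed
  have "g (Suc j) \<le> g j + \<delta> * g j" using up g_pos[of j] \<delta>0 by (subst (asm) ennreal_le_iff) (auto intro: add_nonneg_nonneg)
  moreover have "g j - \<delta> * g j \<le> g (Suc j)" using down g_pos[of "Suc j"] by (subst (asm) ennreal_le_iff) auto
  ultimately show ?thesis by (simp add: abs_le_iff)
qed

lemma mgf_eq_binom_law: "(\<integral>\<^sup>+Y. weight Y \<partial>binom_law unit_cube j) = ennreal (g j)"
  unfolding mgf_eq[symmetric] mgf_def by (rule window.nn_integral_binom_law[OF window_unit_cube measurable_weight])

lemma mgf_eq_pois_law: "(\<integral>\<^sup>+Y. weight Y \<partial>pois_law unit_cube c) = (\<integral>\<^sup>+j. ennreal (g j) \<partial>measure_pmf (poisson_pmf c))"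
  unfolding window.nn_integral_pois_law[OF window_unit_cube measurable_weight] mgf_eq_binom_law measure_unit_cube by simp

end



section \<open>Moment generating function of the binomial component count\<close>

text \<open>Here \<open>j < 2 n\<close> bounds the number of \<open>(k - 1)\<close>-subsets of the \<open>j\<close> points uniformly, and \<open>depoissonize\<close> applies
  with one \<open>\<delta>\<close>. The centering \<open>m\<close> is a common factor and hence arbitrary.\<close>

lemma (in increments) compare_binom_pois:
  fixes m :: real
  assumes n: "n \<ge> 9" and small: "l * C * real k \<le> 1 / 2" "l * C \<le> 1 / 4"
    and \<delta>: "\<delta> = 6 * (l * C) * (2 * real n) ^ (k - 1) * ((2 * (r * R)) ^ CARD('d)) ^ (k - 1)" "\<delta> \<le> 1 / 2"
  shows "(\<integral>Y. exp (l * (cstat Y - m)) \<partial>pois_law unit_cube (real n))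
      \<le> 3 * exp (4 * real n * \<delta>\<^sup>2) * (\<integral>Y. exp (l * (cstat Y - m)) \<partial>binom_law unit_cube n)"
    and "(\<integral>Y. exp (l * (cstat Y - m)) \<partial>binom_law unit_cube n)
      \<le> 2 * exp (6 + 6 * real n * \<delta>\<^sup>2) * (\<integral>Y. exp (l * (cstat Y - m)) \<partial>pois_law unit_cube (real n))"
proof -
  have lC: "0 \<le> l * C" using l0 C0 by simp
  have \<delta>0: "\<delta> \<ge> 0" unfolding \<delta>(1) using lC r0 R_pos by simp
  have near: "\<bar>g (Suc j) - g j\<bar> \<le> \<delta> * g j" if "j < 2 * n" for j
  proof -
    have "real (j choose (k - 1)) \<le> (2 * real n) ^ (k - 1)"
    proof (cases "k - 1 \<le> j")
      case True
      have "j choose (k - 1) \<le> j ^ (k - 1)" using True by (rule binomial_le_pow)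
      also have "\<dots> \<le> (2 * n) ^ (k - 1)" using that by (intro power_mono) auto
      finally show ?thesis by (metis of_nat_le_iff of_nat_mult of_nat_numeral of_nat_power)
    next
      case False
      then have "j choose (k - 1) = 0" by (intro binomial_eq_0) simp
      then have zero: "real (j choose (k - 1)) = 0" by (simp only: of_nat_0)
      show ?thesis unfolding zero by simp
    qed
    then have "6 * (l * C) * real (j choose (k - 1)) * ((2 * (r * R)) ^ CARD('d)) ^ (k - 1) \<le> \<delta>"
      unfolding \<delta>(1) using lC r0 R_pos by (intro mult_right_mono mult_left_mono) auto
    then show ?thesis
      using order.trans[OF g_increment[OF small(1) refl] mult_right_mono] g_pos[of j] by (simp add: less_imp_le)
  qed
  let ?P = "\<integral>\<^sup>+Y. weight Y \<partial>pois_law unit_cube (real n)"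
  have dp: "?P \<le> ennreal (3 * exp (4 * real n * \<delta>\<^sup>2) * g n)" "ennreal (g n) \<le> ennreal (2 * exp (6 + 6 * real n * \<delta>\<^sup>2)) * ?P"
    unfolding mgf_eq_pois_law
    by (rule depoissonize[where g = g, OF n g_pos \<delta>0 \<delta>(2) lC small(2)]; use near g_Suc_le in blast)+
  have fin: "?P < top" using dp(1) ennreal_less_top by (rule le_less_trans)
  define p where "p = enn2real ?P"
  have p: "?P = ennreal p" "p \<ge> 0" using fin by (simp_all add: p_def)
  have P1: "p \<le> 3 * exp (4 * real n * \<delta>\<^sup>2) * g n"
    using dp(1) g_pos[of n] unfolding p(1) by (subst (asm) ennreal_le_iff) auto
  have "ennreal (g n) \<le> ennreal (2 * exp (6 + 6 * real n * \<delta>\<^sup>2) * p)"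
    using dp(2) unfolding p(1) by (simp add: ennreal_mult p(2))
  then have P2: "g n \<le> 2 * exp (6 + 6 * real n * \<delta>\<^sup>2) * p"
    by (rule ennreal_le_iff[THEN iffD1, rotated]) (simp add: p(2))
  have factor: "(\<integral>Y. exp (l * (cstat Y - m)) \<partial>N) = exp (- (l * m)) * enn2real (\<integral>\<^sup>+Y. weight Y \<partial>N)" if N: "sets N = sets conf" for N
  proof -
    have "cstat \<in> borel_measurable N" using measurable_cstat measurable_cong_sets[OF N refl, of borel] by blast
    then have meas: "(\<lambda>Y. exp (l * cstat Y)) \<in> borel_measurable N" by measurable
    have "(\<integral>Y. exp (l * (cstat Y - m)) \<partial>N) = (\<integral>Y. exp (- (l * m)) * exp (l * cstat Y) \<partial>N)"
      by (intro Bochner_Integration.integral_cong refl) (simp add: algebra_simps flip: exp_add)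
    also have "\<dots> = exp (- (l * m)) * (\<integral>Y. exp (l * cstat Y) \<partial>N)" by simp
    also have "(\<integral>Y. exp (l * cstat Y) \<partial>N) = enn2real (\<integral>\<^sup>+Y. weight Y \<partial>N)"
      unfolding weight_def using meas by (intro integral_eq_nn_integral) auto
    finally show ?thesis .
  qed
  have bp: "(\<integral>Y. exp (l * (cstat Y - m)) \<partial>binom_law unit_cube n) = exp (- (l * m)) * g n"
    "(\<integral>Y. exp (l * (cstat Y - m)) \<partial>pois_law unit_cube (real n)) = exp (- (l * m)) * p"
    using factor[of "binom_law unit_cube n"] factor[OF window.sets_pois_law[OF window_unit_cube], of "real n"] less_imp_le[OF g_pos[of n]]
    by (simp_all add: mgf_eq_binom_law p_def)
  show "(\<integral>Y. exp (l * (cstat Y - m)) \<partial>pois_law unit_cube (real n))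
      \<le> 3 * exp (4 * real n * \<delta>\<^sup>2) * (\<integral>Y. exp (l * (cstat Y - m)) \<partial>binom_law unit_cube n)"
    unfolding bp using mult_left_mono[OF P1, of "exp (- (l * m))"] by (simp only: mult_ac exp_ge_zero)
  show "(\<integral>Y. exp (l * (cstat Y - m)) \<partial>binom_law unit_cube n)
      \<le> 2 * exp (6 + 6 * real n * \<delta>\<^sup>2) * (\<integral>Y. exp (l * (cstat Y - m)) \<partial>pois_law unit_cube (real n))"
    unfolding bp using mult_left_mono[OF P2, of "exp (- (l * m))"] by (simp only: mult_ac exp_ge_zero)
qed

lemma void_process_pois_law:
  assumes "c > 0"
  shows "void_process (pois_law unit_cube c) (\<lambda>Y. Y \<inter> unit_cube) c (unit_cube :: (real ^ 'd::finite) set)"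
proof -
  interpret window "unit_cube :: (real ^ 'd) set" by (rule window_unit_cube)
  interpret P: prob_space "pois_law (unit_cube :: (real ^ 'd) set) c" by (rule prob_space_pois_law)
  show ?thesis
  proof
    show "(\<lambda>Y. Y \<inter> unit_cube) \<in> measurable (pois_law unit_cube c) (conf :: (real^'d) set measure)"
      using measurable_conf_Int[OF sets_unit_cube] measurable_cong_sets[OF sets_pois_law refl] by blast
    fix B :: "(real ^ 'd) set" assume B: "B \<in> sets borel"
    have "space (pois_law unit_cube c) = {Y :: (real^'d) set. finite Y}"
      using sets_eq_imp_space_eq[OF sets_pois_law[of c]] by simp
    then have "{Y \<in> space (pois_law unit_cube c). Y \<inter> unit_cube \<inter> B = {}} = {Y. finite Y \<and> Y \<inter> (B \<inter> unit_cube) = {}}" by auto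
    then show "measure (pois_law unit_cube c) {Y \<in> space (pois_law unit_cube c). Y \<inter> unit_cube \<inter> B = {}} = exp (- c * measure lborel (B \<inter> unit_cube))"
      using void_pois_law[of "B \<inter> unit_cube" c] B assms by (simp add: Int_ac)
  qed (use assms in \<open>auto simp: emeasure_unit_cube\<close>)
qed

context sparse_regime
begin

text \<open>With \<open>u = (n r\<^sup>d)\<^sup>k\<^sup>-\<^sup>1\<close> one has \<open>\<rho> = n u\<close> and \<open>\<delta> = K lam u\<close>, so that \<open>n \<delta>\<^sup>2 = K\<^sup>2 a u\<close> is negligible against \<open>a\<close>.\<close>

lemma binomial_mgf:
  fixes \<theta> :: "real ^ 'm"
  assumes e: "e > 0"
  defines "m \<equiv> \<lambda>n. (\<integral>Y. stat \<theta> (r n) (Y \<inter> unit_cube) \<partial>pois_law unit_cube (real n))"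
  shows "\<forall>\<^sub>F n in sequentially.
    (\<integral>Y. exp (lam n * (stat \<theta> (r n) (Y \<inter> unit_cube) - m n)) \<partial>binom_law unit_cube n) \<le> exp (a n * (1 / 2 * (\<theta> \<bullet> (gram *v \<theta>)) + e)) \<and>
    (\<integral>Y. exp (lam n * (stat \<theta> (r n) (Y \<inter> unit_cube) - m n)) \<partial>binom_law unit_cube n) \<ge> exp (a n * (1 / 2 * (\<theta> \<bullet> (gram *v \<theta>)) - e))"
proof -
  obtain C where C: "C \<ge> 0" "\<And>r x X. r > 0 \<Longrightarrow> finite X \<Longrightarrow>
    \<bar>stat \<theta> r (insert x X) - stat \<theta> r X\<bar> \<le> C * of_bool (k \<le> card (X \<inter> cball x (r * R)) + 1)"
    using stat_insert_bound[of \<theta>] by blast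
  have incr: "increments TYPE('d) k \<Gamma> t \<theta> (r n) (lam n) C" for n
    by unfold_locales (use r_pos lam_nonneg C in auto)
  define Q where "Q = \<theta> \<bullet> (gram *v \<theta>)"
  define K where "K = 6 * C * (2 * (2 * R) ^ CARD('d)) ^ (k - 1)"
  define u where "u n = (real n * r n ^ CARD('d)) ^ (k - 1)" for n
  define \<delta> where "\<delta> n = K * (lam n * u n)" for n
  have \<delta>_eq: "\<delta> n = 6 * (lam n * C) * (2 * real n) ^ (k - 1) * ((2 * (r n * R)) ^ CARD('d)) ^ (k - 1)" for n
    unfolding \<delta>_def K_def u_def by (simp only: power_mult_distrib mult_ac)
  have \<delta>_sq: "real n * (\<delta> n)\<^sup>2 = a n * (K\<^sup>2 * u n)" for n
  proof -
    have "\<rho> n = real n * u n"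
    proof -
      have "real n ^ k = real n * real n ^ (k - 1)" using k_pos by (simp add: power_eq_if)
      then show ?thesis unfolding rho_def u_def by (simp only: power_mult_distrib power_mult mult.assoc)
    qed
    then show ?thesis unfolding \<delta>_def a_def by (simp add: power2_eq_square)
  qed
  have u_lim: "u \<longlonglongrightarrow> 0"
  proof -
    have "u \<longlonglongrightarrow> 0 ^ (k - 1)" unfolding u_def by (intro tendsto_power sparse)
    then show ?thesis using k2 by (simp add: power_0_left)
  qed
  have ev1: "\<forall>\<^sub>F n in sequentially. \<delta> n < 1 / 2"
  proof -
    have "\<delta> \<longlonglongrightarrow> K * (0 * 0)" unfolding \<delta>_def[abs_def] by (intro tendsto_intros lam_lim u_lim)
    then show ?thesis by (rule order_tendstoD) simp
  qed
  have ev2: "\<forall>\<^sub>F n in sequentially. lam n * C * real k < 1 / 2"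
  proof -
    have "(\<lambda>n. lam n * C * real k) \<longlonglongrightarrow> 0 * C * real k" by (intro tendsto_intros lam_lim)
    then show ?thesis by (rule order_tendstoD) simp
  qed
  have ev3: "\<forall>\<^sub>F n in sequentially. lam n * C < 1 / 4"
  proof -
    have "(\<lambda>n. lam n * C) \<longlonglongrightarrow> 0 * C" by (intro tendsto_intros lam_lim)
    then show ?thesis by (rule order_tendstoD) simp
  qed
  have ev4: "\<forall>\<^sub>F n in sequentially. 6 * K\<^sup>2 * u n < e / 4"
  proof -
    have "(\<lambda>n. 6 * K\<^sup>2 * u n) \<longlonglongrightarrow> 6 * K\<^sup>2 * 0" by (intro tendsto_intros u_lim)
    then show ?thesis by (rule order_tendstoD) (use e in simp)
  qed
  have e4: "e / 4 > 0" and e2: "e / 2 > 0" using e by auto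
  have pois: "\<forall>\<^sub>F n in sequentially.
    (\<integral>Y. exp (lam n * (stat \<theta> (r n) (Y \<inter> unit_cube) - m n)) \<partial>pois_law unit_cube (real n)) \<le> exp (a n * (1 / 2 * Q + e / 2)) \<and>
    (\<integral>Y. exp (lam n * (stat \<theta> (r n) (Y \<inter> unit_cube) - m n)) \<partial>pois_law unit_cube (real n)) \<ge> exp (a n * (1 / 2 * Q - e / 2))"
    unfolding Q_def m_def
    by (rule poisson_mgf[where M = "\<lambda>n. pois_law unit_cube (real n)" and X = "\<lambda>n Y. Y \<inter> unit_cube", OF _ _ e2])
      (simp_all add: void_process_pois_law)
  show ?thesis
    using pois ev1 ev2 ev3 ev4 a_pos eventually_const_le_exp[OF a_lim e4, of 3] eventually_const_le_exp[OF a_lim e4, of "2 * exp 6"] eventually_ge_at_top[of 9]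
  proof eventually_elim
    case (elim n)
    interpret increments k \<Gamma> t dim \<theta> "r n" "lam n" C by (rule incr)
    let ?B = "\<integral>Y. exp (lam n * (stat \<theta> (r n) (Y \<inter> unit_cube) - m n)) \<partial>binom_law unit_cube n"
    let ?P = "\<integral>Y. exp (lam n * (stat \<theta> (r n) (Y \<inter> unit_cube) - m n)) \<partial>pois_law unit_cube (real n)"
    note cmp = compare_binom_pois[OF elim(9) less_imp_le[OF elim(3)] less_imp_le[OF elim(4)] \<delta>_eq less_imp_le[OF elim(2)], of "m n", unfolded cstat_def]
    have sm: "4 * real n * (\<delta> n)\<^sup>2 \<le> a n * (e / 4)" "6 * real n * (\<delta> n)\<^sup>2 \<le> a n * (e / 4)"
    proof -
      have u: "u n \<ge> 0" using r_pos[of n] by (simp add: u_def)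
      have "6 * real n * (\<delta> n)\<^sup>2 = a n * (6 * K\<^sup>2 * u n)" using \<delta>_sq[of n] by (simp add: mult_ac)
      also have "\<dots> \<le> a n * (e / 4)" using elim by (intro mult_left_mono) auto
      finally show 1: "6 * real n * (\<delta> n)\<^sup>2 \<le> a n * (e / 4)" .
      have "0 \<le> real n * (\<delta> n)\<^sup>2" by simp
      then show "4 * real n * (\<delta> n)\<^sup>2 \<le> a n * (e / 4)" using 1 by linarith
    qed
    have half: "exp (a n * (e / 4)) * exp (a n * (e / 4)) = exp (a n * (e / 2))" by (simp flip: exp_add)
    have "3 * exp (4 * real n * (\<delta> n)\<^sup>2) \<le> exp (a n * (e / 4)) * exp (a n * (e / 4))"
      using elim sm by (intro mult_mono) auto
    then have c1: "3 * exp (4 * real n * (\<delta> n)\<^sup>2) \<le> exp (a n * (e / 2))" unfolding half .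
    have "2 * exp (6 + 6 * real n * (\<delta> n)\<^sup>2) = (2 * exp 6) * exp (6 * real n * (\<delta> n)\<^sup>2)" by (simp add: exp_add)
    also have "\<dots> \<le> exp (a n * (e / 4)) * exp (a n * (e / 4))" using elim sm by (intro mult_mono) auto
    finally have c2: "2 * exp (6 + 6 * real n * (\<delta> n)\<^sup>2) \<le> exp (a n * (e / 2))" unfolding half .
    have nonneg: "0 \<le> ?B" "0 \<le> ?P" by (intro integral_nonneg_AE AE_I2; simp)+
    have "?B \<le> exp (a n * (e / 2)) * ?P" by (rule order.trans[OF cmp(2) mult_right_mono[OF c2 nonneg(2)]])
    also have "\<dots> \<le> exp (a n * (e / 2)) * exp (a n * (1 / 2 * Q + e / 2))" using elim(1) by (intro mult_left_mono) auto
    also have "\<dots> = exp (a n * (1 / 2 * Q + e))" by (simp add: algebra_simps flip: exp_add)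
    finally have up: "?B \<le> exp (a n * (1 / 2 * Q + e))" .
    have "exp (a n * (1 / 2 * Q - e)) = exp (- (a n * (e / 2))) * exp (a n * (1 / 2 * Q - e / 2))"
      by (simp add: algebra_simps flip: exp_add)
    also have "\<dots> \<le> exp (- (a n * (e / 2))) * ?P" using elim(1) by (intro mult_left_mono) auto
    also have "\<dots> \<le> exp (- (a n * (e / 2))) * (exp (a n * (e / 2)) * ?B)"
      by (intro mult_left_mono order.trans[OF cmp(1) mult_right_mono[OF c1 nonneg(1)]]) simp
    also have "\<dots> = ?B" by (simp add: exp_minus)
    finally have low: "exp (a n * (1 / 2 * Q - e)) \<le> ?B" .
    show ?case using up low unfolding Q_def by blast
  qed
qed

text \<open>Replacing \<open>\<theta>\<close> by \<open>\<plusminus> s \<theta>\<close> with a small \<open>s\<close> in the bounds on the moment generating function, Jensen's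
  inequality shows that the centering is known up to \<open>o(a / lam)\<close>, so that any admissible centering
  can be exchanged for the expectation.\<close>

lemma recenter:
  fixes M :: "nat \<Rightarrow> 'w measure" and X :: "nat \<Rightarrow> 'w \<Rightarrow> (real ^ 'd) set" and \<theta> :: "real ^ 'm" and m :: "real ^ 'm \<Rightarrow> nat \<Rightarrow> real"
  assumes prob: "\<forall>n. prob_space (M n)" and X: "\<forall>n. X n \<in> measurable (M n) conf"
    and bdd: "\<forall>\<theta> n. \<exists>K. \<forall>\<omega>\<in>space (M n). \<bar>stat \<theta> (r n) (X n \<omega>)\<bar> \<le> K"
    and m: "\<forall>\<theta> n c. m (c *\<^sub>R \<theta>) n = c * m \<theta> n"
    and mgf: "\<forall>\<theta> e. e > 0 \<longrightarrow> (\<forall>\<^sub>F n in sequentially.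
      (\<integral>\<omega>. exp (lam n * (stat \<theta> (r n) (X n \<omega>) - m \<theta> n)) \<partial>M n) \<le> exp (a n * (1 / 2 * (\<theta> \<bullet> (gram *v \<theta>)) + e)) \<and>
      (\<integral>\<omega>. exp (lam n * (stat \<theta> (r n) (X n \<omega>) - m \<theta> n)) \<partial>M n) \<ge> exp (a n * (1 / 2 * (\<theta> \<bullet> (gram *v \<theta>)) - e)))"
    and e: "e > 0"
  defines "E \<equiv> \<lambda>n. (\<integral>\<omega>. stat \<theta> (r n) (X n \<omega>) \<partial>M n)"
  shows "\<forall>\<^sub>F n in sequentially.
      (\<integral>\<omega>. exp (lam n * (stat \<theta> (r n) (X n \<omega>) - E n)) \<partial>M n) \<le> exp (a n * (1 / 2 * (\<theta> \<bullet> (gram *v \<theta>)) + e)) \<and>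
      (\<integral>\<omega>. exp (lam n * (stat \<theta> (r n) (X n \<omega>) - E n)) \<partial>M n) \<ge> exp (a n * (1 / 2 * (\<theta> \<bullet> (gram *v \<theta>)) - e))"
proof -
  define Q where "Q = \<theta> \<bullet> (gram *v \<theta>)"
  have Q: "Q \<ge> 0" unfolding Q_def by (rule gram_nonneg)
  have stat_meas: "(\<lambda>\<omega>. stat \<theta> (r n) (X n \<omega>)) \<in> borel_measurable (M n)" for \<theta> n
    by (rule measurable_compose[OF X[rule_format] measurable_stat])
  have stat_int: "integrable (M n) (\<lambda>\<omega>. stat \<theta> (r n) (X n \<omega>))" for \<theta> n
  proof -
    interpret prob_space "M n" using prob by blast
    obtain K where "\<forall>\<omega>\<in>space (M n). \<bar>stat \<theta> (r n) (X n \<omega>)\<bar> \<le> K" using bdd by blast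
    then show ?thesis by (intro integrable_const_bound[of _ K] stat_meas AE_I2) auto
  qed
  have stat_scale: "stat (c *\<^sub>R \<theta>) s Y = c * stat \<theta> s Y" for c s Y
    by (simp flip: inner_component_count)
  have shift: "lam n * (\<sigma> * (E n - m \<theta> n)) \<le> ln (\<integral>\<omega>. exp (lam n * (stat (\<sigma> *\<^sub>R \<theta>) (r n) (X n \<omega>) - m (\<sigma> *\<^sub>R \<theta>) n)) \<partial>M n)"
    and pos: "(\<integral>\<omega>. exp (lam n * (stat (\<sigma> *\<^sub>R \<theta>) (r n) (X n \<omega>) - m (\<sigma> *\<^sub>R \<theta>) n)) \<partial>M n) > 0" for n \<sigma>
  proof -
    interpret prob_space "M n" using prob by blast
    let ?W = "\<lambda>\<omega>. lam n * (stat (\<sigma> *\<^sub>R \<theta>) (r n) (X n \<omega>) - m (\<sigma> *\<^sub>R \<theta>) n)"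
    let ?c = "lam n * (\<sigma> * (E n - m \<theta> n))"
    have W_eq: "?W \<omega> = lam n * (\<sigma> * (stat \<theta> (r n) (X n \<omega>) - m \<theta> n))" for \<omega>
      using m by (simp add: stat_scale right_diff_distrib)
    have W_meas: "?W \<in> borel_measurable (M n)" using stat_meas by measurable
    have W_int: "integrable (M n) ?W" by (intro integrable_mult_right Bochner_Integration.integrable_diff stat_int) simp
    have EW: "expectation ?W = ?c"
      unfolding W_eq E_def using stat_int[where \<theta> = \<theta>] prob_space by (simp add: Bochner_Integration.integral_diff)
    obtain K where K: "\<forall>\<omega>\<in>space (M n). \<bar>stat (\<sigma> *\<^sub>R \<theta>) (r n) (X n \<omega>)\<bar> \<le> K" using bdd by blast
    have eW_int: "integrable (M n) (\<lambda>\<omega>. exp (?W \<omega>))"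
    proof (rule integrable_const_bound[of _ "exp (lam n * (K + \<bar>m (\<sigma> *\<^sub>R \<theta>) n\<bar>))"])
      show "AE \<omega> in M n. norm (exp (?W \<omega>)) \<le> exp (lam n * (K + \<bar>m (\<sigma> *\<^sub>R \<theta>) n\<bar>))"
      proof (rule AE_I2)
        fix \<omega> assume "\<omega> \<in> space (M n)"
        then have "\<bar>stat (\<sigma> *\<^sub>R \<theta>) (r n) (X n \<omega>)\<bar> \<le> K" using K by blast
        then have "?W \<omega> \<le> lam n * (K + \<bar>m (\<sigma> *\<^sub>R \<theta>) n\<bar>)" by (intro mult_left_mono lam_nonneg) linarith
        then show "norm (exp (?W \<omega>)) \<le> exp (lam n * (K + \<bar>m (\<sigma> *\<^sub>R \<theta>) n\<bar>))" by simp
      qed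
    qed (use W_meas in measurable)
    have "exp ?c = expectation (\<lambda>\<omega>. exp ?c * (1 + (?W \<omega> - ?c)))"
      using W_int EW prob_space by simp
    also have "\<dots> \<le> expectation (\<lambda>\<omega>. exp (?W \<omega>))"
    proof (intro integral_mono eW_int)
      show "integrable (M n) (\<lambda>\<omega>. exp ?c * (1 + (?W \<omega> - ?c)))"
        by (intro integrable_mult_right Bochner_Integration.integrable_add Bochner_Integration.integrable_diff W_int) simp_all
      fix \<omega>
      have "exp ?c * (1 + (?W \<omega> - ?c)) \<le> exp ?c * exp (?W \<omega> - ?c)" by (intro mult_left_mono exp_ge_add_one_self) simp
      also have "\<dots> = exp (?W \<omega>)" by (simp flip: exp_add)
      finally show "exp ?c * (1 + (?W \<omega> - ?c)) \<le> exp (?W \<omega>)" .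
    qed
    finally have J: "exp ?c \<le> expectation (\<lambda>\<omega>. exp (?W \<omega>))" .
    then show pos: "expectation (\<lambda>\<omega>. exp (?W \<omega>)) > 0" using exp_gt_zero[of ?c] by linarith
    show "?c \<le> ln (expectation (\<lambda>\<omega>. exp (?W \<omega>)))" using J pos by (simp add: ln_ge_iff)
  qed
  (* Jensen at s times theta bounds the shift by a (s Q / 2 + o(1) / s); first s is chosen small, then n large. *)
  define s where "s = e / 2 / (Q + 1)"
  have s: "s > 0" "s * Q \<le> e / 2" using e Q by (auto simp: s_def field_simps)
  have one: "\<forall>\<^sub>F n in sequentially. lam n * (\<sigma> * (E n - m \<theta> n)) \<le> a n * (s * (e / 2))" if \<sigma>: "\<sigma> = s \<or> \<sigma> = - s" for \<sigma>
  proof -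
    have q: "(\<sigma> *\<^sub>R \<theta>) \<bullet> (gram *v (\<sigma> *\<^sub>R \<theta>)) = s * (s * Q)" using \<sigma> by (auto simp: Q_def matrix_vector_mult_scaleR)
    have "s * (e / 4) > 0" using s e by simp
    then have "\<forall>\<^sub>F n in sequentially. (\<integral>\<omega>. exp (lam n * (stat (\<sigma> *\<^sub>R \<theta>) (r n) (X n \<omega>) - m (\<sigma> *\<^sub>R \<theta>) n)) \<partial>M n)
        \<le> exp (a n * (1 / 2 * (s * (s * Q)) + s * (e / 4)))"
      using mgf[rule_format, of "s * (e / 4)" "\<sigma> *\<^sub>R \<theta>", unfolded q] by (auto elim: eventually_mono)
    then show ?thesis using a_pos
    proof eventually_elim
      case (elim n)
      have "lam n * (\<sigma> * (E n - m \<theta> n)) \<le> ln (exp (a n * (1 / 2 * (s * (s * Q)) + s * (e / 4))))"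
        using shift[of n \<sigma>] pos[of n \<sigma>] elim(1) by (meson exp_gt_zero ln_le_cancel_iff order.trans)
      also have "\<dots> = a n * (s * (1 / 2 * (s * Q) + e / 4))" by (simp add: algebra_simps)
      also have "\<dots> \<le> a n * (s * (e / 2))" using s elim(2) by (intro mult_left_mono) auto
      finally show ?case .
    qed
  qed
  have e2: "e / 2 > 0" using e by simp
  show ?thesis
    using one[of s, OF disjI1[OF refl]] one[of "- s", OF disjI2[OF refl]] mgf[rule_format, OF e2, of \<theta>]
  proof eventually_elim
    case (elim n)
    let ?d = "lam n * (E n - m \<theta> n)"
    have "s * ?d \<le> s * (a n * (e / 2))" using elim(1) by (simp add: mult_ac)
    then have d1: "?d \<le> a n * (e / 2)" using s(1) by (rule mult_left_le_imp_le)
    have "s * (- ?d) \<le> s * (a n * (e / 2))" using elim(2) by (simp add: mult_ac)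
    then have d2: "- ?d \<le> a n * (e / 2)" using s(1) by (rule mult_left_le_imp_le)
    let ?I = "\<integral>\<omega>. exp (lam n * (stat \<theta> (r n) (X n \<omega>) - m \<theta> n)) \<partial>M n"
    have split: "(\<integral>\<omega>. exp (lam n * (stat \<theta> (r n) (X n \<omega>) - E n)) \<partial>M n) = exp (- ?d) * ?I"
    proof -
      have "exp (lam n * (stat \<theta> (r n) (X n \<omega>) - E n)) = exp (- ?d) * exp (lam n * (stat \<theta> (r n) (X n \<omega>) - m \<theta> n))" for \<omega>
        by (simp add: algebra_simps flip: exp_add)
      then show ?thesis by simp
    qed
    have "exp (- ?d) * ?I \<le> exp (a n * (e / 2)) * exp (a n * (1 / 2 * Q + e / 2))"
      using elim(3) d2 unfolding Q_def[symmetric] by (intro mult_mono) (auto intro: integral_nonneg_AE)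
    also have "\<dots> = exp (a n * (1 / 2 * Q + e))" by (simp add: algebra_simps flip: exp_add)
    finally have up: "exp (- ?d) * ?I \<le> exp (a n * (1 / 2 * Q + e))" .
    have "exp (a n * (1 / 2 * Q - e)) = exp (- (a n * (e / 2))) * exp (a n * (1 / 2 * Q - e / 2))"
      by (simp add: algebra_simps flip: exp_add)
    also have "\<dots> \<le> exp (- ?d) * ?I" using elim(3) d1 unfolding Q_def[symmetric] by (intro mult_mono) auto
    finally show ?case using up unfolding split Q_def by blast
  qed
qed

end



section \<open>Laws of the point processes\<close>

lemma unit_cube_subset_cball: obtains e where "e > 0" "(unit_cube :: (real ^ 'd::finite) set) \<subseteq> cball 0 e"
proof -
  have "bounded (unit_cube :: (real ^ 'd) set)" by (simp add: unit_cube_eq_cbox)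
  then obtain e where "e > 0" "\<forall>x\<in>unit_cube. norm (x :: real ^ 'd) \<le> e" unfolding bounded_pos by blast
  then have "(unit_cube :: (real ^ 'd) set) \<subseteq> cball 0 e" by auto
  then show ?thesis using \<open>e > 0\<close> that by blast
qed

text \<open>Counts in Borel subsets of the cube are Poisson, so the void probabilities are the case \<open>j = 0\<close>.\<close>

lemma poisson_processD:
  fixes X :: "'w \<Rightarrow> (real ^ 'd::finite) set"
  assumes "poisson_process M c X"
  shows "prob_space M" "X \<in> measurable M conf" "\<forall>\<omega>\<in>space M. X \<omega> \<subseteq> unit_cube"
    and "c > 0 \<Longrightarrow> void_process M X c unit_cube"
proof -
  note def = assms[unfolded poisson_process_def]
  show prob: "prob_space M" and cube: "\<forall>\<omega>\<in>space M. X \<omega> \<subseteq> unit_cube" using def by auto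
  interpret prob_space M by (rule prob)
  have fin: "finite (X \<omega>)" if "\<omega> \<in> space M" for \<omega> using def that by blast
  have eq: "{\<omega> \<in> space M. X \<omega> \<inter> B = {}} = {\<omega> \<in> space M. card (X \<omega> \<inter> (B \<inter> unit_cube)) = 0}" for B
    using cube fin by (auto simp: card_eq_0_iff)
  have counts: "(\<lambda>\<omega>. card (X \<omega> \<inter> (B \<inter> unit_cube))) \<in> measurable M (count_space UNIV)"
    "prob {\<omega> \<in> space M. card (X \<omega> \<inter> (B \<inter> unit_cube)) = 0} = exp (- (c * measure lborel (B \<inter> unit_cube)))"
    if "B \<in> sets borel" for B
  proof -
    have "B \<inter> unit_cube \<in> sets borel" "B \<inter> unit_cube \<subseteq> unit_cube" using that sets_unit_cube by auto
    then have "(\<lambda>\<omega>. card (X \<omega> \<inter> (B \<inter> unit_cube))) \<in> measurable M (count_space UNIV) \<and>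
      (\<forall>j. prob {\<omega> \<in> space M. card (X \<omega> \<inter> (B \<inter> unit_cube)) = j}
        = exp (- (c * measure lborel (B \<inter> unit_cube))) * (c * measure lborel (B \<inter> unit_cube)) ^ j / fact j)"
      using def by blast
    then show "(\<lambda>\<omega>. card (X \<omega> \<inter> (B \<inter> unit_cube))) \<in> measurable M (count_space UNIV)"
      "prob {\<omega> \<in> space M. card (X \<omega> \<inter> (B \<inter> unit_cube)) = 0} = exp (- (c * measure lborel (B \<inter> unit_cube)))"
      by (auto dest: spec[of _ 0])
  qed
  show X: "X \<in> measurable M conf"
  proof (rule measurable_confI)
    fix B :: "(real ^ 'd) set" assume "B \<in> sets borel"
    from measurable_sets[OF counts(1)[OF this], of "{0}"]
    have "(\<lambda>\<omega>. card (X \<omega> \<inter> (B \<inter> unit_cube))) -` {0} \<inter> space M \<in> sets M" by simp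
    also have "(\<lambda>\<omega>. card (X \<omega> \<inter> (B \<inter> unit_cube))) -` {0} \<inter> space M = {\<omega> \<in> space M. X \<omega> \<inter> B = {}}"
      unfolding eq by auto
    finally show "{\<omega> \<in> space M. X \<omega> \<inter> B = {}} \<in> sets M" .
  qed (rule fin)
  show "void_process M X c unit_cube" if "c > 0"
  proof
    show "X \<in> measurable M conf" by (rule X)
    show "c > 0" by (rule that)
    fix B :: "(real ^ 'd) set" assume "B \<in> sets borel"
    from counts(2)[OF this] show "prob {\<omega> \<in> space M. X \<omega> \<inter> B = {}} = exp (- c * measure lborel (B \<inter> unit_cube))"
      unfolding eq by simp
  qed (auto simp: emeasure_unit_cube)
qed

text \<open>Void probabilities identify the law of the random set, by independence of its points.\<close>

lemma binomial_processD:
  fixes X :: "'w \<Rightarrow> (real ^ 'd::finite) set"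
  assumes "binomial_process M n X"
  shows "prob_space M" "X \<in> measurable M conf" "\<forall>\<omega>\<in>space M. finite (X \<omega>) \<and> card (X \<omega>) \<le> n"
    and "distr M conf X = binom_law unit_cube n" "AE \<omega> in M. X \<omega> \<subseteq> unit_cube"
proof -
  interpret window "unit_cube :: (real ^ 'd) set" by (rule window_unit_cube)
  show prob: "prob_space M" using assms by (simp add: binomial_process_def)
  interpret prob_space M by (rule prob)
  obtain U :: "nat \<Rightarrow> 'w \<Rightarrow> real ^ 'd" where U: "indep_vars (\<lambda>_. borel) U {..<n}"
    "\<forall>i<n. distr M borel (U i) = uniform_measure lborel unit_cube" "\<forall>\<omega>\<in>space M. X \<omega> = (\<lambda>i. U i \<omega>) ` {..<n}"
    using assms unfolding binomial_process_def by blast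
  show "\<forall>\<omega>\<in>space M. finite (X \<omega>) \<and> card (X \<omega>) \<le> n"
    using U(3) card_image_le[of "{..<n}"] by fastforce
  have Um: "U i \<in> borel_measurable M" if "i < n" for i
    using U(1) that unfolding indep_vars_def2 by blast
  have void_eq: "{\<omega> \<in> space M. X \<omega> \<inter> B = {}} = {\<omega> \<in> space M. \<forall>i<n. U i \<omega> \<in> - B}" for B
    using U(3) by auto
  show X: "X \<in> measurable M conf"
  proof (rule measurable_confI)
    show "finite (X \<omega>)" if "\<omega> \<in> space M" for \<omega> using U(3) that by simp
    fix B :: "(real ^ 'd) set" assume B: "B \<in> sets borel"
    have "{\<omega> \<in> space M. U i \<omega> \<in> - B} \<in> sets M" if "i \<in> {..<n}" for i
    proof -
      have "U i -` (- B) \<inter> space M \<in> sets M" using Um[of i] B that by (intro measurable_sets) auto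
      also have "U i -` (- B) \<inter> space M = {\<omega> \<in> space M. U i \<omega> \<in> - B}" by auto
      finally show ?thesis .
    qed
    then have "{\<omega> \<in> space M. \<forall>i\<in>{..<n}. U i \<omega> \<in> - B} \<in> sets M" by (rule sets.sets_Collect_finite_All) auto
    then show "{\<omega> \<in> space M. X \<omega> \<inter> B = {}} \<in> sets M" unfolding void_eq[of B] by (simp only: Ball_def lessThan_iff)
  qed
  have void: "prob {\<omega> \<in> space M. X \<omega> \<inter> B = {}} = (1 - measure lborel (unit_cube \<inter> B)) ^ n" if B: "B \<in> sets borel" for B
  proof (cases "n = 0")
    case True
    then show ?thesis unfolding void_eq using prob_space by simp
  next
    case False
    interpret unif: prob_space "uniform_measure lborel (unit_cube :: (real ^ 'd) set)" by (rule prob_space_uniform)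
    have one: "prob (U i -` (- B) \<inter> space M) = 1 - measure lborel (unit_cube \<inter> B)" if "i < n" for i
    proof -
      have "prob (U i -` (- B) \<inter> space M) = measure (distr M borel (U i)) (- B)"
        using Um[OF that] B by (intro measure_distr[symmetric]) auto
      also have "distr M borel (U i) = uniform_measure lborel unit_cube" using U(2) that by blast
      also have "measure (uniform_measure lborel unit_cube) (- B) = 1 - measure (uniform_measure lborel unit_cube) B"
        using unif.prob_compl[of B] B by (simp add: Compl_eq_Diff_UNIV)
      also have "measure (uniform_measure lborel unit_cube) B = measure lborel (unit_cube \<inter> B)"
        using measure_uniform[OF B] by (simp add: measure_unit_cube)
      finally show ?thesis .
    qed
    have "{\<omega> \<in> space M. X \<omega> \<inter> B = {}} = (\<Inter>i\<in>{..<n}. U i -` (- B) \<inter> space M)" unfolding void_eq using False by auto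
    also have "prob \<dots> = (\<Prod>i\<in>{..<n}. prob (U i -` (- B) \<inter> space M))"
      using False B by (intro indep_varsD[OF U(1)]) auto
    also have "\<dots> = (\<Prod>i\<in>{..<n}. 1 - measure lborel (unit_cube \<inter> B))" by (intro prod.cong refl one) auto
    finally show ?thesis by simp
  qed
  show "distr M conf X = binom_law unit_cube n"
  proof (rule conf_measure_eqI)
    show "prob_space (distr M conf X)" by (rule prob_space_distr[OF X])
    show "prob_space (binom_law (unit_cube :: (real ^ 'd) set) n)" by (rule prob_space_binom_law)
    fix B :: "(real ^ 'd) set" assume B: "B \<in> sets borel"
    have "measure (distr M conf X) {Y. finite Y \<and> Y \<inter> B = {}} = prob (X -` {Y. finite Y \<and> Y \<inter> B = {}} \<inter> space M)"
      using B by (intro measure_distr X) simp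
    also have "X -` {Y. finite Y \<and> Y \<inter> B = {}} \<inter> space M = {\<omega> \<in> space M. X \<omega> \<inter> B = {}}" using U(3) by auto
    finally show "measure (distr M conf X) {Y. finite Y \<and> Y \<inter> B = {}} = measure (binom_law unit_cube n) {Y. finite Y \<and> Y \<inter> B = {}}"
      using void[OF B] void_binom_law[OF B, of n] by (simp add: measure_unit_cube)
  qed simp_all
  have "prob {\<omega> \<in> space M. X \<omega> \<inter> - unit_cube = {}} = 1" using void[of "- unit_cube"] sets_unit_cube by simp
  moreover have "{\<omega> \<in> space M. X \<omega> \<inter> - unit_cube = {}} \<in> events"
  proof -
    have "X -` {Y. finite Y \<and> Y \<inter> - unit_cube = {}} \<inter> space M \<in> events" using sets_unit_cube by (intro measurable_sets[OF X]) simp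
    also have "X -` {Y. finite Y \<and> Y \<inter> - unit_cube = {}} \<inter> space M = {\<omega> \<in> space M. X \<omega> \<inter> - unit_cube = {}}" using U(3) by auto
    finally show ?thesis .
  qed
  ultimately have "AE \<omega> in M. \<omega> \<in> {\<omega> \<in> space M. X \<omega> \<inter> - unit_cube = {}}" by (simp only: prob_eq_1)
  then show "AE \<omega> in M. X \<omega> \<subseteq> unit_cube" by (rule AE_mp) (auto intro!: AE_I2)
qed

context sparse_regime
begin

lemma stat_le_card:
  assumes "s > 0" obtains C where "\<forall>Y. finite Y \<longrightarrow> \<bar>stat \<theta> s Y\<bar> \<le> C * real (card Y)"
proof -
  obtain C where C: "C \<ge> 0" "\<And>r x X. r > 0 \<Longrightarrow> finite X \<Longrightarrow>
    \<bar>stat \<theta> r (insert x X) - stat \<theta> r X\<bar> \<le> C * of_bool (k \<le> card (X \<inter> cball x (r * R)) + 1)"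
    using stat_insert_bound[of \<theta>] by blast
  have "\<bar>stat \<theta> s Y\<bar> \<le> C * real (card Y)" if "finite Y" for Y
    using that
  proof (induction Y rule: finite_induct)
    case (insert x Y)
    have "C * of_bool b \<le> C" for b using C(1) by (cases b) auto
    then have "\<bar>stat \<theta> s (insert x Y) - stat \<theta> s Y\<bar> \<le> C" using C(2)[OF assms insert.hyps(1)] order.trans by blast
    then show ?case using insert by (simp add: algebra_simps)
  qed (simp add: stat_empty)
  then show thesis using that by blast
qed

text \<open>A bound on the count that is uniform in \<open>\<omega>\<close> makes all moment generating functions finite. For the
  Poisson process it comes from covering the cube, for the binomial process, whose points may
  leave the cube on a null set, from the number of points.\<close>

lemma component_mgf:
  fixes M :: "nat \<Rightarrow> 'w measure" and X :: "nat \<Rightarrow> 'w \<Rightarrow> (real ^ 'd) set"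
  assumes process: "(\<forall>n. poisson_process (M n) (real n) (X n)) \<or> (\<forall>n. binomial_process (M n) n (X n))"
  shows "prob_space (M n)" "X n \<in> measurable (M n) conf" "\<exists>K. \<forall>\<omega>\<in>space (M n). \<bar>stat \<theta> (r n) (X n \<omega>)\<bar> \<le> K"
    and "e > 0 \<Longrightarrow> \<forall>\<^sub>F n in sequentially.
      (\<integral>\<omega>. exp (lam n * (stat \<theta> (r n) (X n \<omega>) - (\<integral>\<omega>. stat \<theta> (r n) (X n \<omega>) \<partial>M n))) \<partial>M n) \<le> exp (a n * (1 / 2 * (\<theta> \<bullet> (gram *v \<theta>)) + e)) \<and>
      (\<integral>\<omega>. exp (lam n * (stat \<theta> (r n) (X n \<omega>) - (\<integral>\<omega>. stat \<theta> (r n) (X n \<omega>) \<partial>M n))) \<partial>M n) \<ge> exp (a n * (1 / 2 * (\<theta> \<bullet> (gram *v \<theta>)) - e))"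
proof -
  show prob: "prob_space (M n)" for n using process poisson_processD(1) binomial_processD(1) by blast
  show X: "X n \<in> measurable (M n) conf" for n using process poisson_processD(2) binomial_processD(2) by blast
  show bdd: "\<exists>K. \<forall>\<omega>\<in>space (M n). \<bar>stat \<theta> (r n) (X n \<omega>)\<bar> \<le> K" for \<theta> n
    using process
  proof
    assume P: "\<forall>n. poisson_process (M n) (real n) (X n)"
    obtain c where c: "c > 0" "(unit_cube :: (real ^ 'd) set) \<subseteq> cball 0 c" by (rule unit_cube_subset_cball)
    have "\<exists>K. \<forall>Y. finite Y \<longrightarrow> Y \<subseteq> cball 0 (r n * (c / r n)) \<longrightarrow> \<bar>stat \<theta> (r n) Y\<bar> \<le> K"
    proof (rule stat_bounds[where \<theta> = \<theta> and L = "c / r n"])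
      fix K assume "\<And>s z Y. s > 0 \<Longrightarrow> finite Y \<Longrightarrow> Y \<subseteq> cball z (s * (c / r n)) \<Longrightarrow> \<bar>stat \<theta> s Y\<bar> \<le> K"
      from this[OF r_pos[of n]] show ?thesis by (intro exI[of _ K] allI impI)
    qed
    then obtain K where K: "\<forall>Y. finite Y \<longrightarrow> Y \<subseteq> cball 0 (r n * (c / r n)) \<longrightarrow> \<bar>stat \<theta> (r n) Y\<bar> \<le> K" ..
    have "\<bar>stat \<theta> (r n) (X n \<omega>)\<bar> \<le> K" if \<omega>: "\<omega> \<in> space (M n)" for \<omega>
    proof (rule K[rule_format])
      show "finite (X n \<omega>)" using measurable_space[OF X \<omega>] by simp
      have "X n \<omega> \<subseteq> unit_cube" using poisson_processD(3)[OF P[rule_format]] \<omega> by blast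
      then show "X n \<omega> \<subseteq> cball 0 (r n * (c / r n))" using c r_pos[of n] by auto
    qed
    then show ?thesis by blast
  next
    assume B: "\<forall>n. binomial_process (M n) n (X n)"
    obtain C where C: "\<forall>Y. finite Y \<longrightarrow> \<bar>stat \<theta> (r n) Y\<bar> \<le> C * real (card Y)" by (rule stat_le_card[OF r_pos])
    have "\<bar>stat \<theta> (r n) (X n \<omega>)\<bar> \<le> \<bar>C\<bar> * real n" if \<omega>: "\<omega> \<in> space (M n)" for \<omega>
    proof -
      have f: "finite (X n \<omega>)" "card (X n \<omega>) \<le> n" using binomial_processD(3)[OF B[rule_format]] \<omega> by blast+
      have "\<bar>stat \<theta> (r n) (X n \<omega>)\<bar> \<le> C * real (card (X n \<omega>))" using C f(1) by blast
      also have "\<dots> \<le> \<bar>C\<bar> * real n" using f(2) by (intro mult_mono) auto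
      finally show ?thesis .
    qed
    then show ?thesis by blast
  qed
  assume e: "e > 0"
  show "\<forall>\<^sub>F n in sequentially.
      (\<integral>\<omega>. exp (lam n * (stat \<theta> (r n) (X n \<omega>) - (\<integral>\<omega>. stat \<theta> (r n) (X n \<omega>) \<partial>M n))) \<partial>M n) \<le> exp (a n * (1 / 2 * (\<theta> \<bullet> (gram *v \<theta>)) + e)) \<and>
      (\<integral>\<omega>. exp (lam n * (stat \<theta> (r n) (X n \<omega>) - (\<integral>\<omega>. stat \<theta> (r n) (X n \<omega>) \<partial>M n))) \<partial>M n) \<ge> exp (a n * (1 / 2 * (\<theta> \<bullet> (gram *v \<theta>)) - e))"
    using process
  proof
    assume P: "\<forall>n. poisson_process (M n) (real n) (X n)"
    show ?thesis
    proof (rule poisson_mgf[OF _ _ e])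
      show "\<forall>n>0. void_process (M n) (X n) (real n) unit_cube" using poisson_processD(4)[OF P[rule_format]] by simp
      show "\<forall>n. \<forall>\<omega>\<in>space (M n). X n \<omega> \<subseteq> unit_cube" using poisson_processD(3)[OF P[rule_format]] by blast
    qed
  next
    assume B: "\<forall>n. binomial_process (M n) n (X n)"
    have stat_cube: "(\<lambda>Y. stat \<theta> s (Y \<inter> unit_cube)) \<in> borel_measurable conf" for \<theta> s
      by (rule measurable_compose[OF measurable_conf_Int[OF sets_unit_cube] measurable_stat])
    have law: "(\<integral>\<omega>. exp (lam n * (stat \<theta> (r n) (X n \<omega>) - m)) \<partial>M n) = (\<integral>Y. exp (lam n * (stat \<theta> (r n) (Y \<inter> unit_cube) - m)) \<partial>binom_law unit_cube n)" for \<theta> m n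
    proof -
      have "(\<lambda>Y. exp (lam n * (stat \<theta> (r n) (Y \<inter> unit_cube) - m))) \<in> borel_measurable conf" using stat_cube by measurable
      then have "(\<integral>Y. exp (lam n * (stat \<theta> (r n) (Y \<inter> unit_cube) - m)) \<partial>distr (M n) conf (X n))
        = (\<integral>\<omega>. exp (lam n * (stat \<theta> (r n) (X n \<omega> \<inter> unit_cube) - m)) \<partial>M n)" by (rule integral_distr[OF X])
      also have "\<dots> = (\<integral>\<omega>. exp (lam n * (stat \<theta> (r n) (X n \<omega>) - m)) \<partial>M n)"
      proof (rule integral_cong_AE)
        have "(\<lambda>\<omega>. stat \<theta> (r n) (X n \<omega> \<inter> unit_cube)) \<in> borel_measurable (M n)" by (rule measurable_compose[OF X stat_cube])
        then show "(\<lambda>\<omega>. exp (lam n * (stat \<theta> (r n) (X n \<omega> \<inter> unit_cube) - m))) \<in> borel_measurable (M n)" by measurable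
        have "(\<lambda>\<omega>. stat \<theta> (r n) (X n \<omega>)) \<in> borel_measurable (M n)" by (rule measurable_compose[OF X measurable_stat])
        then show "(\<lambda>\<omega>. exp (lam n * (stat \<theta> (r n) (X n \<omega>) - m))) \<in> borel_measurable (M n)" by measurable
        show "AE \<omega> in M n. exp (lam n * (stat \<theta> (r n) (X n \<omega> \<inter> unit_cube) - m)) = exp (lam n * (stat \<theta> (r n) (X n \<omega>) - m))"
          using binomial_processD(5)[OF B[rule_format]] by (rule AE_mp) (auto intro!: AE_I2 simp: Int_absorb2)
      qed
      finally show ?thesis unfolding binomial_processD(4)[OF B[rule_format]] by simp
    qed
    show ?thesis
    proof (rule recenter[where m = "\<lambda>\<theta> n. \<integral>Y. stat \<theta> (r n) (Y \<inter> unit_cube) \<partial>pois_law unit_cube (real n)", OF _ _ _ _ _ e])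
      show "\<forall>\<theta> n c. (\<integral>Y. stat (c *\<^sub>R \<theta>) (r n) (Y \<inter> unit_cube) \<partial>pois_law unit_cube (real n)) = c * (\<integral>Y. stat \<theta> (r n) (Y \<inter> unit_cube) \<partial>pois_law unit_cube (real n))" by (simp flip: inner_component_count)
      show "\<forall>\<theta> e. e > 0 \<longrightarrow> (\<forall>\<^sub>F n in sequentially.
        (\<integral>\<omega>. exp (lam n * (stat \<theta> (r n) (X n \<omega>) - (\<integral>Y. stat \<theta> (r n) (Y \<inter> unit_cube) \<partial>pois_law unit_cube (real n)))) \<partial>M n) \<le> exp (a n * (1 / 2 * (\<theta> \<bullet> (gram *v \<theta>)) + e)) \<and>
        (\<integral>\<omega>. exp (lam n * (stat \<theta> (r n) (X n \<omega>) - (\<integral>Y. stat \<theta> (r n) (Y \<inter> unit_cube) \<partial>pois_law unit_cube (real n)))) \<partial>M n) \<ge> exp (a n * (1 / 2 * (\<theta> \<bullet> (gram *v \<theta>)) - e)))"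
        unfolding law using binomial_mgf by blast
    qed (use prob X bdd in blast)+
  qed
qed

end

section \<open>Moderate deviation principle\<close>

theorem corollary2p12:
  fixes k :: nat
    and \<Gamma> :: "'m::finite \<Rightarrow> 'v pair_pre_digraph"
    and t :: "'m \<Rightarrow> real"
    and r b \<rho> :: "nat \<Rightarrow> real"
    and M :: "nat \<Rightarrow> 'w measure"
    and X :: "nat \<Rightarrow> 'w \<Rightarrow> (real ^ 'd::finite) set"
    and S :: "nat \<Rightarrow> 'w \<Rightarrow> real ^ 'm"
    and P :: "nat \<Rightarrow> (real ^ 'm) set \<Rightarrow> real"
    and I :: "real ^ 'm \<Rightarrow> real"
    and A :: "(real ^ 'm) set"
  assumes d_ge_2: "CARD('d) \<ge> 2"
    and k_ge_2: "k \<ge> 2"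
    and t_pos: "\<And>i. t i > 0"
    and graph: "\<And>i. pair_graph (\<Gamma> i)"
    and vertices: "\<And>i. card (pverts (\<Gamma> i)) = k"
    and conn: "\<And>i. Digraph_Component.connected (with_proj (\<Gamma> i))"
    and non_iso: "\<And>i j. i \<noteq> j \<Longrightarrow> \<not> digraph_iso (with_proj (\<Gamma> i)) (with_proj (\<Gamma> j))"
    and nondegenerate: "\<And>a :: real ^ 'm. a \<noteq> 0 \<Longrightarrow>
      (LINT y|(lborel_tuples k :: (nat \<Rightarrow> real ^ 'd) measure).
         \<bar>a \<bullet> H_vec \<Gamma> t (with_origin k y)\<bar>) > 0"
    and r_pos: "\<And>n. r n > 0"
    and r_lim: "r \<longlonglongrightarrow> 0"
    and rho_def: "\<And>n. \<rho> n = real n ^ k * r n ^ (CARD('d) * (k - 1))"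
    and rho_lim: "filterlim \<rho> at_top sequentially"
    and sparse: "(\<lambda>n. real n * r n ^ CARD('d)) \<longlonglongrightarrow> 0"
    and b_pos: "\<And>n. b n > 0"
    and rho_b: "filterlim (\<lambda>n. \<rho> n / b n) at_top sequentially"
    and rho_b2: "(\<lambda>n. \<rho> n / (b n)\<^sup>2) \<longlonglongrightarrow> 0"
    and process: "(\<forall>n. poisson_process (M n) (real n) (X n)) \<or> (\<forall>n. binomial_process (M n) n (X n))"
    and S_def: "\<And>n \<omega>. S n \<omega> = component_count k \<Gamma> t (r n) (X n \<omega>)"
    and P_def: "\<And>n B. P n B = measure (M n)
      {\<omega> \<in> space (M n). (1 / b n) *\<^sub>R (S n \<omega> - integral\<^sup>L (M n) (S n)) \<in> B}"
    and I_def: "\<And>u. I u = rate_fun TYPE(real ^ 'd) k \<Gamma> t u"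
    and A_borel: "A \<in> sets borel"
  shows "- (INF u\<in>interior A. ereal (I u))
           \<le> liminf (\<lambda>n. ereal (\<rho> n / (b n)\<^sup>2) * log_prob (P n A))
       \<and> liminf (\<lambda>n. ereal (\<rho> n / (b n)\<^sup>2) * log_prob (P n A))
           \<le> limsup (\<lambda>n. ereal (\<rho> n / (b n)\<^sup>2) * log_prob (P n A))
       \<and> limsup (\<lambda>n. ereal (\<rho> n / (b n)\<^sup>2) * log_prob (P n A))
           \<le> - (INF u\<in>closure A. ereal (I u))"
proof -
  define lam where "lam n = b n / \<rho> n" for n
  define a where "a n = (lam n)\<^sup>2 * \<rho> n" for n
  define c where "c n = \<rho> n / (b n)\<^sup>2" for n
  have ac: "a n = 1 / c n" for n
    using b_pos[of n] unfolding a_def lam_def c_def by (simp add: power2_eq_square)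
  (* At n = 0 both a and lam vanish, because rho does. *)
  have alam: "a n / b n = lam n" for n
    using b_pos[of n] unfolding a_def lam_def by (simp add: power2_eq_square)
  have rho_nonneg: "\<rho> n \<ge> 0" for n unfolding rho_def using r_pos[of n] by simp
  have lam_nonneg: "lam n \<ge> 0" for n unfolding lam_def using rho_nonneg[of n] b_pos[of n] by simp
  have c_pos: "\<forall>\<^sub>F n in sequentially. c n > 0"
    using eventually_gt_at_top[of 0]
  proof eventually_elim
    case (elim n)
    then show ?case unfolding c_def rho_def using r_pos[of n] b_pos[of n] by simp
  qed
  have lam_lim: "lam \<longlonglongrightarrow> 0"
    using tendsto_inverse_0_at_top[OF rho_b] unfolding lam_def[abs_def] by (simp add: field_simps)
  have a_lim: "filterlim a at_top sequentially"
    using filterlim_inverse_at_top[OF rho_b2 c_pos[unfolded c_def]] unfolding ac c_def by (simp add: field_simps)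
  interpret sparse_regime k \<Gamma> t "TYPE(real ^ 'd)" r \<rho> lam a
    by (intro sparse_regime.intro shapes.intro sparse_regime_axioms.intro k_ge_2 t_pos graph vertices conn r_pos r_lim
        rho_def sparse lam_nonneg lam_lim a_def a_lim)
  note mgf = component_mgf[OF process]
  have inner_S: "\<theta> \<bullet> S n \<omega> = stat \<theta> (r n) (X n \<omega>)" for \<theta> n \<omega>
    unfolding S_def by (rule inner_component_count)
  have stat_meas: "(\<lambda>\<omega>. stat \<theta> (r n) (X n \<omega>)) \<in> borel_measurable (M n)" for \<theta> n
    by (rule measurable_compose[OF mgf(2) measurable_stat])
  have S_meas: "S n \<in> borel_measurable (M n)" for n
    unfolding borel_measurable_euclidean_space[of "S n"]
    using stat_meas by (simp add: inner_S inner_commute[of "S n _"])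
  have stat_int: "integrable (M n) (\<lambda>\<omega>. stat \<theta> (r n) (X n \<omega>))" for \<theta> n
  proof -
    interpret prob_space "M n" by (rule mgf(1))
    obtain K where "\<forall>\<omega>\<in>space (M n). \<bar>stat \<theta> (r n) (X n \<omega>)\<bar> \<le> K" using mgf(3) by blast
    then show ?thesis by (intro integrable_const_bound[of _ K] stat_meas AE_I2) auto
  qed
  have S_int: "integrable (M n) (S n)" for n
  proof -
    have "integrable (M n) (\<lambda>\<omega>. \<Sum>i\<in>Basis. (S n \<omega> \<bullet> i) *\<^sub>R i)"
      by (intro Bochner_Integration.integrable_sum integrable_scaleR_left)
        (use stat_int in \<open>simp add: inner_S inner_commute[of "S n _"]\<close>)
    then show ?thesis by (simp add: euclidean_representation)
  qed
  define T where "T n \<omega> = (1 / b n) *\<^sub>R (S n \<omega> - integral\<^sup>L (M n) (S n))" for n \<omega>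
  have exponent: "a n * (\<theta> \<bullet> T n \<omega>) = lam n * (stat \<theta> (r n) (X n \<omega>) - (\<integral>\<omega>. stat \<theta> (r n) (X n \<omega>) \<partial>M n))" for \<theta> n \<omega>
  proof -
    have "(\<integral>\<omega>. stat \<theta> (r n) (X n \<omega>) \<partial>M n) = \<theta> \<bullet> integral\<^sup>L (M n) (S n)"
      using integral_inner_right[of \<theta> "M n" "S n"] S_int by (simp add: inner_S)
    then show ?thesis unfolding T_def alam[symmetric] by (simp add: inner_diff_right inner_S)
  qed
  interpret pos_def_matrix "Gram_matrix TYPE(real ^ 'd) k \<Gamma> t"
    by unfold_locales (rule gram_sym, rule gram_pos[OF nondegenerate])
  interpret mgf_asymptotics "Gram_matrix TYPE(real ^ 'd) k \<Gamma> t" M T a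
  proof (intro mgf_asymptotics.intro pos_def_matrix_axioms mgf_asymptotics_axioms.intro)
    fix \<theta> :: "real ^ 'm" and n :: nat
    show prob: "prob_space (M n)" by (rule mgf(1))
    show T_meas: "T n \<in> borel_measurable (M n)"
      unfolding T_def[abs_def] using S_meas by measurable
    interpret prob_space "M n" by (rule prob)
    obtain K where K: "\<forall>\<omega>\<in>space (M n). \<bar>stat \<theta> (r n) (X n \<omega>)\<bar> \<le> K" using mgf(3) by blast
    show "integrable (M n) (\<lambda>\<omega>. exp (a n * (\<theta> \<bullet> T n \<omega>)))"
    proof (rule integrable_const_bound)
      show "AE \<omega> in M n. norm (exp (a n * (\<theta> \<bullet> T n \<omega>))) \<le> exp (lam n * (K + \<bar>\<integral>\<omega>. stat \<theta> (r n) (X n \<omega>) \<partial>M n\<bar>))"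
      proof (rule AE_I2)
        fix \<omega> assume "\<omega> \<in> space (M n)"
        then have "\<bar>stat \<theta> (r n) (X n \<omega>)\<bar> \<le> K" using K by blast
        then have "a n * (\<theta> \<bullet> T n \<omega>) \<le> lam n * (K + \<bar>\<integral>\<omega>. stat \<theta> (r n) (X n \<omega>) \<partial>M n\<bar>)"
          unfolding exponent by (intro mult_left_mono lam_nonneg) linarith
        then show "norm (exp (a n * (\<theta> \<bullet> T n \<omega>))) \<le> exp (lam n * (K + \<bar>\<integral>\<omega>. stat \<theta> (r n) (X n \<omega>) \<partial>M n\<bar>))" by simp
      qed
    qed (use T_meas in measurable)
  next
    show "filterlim a at_top sequentially" by (rule a_lim)
    fix \<theta> :: "real ^ 'm" and e :: real assume e: "e > 0"
    show "\<forall>\<^sub>F n in sequentially. (\<integral>\<omega>. exp (a n * (\<theta> \<bullet> T n \<omega>)) \<partial>M n) \<le> exp (a n * (1 / 2 * (\<theta> \<bullet> (Gram_matrix TYPE(real ^ 'd) k \<Gamma> t *v \<theta>)) + e))"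
      using mgf(4)[OF e, of \<theta>] unfolding exponent by (rule eventually_mono) blast
    show "\<forall>\<^sub>F n in sequentially. (\<integral>\<omega>. exp (a n * (\<theta> \<bullet> T n \<omega>)) \<partial>M n) \<ge> exp (a n * (1 / 2 * (\<theta> \<bullet> (Gram_matrix TYPE(real ^ 'd) k \<Gamma> t *v \<theta>)) - e))"
      using mgf(4)[OF e, of \<theta>] unfolding exponent by (rule eventually_mono) blast
  qed
  have I_eq: "I u = rate u" for u unfolding I_def rate_fun_def rate_def ..
  have P_eq: "P n B = measure (M n) {\<omega> \<in> space (M n). T n \<omega> \<in> B}" for n B unfolding P_def T_def ..
  have speed: "- a n * x = - x / c n" for n x by (simp add: ac)
  have lower: "- (INF u\<in>interior A. ereal (I u)) \<le> liminf (\<lambda>n. ereal (c n) * log_prob (P n A))"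
  proof (rule liminf_ge_neg_INF[OF _ c_pos])
    fix x e assume "x \<in> interior A" "e > (0::real)"
    from prob_lower_bound[OF this(1) A_borel this(2)]
    show "\<forall>\<^sub>F n in sequentially. P n A \<ge> exp (- (I x + e) / c n)" unfolding P_eq I_eq speed .
  qed
  (* The rate function is bounded below on A by its infimum over the closure, so the bound for A suffices. *)
  have upper: "limsup (\<lambda>n. ereal (c n) * log_prob (P n A)) \<le> - (INF u\<in>closure A. ereal (I u))"
  proof (rule limsup_le_neg_INF[OF _ c_pos])
    fix \<alpha> e assume \<alpha>: "\<And>x. x \<in> closure A \<Longrightarrow> I x \<ge> \<alpha>" and pos: "\<alpha> > (0::real)" "e > (0::real)"
    have "rate u \<ge> \<alpha>" if "u \<in> A" for u using \<alpha> closure_subset that unfolding I_eq by blast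
    from prob_upper_bound[OF this pos]
    show "\<forall>\<^sub>F n in sequentially. P n A \<le> exp (- (\<alpha> - e) / c n)" unfolding P_eq speed .
  next
    show "0 \<le> P n A" for n unfolding P_eq by simp
    show "P n A \<le> 1" for n unfolding P_eq using prob_space.prob_le_1[OF mgf(1)] .
  qed
  have "liminf (\<lambda>n. ereal (c n) * log_prob (P n A)) \<le> limsup (\<lambda>n. ereal (c n) * log_prob (P n A))"
    by (intro Liminf_le_Limsup) simp
  with lower upper show ?thesis unfolding c_def by blast
qed


end
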